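(* Let $n\ge2$, let $D\subset\mathbb{R}^n$ be an open disc, and let $k\ge 2$ be an integer. Then generic (in the $C^k$-topology) $C^k$-smooth metrics on $D$ admit only trivial integrals analytic in momenta. That is, there is a generic subset $\mathcal{G}$ of the space of $C^k$-smooth metrics on $D$ (with the $C^k$-topology) such that for every $g\in\mathcal{G}$, every integral $F:T^*D\to\mathbb{R}$ of the geodesic flow of $g$ that is analytic in momenta is trivial.
   Context: "Metric" means pseudo-Riemannian metric of arbitrary signature (including Riemannian). An open disc in $\mathbb{R}^n$ is an open ball. Let $x=(x^1,\dots,x^n)$ be the standard coordinates on $D$ and $p=(p_1,\dots,p_n)$ the corresponding momenta on the cotangent spaces. The geodesic flow of a metric $g=g_{ij}(x)dx^idx^j$ is the Hamiltonian system on $T^*D$ with Hamiltonian $H(x,p)=\tfrac12 g^{ij}(x)p_ip_j$. A (differentiable) function $F:T^*D\to\mathbb{R}$ is an integral if $\{F,H\}\equiv0$, i.e. $\sum_{i=1}^n\bigl(\frac{\partial H}{\partial x^i}\frac{\partial F}{\partial p_i}-\frac{\partial F}{\partial x^i}\frac{\partial H}{\partial p_i}\bigr)\equiv 0$; equivalently, $F$ is constant along the orbits of the geodesic flow. It is analytic in momenta if for every $x\in D$ the function $p\mapsto F(x,p)$ is real analytic on the whole cotangent space $T_x^*D$ (the dependence on the position $x$ need not be analytic). An integral is trivial if it is a function of $H$. A subset of a topological space is generic if it is a countable intersection of open everywhere dense subsets. The $C^k$-topology on the space of $C^k$-smooth metrics on $D$ is the one in which a neighborhood basis of $g$ is given,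 for $\varepsilon>0$, by the sets of metrics whose components in the standard coordinates, together with all partial derivatives up to order $k$, differ from those of $g$ by less than $\varepsilon$ uniformly on $D$. *)

theory Defs
  imports "HOL-Analysis.Analysis"
begin

subsection \<open>Partial derivatives and functions of class \<open>C\<^sup>k\<close>\<close>

definition has_dir_deriv :: "('a::real_normed_vector \<Rightarrow> real) \<Rightarrow> 'a \<Rightarrow> 'a \<Rightarrow> bool" where
  "has_dir_deriv f v z \<longleftrightarrow> (\<lambda>t::real. f (z + t *\<^sub>R v)) differentiable (at 0)"

definition dir_deriv :: "('a::real_normed_vector \<Rightarrow> real) \<Rightarrow> 'a \<Rightarrow> 'a \<Rightarrow> real" where
  "dir_deriv f v z = deriv (\<lambda>t::real. f (z + t *\<^sub>R v)) 0"

fun iter_partial :: "'n list \<Rightarrow> (real ^ 'n::finite \<Rightarrow> real) \<Rightarrow> real ^ 'n \<Rightarrow> real" where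
  "iter_partial [] f = f"
| "iter_partial (i # js) f = dir_deriv (iter_partial js f) (axis i 1)"

text \<open>Intended for open sets \<open>D\<close>: all partial derivatives of order at most \<open>k\<close> exist
  and are continuous on \<open>D\<close>.\<close>

definition Ck_on :: "nat \<Rightarrow> (real ^ 'n::finite) set \<Rightarrow> (real ^ 'n \<Rightarrow> real) \<Rightarrow> bool" where
  "Ck_on k D f \<longleftrightarrow>
     (\<forall>js i. length js < k \<longrightarrow> (\<forall>x\<in>D. has_dir_deriv (iter_partial js f) (axis i 1) x)) \<and>
     (\<forall>js. length js \<le> k \<longrightarrow> continuous_on D (iter_partial js f))"


subsection \<open>The space of \<open>C\<^sup>k\<close> metrics\<close>

text \<open>A metric is given by its matrix of components in the standard coordinates. No condition
  is put on the signature. Membership in \<^term>\<open>extensional D\<close> makes elements of the space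
  determined by their values on \<open>D\<close>.\<close>

definition Ck_metrics :: "nat \<Rightarrow> (real ^ 'n::finite) set \<Rightarrow> (real ^ 'n \<Rightarrow> real ^ 'n ^ 'n) set" where
  "Ck_metrics k D =
     {g \<in> extensional D.
        (\<forall>i j. Ck_on k D (\<lambda>x. g x $ i $ j)) \<and>
        (\<forall>x\<in>D. transpose (g x) = g x \<and> invertible (g x))}"

definition Ck_nbhd ::
  "nat \<Rightarrow> (real ^ 'n::finite) set \<Rightarrow> (real ^ 'n \<Rightarrow> real ^ 'n ^ 'n) \<Rightarrow> real \<Rightarrow> (real ^ 'n \<Rightarrow> real ^ 'n ^ 'n) set" where
  "Ck_nbhd k D g \<epsilon> =
     {h \<in> Ck_metrics k D. \<forall>i j js. length js \<le> k \<longrightarrow>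
        (\<forall>x\<in>D. \<bar>iter_partial js (\<lambda>y. h y $ i $ j) x - iter_partial js (\<lambda>y. g y $ i $ j) x\<bar> < \<epsilon>)}"

definition Ck_topology :: "nat \<Rightarrow> (real ^ 'n::finite) set \<Rightarrow> (real ^ 'n \<Rightarrow> real ^ 'n ^ 'n) topology" where
  "Ck_topology k D =
     topology (\<lambda>U. U \<subseteq> Ck_metrics k D \<and> (\<forall>g\<in>U. \<exists>\<epsilon>>0. Ck_nbhd k D g \<epsilon> \<subseteq> U))"

lemma Ck_nbhd_subset: "Ck_nbhd k D g \<epsilon> \<subseteq> Ck_metrics k D"
  unfolding Ck_nbhd_def by (rule Collect_restrict)

lemma Ck_nbhdD:
  assumes "h \<in> Ck_nbhd k D g \<epsilon>" "length js \<le> k" "x \<in> D"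
  shows "\<bar>iter_partial js (\<lambda>y. h y $ i $ j) x - iter_partial js (\<lambda>y. g y $ i $ j) x\<bar> < \<epsilon>"
  using assms(1)[unfolded Ck_nbhd_def mem_Collect_eq] assms(2,3) by simp

lemma Ck_nbhd_mono:
  fixes g :: "real ^ 'n::finite \<Rightarrow> real ^ 'n ^ 'n"
  assumes de: "d \<le> e"
  shows "Ck_nbhd k D g d \<subseteq> Ck_nbhd k D g e"
proof (rule subsetI)
  fix h assume h: "h \<in> Ck_nbhd k D g d"
  show "h \<in> Ck_nbhd k D g e"
    unfolding Ck_nbhd_def mem_Collect_eq
  proof (intro conjI allI impI ballI)
    show "h \<in> Ck_metrics k D" using h Ck_nbhd_subset by (rule rev_subsetD)
  next
    fix i j x and js :: "'n list" assume "length js \<le> k" "x \<in> D"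
    then show "\<bar>iter_partial js (\<lambda>y. h y $ i $ j) x - iter_partial js (\<lambda>y. g y $ i $ j) x\<bar> < e"
      by (intro less_le_trans[OF Ck_nbhdD[OF h] de])
  qed
qed

lemma openin_Ck_topology:
  "openin (Ck_topology k D) U \<longleftrightarrow>
     U \<subseteq> Ck_metrics k D \<and> (\<forall>g\<in>U. \<exists>\<epsilon>>0. Ck_nbhd k D g \<epsilon> \<subseteq> U)"
proof -
  let ?P = "\<lambda>U. U \<subseteq> Ck_metrics k D \<and> (\<forall>g\<in>U. \<exists>\<epsilon>>0. Ck_nbhd k D g \<epsilon> \<subseteq> U)"
  have "istopology ?P"
    unfolding istopology_def
  proof (rule conjI; intro allI impI)
    fix S T assume S: "?P S" and T: "?P T"
    have "\<exists>\<epsilon>>0. Ck_nbhd k D g \<epsilon> \<subseteq> S \<inter> T" if g: "g \<in> S \<inter> T" for g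
    proof -
      obtain d e where "d > 0" "Ck_nbhd k D g d \<subseteq> S" "e > 0" "Ck_nbhd k D g e \<subseteq> T"
        using S T g by blast
      moreover have "Ck_nbhd k D g (min d e) \<subseteq> Ck_nbhd k D g d \<inter> Ck_nbhd k D g e"
        by (simp add: Ck_nbhd_mono)
      moreover have "min d e > 0"
        using \<open>d > 0\<close> \<open>e > 0\<close> by simp
      ultimately show ?thesis by blast
    qed
    then show "?P (S \<inter> T)" using S by blast
  next
    fix \<K> assume K: "\<forall>K\<in>\<K>. ?P K"
    show "?P (\<Union>\<K>)"
    proof (intro conjI ballI)
      show "\<Union>\<K> \<subseteq> Ck_metrics k D" using K by blast
    next
      fix g assume "g \<in> \<Union>\<K>"
      then obtain K where "K \<in> \<K>" "g \<in> K" by blast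
      with K obtain \<epsilon> where "\<epsilon> > 0" "Ck_nbhd k D g \<epsilon> \<subseteq> K" by blast
      with \<open>K \<in> \<K>\<close> show "\<exists>\<epsilon>>0. Ck_nbhd k D g \<epsilon> \<subseteq> \<Union>\<K>" by blast
    qed
  qed
  from topology_inverse'[OF this] show ?thesis
    unfolding Ck_topology_def by (rule fun_cong)
qed

lemma topspace_Ck_topology: "topspace (Ck_topology k D) = Ck_metrics k D"
proof -
  have "openin (Ck_topology k D) (Ck_metrics k D)"
    unfolding openin_Ck_topology using Ck_nbhd_subset zero_less_one by blast
  moreover have "topspace (Ck_topology k D) \<subseteq> Ck_metrics k D"
    using openin_topspace[of "Ck_topology k D"] unfolding openin_Ck_topology by (rule conjunct1)
  ultimately show ?thesis
    by (intro subset_antisym openin_subset)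
qed

lemma Ck_nbhd_is_neighbourhood:
  assumes g: "g \<in> Ck_metrics k D" and \<epsilon>: "\<epsilon> > 0"
  shows "\<exists>U. openin (Ck_topology k D) U \<and> g \<in> U \<and> U \<subseteq> Ck_nbhd k D g \<epsilon>"
proof -
  let ?U = "\<Union>\<delta>\<in>{..<\<epsilon>}. Ck_nbhd k D g \<delta>"
  have "\<exists>e>0. Ck_nbhd k D h e \<subseteq> ?U" if h: "h \<in> ?U" for h
  proof -
    obtain \<delta> where \<delta>: "\<delta> < \<epsilon>" "h \<in> Ck_nbhd k D g \<delta>" using h by blast
    have "Ck_nbhd k D h ((\<epsilon> - \<delta>) / 2) \<subseteq> Ck_nbhd k D g ((\<epsilon> + \<delta>) / 2)"
    proof
      fix f assume f: "f \<in> Ck_nbhd k D h ((\<epsilon> - \<delta>) / 2)"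
      have "\<bar>iter_partial js (\<lambda>y. f y $ i $ j) x - iter_partial js (\<lambda>y. g y $ i $ j) x\<bar> < (\<epsilon> + \<delta>) / 2"
        if "length js \<le> k" "x \<in> D" for i j js x
      proof -
        have "\<bar>iter_partial js (\<lambda>y. f y $ i $ j) x - iter_partial js (\<lambda>y. h y $ i $ j) x\<bar> < (\<epsilon> - \<delta>) / 2"
          using f that by (rule Ck_nbhdD)
        moreover have "\<bar>iter_partial js (\<lambda>y. h y $ i $ j) x - iter_partial js (\<lambda>y. g y $ i $ j) x\<bar> < \<delta>"
          using \<delta>(2) that by (rule Ck_nbhdD)
        ultimately show ?thesis by argo
      qed
      then show "f \<in> Ck_nbhd k D g ((\<epsilon> + \<delta>) / 2)"
        using rev_subsetD[OF f Ck_nbhd_subset] unfolding Ck_nbhd_def by simp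
    qed
    show ?thesis
    proof (intro exI conjI)
      show "(\<epsilon> - \<delta>) / 2 > 0" using \<delta>(1) by simp
      have "(\<epsilon> + \<delta>) / 2 \<in> {..<\<epsilon>}" using \<delta>(1) by simp
      with \<open>Ck_nbhd k D h ((\<epsilon> - \<delta>) / 2) \<subseteq> _\<close>
      show "Ck_nbhd k D h ((\<epsilon> - \<delta>) / 2) \<subseteq> ?U" by blast
    qed
  qed
  moreover have "?U \<subseteq> Ck_nbhd k D g \<epsilon>"
    by (intro UN_least Ck_nbhd_mono) simp
  moreover have "g \<in> ?U"
    by (rule UN_I[of "\<epsilon> / 2"]) (use g \<epsilon> in \<open>simp_all add: Ck_nbhd_def\<close>)
  moreover have "?U \<subseteq> Ck_metrics k D"
    using Ck_nbhd_subset by blast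
  ultimately show ?thesis
    by (intro exI[of _ ?U] conjI openin_Ck_topology[THEN iffD2] ballI)
qed

text \<open>The intersection with \<^term>\<open>topspace X\<close> only matters for the empty family.\<close>

definition generic_in :: "'a topology \<Rightarrow> 'a set \<Rightarrow> bool" where
  "generic_in X G \<longleftrightarrow>
     (\<exists>\<U>. countable \<U> \<and> (\<forall>U\<in>\<U>. openin X U \<and> X closure_of U = topspace X) \<and>
          G = topspace X \<inter> \<Inter>\<U>)"


subsection \<open>The geodesic flow and its integrals\<close>

text \<open>The cotangent bundle of \<open>D\<close> is \<^term>\<open>D \<times> UNIV\<close>, with elements \<open>(x, p)\<close>.\<close>

definition hamiltonian ::
  "(real ^ 'n::finite \<Rightarrow> real ^ 'n ^ 'n) \<Rightarrow> (real ^ 'n) \<times> (real ^ 'n) \<Rightarrow> real" where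
  "hamiltonian g = (\<lambda>(x, p). 1 / 2 * (\<Sum>i\<in>UNIV. \<Sum>j\<in>UNIV. matrix_inv (g x) $ i $ j * p $ i * p $ j))"

definition poisson_bracket ::
  "((real ^ 'n::finite) \<times> (real ^ 'n) \<Rightarrow> real) \<Rightarrow> ((real ^ 'n) \<times> (real ^ 'n) \<Rightarrow> real) \<Rightarrow>
   (real ^ 'n) \<times> (real ^ 'n) \<Rightarrow> real" where
  "poisson_bracket F H z =
     (\<Sum>i\<in>UNIV. dir_deriv H (axis i 1, 0) z * dir_deriv F (0, axis i 1) z -
                dir_deriv F (axis i 1, 0) z * dir_deriv H (0, axis i 1) z)"

definition geodesic_integral ::
  "(real ^ 'n::finite) set \<Rightarrow> (real ^ 'n \<Rightarrow> real ^ 'n ^ 'n) \<Rightarrow> ((real ^ 'n) \<times> (real ^ 'n) \<Rightarrow> real) \<Rightarrow> bool" where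
  "geodesic_integral D g F \<longleftrightarrow>
     F differentiable_on (D \<times> UNIV) \<and>
     (\<forall>z \<in> D \<times> UNIV. poisson_bracket F (hamiltonian g) z = 0)"

text \<open>Local expansion into a multivariate power series, indexed by multi-indices \<open>\<alpha>\<close>;
  unconditional summation over the multi-indices amounts to absolute convergence.\<close>

definition real_analytic_on :: "(real ^ 'n::finite \<Rightarrow> real) \<Rightarrow> (real ^ 'n) set \<Rightarrow> bool" where
  "real_analytic_on f S \<longleftrightarrow>
     (\<forall>q\<in>S. \<exists>r>0. \<exists>a :: ('n \<Rightarrow> nat) \<Rightarrow> real. \<forall>p\<in>ball q r.
        ((\<lambda>\<alpha>. a \<alpha> * (\<Prod>i\<in>UNIV. (p $ i - q $ i) ^ \<alpha> i)) has_sum f p) UNIV)"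

definition analytic_in_momenta ::
  "(real ^ 'n::finite) set \<Rightarrow> ((real ^ 'n) \<times> (real ^ 'n) \<Rightarrow> real) \<Rightarrow> bool" where
  "analytic_in_momenta D F \<longleftrightarrow> (\<forall>x\<in>D. real_analytic_on (\<lambda>p. F (x, p)) UNIV)"

definition trivial_integral ::
  "(real ^ 'n::finite) set \<Rightarrow> (real ^ 'n \<Rightarrow> real ^ 'n ^ 'n) \<Rightarrow> ((real ^ 'n) \<times> (real ^ 'n) \<Rightarrow> real) \<Rightarrow> bool" where
  "trivial_integral D g F \<longleftrightarrow>
     (\<exists>\<phi> :: real \<Rightarrow> real. \<forall>z \<in> D \<times> UNIV. F z = \<phi> (hamiltonian g z))"

end

theory Submission
  imports Defs "HOL-Complex_Analysis.Great_Picard"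
begin

text \<open>Expanding an integral \<open>F\<close> in homogeneous components \<open>P\<close> in the velocities \<open>v = g\<^sup>-\<^sup>1 p\<close>, the
  equation \<open>{F, H} = 0\<close> only involves derivatives of \<open>P\<close> in \<open>x\<close> along straight lines in the direction
  \<open>v\<close>. Bounded solutions of this weak equation are automatically Hoelder continuous, hence form
  locally compact families, so for fixed bounds the metrics that admit a weak integral whose
  derivative at a given point and in given directions is bounded away from \<open>0\<close> form a closed set.

  This closed set has no interior. Perturb \<open>g\<close> by a small multiple of \<open>\<psi>(x) cos (n \<xi> \<bullet> x)\<close> times the
  identity matrix, with \<open>\<psi>\<close> a bump function, and let \<open>n\<close> tend to infinity. Subtracting from an integral of
  the perturbed metric a nearly best approximation by integrals of \<open>g\<close> and rescaling, one obtains in the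
  limit a solution of the linearized equation with oscillating right-hand side. Comparing two lines of
  direction \<open>v\<close> orthogonal to \<open>\<xi>\<close> with opposite phases shows that the derivative of \<open>P x\<close> at \<open>v\<close> in
  the direction \<open>g\<^sup>-\<^sup>1 \<xi>\<close> vanishes; if this holds for all \<open>\<xi>\<close> orthogonal to \<open>v\<close>, then \<open>P x\<close> is
  constant on the level sets of the quadratic form \<open>g x\<close>.

  For a metric outside countably many such closed sets, a Baire category argument in \<open>x\<close> gives the
  expansion of \<open>F\<close> with uniform bounds on a dense open set, so that \<open>F\<close> is a function of \<open>H\<close> on a
  dense set of fibres. By continuity it is one on every fibre, and \<open>{F, H} = 0\<close> forces this function not
  to depend on the fibre.\<close>

subsection \<open>Homogeneous polynomials\<close>

text \<open>As \<open>F\<close> is merely differentiable in the position, nothing makes the single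
  coefficients of its expansion differentiable. The proof only ever differentiates the value at
  \<open>v\<close> in the direction \<open>v\<close>; in velocity variables this direction is the
  same at every point of the line.

  The metric \<open>g\<close> to be perturbed may have many integrals itself (it may be flat), so
  integrals of nearby metrics cannot be compared with zero. This is why a nearly best approximation
  is subtracted. The rest is divided by its size or by the size of the perturbing force, whichever
  is larger: either the force disappears in the limit, which contradicts near-optimality, or it
  survives. The force has the size amplitude times frequency, so the amplitude may be as small as
  closeness in \<open>C\<^sup>k\<close> demands.

  Level sets of an indefinite form may be disconnected, so vanishing tangential derivatives alone do
  not identify the values of \<open>P x\<close>. This is overcome by comparing values along secant
  lines, where \<open>P x\<close> satisfies a first-order equation with at most one polynomial
  solution for a given value at the midpoint.\<close>

definition mdeg :: "('n::finite \<Rightarrow> nat) \<Rightarrow> nat" where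
  "mdeg \<alpha> = (\<Sum>i\<in>UNIV. \<alpha> i)"

definition mons :: "nat \<Rightarrow> ('n::finite \<Rightarrow> nat) set" where
  "mons m = {\<alpha>. mdeg \<alpha> = m}"

definition mon :: "('n::finite \<Rightarrow> nat) \<Rightarrow> real ^ 'n \<Rightarrow> real" where
  "mon \<alpha> v = (\<Prod>i\<in>UNIV. (v $ i) ^ \<alpha> i)"

text \<open>The directional derivative of \<open>mon \<alpha>\<close> at \<open>v\<close> along
  \<open>u\<close>. Where \<open>\<alpha> i = 0\<close> the truncated subtraction is harmless,
  because the factor \<open>real (\<alpha> i)\<close> vanishes.\<close>

definition dmon :: "('n::finite \<Rightarrow> nat) \<Rightarrow> real ^ 'n \<Rightarrow> real ^ 'n \<Rightarrow> real" where
  "dmon \<alpha> v u = (\<Sum>i\<in>UNIV. real (\<alpha> i) * u $ i * mon (\<alpha>(i := \<alpha> i - 1)) v)"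

text \<open>The coefficient family is indexed by all multi-indices but read only in degree
  \<open>m\<close>, so one family can serve every degree of a Taylor expansion.\<close>

definition hp :: "nat \<Rightarrow> (('n::finite \<Rightarrow> nat) \<Rightarrow> real) \<Rightarrow> real ^ 'n \<Rightarrow> real" where
  "hp m a v = (\<Sum>\<alpha>\<in>mons m. a \<alpha> * mon \<alpha> v)"

definition dhp :: "nat \<Rightarrow> (('n::finite \<Rightarrow> nat) \<Rightarrow> real) \<Rightarrow> real ^ 'n \<Rightarrow> real ^ 'n \<Rightarrow> real" where
  "dhp m a v u = (\<Sum>\<alpha>\<in>mons m. a \<alpha> * dmon \<alpha> v u)"

lemma mons_le: "\<alpha> \<in> mons m \<Longrightarrow> \<alpha> i \<le> m"
  unfolding mons_def mdeg_def by (auto intro: member_le_sum)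

lemma finite_mons [simp]: "finite (mons m :: ('n::finite \<Rightarrow> nat) set)"
proof (rule finite_subset)
  show "mons m \<subseteq> PiE (UNIV :: 'n set) (\<lambda>_. {..m})"
    using mons_le by fastforce
  show "finite (PiE (UNIV :: 'n set) (\<lambda>_. {..m}))"
    by (intro finite_PiE) auto
qed

lemma mon_scale: "mon \<alpha> (s *\<^sub>R v) = s ^ mdeg \<alpha> * mon \<alpha> v"
  unfolding mon_def mdeg_def by (simp add: power_mult_distrib prod.distrib power_sum)

lemma mdeg_update_pred:
  assumes "\<alpha> i > 0" shows "Suc (mdeg (\<alpha>(i := \<alpha> i - 1))) = mdeg \<alpha>"
proof -
  have "mdeg \<alpha> = \<alpha> i + (\<Sum>j\<in>UNIV - {i}. \<alpha> j)"
    unfolding mdeg_def by (simp add: sum.remove)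
  moreover have "mdeg (\<alpha>(i := \<alpha> i - 1)) = (\<alpha> i - 1) + (\<Sum>j\<in>UNIV - {i}. \<alpha> j)"
    unfolding mdeg_def by (subst sum.remove[of _ i]) (auto intro!: sum.cong)
  ultimately show ?thesis using assms by simp
qed

lemma mon_has_derivative: "(mon \<alpha> has_derivative dmon \<alpha> v) (at v within S)"
proof -
  have *: "((\<lambda>v. \<Prod>i\<in>UNIV. (v $ i) ^ \<alpha> i) has_derivative
     (\<lambda>u. \<Sum>i\<in>UNIV. (real (\<alpha> i) * u $ i * (v $ i) ^ (\<alpha> i - 1)) * (\<Prod>j\<in>UNIV - {i}. (v $ j) ^ \<alpha> j))) (at v within S)"
    by (rule has_derivative_prod)
      (auto intro!: derivative_eq_intros bounded_linear_imp_has_derivative bounded_linear_vec_nth simp: mult_ac)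
  have "mon (\<alpha>(i := \<alpha> i - 1)) v = (v $ i) ^ (\<alpha> i - 1) * (\<Prod>j\<in>UNIV - {i}. (v $ j) ^ \<alpha> j)" for i
    unfolding mon_def by (subst prod.remove[of _ i]) (auto intro!: prod.cong)
  then have "dmon \<alpha> v = (\<lambda>u. \<Sum>i\<in>UNIV. (real (\<alpha> i) * u $ i * (v $ i) ^ (\<alpha> i - 1)) * (\<Prod>j\<in>UNIV - {i}. (v $ j) ^ \<alpha> j))"
    unfolding dmon_def by (auto simp: mult_ac)
  with * show ?thesis unfolding mon_def by (simp add: mon_def[abs_def])
qed

text \<open>The extra factor \<open>s\<close> on the left avoids the exponent
  \<open>mdeg \<alpha> - 1\<close>, which would be truncated in degree 0.\<close>

lemma dmon_scale: "s * dmon \<alpha> (s *\<^sub>R v) u = s ^ mdeg \<alpha> * dmon \<alpha> v u"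
proof -
  have "s * (real (\<alpha> i) * u $ i * mon (\<alpha>(i := \<alpha> i - 1)) (s *\<^sub>R v)) =
        s ^ mdeg \<alpha> * (real (\<alpha> i) * u $ i * mon (\<alpha>(i := \<alpha> i - 1)) v)" for i
  proof (cases "\<alpha> i = 0")
    case False
    then have "s ^ mdeg \<alpha> = s * s ^ mdeg (\<alpha>(i := \<alpha> i - 1))"
      using mdeg_update_pred[of \<alpha> i] by (metis neq0_conv power_Suc)
    then show ?thesis by (simp add: mon_scale)
  qed simp
  then show ?thesis unfolding dmon_def sum_distrib_left by (intro sum.cong refl) blast
qed

lemma tendsto_mon [tendsto_intros]:
  "(f \<longlongrightarrow> l) F \<Longrightarrow> ((\<lambda>x. mon \<alpha> (f x)) \<longlongrightarrow> mon \<alpha> l) F"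
  unfolding mon_def by (intro tendsto_intros)

lemma tendsto_dmon [tendsto_intros]:
  "(f \<longlongrightarrow> l) F \<Longrightarrow> (g \<longlongrightarrow> k) F \<Longrightarrow> ((\<lambda>x. dmon \<alpha> (f x) (g x)) \<longlongrightarrow> dmon \<alpha> l k) F"
  unfolding dmon_def by (intro tendsto_intros)

lemma mon_bound:
  assumes "norm v \<le> \<sigma>" shows "\<bar>mon \<alpha> v\<bar> \<le> \<sigma> ^ mdeg \<alpha>"
proof -
  have "\<bar>mon \<alpha> v\<bar> = (\<Prod>i\<in>UNIV. \<bar>v $ i\<bar> ^ \<alpha> i)"
    unfolding mon_def by (simp add: abs_prod power_abs)
  also have "\<dots> \<le> (\<Prod>i\<in>UNIV. \<sigma> ^ \<alpha> i)"
    by (intro prod_mono conjI power_mono) (use assms component_le_norm_cart[of v] in \<open>auto intro: order_trans\<close>)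
  also have "\<dots> = \<sigma> ^ mdeg \<alpha>" unfolding mdeg_def by (simp add: power_sum)
  finally show ?thesis .
qed

lemma mon_Lipschitz:
  assumes "norm v \<le> \<sigma>" "norm w \<le> \<sigma>"
  shows "\<bar>mon \<alpha> v - mon \<alpha> w\<bar> \<le> real (mdeg \<alpha>) * \<sigma> ^ (mdeg \<alpha> - 1) * norm (v - w)"
proof (cases "\<sigma> = 0 \<or> mdeg \<alpha> = 0")
  case True
  then show ?thesis
  proof
    assume "\<sigma> = 0" then show ?thesis using assms by simp
  next
    assume "mdeg \<alpha> = 0" then have "\<alpha> i = 0" for i unfolding mdeg_def by simp
    then show ?thesis using \<open>mdeg \<alpha> = 0\<close> unfolding mon_def by simp
  qed
next
  case False
  then have s: "\<sigma> > 0" using assms norm_ge_zero[of v] by linarith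
  \<comment> \<open>The product estimate \<open>norm_prod_diff\<close> wants factors of absolute
    value at most 1, hence the rescaling to the unit ball.\<close>
  have le1: "\<bar>(inverse \<sigma> *\<^sub>R x) $ i\<bar> \<le> 1" if "norm x \<le> \<sigma>" for x :: "real ^ 'n" and i
  proof -
    have "\<bar>x $ i\<bar> \<le> \<sigma>" using component_le_norm_cart[of x i] that by linarith
    then show ?thesis using s by (simp add: abs_mult field_simps)
  qed
  have main: "\<bar>mon \<alpha> (inverse \<sigma> *\<^sub>R v) - mon \<alpha> (inverse \<sigma> *\<^sub>R w)\<bar> \<le> real (mdeg \<alpha>) * (inverse \<sigma> * norm (v - w))"
  proof -
    let ?v = "inverse \<sigma> *\<^sub>R v" and ?w = "inverse \<sigma> *\<^sub>R w"
    have "norm (mon \<alpha> ?v - mon \<alpha> ?w) \<le> (\<Sum>i\<in>UNIV. norm ((?v $ i) ^ \<alpha> i - (?w $ i) ^ \<alpha> i))"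
      unfolding mon_def by (intro norm_prod_diff) (use le1 assms in \<open>auto simp: power_abs intro!: power_le_one\<close>)
    also have "\<dots> \<le> (\<Sum>i\<in>UNIV. real (\<alpha> i) * (inverse \<sigma> * norm (v - w)))"
    proof (rule sum_mono)
      fix i
      have "norm ((?v $ i) ^ \<alpha> i - (?w $ i) ^ \<alpha> i) \<le> \<alpha> i * norm (?v $ i - ?w $ i)"
        by (intro norm_power_diff) (use le1 assms in auto)
      also have "norm (?v $ i - ?w $ i) = inverse \<sigma> * \<bar>(v - w) $ i\<bar>"
        using s by (simp add: abs_mult right_diff_distrib[symmetric])
      also have "real (\<alpha> i) * \<dots> \<le> real (\<alpha> i) * (inverse \<sigma> * norm (v - w))"
        using component_le_norm_cart[of "v - w" i] s by (intro mult_left_mono) auto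
      finally show "norm ((?v $ i) ^ \<alpha> i - (?w $ i) ^ \<alpha> i) \<le> real (\<alpha> i) * (inverse \<sigma> * norm (v - w))" by simp
    qed
    also have "\<dots> = real (mdeg \<alpha>) * (inverse \<sigma> * norm (v - w))"
      unfolding mdeg_def by (simp add: sum_distrib_right)
    finally show ?thesis by simp
  qed
  have sc: "mon \<alpha> x = \<sigma> ^ mdeg \<alpha> * mon \<alpha> (inverse \<sigma> *\<^sub>R x)" for x
    using mon_scale[of \<alpha> \<sigma> "inverse \<sigma> *\<^sub>R x"] s by simp
  have "\<bar>mon \<alpha> v - mon \<alpha> w\<bar> = \<sigma> ^ mdeg \<alpha> * \<bar>mon \<alpha> (inverse \<sigma> *\<^sub>R v) - mon \<alpha> (inverse \<sigma> *\<^sub>R w)\<bar>"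
    unfolding sc[of v] sc[of w] using s by (simp add: right_diff_distrib[symmetric] abs_mult)
  also have "\<dots> \<le> \<sigma> ^ mdeg \<alpha> * (real (mdeg \<alpha>) * (inverse \<sigma> * norm (v - w)))"
    using main s by (intro mult_left_mono) auto
  also have "\<sigma> ^ mdeg \<alpha> = \<sigma> * \<sigma> ^ (mdeg \<alpha> - 1)"
    using False by (cases "mdeg \<alpha>") auto
  finally show ?thesis using s by (simp add: field_simps)
qed

lemma dmon_bound:
  assumes "norm v \<le> \<sigma>"
  shows "\<bar>dmon \<alpha> v u\<bar> \<le> real (mdeg \<alpha>) * \<sigma> ^ (mdeg \<alpha> - 1) * norm u"
proof -
  have s: "\<sigma> \<ge> 0" using assms norm_ge_zero[of v] by linarith
  have "\<bar>dmon \<alpha> v u\<bar> \<le> (\<Sum>i\<in>UNIV. \<bar>real (\<alpha> i) * u $ i * mon (\<alpha>(i := \<alpha> i - 1)) v\<bar>)"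
    unfolding dmon_def by (rule sum_abs)
  also have "\<dots> \<le> (\<Sum>i\<in>UNIV. real (\<alpha> i) * (\<sigma> ^ (mdeg \<alpha> - 1) * norm u))"
  proof (rule sum_mono)
    fix i
    show "\<bar>real (\<alpha> i) * u $ i * mon (\<alpha>(i := \<alpha> i - 1)) v\<bar> \<le> real (\<alpha> i) * (\<sigma> ^ (mdeg \<alpha> - 1) * norm u)"
    proof (cases "\<alpha> i = 0")
      case False
      then have "mdeg (\<alpha>(i := \<alpha> i - 1)) = mdeg \<alpha> - 1" using mdeg_update_pred[of \<alpha> i] by simp
      then have "\<bar>mon (\<alpha>(i := \<alpha> i - 1)) v\<bar> \<le> \<sigma> ^ (mdeg \<alpha> - 1)"
        using mon_bound[OF assms] by metis
      then have "\<bar>u $ i\<bar> * \<bar>mon (\<alpha>(i := \<alpha> i - 1)) v\<bar> \<le> norm u * \<sigma> ^ (mdeg \<alpha> - 1)"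
        by (intro mult_mono component_le_norm_cart) (use s in auto)
      then show ?thesis by (simp add: abs_mult mult.assoc mult_left_mono mult.commute[of "norm u"])
    qed simp
  qed
  also have "\<dots> = real (mdeg \<alpha>) * \<sigma> ^ (mdeg \<alpha> - 1) * norm u"
    unfolding mdeg_def by (simp add: sum_distrib_right mult.assoc)
  finally show ?thesis .
qed

lemma dmon_add: "dmon \<alpha> v (u + w) = dmon \<alpha> v u + dmon \<alpha> v w"
  unfolding dmon_def by (simp add: algebra_simps sum.distrib)

lemma dmon_scaleR: "dmon \<alpha> v (s *\<^sub>R u) = s * dmon \<alpha> v u"
  unfolding dmon_def by (simp add: algebra_simps sum_distrib_left)

lemma hp_has_derivative: "(hp m a has_derivative dhp m a v) (at v within S)"
  unfolding hp_def[abs_def] dhp_def[abs_def]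
  by (auto intro!: derivative_eq_intros mon_has_derivative[THEN has_derivative_eq_rhs])

lemma dhp_add: "dhp m a v (u + w) = dhp m a v u + dhp m a v w"
  unfolding dhp_def by (simp add: dmon_add algebra_simps sum.distrib)

lemma dhp_scaleR: "dhp m a v (s *\<^sub>R u) = s * dhp m a v u"
  unfolding dhp_def by (simp add: dmon_scaleR algebra_simps sum_distrib_left)

lemma dhp_zero [simp]: "dhp m a v 0 = 0"
  using dhp_scaleR[of m a v 0 0] by simp

lemma dhp_diff: "dhp m a v (u - w) = dhp m a v u - dhp m a v w"
  using dhp_add[of m a v "u - w" w] by simp

lemma hp_scale: "hp m a (s *\<^sub>R v) = s ^ m * hp m a v"
  unfolding hp_def sum_distrib_left
  by (intro sum.cong) (auto simp: mon_scale mons_def)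

lemma dhp_scale: "s * dhp m a (s *\<^sub>R v) u = s ^ m * dhp m a v u"
proof -
  have "s * (a \<alpha> * dmon \<alpha> (s *\<^sub>R v) u) = s ^ m * (a \<alpha> * dmon \<alpha> v u)" if "\<alpha> \<in> mons m" for \<alpha>
    using dmon_scale[of s \<alpha> v u] that by (simp add: mons_def algebra_simps)
  then show ?thesis unfolding dhp_def sum_distrib_left by (intro sum.cong) auto
qed

lemma dhp_Euler: "dhp m a v v = real m * hp m a v"
proof -
  have "dmon \<alpha> v v = real m * mon \<alpha> v" if "\<alpha> \<in> mons m" for \<alpha>
  proof -
    have "real (\<alpha> i) * v $ i * mon (\<alpha>(i := \<alpha> i - 1)) v = real (\<alpha> i) * mon \<alpha> v" for i
    proof (cases "\<alpha> i")
      case (Suc k)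
      have "mon (\<alpha>(i := \<alpha> i - 1)) v = (v $ i) ^ (\<alpha> i - 1) * (\<Prod>j\<in>UNIV - {i}. (v $ j) ^ \<alpha> j)"
        unfolding mon_def by (subst prod.remove[of _ i]) (auto intro!: prod.cong)
      moreover have "mon \<alpha> v = (v $ i) ^ (\<alpha> i) * (\<Prod>j\<in>UNIV - {i}. (v $ j) ^ \<alpha> j)"
        unfolding mon_def by (simp add: prod.remove)
      ultimately show ?thesis using Suc by simp
    qed simp
    then have "dmon \<alpha> v v = (\<Sum>i\<in>UNIV. real (\<alpha> i)) * mon \<alpha> v"
      unfolding dmon_def sum_distrib_right by (intro sum.cong refl) blast
    then show ?thesis using that unfolding mons_def mdeg_def by auto
  qed
  then show ?thesis unfolding dhp_def hp_def sum_distrib_left by (intro sum.cong) auto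
qed

lemma hp_lincomb: "hp m (\<lambda>\<alpha>. s * a \<alpha> + t * b \<alpha>) v = s * hp m a v + t * hp m b v"
  unfolding hp_def by (simp add: algebra_simps sum.distrib sum_distrib_left)

lemma dhp_lincomb: "dhp m (\<lambda>\<alpha>. s * a \<alpha> + t * b \<alpha>) v u = s * dhp m a v u + t * dhp m b v u"
  unfolding dhp_def by (simp add: algebra_simps sum.distrib sum_distrib_left)

lemma hp_bound:
  fixes a :: "('n::finite \<Rightarrow> nat) \<Rightarrow> real"
  assumes "\<And>\<alpha>. \<alpha> \<in> mons m \<Longrightarrow> \<bar>a \<alpha>\<bar> \<le> B" "norm v \<le> V"
  shows "\<bar>hp m a v\<bar> \<le> real (card (mons m :: ('n::finite \<Rightarrow> nat) set)) * V ^ m * B"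
    (is "_ \<le> ?c * _ * _")
proof -
  have "\<bar>hp m a v\<bar> \<le> (\<Sum>\<alpha>\<in>mons m. \<bar>a \<alpha> * mon \<alpha> v\<bar>)"
    unfolding hp_def by (rule sum_abs)
  also have "\<dots> \<le> (\<Sum>\<alpha>\<in>(mons m :: ('n \<Rightarrow> nat) set). B * V ^ m)"
  proof (rule sum_mono)
    fix \<alpha> :: "'n \<Rightarrow> nat" assume a: "\<alpha> \<in> mons m"
    show "\<bar>a \<alpha> * mon \<alpha> v\<bar> \<le> B * V ^ m"
      unfolding abs_mult using assms(1)[OF a] mon_bound[OF assms(2), of \<alpha>] a
      by (intro mult_mono) (auto simp: mons_def)
  qed
  finally show ?thesis by (simp add: mult_ac)
qed

lemma dhp_bound:
  fixes a :: "('n::finite \<Rightarrow> nat) \<Rightarrow> real"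
  assumes "\<And>\<alpha>. \<alpha> \<in> mons m \<Longrightarrow> \<bar>a \<alpha>\<bar> \<le> B" "norm v \<le> V"
  shows "\<bar>dhp m a v u\<bar> \<le> real (card (mons m :: ('n::finite \<Rightarrow> nat) set)) * real m * V ^ (m - 1) * B * norm u"
   
proof -
  have "\<bar>dhp m a v u\<bar> \<le> (\<Sum>\<alpha>\<in>mons m. \<bar>a \<alpha> * dmon \<alpha> v u\<bar>)"
    unfolding dhp_def by (rule sum_abs)
  also have "\<dots> \<le> (\<Sum>\<alpha>\<in>(mons m :: ('n \<Rightarrow> nat) set). B * (real m * V ^ (m - 1) * norm u))"
  proof (rule sum_mono)
    fix \<alpha> :: "'n \<Rightarrow> nat" assume a: "\<alpha> \<in> mons m"
    show "\<bar>a \<alpha> * dmon \<alpha> v u\<bar> \<le> B * (real m * V ^ (m - 1) * norm u)"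
      unfolding abs_mult using assms(1)[OF a] dmon_bound[OF assms(2), of \<alpha> u] a
      by (intro mult_mono) (auto simp: mons_def)
  qed
  finally show ?thesis by (simp add: mult_ac)
qed

lemma hp_Lipschitz:
  fixes a :: "('n::finite \<Rightarrow> nat) \<Rightarrow> real"
  assumes "\<And>\<alpha>. \<alpha> \<in> mons m \<Longrightarrow> \<bar>a \<alpha>\<bar> \<le> B" "norm v \<le> V" "norm w \<le> V"
  shows "\<bar>hp m a v - hp m a w\<bar> \<le> real (card (mons m :: ('n::finite \<Rightarrow> nat) set)) * real m * V ^ (m - 1) * B * norm (v - w)"
   
proof -
  have "\<bar>hp m a v - hp m a w\<bar> \<le> (\<Sum>\<alpha>\<in>mons m. \<bar>a \<alpha> * (mon \<alpha> v - mon \<alpha> w)\<bar>)"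
    unfolding hp_def sum_subtractf[symmetric] right_diff_distrib[symmetric] by (rule sum_abs)
  also have "\<dots> \<le> (\<Sum>\<alpha>\<in>(mons m :: ('n \<Rightarrow> nat) set). B * (real m * V ^ (m - 1) * norm (v - w)))"
  proof (rule sum_mono)
    fix \<alpha> :: "'n \<Rightarrow> nat" assume a: "\<alpha> \<in> mons m"
    show "\<bar>a \<alpha> * (mon \<alpha> v - mon \<alpha> w)\<bar> \<le> B * (real m * V ^ (m - 1) * norm (v - w))"
      unfolding abs_mult using assms(1)[OF a] mon_Lipschitz[OF assms(2,3), of \<alpha>] a
      by (intro mult_mono) (auto simp: mons_def)
  qed
  finally show ?thesis by (simp add: mult_ac)
qed

lemma tendsto_hp [tendsto_intros]:
  assumes "\<And>\<alpha>. \<alpha> \<in> mons m \<Longrightarrow> ((\<lambda>x. a x \<alpha>) \<longlongrightarrow> b \<alpha>) F" "(f \<longlongrightarrow> l) F"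
  shows "((\<lambda>x. hp m (a x) (f x)) \<longlongrightarrow> hp m b l) F"
  unfolding hp_def by (intro tendsto_intros assms)

lemma tendsto_dhp [tendsto_intros]:
  assumes "\<And>\<alpha>. \<alpha> \<in> mons m \<Longrightarrow> ((\<lambda>x. a x \<alpha>) \<longlongrightarrow> b \<alpha>) F" "(f \<longlongrightarrow> l) F" "(g \<longlongrightarrow> k) F"
  shows "((\<lambda>x. dhp m (a x) (f x) (g x)) \<longlongrightarrow> dhp m b l k) F"
  unfolding dhp_def by (intro tendsto_intros assms)

section \<open>Coefficients of a homogeneous polynomial recovered from its values\<close>

lemma divided_difference_weights:
  fixes \<delta> :: real
  assumes "\<delta> \<noteq> 0"
  shows "\<exists>l :: nat \<Rightarrow> real. \<forall>y b. b \<le> a \<longrightarrow> (\<Sum>k\<le>a. l k * (y + \<delta> * real k) ^ b) = (if b = a then 1 else 0)"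
proof (induction a)
  case 0
  show ?case by (intro exI[of _ "\<lambda>_. 1"]) auto
next
  case (Suc a)
  then obtain l where l: "\<And>y b. b \<le> a \<Longrightarrow> (\<Sum>k\<le>a. l k * (y + \<delta> * real k) ^ b) = (if b = a then 1 else 0 :: real)"
    by auto
  \<comment> \<open>The new weights apply those of order \<open>a\<close> to forward differences.
    The forward difference of the power \<open>Suc a\<close> has leading coefficient
    \<open>real (Suc a) * \<delta>\<close>, which \<open>c\<close> normalises to 1.\<close>
  define c where "c = 1 / (real (Suc a) * \<delta>)"
  define l' where "l' k = c * ((if k = 0 then 0 else l (k - 1)) - (if k \<le> a then l k else 0))" for k
  have shift: "(\<Sum>k\<le>Suc a. l' k * f k) = c * (\<Sum>k\<le>a. l k * (f (Suc k) - f k))" for f :: "nat \<Rightarrow> real"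
  proof -
    have "(\<Sum>k\<le>Suc a. l' k * f k) = c * ((\<Sum>k\<le>Suc a. (if k = 0 then 0 else l (k - 1)) * f k) - (\<Sum>k\<le>Suc a. (if k \<le> a then l k else 0) * f k))"
      unfolding l'_def by (simp only: sum_distrib_left sum_subtractf[symmetric] algebra_simps)
    also have "(\<Sum>k\<le>Suc a. (if k = 0 then 0 else l (k - 1)) * f k) = (\<Sum>k\<le>a. l k * f (Suc k))"
      by (subst sum.atMost_Suc_shift) simp
    also have "(\<Sum>k\<le>Suc a. (if k \<le> a then l k else 0) * f k) = (\<Sum>k\<le>a. l k * f k)"
      by simp
    finally show ?thesis by (simp add: sum_subtractf right_diff_distrib)
  qed
  have "(\<Sum>k\<le>Suc a. l' k * (y + \<delta> * real k) ^ b) = (if b = Suc a then 1 else 0)" if b: "b \<le> Suc a" for y b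
  proof -
    have bin: "(y + \<delta> * real (Suc k)) ^ b - (y + \<delta> * real k) ^ b
      = (\<Sum>i<b. of_nat (b choose i) * \<delta> ^ (b - i) * (y + \<delta> * real k) ^ i)" for k
    proof -
      have "y + \<delta> * real (Suc k) = (y + \<delta> * real k) + \<delta>" by (simp add: algebra_simps)
      then have "(y + \<delta> * real (Suc k)) ^ b = (\<Sum>i\<le>b. of_nat (b choose i) * (y + \<delta> * real k) ^ i * \<delta> ^ (b - i))"
        using binomial_ring by metis
      also have "{..b} = insert b {..<b}" by auto
      finally show ?thesis by (simp add: mult_ac)
    qed
    have "(\<Sum>k\<le>Suc a. l' k * (y + \<delta> * real k) ^ b)
       = c * (\<Sum>k\<le>a. \<Sum>i<b. of_nat (b choose i) * \<delta> ^ (b - i) * (l k * (y + \<delta> * real k) ^ i))"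
      unfolding shift bin sum_distrib_left by (simp add: mult_ac)
    also have "\<dots> = c * (\<Sum>i<b. of_nat (b choose i) * \<delta> ^ (b - i) * (\<Sum>k\<le>a. l k * (y + \<delta> * real k) ^ i))"
      by (subst sum.swap) (simp only: sum_distrib_left)
    also have "\<dots> = c * (\<Sum>i<b. of_nat (b choose i) * \<delta> ^ (b - i) * (if i = a then 1 else 0))"
      using l b by (intro arg_cong[where f="(*) c"] sum.cong) auto
    also have "\<dots> = (if b = Suc a then 1 else 0)"
    proof (cases "b = Suc a")
      case True
      have "Suc a choose a = Suc a" using binomial_Suc_n by blast
      then show ?thesis using True assms unfolding c_def by (simp add: sum.delta if_distrib cong: if_cong)
    next
      case False
      then have "a \<notin> {..<b}" using b by auto
      then show ?thesis using False by (auto intro!: sum.neutral)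
    qed
    finally show ?thesis .
  qed
  then show ?case by blast
qed

text \<open>The nodes do not depend on the shift \<open>x\<close>: the leading coefficients of a polynomial are
  invariant under translation, and divided differences only see the leading coefficients.\<close>

lemma hp_coefficients_from_values:
  fixes c :: "real ^ 'n::finite"
  assumes "\<rho> > 0"
  shows "\<exists>(I :: ('n \<Rightarrow> nat) set) z \<Lambda>. finite I \<and> z ` I \<subseteq> cball c \<rho> \<and>
    (\<forall>a x. \<forall>\<alpha>\<in>mons m. a \<alpha> = (\<Sum>\<kappa>\<in>I. \<Lambda> \<alpha> \<kappa> * hp m a (z \<kappa> - x)))"
proof -
  \<comment> \<open>At most \<open>m\<close> steps of this length in each coordinate keep a node
    within distance \<open>\<rho>\<close> of \<open>c\<close>, even in the l1 norm.\<close>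
  define \<delta> where "\<delta> = \<rho> / (real (CARD('n)) * real (Suc m))"
  have d: "\<delta> > 0" using assms unfolding \<delta>_def by simp
  obtain l where l: "\<And>a y b. b \<le> a \<Longrightarrow> (\<Sum>k\<le>a. l a k * (y + \<delta> * real k) ^ b) = (if b = a then 1 else 0 :: real)"
    using divided_difference_weights[of \<delta>] d by (metis less_irrefl)
  \<comment> \<open>Extension by 0, so that the one-dimensional sums for all orders run over the
    same range and the product of sums can be expanded.\<close>
  define l' where "l' a k = (if k \<le> a then l a k else 0)" for a k
  have l': "(\<Sum>k\<le>m. l' a k * (y + \<delta> * real k) ^ b) = (if b = a then 1 else 0)" if "b \<le> a" "a \<le> m" for a b y
  proof -
    have "(\<Sum>k\<le>m. l' a k * (y + \<delta> * real k) ^ b) = (\<Sum>k\<le>a. l' a k * (y + \<delta> * real k) ^ b)"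
      by (rule sum.mono_neutral_right) (use that in \<open>auto simp: l'_def\<close>)
    then show ?thesis using l[OF that(1), of y] by (simp add: l'_def)
  qed
  define I where "I = PiE (UNIV :: 'n set) (\<lambda>_. {..m})"
  define z :: "('n \<Rightarrow> nat) \<Rightarrow> real ^ 'n" where "z \<kappa> = (\<chi> i. c $ i + \<delta> * real (\<kappa> i))" for \<kappa>
  define \<Lambda> where "\<Lambda> \<alpha> \<kappa> = (\<Prod>i\<in>UNIV. l' (\<alpha> i) (\<kappa> i))" for \<alpha> \<kappa> :: "'n \<Rightarrow> nat"
  have fin: "finite I" unfolding I_def by (intro finite_PiE) auto
  have "z \<kappa> \<in> cball c \<rho>" if "\<kappa> \<in> I" for \<kappa>
  proof -
    have "norm (z \<kappa> - c) \<le> (\<Sum>i\<in>UNIV. \<bar>(z \<kappa> - c) $ i\<bar>)" by (rule norm_le_l1_cart)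
    also have "\<dots> \<le> (\<Sum>i\<in>(UNIV :: 'n set). \<delta> * real (Suc m))"
    proof (rule sum_mono)
      fix i
      have "\<kappa> i \<le> m" using that unfolding I_def by auto
      then show "\<bar>(z \<kappa> - c) $ i\<bar> \<le> \<delta> * real (Suc m)"
        using d unfolding z_def by (simp add: abs_mult)
    qed
    also have "\<dots> = \<rho>" unfolding \<delta>_def by simp
    finally show ?thesis by (simp add: dist_norm norm_minus_commute)
  qed
  moreover have "a \<alpha> = (\<Sum>\<kappa>\<in>I. \<Lambda> \<alpha> \<kappa> * hp m a (z \<kappa> - x))" if \<alpha>: "\<alpha> \<in> mons m" for a x \<alpha>
  proof -
    have mono: "(\<Sum>\<kappa>\<in>I. \<Lambda> \<alpha> \<kappa> * mon \<beta> (z \<kappa> - x)) = (if \<beta> = \<alpha> then 1 else 0)" if \<beta>: "\<beta> \<in> mons m" for \<beta>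
    proof -
      have "(\<Sum>\<kappa>\<in>I. \<Lambda> \<alpha> \<kappa> * mon \<beta> (z \<kappa> - x))
        = (\<Sum>\<kappa>\<in>I. \<Prod>i\<in>UNIV. l' (\<alpha> i) (\<kappa> i) * ((c $ i - x $ i) + \<delta> * real (\<kappa> i)) ^ \<beta> i)"
        unfolding \<Lambda>_def mon_def z_def prod.distrib[symmetric] by (simp add: algebra_simps)
      also have "\<dots> = (\<Prod>i\<in>UNIV. \<Sum>k\<le>m. l' (\<alpha> i) k * ((c $ i - x $ i) + \<delta> * real k) ^ \<beta> i)"
        unfolding I_def by (rule prod_sum_PiE[symmetric]) auto
      also have "\<dots> = (if \<beta> = \<alpha> then 1 else 0)"
      proof (cases "\<beta> = \<alpha>")
        case True
        then show ?thesis using mons_le[OF \<alpha>] by (auto intro!: prod.neutral simp: l')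
      next
        case False
        \<comment> \<open>Two distinct multi-indices of equal degree: in some coordinate
          \<open>\<beta>\<close> is smaller, and there the divided difference of order
          \<open>\<alpha> i\<close> kills the lower power.\<close>
        have "\<exists>i. \<beta> i < \<alpha> i"
        proof (rule ccontr)
          assume "\<not> ?thesis"
          then have le: "\<alpha> i \<le> \<beta> i" for i by (simp add: not_less)
          obtain j where "\<alpha> j < \<beta> j" using False le by (metis ext le_neq_implies_less)
          then have "mdeg \<alpha> < mdeg \<beta>" unfolding mdeg_def
            by (intro sum_strict_mono_ex1) (use le in auto)
          then show False using \<alpha> \<beta> by (auto simp: mons_def)
        qed
        then obtain i where "\<beta> i < \<alpha> i" by blast
        then have "(\<Sum>k\<le>m. l' (\<alpha> i) k * ((c $ i - x $ i) + \<delta> * real k) ^ \<beta> i) = 0"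
          using l'[of "\<beta> i" "\<alpha> i"] mons_le[OF \<alpha>, of i] by simp
        then show ?thesis using False by (auto intro!: prod_zero)
      qed
      finally show ?thesis .
    qed
    have "(\<Sum>\<kappa>\<in>I. \<Lambda> \<alpha> \<kappa> * hp m a (z \<kappa> - x)) = (\<Sum>\<beta>\<in>mons m. a \<beta> * (\<Sum>\<kappa>\<in>I. \<Lambda> \<alpha> \<kappa> * mon \<beta> (z \<kappa> - x)))"
      unfolding hp_def sum_distrib_left by (subst sum.swap) (simp add: mult_ac)
    also have "\<dots> = (\<Sum>\<beta>\<in>mons m. a \<beta> * (if \<beta> = \<alpha> then 1 else 0))"
      using mono by (intro sum.cong) auto
    also have "\<dots> = a \<alpha>" using \<alpha> by (simp add: sum.delta if_distrib cong: if_cong)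
    finally show ?thesis by simp
  qed
  ultimately show ?thesis using fin by (intro exI[of _ I] exI[of _ z] exI[of _ \<Lambda>]) auto
qed

section \<open>Products and linear substitutions of homogeneous polynomials\<close>

lemma hp_sum_closed:
  assumes "finite S" "\<And>s. s \<in> S \<Longrightarrow> \<exists>b. \<forall>v. f s v = hp m b v"
  shows "\<exists>b. \<forall>v. (\<Sum>s\<in>S. c s * f s v) = hp m b v"
  using assms
proof (induction S rule: finite_induct)
  case empty
  show ?case by (intro exI[of _ "\<lambda>_. 0"]) (simp add: hp_def)
next
  case (insert x S)
  then obtain b b' where "\<forall>v. (\<Sum>s\<in>S. c s * f s v) = hp m b v" "\<forall>v. f x v = hp m b' v" by blast
  then have "\<forall>v. (\<Sum>s\<in>insert x S. c s * f s v) = hp m (\<lambda>\<alpha>. c x * b' \<alpha> + 1 * b \<alpha>) v"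
    using insert.hyps by (simp add: hp_lincomb[of m "c x" _ 1, simplified])
  then show ?case by blast
qed

lemma mon_eq_hp: "\<alpha> \<in> mons m \<Longrightarrow> \<exists>b. \<forall>v. mon \<alpha> v = hp m b v"
  by (intro exI[of _ "\<lambda>\<beta>. if \<beta> = \<alpha> then 1 else 0"])
    (simp add: hp_def sum.delta if_distrib[of "\<lambda>x. x * _"] cong: if_cong)

lemma hp_mult_closed:
  fixes f g :: "real ^ 'n::finite \<Rightarrow> real"
  assumes "\<exists>b. \<forall>v. f v = hp m b v" "\<exists>b. \<forall>v. g v = hp k b v"
  shows "\<exists>b. \<forall>v. f v * g v = hp (m + k) b v"
proof -
  obtain a b where a: "\<And>v. f v = hp m a v" and b: "\<And>v. g v = hp k b v" using assms by blast
  have "f v * g v = (\<Sum>(\<alpha>,\<beta>)\<in>mons m \<times> mons k. (a \<alpha> * b \<beta>) * mon (\<lambda>i. \<alpha> i + \<beta> i) v)" for v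
    unfolding a b hp_def sum_product sum.cartesian_product mon_def
    by (intro sum.cong) (auto simp: power_add prod.distrib)
  moreover have "\<exists>d. \<forall>v. (\<Sum>s\<in>mons m \<times> mons k. (a (fst s) * b (snd s)) * mon (\<lambda>i. fst s i + snd s i) v) = hp (m + k) d v"
  proof (rule hp_sum_closed)
    fix s assume "s \<in> (mons m :: ('n \<Rightarrow> nat) set) \<times> (mons k :: ('n \<Rightarrow> nat) set)"
    then have "(\<lambda>i. fst s i + snd s i) \<in> mons (m + k)"
      by (auto simp: mons_def mdeg_def sum.distrib)
    then show "\<exists>b. \<forall>v. mon (\<lambda>i. fst s i + snd s i) v = hp (m + k) b v" by (rule mon_eq_hp)
  qed simp
  ultimately show ?thesis by (simp add: case_prod_beta)
qed

text \<open>This turns polynomials in the momentum \<open>g x *v v\<close> into polynomials of the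
  same degree in the velocity \<open>v\<close>. Only the existence of new coefficients matters: the
  components of \<open>A *v v\<close> have degree 1, and the class is closed under products and
  linear combinations.\<close>

lemma hp_linear_substitution:
  fixes A :: "real ^ 'n ^ 'n::finite"
  shows "\<exists>b. \<forall>v. hp m a (A *v v) = hp m b v"
proof -
  have lin: "\<exists>b. \<forall>v. (A *v v) $ i = hp 1 b v" for i
  proof -
    define e :: "'n \<Rightarrow> 'n \<Rightarrow> nat" where "e j = (\<lambda>i. if i = j then 1 else 0)" for j
    have me: "mon (e j) v = v $ j" for j v
    proof -
      have "mon (e j) v = (\<Prod>i\<in>UNIV. if i = j then v $ i else 1)"
        unfolding mon_def e_def by (intro prod.cong) auto
      then show ?thesis by (simp add: prod.delta)
    qed
    have "e j \<in> mons 1" for j unfolding mons_def mdeg_def e_def by simp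
    then have "\<exists>b. \<forall>v. (\<Sum>j\<in>UNIV. A $ i $ j * mon (e j) v) = hp 1 b v"
      by (intro hp_sum_closed mon_eq_hp) auto
    then show ?thesis by (simp add: me matrix_vector_mult_def)
  qed
  have pw: "\<exists>b. \<forall>v. (A *v v) $ i ^ k = hp k b v" for i k
  proof (induction k)
    case 0
    have "hp 0 (\<lambda>_. 1) v = 1" for v :: "real ^ 'n"
    proof -
      have "mons 0 = {\<lambda>_::'n. 0::nat}" unfolding mons_def mdeg_def by auto
      then show ?thesis by (simp add: hp_def mon_def)
    qed
    then show ?case by (intro exI[of _ "\<lambda>_. 1"]) simp
  next
    case (Suc k)
    from hp_mult_closed[OF lin[of i] this] show ?case by simp
  qed
  have pr: "\<exists>b. \<forall>v. (\<Prod>i\<in>S. (A *v v) $ i ^ \<alpha> i) = hp (sum \<alpha> S) b v" if "finite S" for S and \<alpha> :: "'n \<Rightarrow> nat"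
    using that
  proof (induction S rule: finite_induct)
    case empty
    from pw[of undefined 0] show ?case by simp
  next
    case (insert x S)
    from hp_mult_closed[OF pw[of x "\<alpha> x"] insert.IH] show ?case using insert.hyps by simp
  qed
  have "\<exists>b. \<forall>v. (\<Sum>\<alpha>\<in>mons m. a \<alpha> * mon \<alpha> (A *v v)) = hp m b v"
  proof (rule hp_sum_closed)
    fix \<alpha> :: "'n \<Rightarrow> nat" assume "\<alpha> \<in> mons m"
    with pr[of UNIV \<alpha>] show "\<exists>b. \<forall>v. mon \<alpha> (A *v v) = hp m b v"
      by (simp add: mon_def mons_def mdeg_def)
  qed simp
  then show ?thesis by (simp add: hp_def)
qed

text \<open>Continuous convergence: \<open>f j y\<close> tends to \<open>g x\<close> as
  \<open>j\<close> tends to infinity and \<open>y\<close> to \<open>x\<close> within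
  \<open>K\<close>, jointly. On compact \<open>K\<close> and for metric-valued functions this is
  uniform convergence to a continuous limit, but in this form it can be composed with moving points
  and with the usual limit rules.\<close>

definition cconv :: "'a::topological_space set \<Rightarrow> (nat \<Rightarrow> 'a \<Rightarrow> 'b::topological_space) \<Rightarrow> ('a \<Rightarrow> 'b) \<Rightarrow> bool" where
  "cconv K f g \<longleftrightarrow> (\<forall>x\<in>K. ((\<lambda>z. f (fst z) (snd z)) \<longlongrightarrow> g x) (sequentially \<times>\<^sub>F inf (nhds x) (principal K)))"

lemma eventually_uniformly_compact:
  assumes "compact K"
    and ev: "\<And>x. x \<in> K \<Longrightarrow> eventually P (sequentially \<times>\<^sub>F inf (nhds x) (principal K))"
  shows "\<exists>N. \<forall>j\<ge>N. \<forall>y\<in>K. P (j, y)"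
proof -
  have "\<exists>N U. open U \<and> x \<in> U \<and> (\<forall>j\<ge>N. \<forall>y\<in>U \<inter> K. P (j, y))" if x: "x \<in> K" for x
  proof -
    obtain Q R where QR: "eventually Q sequentially" "eventually R (inf (nhds x) (principal K))" "\<And>i y. Q i \<Longrightarrow> R y \<Longrightarrow> P (i, y)"
      using ev[OF x] unfolding eventually_prod_filter by auto
    then show ?thesis
      unfolding eventually_sequentially eventually_inf_principal eventually_nhds by blast
  qed
  then obtain N U where NU: "\<And>x. x \<in> K \<Longrightarrow> open (U x) \<and> x \<in> U x \<and> (\<forall>j\<ge>N x. \<forall>y\<in>U x \<inter> K. P (j, y))"
    by metis
  obtain C where C: "C \<subseteq> K" "finite C" "K \<subseteq> (\<Union>c\<in>C. U c)"
    by (rule compactE_image[OF assms(1), of K U]) (use NU in auto)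
  have "P (j, y)" if jy: "j \<ge> (\<Sum>c\<in>C. N c)" "y \<in> K" for j y
  proof -
    obtain c where c: "c \<in> C" "y \<in> U c" using C jy by blast
    then have "N c \<le> (\<Sum>c\<in>C. N c)" using C by (intro member_le_sum) auto
    then show ?thesis using NU[of c] c C jy by auto
  qed
  then show ?thesis by blast
qed

lemma cconv_seq:
  assumes "cconv K f g" "x \<in> K" "\<And>j. y j \<in> K" "(y \<longlongrightarrow> x) F" "filterlim s sequentially F"
  shows "((\<lambda>j. f (s j) (y j)) \<longlongrightarrow> g x) F"
proof -
  have "filterlim y (inf (nhds x) (principal K)) F"
    using assms(3,4) by (auto simp: filterlim_inf filterlim_principal)
  from filterlim_compose[OF assms(1)[unfolded cconv_def, rule_format, OF assms(2)] filterlim_Pair[OF assms(5) this]]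
  show ?thesis by simp
qed

lemma cconv_pointwise:
  assumes "cconv K f g" "x \<in> K" shows "(\<lambda>j. f j x) \<longlonglongrightarrow> g x"
  by (rule cconv_seq[OF assms(1,2)]) (auto intro: assms filterlim_ident)

lemma cconv_subseq:
  assumes "cconv K f g" "strict_mono s" shows "cconv K (\<lambda>j. f (s j)) g"
  unfolding cconv_def
proof
  fix x assume x: "x \<in> K"
  have "filterlim (\<lambda>z. (s (fst z), snd z)) (sequentially \<times>\<^sub>F inf (nhds x) (principal K)) (sequentially \<times>\<^sub>F inf (nhds x) (principal K))"
    by (intro filterlim_Pair filterlim_compose[OF filterlim_subseq[OF assms(2)] filterlim_fst] filterlim_snd)
  from filterlim_compose[OF assms(1)[unfolded cconv_def, rule_format, OF x] this]
  show "((\<lambda>z. f (s (fst z)) (snd z)) \<longlongrightarrow> g x) (sequentially \<times>\<^sub>F inf (nhds x) (principal K))" by simp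
qed

text \<open>The joint limit controls \<open>f j y\<close> for all \<open>y\<close> near
  \<open>x\<close> and all large \<open>j\<close> at once. Letting \<open>j\<close> tend to infinity
  at fixed \<open>y\<close> hands this control on to \<open>g\<close>.\<close>

lemma cconv_continuous:
  fixes f :: "nat \<Rightarrow> 'a::metric_space \<Rightarrow> 'b::metric_space"
  assumes "cconv K f g" shows "continuous_on K g"
  unfolding continuous_on_iff
proof (intro ballI allI impI)
  fix x e assume x: "x \<in> K" and e: "(0::real) < e"
  have "eventually (\<lambda>z. dist (f (fst z) (snd z)) (g x) < e / 2) (sequentially \<times>\<^sub>F inf (nhds x) (principal K))"
    by (rule tendstoD) (use assms x e in \<open>auto simp: cconv_def\<close>)
  then obtain Q R where Q: "eventually Q sequentially" and R: "eventually R (inf (nhds x) (principal K))"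
    and QR: "\<And>i y. Q i \<Longrightarrow> R y \<Longrightarrow> dist (f i y) (g x) < e / 2"
    unfolding eventually_prod_filter by auto
  from R obtain d where d: "d > 0" "\<And>y. y \<in> K \<Longrightarrow> dist y x < d \<Longrightarrow> R y"
    unfolding eventually_inf_principal eventually_nhds_metric by blast
  have "dist (g y) (g x) < e" if y: "y \<in> K" "dist y x < d" for y
  proof -
    have "dist (g y) (g x) \<le> e / 2"
    proof (rule tendsto_upperbound)
      show "(\<lambda>j. dist (f j y) (g x)) \<longlonglongrightarrow> dist (g y) (g x)"
        by (intro tendsto_intros cconv_pointwise[OF assms y(1)])
      show "eventually (\<lambda>j. dist (f j y) (g x) \<le> e / 2) sequentially"
        using Q by eventually_elim (use QR d y in \<open>auto intro: less_imp_le\<close>)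
    qed simp
    then show ?thesis using e by simp
  qed
  then show "\<exists>d>0. \<forall>x'\<in>K. dist x' x < d \<longrightarrow> dist (g x') (g x) < e" using d by blast
qed

lemma cconv_uniform:
  fixes f :: "nat \<Rightarrow> 'a::metric_space \<Rightarrow> 'b::metric_space"
  assumes "compact K" "cconv K f g" "e > 0"
  shows "\<exists>N. \<forall>j\<ge>N. \<forall>x\<in>K. dist (f j x) (g x) < e"
proof -
  have "\<exists>N. \<forall>j\<ge>N. \<forall>x\<in>K. (\<lambda>z. dist (f (fst z) (snd z)) (g (snd z)) < e) (j, x)"
  proof (rule eventually_uniformly_compact[OF assms(1)])
    fix x assume x: "x \<in> K"
    let ?F = "sequentially \<times>\<^sub>F inf (nhds x) (principal K)"
    have "filterlim (snd :: nat \<times> 'a \<Rightarrow> 'a) (inf (nhds x) (principal K)) ?F" by (rule filterlim_snd)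
    moreover have "(g \<longlongrightarrow> g x) (inf (nhds x) (principal K))"
    proof (rule tendstoI)
      fix e :: real assume "e > 0"
      then show "eventually (\<lambda>y. dist (g y) (g x) < e) (inf (nhds x) (principal K))"
        using cconv_continuous[OF assms(2)] x
        unfolding continuous_on_iff eventually_inf_principal eventually_nhds_metric by blast
    qed
    ultimately have "((\<lambda>z. g (snd z)) \<longlongrightarrow> g x) ?F" by (rule filterlim_compose[rotated])
    moreover have "((\<lambda>z. f (fst z) (snd z)) \<longlongrightarrow> g x) ?F" using assms(2) x by (auto simp: cconv_def)
    ultimately have "((\<lambda>z. dist (f (fst z) (snd z)) (g (snd z))) \<longlongrightarrow> dist (g x) (g x)) ?F" by (intro tendsto_intros)
    then show "eventually (\<lambda>z. dist (f (fst z) (snd z)) (g (snd z)) < e) ?F"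
      using assms(3) by (intro order_tendstoD) auto
  qed
  then show ?thesis by simp
qed

lemma cconv_bounded:
  fixes f :: "nat \<Rightarrow> 'a::metric_space \<Rightarrow> 'b::real_normed_vector"
  assumes "compact K" "cconv K f g"
  shows "\<exists>C\<ge>0. \<exists>N. \<forall>j\<ge>N. \<forall>x\<in>K. norm (f j x) \<le> C"
proof -
  obtain N where N: "\<And>j x. j \<ge> N \<Longrightarrow> x \<in> K \<Longrightarrow> dist (f j x) (g x) < 1"
    using cconv_uniform[OF assms, of 1] by auto
  have "bounded (g ` K)"
    using compact_continuous_image[OF cconv_continuous[OF assms(2)] assms(1)] by (rule compact_imp_bounded)
  then obtain C where C: "\<And>x. x \<in> K \<Longrightarrow> norm (g x) \<le> C" by (auto simp: bounded_iff)
  have "norm (f j x) \<le> \<bar>C\<bar> + 1" if "j \<ge> N" "x \<in> K" for j x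
  proof -
    have "norm (f j x) \<le> norm (g x) + dist (f j x) (g x)"
      by (metis dist_norm norm_triangle_sub)
    then show ?thesis using N[OF that] C[OF that(2)] by linarith
  qed
  then show ?thesis by (intro exI[of _ "\<bar>C\<bar> + 1"]) auto
qed

lemma uniform_imp_cconv:
  fixes f :: "nat \<Rightarrow> 'a::metric_space \<Rightarrow> 'b::metric_space"
  assumes "\<And>e. e > 0 \<Longrightarrow> \<exists>N. \<forall>j\<ge>N. \<forall>x\<in>K. dist (f j x) (g x) < e" "continuous_on K g"
  shows "cconv K f g"
  unfolding cconv_def
proof (intro ballI tendstoI)
  fix x e assume x: "x \<in> K" and e: "(0::real) < e"
  obtain N where N: "\<forall>j\<ge>N. \<forall>x\<in>K. dist (f j x) (g x) < e / 2" using assms(1)[of "e/2"] e by auto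
  obtain d where d: "d > 0" "\<forall>x'\<in>K. dist x' x < d \<longrightarrow> dist (g x') (g x) < e / 2"
    using assms(2) x e unfolding continuous_on_iff by (metis half_gt_zero)
  have "eventually (\<lambda>j. j \<ge> N) sequentially" by (rule eventually_ge_at_top)
  moreover have "eventually (\<lambda>y. y \<in> K \<and> dist y x < d) (inf (nhds x) (principal K))"
    unfolding eventually_inf_principal eventually_nhds_metric using d(1) by blast
  ultimately have "eventually (\<lambda>z. fst z \<ge> N \<and> (snd z \<in> K \<and> dist (snd z) x < d)) (sequentially \<times>\<^sub>F inf (nhds x) (principal K))"
    unfolding eventually_prod_filter by fastforce
  then show "\<forall>\<^sub>F z in sequentially \<times>\<^sub>F inf (nhds x) (principal K). dist (f (fst z) (snd z)) (g x) < e"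
  proof eventually_elim
    case (elim z)
    have "dist (f (fst z) (snd z)) (g x) \<le> dist (f (fst z) (snd z)) (g (snd z)) + dist (g (snd z)) (g x)"
      by (rule dist_triangle)
    also have "\<dots> < e / 2 + e / 2" using N d(2) elim by (intro add_strict_mono) auto
    finally show ?case by simp
  qed
qed

subsection \<open>Polynomials with a prescribed derivative along lines\<close>

text \<open>In the language of symmetric tensors this prescribes the symmetrised derivative. Nothing
  is said about derivatives of single coefficients. The derivative within the set of admissible
  parameters becomes one-sided where the line leaves \<open>K\<close>.\<close>

definition line_eq ::
  "(real ^ 'n::finite) set \<Rightarrow> nat \<Rightarrow> (real ^ 'n \<Rightarrow> ('n \<Rightarrow> nat) \<Rightarrow> real) \<Rightarrow> (real ^ 'n \<Rightarrow> real ^ 'n \<Rightarrow> real) \<Rightarrow> bool" where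
  "line_eq K m a T \<longleftrightarrow> (\<forall>x v t. x + t *\<^sub>R v \<in> K \<longrightarrow>
     ((\<lambda>s. hp m (a (x + s *\<^sub>R v)) v) has_real_derivative T (x + t *\<^sub>R v) v) (at t within {s. x + s *\<^sub>R v \<in> K}))"

lemma line_eqD:
  "line_eq K m a T \<Longrightarrow> x + t *\<^sub>R v \<in> K \<Longrightarrow>
     ((\<lambda>s. hp m (a (x + s *\<^sub>R v)) v) has_real_derivative T (x + t *\<^sub>R v) v) (at t within {s. x + s *\<^sub>R v \<in> K})"
  by (rule line_eq_def[THEN iffD1, rule_format])

lemma line_eq_subset: "line_eq K m a T \<Longrightarrow> L \<subseteq> K \<Longrightarrow> line_eq L m a T"
  unfolding line_eq_def by (intro allI impI) (rule DERIV_subset, auto)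

lemma line_eq_cong:
  assumes "line_eq K m a T" "\<And>x v. x \<in> K \<Longrightarrow> T x v = T' x v" shows "line_eq K m a T'"
  using assms unfolding line_eq_def by simp

lemma line_eq_lincomb:
  assumes "line_eq K m a T" "line_eq K m b T'"
  shows "line_eq K m (\<lambda>x \<alpha>. s * a x \<alpha> + t * b x \<alpha>) (\<lambda>x v. s * T x v + t * T' x v)"
  unfolding line_eq_def hp_lincomb
proof (intro allI impI)
  fix x v r assume "x + r *\<^sub>R v \<in> K"
  from line_eqD[OF assms(1) this] line_eqD[OF assms(2) this]
  show "((\<lambda>r. s * hp m (a (x + r *\<^sub>R v)) v + t * hp m (b (x + r *\<^sub>R v)) v) has_real_derivative
     s * T (x + r *\<^sub>R v) v + t * T' (x + r *\<^sub>R v) v) (at r within {s. x + s *\<^sub>R v \<in> K})"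
    by (auto intro!: derivative_eq_intros)
qed

lemma convex_line_section:
  assumes "convex K" shows "convex {s::real. x + s *\<^sub>R v \<in> K}"
proof (rule convexI, unfold mem_Collect_eq)
  fix s t p q :: real
  assume *: "x + s *\<^sub>R v \<in> K" "x + t *\<^sub>R v \<in> K" "0 \<le> p" "0 \<le> q" "p + q = 1"
  have "x + (p *\<^sub>R s + q *\<^sub>R t) *\<^sub>R v = (p + q) *\<^sub>R x + (p *\<^sub>R s + q *\<^sub>R t) *\<^sub>R v" using * by simp
  also have "\<dots> = p *\<^sub>R (x + s *\<^sub>R v) + q *\<^sub>R (x + t *\<^sub>R v)" by (simp add: algebra_simps)
  also have "\<dots> \<in> K" using assms * by (intro convexD) auto
  finally show "x + (p *\<^sub>R s + q *\<^sub>R t) *\<^sub>R v \<in> K" .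
qed

lemma line_eq_increment:
  assumes "convex K" "line_eq K m a T" "x \<in> K" "x + s *\<^sub>R v \<in> K" "\<And>y. y \<in> K \<Longrightarrow> \<bar>T y v\<bar> \<le> B"
  shows "\<bar>hp m (a (x + s *\<^sub>R v)) v - hp m (a x) v\<bar> \<le> B * \<bar>s\<bar>"
proof -
  let ?S = "{s. x + s *\<^sub>R v \<in> K}"
  have "norm (hp m (a (x + s *\<^sub>R v)) v - hp m (a (x + 0 *\<^sub>R v)) v) \<le> B * norm (s - 0)"
  proof (rule field_differentiable_bound[where S = ?S and f' = "\<lambda>t. T (x + t *\<^sub>R v) v"])
    show "convex ?S" by (rule convex_line_section[OF assms(1)])
    show "((\<lambda>s. hp m (a (x + s *\<^sub>R v)) v) has_real_derivative T (x + z *\<^sub>R v) v) (at z within ?S)" if "z \<in> ?S" for z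
      using line_eqD[OF assms(2)] that by simp
  qed (use assms in auto)
  then show ?thesis by simp
qed

text \<open>Two points \<open>x\<close>, \<open>x'\<close> are compared through the point \<open>y\<close> at distance of order
  \<open>sqrt (norm (x - x'))\<close> from both, in enough directions \<open>w = z - x\<close> to determine the polynomial.\<close>

lemma line_eq_Hoelder:
  fixes c :: "real ^ 'n::finite"
  assumes "\<rho> > 0"
  shows "\<exists>C\<ge>0. \<forall>a T B. B \<ge> 0 \<longrightarrow> (\<forall>x\<in>cball c \<rho>. \<forall>\<alpha>\<in>mons m. \<bar>a x \<alpha>\<bar> \<le> B) \<longrightarrow> line_eq (cball c \<rho>) m a T \<longrightarrow>
     (\<forall>x\<in>cball c \<rho>. \<forall>v. norm v \<le> 2 * \<rho> + 1 \<longrightarrow> \<bar>T x v\<bar> \<le> B) \<longrightarrow>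
     (\<forall>x\<in>cball c \<rho>. \<forall>x'\<in>cball c \<rho>. norm (x - x') \<le> 1 \<longrightarrow>
       (\<forall>\<alpha>\<in>mons m. \<bar>a x \<alpha> - a x' \<alpha>\<bar> \<le> C * B * sqrt (norm (x - x'))))"
proof -
  \<comment> \<open>The directions used below are differences of points of the ball, of norm at most
    \<open>2 * \<rho>\<close>, modified by at most 1.\<close>
  let ?K = "cball c \<rho>" and ?V = "2 * \<rho> + 1"
  obtain I :: "('n \<Rightarrow> nat) set" and z \<Lambda> where I: "finite I" "z ` I \<subseteq> ?K"
    and co': "\<forall>a x. \<forall>\<alpha>\<in>mons m. a \<alpha> = (\<Sum>\<kappa>\<in>I. \<Lambda> \<alpha> \<kappa> * hp m a (z \<kappa> - x))"
    using hp_coefficients_from_values[OF assms, of c m] by (elim exE conjE) (rule that)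
  have co: "a \<alpha> = (\<Sum>\<kappa>\<in>I. \<Lambda> \<alpha> \<kappa> * hp m a (z \<kappa> - x))" if "\<alpha> \<in> mons m" for a x \<alpha>
    by (rule co'[rule_format, OF that])
  define L where "L = real (card (mons m :: ('n \<Rightarrow> nat) set)) * real m * ?V ^ (m - 1)"
  have L: "L \<ge> 0" unfolding L_def using assms by simp
  \<comment> \<open>The summand 2 stands for the increments along the two lines,
    \<open>2 * L\<close> for exchanging the direction \<open>w\<close> for \<open>w'\<close> at
    \<open>y\<close> and at \<open>x'\<close>. Summing over all \<open>\<alpha>\<close> makes the
    constant independent of the coefficient considered.\<close>
  define C where "C = (\<Sum>\<alpha>\<in>mons m. \<Sum>\<kappa>\<in>I. \<bar>\<Lambda> \<alpha> \<kappa>\<bar>) * (2 + 2 * L)"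
  have C: "C \<ge> 0" unfolding C_def using L by (intro mult_nonneg_nonneg sum_nonneg) auto
  show ?thesis
  proof (intro exI[of _ C] conjI C allI impI ballI)
    fix a :: "real ^ 'n \<Rightarrow> ('n \<Rightarrow> nat) \<Rightarrow> real" and T B x x' and \<alpha> :: "'n \<Rightarrow> nat"
    assume B: "0 \<le> B" and aB: "\<forall>x\<in>?K. \<forall>\<alpha>\<in>mons m. \<bar>a x \<alpha>\<bar> \<le> B" and le: "line_eq ?K m a T"
      and TB: "\<forall>x\<in>?K. \<forall>v. norm v \<le> ?V \<longrightarrow> \<bar>T x v\<bar> \<le> B"
      and x: "x \<in> ?K" and x': "x' \<in> ?K" and near: "norm (x - x') \<le> 1" and \<alpha>: "\<alpha> \<in> mons m"
    \<comment> \<open>The increments along the lines cost a multiple of \<open>s\<close>, the change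
      of direction a multiple of \<open>norm (x - x') / s\<close>. The square root balances the
      two.\<close>
    define s where "s = sqrt (norm (x - x'))"
    have s01: "0 \<le> s" "s \<le> 1" using near unfolding s_def by auto
    have s2: "s * s = norm (x - x')" unfolding s_def by simp
    have diam: "norm (p - q) \<le> 2 * \<rho>" if "p \<in> ?K" "q \<in> ?K" for p q
      using that dist_triangle[of p q c] by (auto simp: dist_norm norm_minus_commute)
    have key: "\<bar>hp m (a x) w - hp m (a x') w\<bar> \<le> (2 + 2 * L) * B * s" if zK: "zz \<in> ?K" and w: "w = zz - x" for zz w
    proof (cases "x = x'")
      case True then show ?thesis using B L s01 by simp
    next
      case False
      then have sp: "s > 0" unfolding s_def by simp
      define y where "y = x + s *\<^sub>R w"
      \<comment> \<open>The direction in which \<open>x'\<close> reaches the same point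
        \<open>y\<close> in the same time \<open>s\<close>.\<close>
      define w' where "w' = w + (1 / s) *\<^sub>R (x - x')"
      have y': "y = x' + s *\<^sub>R w'" unfolding y_def w'_def using sp by (simp add: algebra_simps)
      have yK: "y \<in> ?K"
      proof -
        have "y = (1 - s) *\<^sub>R x + s *\<^sub>R zz" unfolding y_def w by (simp add: algebra_simps)
        then show ?thesis using convexD_alt[OF convex_cball x zK, of s] s01 by simp
      qed
      have wn: "norm w \<le> ?V" using diam[OF zK x] unfolding w by simp
      have "norm (w - w') = norm (x - x') / s" unfolding w'_def using sp by simp
      then have dw: "norm (w - w') = s" unfolding s2[symmetric] using sp by simp
      have w'n: "norm w' \<le> ?V"
      proof -
        have "norm w' \<le> norm w + norm (w - w')" by (metis norm_minus_commute norm_triangle_sub)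
        then show ?thesis using diam[OF zK x] dw s01 unfolding w by simp
      qed
      have conv: "convex ?K" by simp
      have 1: "\<bar>hp m (a y) w - hp m (a x) w\<bar> \<le> B * s"
        using line_eq_increment[OF conv le x, of s w B] yK TB wn s01 unfolding y_def by auto
      have 2: "\<bar>hp m (a y) w' - hp m (a x') w'\<bar> \<le> B * s"
        using line_eq_increment[OF conv le x', of s w' B] yK TB w'n s01 unfolding y' by auto
      have lip: "\<bar>hp m (a u) w - hp m (a u) w'\<bar> \<le> L * B * s" if "u \<in> ?K" for u
        using hp_Lipschitz[of m "a u" B w ?V w'] aB that wn w'n unfolding L_def dw by auto
      have "\<bar>hp m (a x) w - hp m (a x') w\<bar> \<le> B * s + B * s + L * B * s + L * B * s"
        using 1 2 lip[OF yK] lip[OF x'] by linarith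
      then show ?thesis by (simp add: algebra_simps)
    qed
    have "a x \<alpha> - a x' \<alpha> = (\<Sum>\<kappa>\<in>I. \<Lambda> \<alpha> \<kappa> * (hp m (a x) (z \<kappa> - x) - hp m (a x') (z \<kappa> - x)))"
      using co[OF \<alpha>, of "a x" x] co[OF \<alpha>, of "a x'" x] by (simp add: right_diff_distrib sum_subtractf)
    also have "\<bar>\<dots>\<bar> \<le> (\<Sum>\<kappa>\<in>I. \<bar>\<Lambda> \<alpha> \<kappa> * (hp m (a x) (z \<kappa> - x) - hp m (a x') (z \<kappa> - x))\<bar>)"
      by (rule sum_abs)
    also have "\<dots> \<le> (\<Sum>\<kappa>\<in>I. \<bar>\<Lambda> \<alpha> \<kappa>\<bar> * ((2 + 2 * L) * B * s))"
      unfolding abs_mult using I by (intro sum_mono mult_left_mono key[OF _ refl]) auto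
    also have "\<dots> = (\<Sum>\<kappa>\<in>I. \<bar>\<Lambda> \<alpha> \<kappa>\<bar>) * ((2 + 2 * L) * B * s)"
      by (simp add: sum_distrib_right)
    also have "\<dots> \<le> (\<Sum>\<alpha>\<in>mons m. \<Sum>\<kappa>\<in>I. \<bar>\<Lambda> \<alpha> \<kappa>\<bar>) * ((2 + 2 * L) * B * s)"
      using L B s01 \<alpha> by (intro mult_right_mono member_le_sum) (auto intro: sum_nonneg)
    finally show "\<bar>a x \<alpha> - a x' \<alpha>\<bar> \<le> C * B * sqrt (norm (x - x'))"
      unfolding C_def s_def by (simp add: mult_ac)
  qed
qed

lemma common_subsequence:
  assumes "finite S"
    and ex: "\<And>\<alpha> s. \<alpha> \<in> S \<Longrightarrow> strict_mono (s :: nat \<Rightarrow> nat) \<Longrightarrow> \<exists>r. strict_mono (r :: nat \<Rightarrow> nat) \<and> P \<alpha> (s \<circ> r)"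
    and stable: "\<And>\<alpha> s r. P \<alpha> s \<Longrightarrow> strict_mono (r :: nat \<Rightarrow> nat) \<Longrightarrow> P \<alpha> (s \<circ> r)"
  shows "\<exists>s. strict_mono (s :: nat \<Rightarrow> nat) \<and> (\<forall>\<alpha>\<in>S. P \<alpha> s)"
  using assms(1) ex
proof (induction S rule: finite_induct)
  case empty
  show ?case by (intro exI[of _ id]) (auto simp: strict_mono_def)
next
  case (insert \<beta> S)
  then obtain s where s: "strict_mono s" "\<forall>\<alpha>\<in>S. P \<alpha> s" by blast
  obtain r where r: "strict_mono r" "P \<beta> (s \<circ> r)" using insert.prems s(1) by blast
  then show ?case using s stable strict_mono_o by blast
qed

text \<open>The Hoelder estimate makes each coefficient equicontinuous in \<open>j\<close>, so
  Arzela-Ascoli applies. A common subsequence exists because there are finitely many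
  coefficients.\<close>

lemma line_eq_compactness:
  fixes c :: "real ^ 'n::finite" and a :: "nat \<Rightarrow> real ^ 'n \<Rightarrow> ('n \<Rightarrow> nat) \<Rightarrow> real"
  assumes "\<rho> > 0"
    and aB: "\<And>j x \<alpha>. x \<in> cball c \<rho> \<Longrightarrow> \<alpha> \<in> mons m \<Longrightarrow> \<bar>a j x \<alpha>\<bar> \<le> B"
    and le: "\<And>j. line_eq (cball c \<rho>) m (a j) (T j)"
    and TB: "\<And>j x v. x \<in> cball c \<rho> \<Longrightarrow> norm v \<le> 2 * \<rho> + 1 \<Longrightarrow> \<bar>T j x v\<bar> \<le> B"
  shows "\<exists>s b. strict_mono (s :: nat \<Rightarrow> nat) \<and>
    (\<forall>\<alpha>\<in>mons m. cconv (cball c \<rho>) (\<lambda>j x. a (s j) x \<alpha>) (\<lambda>x. b x \<alpha>))"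
proof -
  let ?K = "cball c \<rho>"
  have B: "B \<ge> 0" using TB[of c 0 0] assms(1) by (simp add: order_trans[OF abs_ge_zero])
  obtain C where C: "C \<ge> 0" and hol: "\<forall>a T B. B \<ge> 0 \<longrightarrow> (\<forall>x\<in>?K. \<forall>\<alpha>\<in>mons m. \<bar>a x \<alpha>\<bar> \<le> B) \<longrightarrow> line_eq ?K m a T \<longrightarrow>
     (\<forall>x\<in>?K. \<forall>v. norm v \<le> 2 * \<rho> + 1 \<longrightarrow> \<bar>T x v\<bar> \<le> B) \<longrightarrow>
     (\<forall>x\<in>?K. \<forall>x'\<in>?K. norm (x - x') \<le> 1 \<longrightarrow> (\<forall>\<alpha>\<in>mons m. \<bar>a x \<alpha> - a x' \<alpha>\<bar> \<le> C * B * sqrt (norm (x - x'))))"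
    using line_eq_Hoelder[OF assms(1), of c m] by (elim exE conjE) (rule that)
  have hold: "\<bar>a j x \<alpha> - a j x' \<alpha>\<bar> \<le> C * B * sqrt (norm (x - x'))"
    if "x \<in> ?K" "x' \<in> ?K" "norm (x - x') \<le> 1" "\<alpha> \<in> mons m" for j x x' \<alpha>
    by (rule hol[rule_format, of B "a j" "T j"]) (use B aB le TB that in auto)
  have "\<exists>s. strict_mono s \<and> (\<forall>\<alpha>\<in>mons m. \<exists>g. cconv ?K (\<lambda>j x. a (s j) x \<alpha>) g)"
  proof (rule common_subsequence)
    show "finite (mons m :: ('n \<Rightarrow> nat) set)" by simp
  next
    fix \<alpha> :: "'n \<Rightarrow> nat" and s :: "nat \<Rightarrow> nat" assume \<alpha>: "\<alpha> \<in> mons m" and s: "strict_mono s"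
    obtain g k where gk: "continuous_on ?K g" "strict_mono (k :: nat \<Rightarrow> nat)"
      "\<And>e. 0 < e \<Longrightarrow> \<exists>N. \<forall>n x. n \<ge> N \<and> x \<in> ?K \<longrightarrow> norm (a (s (k n)) x \<alpha> - g x) < e"
    proof (rule Arzela_Ascoli[of ?K "\<lambda>n x. a (s n) x \<alpha>" B])
      show "compact ?K" by simp
      show "norm (a (s n) x \<alpha>) \<le> B" if "x \<in> ?K" for n x using aB[OF that \<alpha>] by simp
      fix x e assume x: "x \<in> ?K" and e: "(0::real) < e"
      \<comment> \<open>Obtained by solving \<open>C * B * sqrt d < e\<close>. The added 1 keeps the
        denominator positive, and the minimum keeps the points within the range of the Hoelder
        estimate.\<close>
      define d where "d = min 1 ((e / (C * B + 1)) ^ 2)"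
      have CB: "C * B + 1 > 0" using C B by (simp add: add_nonneg_pos)
      have d: "d > 0" unfolding d_def using e CB by simp
      have "norm (a (s n) x \<alpha> - a (s n) y \<alpha>) < e" if y: "y \<in> ?K" "norm (x - y) < d" for n y
      proof -
        have "sqrt (norm (x - y)) < sqrt ((e / (C * B + 1)) ^ 2)" using y unfolding d_def by (intro real_sqrt_less_mono) simp
        also have "\<dots> = e / (C * B + 1)" using e CB by (intro real_sqrt_unique) auto
        finally have sq: "sqrt (norm (x - y)) < e / (C * B + 1)" .
        have "norm (a (s n) x \<alpha> - a (s n) y \<alpha>) \<le> C * B * sqrt (norm (x - y))"
          using hold[OF x y(1) _ \<alpha>] y(2) unfolding d_def by simp
        also have "\<dots> \<le> (C * B + 1) * sqrt (norm (x - y))" by (intro mult_right_mono) auto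
        also have "\<dots> < e" using sq CB by (simp add: field_simps)
        finally show ?thesis .
      qed
      then show "\<exists>d>0. \<forall>n y. y \<in> ?K \<and> norm (x - y) < d \<longrightarrow> norm (a (s n) x \<alpha> - a (s n) y \<alpha>) < e"
        using d by blast
    qed (rule that)
    have "cconv ?K (\<lambda>j x. a ((s \<circ> k) j) x \<alpha>) g"
    proof (rule uniform_imp_cconv[OF _ gk(1)])
      fix e :: real assume "e > 0"
      from gk(3)[OF this] show "\<exists>N. \<forall>j\<ge>N. \<forall>x\<in>?K. dist (a ((s \<circ> k) j) x \<alpha>) (g x) < e"
        unfolding dist_norm o_def by blast
    qed
    then show "\<exists>r. strict_mono r \<and> (\<exists>g. cconv ?K (\<lambda>j x. a ((s \<circ> r) j) x \<alpha>) g)"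
      using gk(2) by blast
  next
    fix \<alpha> :: "'n \<Rightarrow> nat" and s r :: "nat \<Rightarrow> nat"
    assume "\<exists>g. cconv ?K (\<lambda>j x. a (s j) x \<alpha>) g" "strict_mono r"
    then show "\<exists>g. cconv ?K (\<lambda>j x. a ((s \<circ> r) j) x \<alpha>) g"
      using cconv_subseq[of ?K "\<lambda>j x. a (s j) x \<alpha>" _ r] by auto
  qed
  then obtain s where s: "strict_mono s" "\<forall>\<alpha>\<in>mons m. \<exists>g. cconv ?K (\<lambda>j x. a (s j) x \<alpha>) g" by blast
  from bchoice[OF s(2)] obtain b where "\<forall>\<alpha>\<in>mons m. cconv ?K (\<lambda>j x. a (s j) x \<alpha>) (b \<alpha>)" by blast
  then show ?thesis using s(1) by (intro exI[of _ s] exI[of _ "\<lambda>x \<alpha>. b \<alpha> x"]) simp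
qed

text \<open>\<open>has_derivative_sequence\<close> supplies some differentiable pointwise limit,
  which uniqueness of limits identifies with \<open>g\<close> on \<open>S\<close>.\<close>

lemma DERIV_sequence_limit:
  fixes f :: "nat \<Rightarrow> real \<Rightarrow> real"
  assumes "convex S" "\<And>n x. x \<in> S \<Longrightarrow> (f n has_real_derivative f' n x) (at x within S)"
    and unif: "\<And>e. e > 0 \<Longrightarrow> \<exists>N. \<forall>n\<ge>N. \<forall>x\<in>S. \<bar>f' n x - g' x\<bar> < e"
    and lim: "\<And>x. x \<in> S \<Longrightarrow> (\<lambda>n. f n x) \<longlonglongrightarrow> g x" and x: "x \<in> S"
  shows "(g has_real_derivative g' x) (at x within S)"
proof -
  have "\<exists>h. \<forall>x\<in>S. (\<lambda>n. f n x) \<longlonglongrightarrow> h x \<and> (h has_derivative (\<lambda>y. g' x * y)) (at x within S)"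
  proof (rule has_derivative_sequence[where f = f and f' = "\<lambda>n x y. f' n x * y" and g' = "\<lambda>x y. g' x * y", OF assms(1) _ _ x lim[OF x]])
    show "(f n has_derivative (\<lambda>y. f' n x * y)) (at x within S)" if "x \<in> S" for n x
      using assms(2)[OF that] by (simp add: has_field_derivative_def)
    show "\<forall>\<^sub>F n in sequentially. \<forall>x\<in>S. \<forall>h. norm (f' n x * h - g' x * h) \<le> e * norm h" if e: "e > 0" for e
    proof -
      obtain N where "\<forall>n\<ge>N. \<forall>x\<in>S. \<bar>f' n x - g' x\<bar> < e" using unif[OF e] by blast
      then have "\<forall>n\<ge>N. \<forall>x\<in>S. \<forall>h. norm (f' n x * h - g' x * h) \<le> e * norm h"
        by (auto simp: left_diff_distrib[symmetric] abs_mult intro!: mult_right_mono intro: less_imp_le)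
      then show ?thesis unfolding eventually_sequentially by blast
    qed
  qed
  then obtain h where h: "\<And>x. x \<in> S \<Longrightarrow> (\<lambda>n. f n x) \<longlonglongrightarrow> h x" "\<And>x. x \<in> S \<Longrightarrow> (h has_derivative (\<lambda>y. g' x * y)) (at x within S)"
    by blast
  have "h y = g y" if "y \<in> S" for y using LIMSEQ_unique h(1) lim that by blast
  then show ?thesis unfolding has_field_derivative_def
    using has_derivative_transform[OF x, of g h] h(2)[OF x] by simp
qed

lemma line_eq_limit:
  fixes a :: "nat \<Rightarrow> real ^ 'n::finite \<Rightarrow> ('n \<Rightarrow> nat) \<Rightarrow> real"
  assumes "compact K" "convex K"
    and le: "\<And>j. line_eq K m (a j) (T j)"
    and ac: "\<And>\<alpha>. \<alpha> \<in> mons m \<Longrightarrow> cconv K (\<lambda>j x. a j x \<alpha>) (\<lambda>x. b x \<alpha>)"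
    and Tc: "\<And>v. cconv K (\<lambda>j x. T j x v) (\<lambda>x. U x v)"
  shows "line_eq K m b U"
  unfolding line_eq_def
proof (intro allI impI)
  fix x v t assume xt: "x + t *\<^sub>R v \<in> K"
  show "((\<lambda>s. hp m (b (x + s *\<^sub>R v)) v) has_real_derivative U (x + t *\<^sub>R v) v) (at t within {s. x + s *\<^sub>R v \<in> K})"
  proof (rule DERIV_sequence_limit[where f = "\<lambda>j s. hp m (a j (x + s *\<^sub>R v)) v" and f' = "\<lambda>j s. T j (x + s *\<^sub>R v) v" and g' = "\<lambda>s. U (x + s *\<^sub>R v) v"])
    show "convex {s. x + s *\<^sub>R v \<in> K}" by (rule convex_line_section[OF assms(2)])
    show "\<exists>N. \<forall>n\<ge>N. \<forall>s\<in>{s. x + s *\<^sub>R v \<in> K}. \<bar>T n (x + s *\<^sub>R v) v - U (x + s *\<^sub>R v) v\<bar> < e" if "e > 0" for e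
      using cconv_uniform[OF assms(1) Tc that, of v] unfolding dist_real_def mem_Collect_eq by blast
    show "(\<lambda>n. hp m (a n (x + s *\<^sub>R v)) v) \<longlonglongrightarrow> hp m (b (x + s *\<^sub>R v)) v" if "s \<in> {s. x + s *\<^sub>R v \<in> K}" for s
      using that by (intro tendsto_intros cconv_pointwise[OF ac]) auto
  qed (use xt line_eqD[OF le] in auto)
qed

subsection \<open>Calculus of functions of class \<open>C\<^sup>k\<close>\<close>

lemma has_dir_deriv_iff:
  "has_dir_deriv f v x \<longleftrightarrow> ((\<lambda>t. f (x + t *\<^sub>R v)) has_real_derivative dir_deriv f v x) (at 0)"
  unfolding has_dir_deriv_def dir_deriv_def by (simp add: DERIV_deriv_iff_real_differentiable)

lemma dir_derivI:
  assumes "((\<lambda>t. f (x + t *\<^sub>R v)) has_real_derivative d) (at 0)"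
  shows "has_dir_deriv f v x" "dir_deriv f v x = d"
  using assms unfolding has_dir_deriv_def dir_deriv_def
  by (auto simp: DERIV_imp_deriv real_differentiable_def)

lemma has_dir_deriv_shift:
  assumes "has_dir_deriv f v (x + t *\<^sub>R v)"
  shows "((\<lambda>s. f (x + s *\<^sub>R v)) has_real_derivative dir_deriv f v (x + t *\<^sub>R v)) (at t)"
proof -
  have "((\<lambda>s. f ((x + t *\<^sub>R v) + s *\<^sub>R v)) has_real_derivative dir_deriv f v (x + t *\<^sub>R v)) (at 0)"
    using assms by (simp add: has_dir_deriv_iff)
  then have "((\<lambda>s. f ((x + t *\<^sub>R v) + (s - t) *\<^sub>R v)) has_real_derivative dir_deriv f v (x + t *\<^sub>R v)) (at t)"
    using DERIV_shift[of "\<lambda>s. f ((x + t *\<^sub>R v) + (s - t) *\<^sub>R v)" _ 0 t] by (simp add: add.commute)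
  then show ?thesis by (simp add: algebra_simps)
qed

lemma dir_deriv_of_has_derivative:
  assumes "(f has_derivative f') (at x)"
  shows "has_dir_deriv f v x" "dir_deriv f v x = f' v"
proof -
  have "((\<lambda>t. f (x + t *\<^sub>R v)) has_derivative (\<lambda>t. f' (t *\<^sub>R v))) (at 0)"
    by (rule has_derivative_compose[where g = f and f = "\<lambda>t. x + t *\<^sub>R v"])
      (use assms in \<open>auto intro!: derivative_eq_intros\<close>)
  moreover have "f' (t *\<^sub>R v) = f' v * t" for t
    using linear_cmul[OF has_derivative_linear[OF assms], of t v] by simp
  ultimately have "((\<lambda>t. f (x + t *\<^sub>R v)) has_real_derivative f' v) (at 0)"
    by (simp only: has_field_derivative_def)
  then show "has_dir_deriv f v x" "dir_deriv f v x = f' v" by (rule dir_derivI)+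
qed

lemma eventually_line_in_open:
  fixes x v :: "'a::real_normed_vector"
  assumes "open D" "x \<in> D" shows "eventually (\<lambda>t::real. x + t *\<^sub>R v \<in> D) (nhds 0)"
proof -
  have "((\<lambda>t::real. x + t *\<^sub>R v) \<longlongrightarrow> x + 0 *\<^sub>R v) (nhds 0)" by (intro tendsto_intros filterlim_ident)
  then show ?thesis using assms topological_tendstoD by fastforce
qed

lemma dir_deriv_cong:
  assumes "open D" "x \<in> D" "\<And>y. y \<in> D \<Longrightarrow> f y = g y"
  shows "has_dir_deriv f v x \<longleftrightarrow> has_dir_deriv g v x" "dir_deriv f v x = dir_deriv g v x"
proof -
  have ev: "eventually (\<lambda>t. f (x + t *\<^sub>R v) = g (x + t *\<^sub>R v)) (nhds 0)"
    using eventually_line_in_open[OF assms(1,2), of v] by eventually_elim (use assms(3) in auto)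
  have "(\<lambda>D. DERIV (\<lambda>t. f (x + t *\<^sub>R v)) 0 :> D) = (\<lambda>D. DERIV (\<lambda>t. g (x + t *\<^sub>R v)) 0 :> D)"
    using DERIV_cong_ev[OF refl ev refl] by auto
  then show "has_dir_deriv f v x \<longleftrightarrow> has_dir_deriv g v x" "dir_deriv f v x = dir_deriv g v x"
    unfolding has_dir_deriv_def dir_deriv_def deriv_def real_differentiable_def by metis+
qed

lemma iter_partial_cong:
  assumes "open D" "\<And>y. y \<in> D \<Longrightarrow> f y = g y" "x \<in> D"
  shows "iter_partial js f x = iter_partial js g x"
  using assms(3)
proof (induction js arbitrary: x)
  case (Cons i js)
  show ?case using dir_deriv_cong(2)[OF assms(1) Cons.prems Cons.IH] by simp
qed (use assms in auto)

lemma iter_partial_snoc: "iter_partial (js @ [i]) f = iter_partial js (dir_deriv f (axis i 1))"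
  by (induction js) auto

lemma Ck_on_cong:
  fixes D :: "(real ^ 'n::finite) set"
  assumes "open D" "\<And>y. y \<in> D \<Longrightarrow> f y = g y" "Ck_on k D f"
  shows "Ck_on k D g"
proof -
  have eq: "iter_partial js f x = iter_partial js g x" if "x \<in> D" for x and js :: "'n list"
    by (rule iter_partial_cong) (use assms that in auto)
  show ?thesis unfolding Ck_on_def
  proof (intro conjI allI impI ballI)
    fix js :: "'n list" and i x assume "length js < k" "x \<in> D"
    then have "has_dir_deriv (iter_partial js f) (axis i 1) x" using assms(3) unfolding Ck_on_def by blast
    then show "has_dir_deriv (iter_partial js g) (axis i 1) x"
      using dir_deriv_cong(1)[where f = "iter_partial js f" and g = "iter_partial js g", OF assms(1) \<open>x \<in> D\<close> eq] by blast
  next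
    fix js :: "'n list" assume "length js \<le> k"
    then have "continuous_on D (iter_partial js f)" using assms(3) unfolding Ck_on_def by blast
    then show "continuous_on D (iter_partial js g)" using eq by (simp cong: continuous_on_cong)
  qed
qed

text \<open>\<open>iter_partial\<close> recurses on the derivative taken last, whereas this splits
  off the one applied to \<open>f\<close> first. It turns regularity proofs into inductions on
  \<open>k\<close> over varying functions.\<close>

lemma Ck_on_Suc:
  fixes D :: "(real ^ 'n::finite) set"
  shows
  "Ck_on (Suc k) D f \<longleftrightarrow> continuous_on D f \<and>
     (\<forall>i. (\<forall>x\<in>D. has_dir_deriv f (axis i 1) x) \<and> Ck_on k D (dir_deriv f (axis i 1)))" (is "_ \<longleftrightarrow> ?R")
proof
  assume C: "Ck_on (Suc k) D f"
  have "Ck_on k D (dir_deriv f (axis i 1))" for i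
    unfolding Ck_on_def iter_partial_snoc[symmetric]
    using C unfolding Ck_on_def by auto
  moreover have "continuous_on D f" "\<forall>x\<in>D. has_dir_deriv f (axis i 1) x" for i
    using C[unfolded Ck_on_def, THEN conjunct2, rule_format, of "[]"]
      C[unfolded Ck_on_def, THEN conjunct1, rule_format, of "[]"] by auto
  ultimately show ?R by blast
next
  assume R: ?R
  show "Ck_on (Suc k) D f" unfolding Ck_on_def
  proof (intro conjI allI impI ballI)
    fix js :: "'n list" and i x assume js: "length js < Suc k" "x \<in> D"
    show "has_dir_deriv (iter_partial js f) (axis i 1) x"
    proof (cases js rule: rev_cases)
      case Nil then show ?thesis using R js by simp
    next
      case (snoc js' l)
      then show ?thesis using R js unfolding snoc iter_partial_snoc Ck_on_def by auto
    qed
  next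
    fix js :: "'n list" assume js: "length js \<le> Suc k"
    show "continuous_on D (iter_partial js f)"
    proof (cases js rule: rev_cases)
      case Nil then show ?thesis using R by simp
    next
      case (snoc js' l)
      then show ?thesis using R js unfolding snoc iter_partial_snoc Ck_on_def by auto
    qed
  qed
qed

lemma Ck_on_mono: "Ck_on k D f \<Longrightarrow> l \<le> k \<Longrightarrow> Ck_on l D f"
  unfolding Ck_on_def by auto

lemma Ck_on_subset: "Ck_on k D f \<Longrightarrow> E \<subseteq> D \<Longrightarrow> Ck_on k E f"
  unfolding Ck_on_def by (meson continuous_on_subset subsetD)

lemma dir_deriv_lincomb:
  assumes "has_dir_deriv f v x" "has_dir_deriv g v x"
  shows "has_dir_deriv (\<lambda>x. a * f x + b * g x) v x"
    "dir_deriv (\<lambda>x. a * f x + b * g x) v x = a * dir_deriv f v x + b * dir_deriv g v x"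
  by (rule dir_derivI; use assms in \<open>auto simp: has_dir_deriv_iff intro!: derivative_eq_intros\<close>)+

lemma dir_deriv_mult:
  assumes "has_dir_deriv f v x" "has_dir_deriv g v x"
  shows "has_dir_deriv (\<lambda>x. f x * g x) v x"
    "dir_deriv (\<lambda>x. f x * g x) v x = dir_deriv f v x * g x + f x * dir_deriv g v x"
  by (rule dir_derivI; use assms in \<open>auto simp: has_dir_deriv_iff intro!: derivative_eq_intros\<close>)+

lemma iter_partial_lincomb:
  assumes "open D" "Ck_on k D f" "Ck_on k D g" "length js \<le> k" "x \<in> D"
  shows "iter_partial js (\<lambda>x. a * f x + b * g x) x = a * iter_partial js f x + b * iter_partial js g x"
  using assms(4,5)
proof (induction js arbitrary: x)
  case (Cons i js)
  then have h: "has_dir_deriv (iter_partial js f) (axis i 1) x" "has_dir_deriv (iter_partial js g) (axis i 1) x"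
    using assms(2,3) unfolding Ck_on_def by auto
  have "dir_deriv (iter_partial js (\<lambda>x. a * f x + b * g x)) (axis i 1) x
     = dir_deriv (\<lambda>x. a * iter_partial js f x + b * iter_partial js g x) (axis i 1) x"
    by (rule dir_deriv_cong(2)[OF assms(1)]) (use Cons in auto)
  then show ?case using dir_deriv_lincomb(2)[OF h] by simp
qed simp

lemma Ck_on_lincomb:
  fixes D :: "(real ^ 'n::finite) set"
  assumes "open D" "Ck_on k D f" "Ck_on k D g"
  shows "Ck_on k D (\<lambda>x. a * f x + b * g x)"
proof -
  note eq = iter_partial_lincomb[OF assms]
  show ?thesis unfolding Ck_on_def
  proof (intro conjI allI impI ballI)
    fix js :: "'n list" and i x assume js: "length js < k" "x \<in> D"
    have h: "has_dir_deriv (iter_partial js f) (axis i 1) x" "has_dir_deriv (iter_partial js g) (axis i 1) x"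
      using assms(2,3) js unfolding Ck_on_def by auto
    show "has_dir_deriv (iter_partial js (\<lambda>x. a * f x + b * g x)) (axis i 1) x"
      using dir_deriv_lincomb(1)[OF h, of a b] dir_deriv_cong(1)[where f = "iter_partial js (\<lambda>x. a * f x + b * g x)" and g = "\<lambda>x. a * iter_partial js f x + b * iter_partial js g x", OF assms(1) js(2) eq] js by simp
  next
    fix js :: "'n list" assume js: "length js \<le> k"
    have "continuous_on D (\<lambda>x. a * iter_partial js f x + b * iter_partial js g x)"
      using assms(2,3) js unfolding Ck_on_def by (intro continuous_intros) auto
    then show "continuous_on D (iter_partial js (\<lambda>x. a * f x + b * g x))"
      using eq[OF js] by (simp cong: continuous_on_cong)
  qed
qed

lemma Ck_on_mult:
  assumes "open D"
  shows "Ck_on k D f \<Longrightarrow> Ck_on k D g \<Longrightarrow> Ck_on k D (\<lambda>x. f x * g x)"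
proof (induction k arbitrary: f g)
  case 0
  then show ?case unfolding Ck_on_def by (auto intro!: continuous_intros)
next
  case (Suc k)
  have f: "\<And>i x. x \<in> D \<Longrightarrow> has_dir_deriv f (axis i 1) x" "\<And>i. Ck_on k D (dir_deriv f (axis i 1))"
    and g: "\<And>i x. x \<in> D \<Longrightarrow> has_dir_deriv g (axis i 1) x" "\<And>i. Ck_on k D (dir_deriv g (axis i 1))"
    and c: "continuous_on D f" "continuous_on D g"
    using Suc.prems unfolding Ck_on_Suc by auto
  have fg: "Ck_on k D f" "Ck_on k D g" using Suc.prems Ck_on_mono by fastforce+
  show ?case unfolding Ck_on_Suc
  proof (intro conjI allI ballI)
    show "continuous_on D (\<lambda>x. f x * g x)" using c by (intro continuous_intros)
    fix i
    show "has_dir_deriv (\<lambda>x. f x * g x) (axis i 1) x" if "x \<in> D" for x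
      using dir_deriv_mult(1)[OF f(1) g(1)] that by blast
    have "Ck_on k D (\<lambda>x. 1 * (dir_deriv f (axis i 1) x * g x) + 1 * (f x * dir_deriv g (axis i 1) x))"
      by (intro Ck_on_lincomb[OF assms] Suc.IH f g fg)
    then show "Ck_on k D (dir_deriv (\<lambda>x. f x * g x) (axis i 1))"
      by (rule Ck_on_cong[OF assms, rotated]) (use dir_deriv_mult(2)[OF f(1) g(1)] in auto)
  qed
qed

lemma Ck_on_const: "Ck_on k (UNIV :: (real ^ 'n::finite) set) (\<lambda>_. c)"
proof (induction k arbitrary: c)
  case 0 show ?case by (simp add: Ck_on_def)
next
  case (Suc k)
  have d: "has_dir_deriv (\<lambda>_. c) v x" "dir_deriv (\<lambda>_. c) v x = 0" for v x :: "real ^ 'n"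
    using dir_derivI[where f = "\<lambda>_ :: real ^ 'n. c" and d = 0, OF DERIV_const] by auto
  then have "dir_deriv (\<lambda>_. c) v = (\<lambda>_. 0)" for v :: "real ^ 'n" by auto
  then show ?case unfolding Ck_on_Suc using d Suc by simp
qed

lemma Ck_on_inner: "Ck_on k UNIV (\<lambda>x. x \<bullet> w)"
proof (cases k)
  case 0 then show ?thesis by (auto simp: Ck_on_def intro!: continuous_intros)
next
  case (Suc l)
  have d: "has_dir_deriv (\<lambda>x. x \<bullet> w) v x" "dir_deriv (\<lambda>x. x \<bullet> w) v x = v \<bullet> w" for v x
    by (rule dir_derivI; auto intro!: derivative_eq_intros simp: inner_left_distrib)+
  then have "dir_deriv (\<lambda>x. x \<bullet> w) v = (\<lambda>_. v \<bullet> w)" for v by auto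
  then show ?thesis unfolding Suc Ck_on_Suc using d Ck_on_const by (auto intro!: continuous_intros)
qed

text \<open>Differentiation shifts the phase by \<open>pi / 2\<close>, so with an arbitrary phase
  \<open>b\<close> the family is closed under derivatives up to constant factors and the induction
  goes through.\<close>

lemma Ck_on_cos: "Ck_on k UNIV (\<lambda>x. cos (x \<bullet> w + b))"
proof (induction k arbitrary: b)
  case 0 show ?case by (auto simp: Ck_on_def intro!: continuous_intros)
next
  case (Suc k)
  have d: "has_dir_deriv (\<lambda>x. cos (x \<bullet> w + b)) v x"
    "dir_deriv (\<lambda>x. cos (x \<bullet> w + b)) v x = (v \<bullet> w) * cos (x \<bullet> w + (b + pi / 2))" for v x
  proof -
    have "cos (x \<bullet> w + (b + pi / 2)) = - sin (x \<bullet> w + b)"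
      using cos_add[of "x \<bullet> w + b" "pi/2"] by (simp add: add.assoc)
    then show "has_dir_deriv (\<lambda>x. cos (x \<bullet> w + b)) v x"
      "dir_deriv (\<lambda>x. cos (x \<bullet> w + b)) v x = (v \<bullet> w) * cos (x \<bullet> w + (b + pi / 2))"
      by (intro dir_derivI; auto intro!: derivative_eq_intros simp: inner_left_distrib)+
  qed
  have "Ck_on k UNIV (\<lambda>x. (v \<bullet> w) * cos (x \<bullet> w + (b + pi / 2)))" for v
    by (intro Ck_on_mult Ck_on_const Suc) auto
  moreover have "dir_deriv (\<lambda>x. cos (x \<bullet> w + b)) v = (\<lambda>x. (v \<bullet> w) * cos (x \<bullet> w + (b + pi / 2)))" for v
    using d by auto
  ultimately show ?case unfolding Ck_on_Suc using d by (auto intro!: continuous_intros)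
qed

lemma DERIV_max_0_power:
  assumes "l \<ge> 1"
  shows "((\<lambda>y::real. max 0 y ^ Suc l) has_real_derivative real (Suc l) * max 0 y ^ l) (at y)"
proof -
  consider "y > 0" | "y < 0" | "y = 0" by linarith
  then show ?thesis
  proof cases
    case 1
    have "eventually (\<lambda>z. max 0 z ^ Suc l = z ^ Suc l) (nhds y)"
      using eventually_nhds_in_open[of "{0<..}" y] 1 by (auto elim: eventually_mono)
    moreover have "((\<lambda>y. y ^ Suc l) has_real_derivative real (Suc l) * max 0 y ^ l) (at y)"
      using 1 DERIV_pow[of "Suc l" y UNIV] by (simp add: max_def)
    ultimately show ?thesis
      by (subst DERIV_cong_ev[OF refl _ refl, where g = "\<lambda>y. y ^ Suc l"])
  next
    case 2
    have "eventually (\<lambda>z. max 0 z ^ Suc l = 0) (nhds y)"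
      using eventually_nhds_in_open[of "{..<0}" y] 2 by (auto elim!: eventually_mono)
    moreover have "((\<lambda>y. 0) has_real_derivative real (Suc l) * max 0 y ^ l) (at y)"
      using 2 assms by (auto intro!: derivative_eq_intros simp: max_def)
    ultimately show ?thesis
      by (subst DERIV_cong_ev[OF refl _ refl, where g = "\<lambda>_. 0"])
  next
    case 3
    have "((\<lambda>z. max 0 z ^ l) \<longlongrightarrow> max 0 0 ^ l) (at (0::real))" by (intro tendsto_intros)
    then have t: "((\<lambda>z. max 0 z ^ l) \<longlongrightarrow> 0) (at (0::real))" using assms by (simp add: power_0_left)
    have "((\<lambda>z. (max 0 z ^ Suc l - max 0 0 ^ Suc l) / (z - 0)) \<longlongrightarrow> 0) (at (0::real))"
    proof (rule Lim_null_comparison[OF _ t])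
      have "norm ((max 0 z ^ Suc l - max 0 0 ^ Suc l) / (z - 0)) \<le> max 0 z ^ l" for z :: real
        by (cases "z > 0") (auto simp: max_def)
      then show "\<forall>\<^sub>F z in at 0. norm ((max 0 z ^ Suc l - max 0 0 ^ Suc l) / (z - 0)) \<le> max 0 (z::real) ^ l" by simp
    qed
    then show ?thesis using 3 assms by (simp add: has_field_derivative_iff power_0_left)
  qed
qed

text \<open>A cutoff of finite smoothness is enough for \<open>C\<^sup>k\<close>. Its derivatives
  are polynomial multiples of the same function with smaller \<open>l\<close>, which makes the
  smoothness proof a simple induction.\<close>

definition bump :: "real ^ 'n::finite \<Rightarrow> real \<Rightarrow> nat \<Rightarrow> real ^ 'n \<Rightarrow> real" where
  "bump c \<rho> l x = max 0 (\<rho>\<^sup>2 - (x - c) \<bullet> (x - c)) ^ l"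

lemma Ck_on_bump: "k < l \<Longrightarrow> Ck_on k UNIV (bump c \<rho> l)"
proof (induction k arbitrary: l)
  case 0
  then show ?case unfolding bump_def[abs_def] by (auto simp: Ck_on_def intro!: continuous_intros)
next
  case (Suc k)
  then obtain l' where l': "l = Suc l'" "k < l'" "l' \<ge> 1" by (cases l) auto
  have d: "((\<lambda>t. bump c \<rho> l (x + t *\<^sub>R v)) has_real_derivative
       real l * bump c \<rho> l' x * (- 2 * ((x - c) \<bullet> v))) (at 0)" for x v
  proof -
    let ?q = "\<lambda>t. \<rho>\<^sup>2 - (x + t *\<^sub>R v - c) \<bullet> (x + t *\<^sub>R v - c)"
    have "?q = (\<lambda>t. \<rho>\<^sup>2 - ((x - c) \<bullet> (x - c) + 2 * t * ((x - c) \<bullet> v) + t * t * (v \<bullet> v)))"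
      by (auto simp: inner_simps inner_commute algebra_simps)
    then have q: "(?q has_real_derivative (- 2 * ((x - c) \<bullet> v))) (at 0)"
      by (auto intro!: derivative_eq_intros)
    from DERIV_chain2[OF DERIV_max_0_power[OF l'(3), of "?q 0"] q]
    show ?thesis unfolding bump_def l'(1) by simp
  qed
  have ck: "Ck_on k UNIV (\<lambda>x. real l * bump c \<rho> l' x * (- 2 * ((x - c) \<bullet> v)))" for v
  proof -
    have "Ck_on k UNIV (\<lambda>x. (-2) * (x \<bullet> v) + 2 * (c \<bullet> v))"
      by (rule Ck_on_lincomb[OF _ Ck_on_inner Ck_on_const]) simp
    moreover have "(\<lambda>x. (-2) * (x \<bullet> v) + 2 * (c \<bullet> v)) = (\<lambda>x. - 2 * ((x - c) \<bullet> v))"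
      by (auto simp: inner_simps algebra_simps)
    ultimately have "Ck_on k UNIV (\<lambda>x. - 2 * ((x - c) \<bullet> v))" by (simp only:)
    then show ?thesis
      by (intro Ck_on_mult[OF open_UNIV Ck_on_mult[OF open_UNIV Ck_on_const Suc.IH[OF l'(2)]]])
  qed
  have "dir_deriv (bump c \<rho> l) v = (\<lambda>x. real l * bump c \<rho> l' x * (- 2 * ((x - c) \<bullet> v)))" for v
    using dir_derivI(2)[OF d] by auto
  then show ?case unfolding Ck_on_Suc
    using ck dir_derivI(1)[OF d] by (auto simp: bump_def[abs_def] intro!: continuous_intros)
qed

lemma bump_eq_0: "l > 0 \<Longrightarrow> x \<notin> cball c \<rho> \<Longrightarrow> bump c \<rho> l x = 0"
  if "\<rho> \<ge> 0"
proof -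
  assume l: "l > 0" and "x \<notin> cball c \<rho>"
  then have "norm (x - c) > \<rho>" by (simp add: dist_norm norm_minus_commute)
  then have "\<rho>\<^sup>2 \<le> (norm (x - c))\<^sup>2" using that by (intro power_mono) auto
  then show ?thesis using l by (simp add: bump_def power2_norm_eq_inner max_def)
qed

lemma iter_partial_eq_0:
  assumes "open U" "\<And>y. y \<in> U \<Longrightarrow> f y = 0" "x \<in> U"
  shows "iter_partial js f x = 0"
  using assms(3)
proof (induction js arbitrary: x)
  case (Cons i js)
  have "dir_deriv (iter_partial js f) (axis i 1) x = dir_deriv (\<lambda>_. 0) (axis i 1) x"
    by (rule dir_deriv_cong(2)[OF assms(1) Cons.prems Cons.IH])
  also have "\<dots> = 0" by (rule dir_derivI) simp
  finally show ?case by simp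
qed (use assms in auto)

lemma compact_support_iter_partial_bound:
  fixes f :: "real ^ 'n::finite \<Rightarrow> real"
  assumes "Ck_on k UNIV f" "compact K" "\<And>x. x \<notin> K \<Longrightarrow> f x = 0"
  shows "\<exists>B>0. \<forall>js x. length js \<le> k \<longrightarrow> \<bar>iter_partial js f x\<bar> \<le> B"
proof -
  let ?J = "{js :: 'n list. set js \<subseteq> UNIV \<and> length js \<le> k}"
  have "\<exists>b. \<forall>x. \<bar>iter_partial js f x\<bar> \<le> b" if "js \<in> ?J" for js
  proof -
    have "continuous_on K (iter_partial js f)"
      using assms(1) that unfolding Ck_on_def by (auto intro: continuous_on_subset)
    from compact_imp_bounded[OF compact_continuous_image[OF this assms(2)]]
    obtain b where b: "\<And>x. x \<in> K \<Longrightarrow> \<bar>iter_partial js f x\<bar> \<le> b" by (auto simp: bounded_iff)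
    have "\<bar>iter_partial js f x\<bar> \<le> \<bar>b\<bar>" for x
    proof (cases "x \<in> K")
      case True then show ?thesis using b[OF True] by linarith
    next
      case False
      have "iter_partial js f x = 0"
        by (rule iter_partial_eq_0[of "- K"]) (use assms(2,3) False in \<open>auto simp: compact_imp_closed open_Compl\<close>)
      then show ?thesis by simp
    qed
    then show ?thesis by blast
  qed
  then obtain b where b: "\<And>js x. js \<in> ?J \<Longrightarrow> \<bar>iter_partial js f x\<bar> \<le> b js" by metis
  have fin: "finite ?J" by (rule finite_lists_length_le) simp
  have "\<bar>iter_partial js f x\<bar> \<le> 1 + (\<Sum>js\<in>?J. \<bar>b js\<bar>)" if "length js \<le> k" for js x
  proof -
    have "\<bar>b js\<bar> \<le> (\<Sum>js\<in>?J. \<bar>b js\<bar>)" using fin that by (intro member_le_sum) auto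
    then show ?thesis using b[of js x] that by simp
  qed
  moreover have "1 + (\<Sum>js\<in>?J. \<bar>b js\<bar>) > 0" by (intro add_pos_nonneg sum_nonneg) auto
  ultimately show ?thesis by blast
qed

lemma C1_has_derivative:
  fixes f :: "real ^ 'n::finite \<Rightarrow> real"
  assumes D: "open D" and C: "Ck_on 1 D f" and x: "x \<in> D"
  shows "(f has_derivative (\<lambda>u. \<Sum>i\<in>UNIV. u $ i * dir_deriv f (axis i 1) x)) (at x)"
proof -
  let ?d = "\<lambda>i. dir_deriv f (axis i 1)"
  have h: "has_dir_deriv f (axis i 1) y" if "y \<in> D" for i y
    using C that unfolding One_nat_def Ck_on_Suc by auto
  have c: "continuous_on D (?d i)" for i
    using C[unfolded Ck_on_def, THEN conjunct2, rule_format, of "[i]"] by simp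
  show ?thesis
    unfolding has_derivative_at_alt
  proof (intro conjI allI impI)
    show "bounded_linear (\<lambda>u. \<Sum>i\<in>UNIV. u $ i * ?d i x)"
      by (intro bounded_linear_sum bounded_linear_mult_const bounded_linear_vec_nth)
    fix e :: real assume e: "e > 0"
    define e' where "e' = e / real CARD('n)"
    have e': "e' > 0" unfolding e'_def using e by simp
    have "\<forall>\<^sub>F y in nhds x. y \<in> D \<and> (\<forall>i\<in>UNIV. \<bar>?d i y - ?d i x\<bar> < e')"
    proof (intro eventually_conj eventually_ball_finite ballI)
      show "\<forall>\<^sub>F y in nhds x. y \<in> D" by (rule eventually_nhds_in_open[OF D x])
      fix i
      have "isCont (?d i) x" using c D x by (simp add: continuous_on_eq_continuous_at)
      then have "((?d i) \<longlongrightarrow> ?d i x) (nhds x)" by (simp add: isCont_def tendsto_at_iff_tendsto_nhds)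
      from tendstoD[OF this e'] show "\<forall>\<^sub>F y in nhds x. \<bar>?d i y - ?d i x\<bar> < e'" by (simp add: dist_real_def)
    qed simp
    then obtain \<delta> where \<delta>: "\<delta> > 0" and near: "\<And>y. dist y x < \<delta> \<Longrightarrow> y \<in> D \<and> (\<forall>i. \<bar>?d i y - ?d i x\<bar> < e')"
      unfolding eventually_nhds_metric by auto
    show "\<exists>d>0. \<forall>y. norm (y - x) < d \<longrightarrow> norm (f y - f x - (\<Sum>i\<in>UNIV. (y - x) $ i * ?d i x)) \<le> e * norm (y - x)"
    proof (intro exI[of _ \<delta>] conjI \<delta> allI impI)
      fix y assume y: "norm (y - x) < \<delta>"
      define u where "u = y - x"
      \<comment> \<open>\<open>P I\<close> is the increment with only the coordinates in
        \<open>I\<close> switched on. Adding one coordinate at a time reduces the estimate to the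
        one-dimensional mean value inequality, and all intermediate points stay as close to
        \<open>x\<close> as \<open>y\<close> is.\<close>
      define P :: "'n set \<Rightarrow> real ^ 'n" where "P I = (\<chi> i. if i \<in> I then u $ i else 0)" for I
      have approx: "\<bar>f (x + P I) - f x - (\<Sum>i\<in>I. u $ i * ?d i x)\<bar> \<le> (\<Sum>i\<in>I. e' * \<bar>u $ i\<bar>)" if "finite I" for I :: "'n set"
        using that
      proof (induction I rule: finite_induct)
        case empty
        have "P {} = 0" unfolding P_def by (simp add: vec_eq_iff)
        then show ?case by simp
      next
        case (insert j I)
        let ?z = "x + P I" and ?S = "{-\<bar>u $ j\<bar>..\<bar>u $ j\<bar>}"
        have inball: "dist (?z + t *\<^sub>R axis j 1) x < \<delta>" if "t \<in> ?S" for t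
        proof -
          have "norm (P I + t *\<^sub>R axis j 1) \<le> norm u"
            by (rule norm_le_componentwise_cart) (use that insert.hyps in \<open>auto simp: P_def axis_def\<close>)
          then show ?thesis using y unfolding u_def by (simp add: dist_norm add.assoc)
        qed
        have "norm ((f (?z + u $ j *\<^sub>R axis j 1) - u $ j * ?d j x) - (f (?z + 0 *\<^sub>R axis j 1) - 0 * ?d j x)) \<le> e' * norm (u $ j - 0)"
        proof (rule field_differentiable_bound[where S = ?S and f = "\<lambda>t. f (?z + t *\<^sub>R axis j 1) - t * ?d j x"
              and f' = "\<lambda>t. ?d j (?z + t *\<^sub>R axis j 1) - ?d j x"])
          fix t assume t: "t \<in> ?S"
          have "((\<lambda>t. f (?z + t *\<^sub>R axis j 1)) has_real_derivative ?d j (?z + t *\<^sub>R axis j 1)) (at t)"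
            by (rule has_dir_deriv_shift, rule h) (use near inball[OF t] in blast)
          then have "((\<lambda>t. f (?z + t *\<^sub>R axis j 1) - t * ?d j x) has_real_derivative ?d j (?z + t *\<^sub>R axis j 1) - 1 * ?d j x) (at t)"
            by (intro DERIV_diff DERIV_cmult_right DERIV_ident)
          then show "((\<lambda>t. f (?z + t *\<^sub>R axis j 1) - t * ?d j x) has_real_derivative ?d j (?z + t *\<^sub>R axis j 1) - ?d j x) (at t within ?S)"
            by (simp add: has_field_derivative_at_within)
          show "norm (?d j (?z + t *\<^sub>R axis j 1) - ?d j x) \<le> e'"
            using near inball[OF t] by (auto intro: less_imp_le)
        qed auto
        moreover have "?z + u $ j *\<^sub>R axis j 1 = x + P (insert j I)"
          using insert.hyps by (auto simp: vec_eq_iff P_def axis_def)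
        ultimately have "\<bar>f (x + P (insert j I)) - f (x + P I) - u $ j * ?d j x\<bar> \<le> e' * \<bar>u $ j\<bar>" by simp
        then show ?case using insert by simp
      qed
      have xP: "x + P UNIV = y" by (simp add: P_def u_def vec_eq_iff)
      from approx[of UNIV] have "\<bar>f (x + P UNIV) - f x - (\<Sum>i\<in>UNIV. u $ i * ?d i x)\<bar> \<le> (\<Sum>i\<in>UNIV. e' * \<bar>u $ i\<bar>)" by simp
      also have "\<dots> \<le> (\<Sum>i\<in>(UNIV :: 'n set). e' * norm u)"
        using e' by (intro sum_mono mult_left_mono component_le_norm_cart) auto
      also have "\<dots> = e * norm u" unfolding e'_def by simp
      finally have "\<bar>f y - f x - (\<Sum>i\<in>UNIV. u $ i * ?d i x)\<bar> \<le> e * norm u" unfolding xP .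
      then show "norm (f y - f x - (\<Sum>i\<in>UNIV. (y - x) $ i * ?d i x)) \<le> e * norm (y - x)"
        by (simp add: u_def)
    qed
  qed
qed

subsection \<open>Weak integrals of the geodesic flow\<close>

lemma matrix_inv_mult:
  fixes A :: "real ^ 'n ^ 'n::finite"
  assumes "invertible A"
  shows "A ** matrix_inv A = mat 1" "matrix_inv A ** A = mat 1"
  using someI_ex[OF assms[unfolded invertible_def]] unfolding matrix_inv_def by auto

lemma matrix_inv_vec:
  fixes A :: "real ^ 'n ^ 'n::finite"
  assumes "invertible A"
  shows "A *v (matrix_inv A *v x) = x" "matrix_inv A *v (A *v x) = x"
  by (simp_all add: matrix_vector_mul_assoc matrix_inv_mult[OF assms])

lemma symmetric_matrix_inner:
  fixes A :: "real ^ 'n ^ 'n::finite"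
  assumes "transpose A = A" shows "(A *v x) \<bullet> y = x \<bullet> (A *v y)"
  by (metis assms dot_lmul_matrix vector_transpose_matrix)

lemma symmetric_matrix_inv_inner:
  fixes A :: "real ^ 'n ^ 'n::finite"
  assumes "transpose A = A" "invertible A"
  shows "(matrix_inv A *v x) \<bullet> y = x \<bullet> (matrix_inv A *v y)"
  using symmetric_matrix_inner[OF assms(1), of "matrix_inv A *v x" "matrix_inv A *v y"]
  by (simp add: matrix_inv_vec[OF assms(2)])

lemma tendsto_det [tendsto_intros]:
  fixes f :: "'a \<Rightarrow> real ^ 'n ^ 'n::finite"
  assumes "(f \<longlongrightarrow> A) F" shows "((\<lambda>x. det (f x)) \<longlongrightarrow> det A) F"
  unfolding det_def by (intro tendsto_intros assms)

lemma tendsto_matrix_vector_mult [tendsto_intros]: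
  fixes f :: "'a \<Rightarrow> real ^ 'n ^ 'm::finite"
  assumes "(f \<longlongrightarrow> A) F" "(g \<longlongrightarrow> v) F" shows "((\<lambda>x. f x *v g x) \<longlongrightarrow> A *v v) F"
  unfolding matrix_vector_mult_def by (intro tendsto_intros assms)

text \<open>By Cramer's rule the entries of the inverse are quotients of determinants.
  \<open>N M k j\<close> is \<open>M\<close> with column \<open>k\<close> replaced by the
  \<open>j\<close>-th unit vector.\<close>

lemma tendsto_matrix_inv:
  fixes f :: "'a \<Rightarrow> real ^ 'n ^ 'n::finite"
  assumes f: "(f \<longlongrightarrow> A) F" and A: "invertible A"
  shows "((\<lambda>x. matrix_inv (f x)) \<longlongrightarrow> matrix_inv A) F"
proof -
  define N :: "real ^ 'n ^ 'n \<Rightarrow> 'n \<Rightarrow> 'n \<Rightarrow> real ^ 'n ^ 'n" where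
    "N M k j = (\<chi> i l. if l = k then axis j 1 $ i else M $ i $ l)" for M k j
  have cr: "matrix_inv M $ k $ j = det (N M k j) / det M" if "det M \<noteq> 0" for M k j
  proof -
    have "M *v (matrix_inv M *v axis j 1) = axis j 1"
      using matrix_inv_vec that invertible_det_nz by blast
    then have "matrix_inv M *v axis j 1 = (\<chi> k. det (N M k j) / det M)"
      unfolding N_def using cramer[OF that] by blast
    then have "(matrix_inv M *v axis j 1) $ k = det (N M k j) / det M" by simp
    then show ?thesis by (simp add: matrix_vector_mult_basis column_def)
  qed
  have dA: "det A \<noteq> 0" using A invertible_det_nz by blast
  have ev: "eventually (\<lambda>x. det (f x) \<noteq> 0) F"
    by (rule tendsto_imp_eventually_ne[OF tendsto_det[OF f] dA])
  show ?thesis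
  proof (intro vec_tendstoI)
    fix k j
    have "((\<lambda>x. N (f x) k j) \<longlongrightarrow> N A k j) F"
      unfolding N_def
    proof (intro tendsto_vec_lambda)
      fix i l
      show "((\<lambda>x. if l = k then axis j 1 $ i else f x $ i $ l) \<longlongrightarrow> (if l = k then axis j 1 $ i else A $ i $ l)) F"
        using tendsto_vec_nth[OF tendsto_vec_nth[OF f]] by simp
    qed
    then have "((\<lambda>x. det (N (f x) k j) / det (f x)) \<longlongrightarrow> det (N A k j) / det A) F"
      using dA by (intro tendsto_intros f)
    then show "((\<lambda>x. matrix_inv (f x) $ k $ j) \<longlongrightarrow> matrix_inv A $ k $ j) F"
      unfolding cr[OF dA] by (rule Lim_transform_eventually) (use ev in \<open>eventually_elim\<close>, simp add: cr)
  qed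
qed

definition dg :: "(real ^ 'n::finite \<Rightarrow> real ^ 'n ^ 'n) \<Rightarrow> 'n \<Rightarrow> 'n \<Rightarrow> 'n \<Rightarrow> real ^ 'n \<Rightarrow> real" where
  "dg g i a b = dir_deriv (\<lambda>y. g y $ a $ b) (axis i 1)"

text \<open>\<open>Gam g x v\<close> is the vector of Christoffel symbols contracted twice with \<open>v\<close>: geodesics satisfy
  \<open>v' = - Gam g x v\<close>. So \<open>P x\<close>, a polynomial in the velocities, is an integral iff its derivative along
  \<open>t \<mapsto> (x + t v, v)\<close> is the derivative of \<open>P x\<close> at \<open>v\<close> in the direction \<open>Gam g x v\<close>.\<close>

definition gam :: "(real ^ 'n::finite \<Rightarrow> real ^ 'n ^ 'n) \<Rightarrow> real ^ 'n \<Rightarrow> real ^ 'n \<Rightarrow> real ^ 'n" where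
  "gam g x v = (\<chi> l. \<Sum>i\<in>UNIV. \<Sum>j\<in>UNIV. (dg g i l j x - 1 / 2 * dg g l i j x) * v $ i * v $ j)"

definition Gam :: "(real ^ 'n::finite \<Rightarrow> real ^ 'n ^ 'n) \<Rightarrow> real ^ 'n \<Rightarrow> real ^ 'n \<Rightarrow> real ^ 'n" where
  "Gam g x v = matrix_inv (g x) *v gam g x v"

definition weak_integral ::
  "(real ^ 'n::finite) set \<Rightarrow> nat \<Rightarrow> (real ^ 'n \<Rightarrow> real ^ 'n ^ 'n) \<Rightarrow> (real ^ 'n \<Rightarrow> ('n \<Rightarrow> nat) \<Rightarrow> real) \<Rightarrow> bool" where
  "weak_integral K m g a \<longleftrightarrow> line_eq K m a (\<lambda>x v. dhp m (a x) v (Gam g x v))"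

lemma tendsto_gam:
  assumes "\<And>i a b. ((\<lambda>z. dg (h z) i a b (y z)) \<longlongrightarrow> dg g i a b x) F" "(w \<longlongrightarrow> v) F"
  shows "((\<lambda>z. gam (h z) (y z) (w z)) \<longlongrightarrow> gam g x v) F"
  unfolding gam_def by (intro tendsto_intros assms)

lemma tendsto_Gam:
  assumes "invertible (g x)" "\<And>a b. ((\<lambda>z. h z (y z) $ a $ b) \<longlongrightarrow> g x $ a $ b) F"
    and "\<And>i a b. ((\<lambda>z. dg (h z) i a b (y z)) \<longlongrightarrow> dg g i a b x) F" "(w \<longlongrightarrow> v) F"
  shows "((\<lambda>z. Gam (h z) (y z) (w z)) \<longlongrightarrow> Gam g x v) F"
proof -
  have "((\<lambda>z. h z (y z)) \<longlongrightarrow> g x) F" by (intro vec_tendstoI assms(2))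
  then show ?thesis unfolding Gam_def
    by (intro tendsto_intros tendsto_matrix_inv tendsto_gam assms)
qed

lemma cconv_compose:
  assumes "cconv K f g" "x \<in> K" "eventually (\<lambda>z. y z \<in> K) F" "(y \<longlongrightarrow> x) F" "filterlim s sequentially F"
  shows "((\<lambda>z. f (s z) (y z)) \<longlongrightarrow> g x) F"
proof -
  have "filterlim y (inf (nhds x) (principal K)) F"
    using assms(3,4) by (auto simp: filterlim_inf filterlim_principal)
  from filterlim_compose[OF assms(1)[unfolded cconv_def, rule_format, OF assms(2)] filterlim_Pair[OF assms(5) this]]
  show ?thesis by simp
qed

lemma cconv_const: "continuous_on K g \<Longrightarrow> cconv K (\<lambda>_. g) g"
  for g :: "'a::metric_space \<Rightarrow> 'b::metric_space"
  by (rule uniform_imp_cconv) auto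

lemma cconv_filter_facts:
  shows "filterlim fst sequentially (sequentially \<times>\<^sub>F inf (nhds x) (principal K))"
    and "(snd \<longlongrightarrow> x) (sequentially \<times>\<^sub>F inf (nhds x) (principal K))"
    and "eventually (\<lambda>z. snd z \<in> K) (sequentially \<times>\<^sub>F inf (nhds x) (principal K))"
proof -
  let ?F = "sequentially \<times>\<^sub>F inf (nhds x) (principal K)"
  show "filterlim fst sequentially ?F" by (rule filterlim_fst)
  have "filterlim snd (inf (nhds x) (principal K)) ?F" by (rule filterlim_snd)
  then show "(snd \<longlongrightarrow> x) ?F" "eventually (\<lambda>z. snd z \<in> K) ?F"
    by (auto simp: filterlim_inf filterlim_principal)
qed

text \<open>Replaces the product filter by an arbitrary filter \<open>F\<close> with the relevant
  properties, so that proofs can use limit rules and \<open>cconv_compose\<close> directly.\<close>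

lemma cconvI:
  fixes K :: "'a::topological_space set"
  assumes "\<And>x F s y. x \<in> K \<Longrightarrow> filterlim s sequentially F \<Longrightarrow> (y \<longlongrightarrow> x) F \<Longrightarrow> eventually (\<lambda>z. y z \<in> K) F \<Longrightarrow>
    ((\<lambda>z::nat \<times> 'a. f (s z) (y z)) \<longlongrightarrow> g x) F"
  shows "cconv K f g"
  unfolding cconv_def by (intro ballI assms[where s = fst and y = snd] cconv_filter_facts)

text \<open>\<open>Gam\<close> only involves the metric and its first derivatives, so this is all
  that the compactness arguments use of convergence in the
  \<open>C\<^sup>k\<close>-topology.\<close>

definition C1_conv :: "(real ^ 'n::finite) set \<Rightarrow> (nat \<Rightarrow> real ^ 'n \<Rightarrow> real ^ 'n ^ 'n) \<Rightarrow> (real ^ 'n \<Rightarrow> real ^ 'n ^ 'n) \<Rightarrow> bool" where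
  "C1_conv K h g \<longleftrightarrow> (\<forall>a b. cconv K (\<lambda>j x. h j x $ a $ b) (\<lambda>x. g x $ a $ b)) \<and>
     (\<forall>i a b. cconv K (\<lambda>j. dg (h j) i a b) (dg g i a b))"

lemma Ck_metrics_entries:
  assumes "g \<in> Ck_metrics k D" "k \<ge> 1" "open D"
  shows "continuous_on D (\<lambda>x. g x $ a $ b)" "continuous_on D (dg g i a b)"
    "x \<in> D \<Longrightarrow> has_dir_deriv (\<lambda>x. g x $ a $ b) (axis i 1) x"
proof -
  have "Ck_on (Suc 0) D (\<lambda>x. g x $ a $ b)"
    using assms unfolding Ck_metrics_def by (auto intro: Ck_on_mono)
  then show "continuous_on D (\<lambda>x. g x $ a $ b)" "continuous_on D (dg g i a b)"
    "x \<in> D \<Longrightarrow> has_dir_deriv (\<lambda>x. g x $ a $ b) (axis i 1) x"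
    unfolding Ck_on_Suc dg_def Ck_on_def[of 0] by (auto dest: spec[of _ "[]"])
qed

lemma Ck_metrics_invertible: "g \<in> Ck_metrics k D \<Longrightarrow> x \<in> D \<Longrightarrow> invertible (g x)"
  and Ck_metrics_symmetric: "g \<in> Ck_metrics k D \<Longrightarrow> x \<in> D \<Longrightarrow> transpose (g x) = g x"
  unfolding Ck_metrics_def by auto

lemma Ck_nbhd_C1_conv:
  assumes g: "g \<in> Ck_metrics k D" and k: "k \<ge> 1" and D: "open D" "K \<subseteq> D"
    and h: "\<And>j. h j \<in> Ck_nbhd k D g (\<epsilon> j)" and e: "\<epsilon> \<longlonglongrightarrow> 0"
  shows "C1_conv K h g"
proof -
  have small: "\<exists>N. \<forall>j\<ge>N. \<epsilon> j < e" if "e > 0" for e :: real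
    using order_tendstoD(2)[OF assms(6) that] by (simp add: eventually_sequentially)
  have "cconv K (\<lambda>j x. h j x $ a $ b) (\<lambda>x. g x $ a $ b)" for a b
  proof (rule uniform_imp_cconv)
    show "continuous_on K (\<lambda>x. g x $ a $ b)"
      using Ck_metrics_entries(1)[OF g k D(1)] D(2) continuous_on_subset by blast
    fix e :: real assume "e > 0"
    from small[OF this] obtain N where N: "\<forall>j\<ge>N. \<epsilon> j < e" by blast
    have "dist (h j x $ a $ b) (g x $ a $ b) < e" if "j \<ge> N" "x \<in> K" for j x
      using Ck_nbhdD[OF h[of j], of "[]" x a b] D(2) that N by (fastforce simp: dist_real_def)
    then show "\<exists>N. \<forall>j\<ge>N. \<forall>x\<in>K. dist (h j x $ a $ b) (g x $ a $ b) < e" by blast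
  qed
  moreover have "cconv K (\<lambda>j. dg (h j) i a b) (dg g i a b)" for i a b
  proof (rule uniform_imp_cconv)
    show "continuous_on K (dg g i a b)"
      using Ck_metrics_entries(2)[OF g k D(1)] D(2) continuous_on_subset by blast
    fix e :: real assume "e > 0"
    from small[OF this] obtain N where N: "\<forall>j\<ge>N. \<epsilon> j < e" by blast
    have "dist (dg (h j) i a b x) (dg g i a b x) < e" if "j \<ge> N" "x \<in> K" for j x
      using Ck_nbhdD[OF h[of j], of "[i]" x a b] D(2) k that N by (fastforce simp: dist_real_def dg_def)
    then show "\<exists>N. \<forall>j\<ge>N. \<forall>x\<in>K. dist (dg (h j) i a b x) (dg g i a b x) < e" by blast
  qed
  ultimately show ?thesis unfolding C1_conv_def by blast
qed

text \<open>The joint convergence in point and direction yields bounds uniform in the direction. The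
  convergence for a fixed direction suffices for passing to the limit in the equation.\<close>

lemma C1_conv_Gam:
  assumes "C1_conv K h g" "\<And>x. x \<in> K \<Longrightarrow> invertible (g x)"
  shows "cconv (K \<times> S) (\<lambda>j p. Gam (h j) (fst p) (snd p)) (\<lambda>p. Gam g (fst p) (snd p))"
    "cconv K (\<lambda>j x. Gam (h j) x v) (\<lambda>x. Gam g x v)"
    "cconv K (\<lambda>j x. matrix_inv (h j x)) (\<lambda>x. matrix_inv (g x))"
proof -
  have *: "((\<lambda>z. h (s z) (y z) $ a $ b) \<longlongrightarrow> g x $ a $ b) F"
    "((\<lambda>z. dg (h (s z)) i a b (y z)) \<longlongrightarrow> dg g i a b x) F"
    if "x \<in> K" "filterlim s sequentially F" "(y \<longlongrightarrow> x) F" "eventually (\<lambda>z. y z \<in> K) F"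
    for x F and s :: "'c \<Rightarrow> nat" and y a b i
  proof -
    have "cconv K (\<lambda>j x. h j x $ a $ b) (\<lambda>x. g x $ a $ b)" "cconv K (\<lambda>j. dg (h j) i a b) (dg g i a b)"
      using assms(1) unfolding C1_conv_def by blast+
    from this[THEN cconv_compose, OF that(1,4,3,2)]
    show "((\<lambda>z. h (s z) (y z) $ a $ b) \<longlongrightarrow> g x $ a $ b) F"
      "((\<lambda>z. dg (h (s z)) i a b (y z)) \<longlongrightarrow> dg g i a b x) F" .
  qed
  show "cconv (K \<times> S) (\<lambda>j p. Gam (h j) (fst p) (snd p)) (\<lambda>p. Gam g (fst p) (snd p))"
  proof (rule cconvI)
    fix p F s and y :: "nat \<times> ((real, 'a) vec \<times> (real, 'a) vec) \<Rightarrow> (real, 'a) vec \<times> (real, 'a) vec"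
    assume p: "p \<in> K \<times> S" and s: "filterlim s sequentially F" and y: "(y \<longlongrightarrow> p) F" and K: "eventually (\<lambda>z. y z \<in> K \<times> S) F"
    have pK: "fst p \<in> K" using p by auto
    have y1: "((\<lambda>z. fst (y z)) \<longlongrightarrow> fst p) F" "((\<lambda>z. snd (y z)) \<longlongrightarrow> snd p) F" using y by (auto intro: tendsto_intros)
    have K1: "eventually (\<lambda>z. fst (y z) \<in> K) F" using K by eventually_elim auto
    show "((\<lambda>z. Gam (h (s z)) (fst (y z)) (snd (y z))) \<longlongrightarrow> Gam g (fst p) (snd p)) F"
      by (rule tendsto_Gam[OF assms(2)[OF pK] *[OF pK s y1(1) K1] y1(2)])
  qed
  show "cconv K (\<lambda>j x. Gam (h j) x v) (\<lambda>x. Gam g x v)"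
    by (rule cconvI, rule tendsto_Gam[OF assms(2) * tendsto_const])
  show "cconv K (\<lambda>j x. matrix_inv (h j x)) (\<lambda>x. matrix_inv (g x))"
  proof (rule cconvI)
    fix x F s and y :: "nat \<times> (real, 'a) vec \<Rightarrow> (real, 'a) vec"
    assume x: "x \<in> K" "filterlim s sequentially F" "(y \<longlongrightarrow> x) F" "eventually (\<lambda>z. y z \<in> K) F"
    have "((\<lambda>z. h (s z) (y z)) \<longlongrightarrow> g x) F" by (intro vec_tendstoI *(1)[OF x])
    then show "((\<lambda>z. matrix_inv (h (s z) (y z))) \<longlongrightarrow> matrix_inv (g x)) F"
      by (rule tendsto_matrix_inv[OF _ assms(2)[OF x(1)]])
  qed
qed

text \<open>The error term \<open>E\<close> allows two uses: with \<open>E = 0\<close> for weak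
  integrals of a converging sequence of metrics, and with the oscillating force for the rescaled
  differences.\<close>

lemma perturbed_line_eq_compactness:
  fixes c :: "real ^ 'n::finite" and a :: "nat \<Rightarrow> real ^ 'n \<Rightarrow> ('n \<Rightarrow> nat) \<Rightarrow> real"
  assumes \<rho>: "\<rho> > 0"
    and G: "cconv (cball c \<rho> \<times> cball 0 (2 * \<rho> + 1)) (\<lambda>j p. G j (fst p) (snd p)) (\<lambda>p. G0 (fst p) (snd p))"
    and aB: "\<And>j x \<alpha>. x \<in> cball c \<rho> \<Longrightarrow> \<alpha> \<in> mons m \<Longrightarrow> \<bar>a j x \<alpha>\<bar> \<le> B"
    and le: "\<And>j. line_eq (cball c \<rho>) m (a j) (\<lambda>x v. dhp m (a j x) v (G j x v) + E j x v)"
    and EB: "\<And>j x v. j \<ge> M \<Longrightarrow> x \<in> cball c \<rho> \<Longrightarrow> norm v \<le> 2 * \<rho> + 1 \<Longrightarrow> \<bar>E j x v\<bar> \<le> B'"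
  shows "\<exists>s b. strict_mono (s :: nat \<Rightarrow> nat) \<and>
    (\<forall>\<alpha>\<in>mons m. cconv (cball c \<rho>) (\<lambda>j x. a (s j) x \<alpha>) (\<lambda>x. b x \<alpha>))"
proof -
  let ?V = "2 * \<rho> + 1" and ?K = "cball c \<rho>"
  have cpt: "compact (?K \<times> cball (0 :: real ^ 'n) ?V)" by (intro compact_Times compact_cball)
  obtain C N where C: "C \<ge> 0" and CN: "\<And>j p. j \<ge> N \<Longrightarrow> p \<in> ?K \<times> cball 0 ?V \<Longrightarrow> norm (G j (fst p) (snd p)) \<le> C"
    using cconv_bounded[OF cpt G] by blast
  define L where "L = real (card (mons m :: ('n \<Rightarrow> nat) set)) * real m * ?V ^ (m - 1) * \<bar>B\<bar>"
  have L: "L \<ge> 0" unfolding L_def using \<rho> by simp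
  \<comment> \<open>The bounds on \<open>G\<close> and \<open>E\<close> hold from the indices
    \<open>N\<close> and \<open>M\<close> on, hence the shift of the sequence.\<close>
  have "\<exists>s b. strict_mono s \<and> (\<forall>\<alpha>\<in>mons m. cconv ?K (\<lambda>j x. a (s j + (N + M)) x \<alpha>) (\<lambda>x. b x \<alpha>))"
  proof (rule line_eq_compactness[OF \<rho>, where m = m and a = "\<lambda>j. a (j + (N + M))" and B = "\<bar>B\<bar> + \<bar>B'\<bar> + L * C"
        and T = "\<lambda>j x v. dhp m (a (j + (N + M)) x) v (G (j + (N + M)) x v) + E (j + (N + M)) x v"])
    show "\<bar>a (j + (N + M)) x \<alpha>\<bar> \<le> \<bar>B\<bar> + \<bar>B'\<bar> + L * C" if "x \<in> ?K" "\<alpha> \<in> mons m" for j x \<alpha>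
      using aB[OF that, of "j + (N + M)"] L C mult_nonneg_nonneg[OF L C] by linarith
    fix j x v assume x: "x \<in> ?K" and v: "norm (v :: real ^ 'n) \<le> ?V"
    have "\<bar>dhp m (a (j + (N + M)) x) v (G (j + (N + M)) x v)\<bar> \<le> L * norm (G (j + (N + M)) x v)"
      using dhp_bound[of m "a (j + (N + M)) x" "\<bar>B\<bar>" v ?V] aB[OF x] v unfolding L_def by (meson abs_ge_self order_trans)
    also have "\<dots> \<le> L * C" using CN[of "j + (N + M)" "(x, v)"] x v L by (intro mult_left_mono) (auto simp: dist_norm)
    finally show "\<bar>dhp m (a (j + (N + M)) x) v (G (j + (N + M)) x v) + E (j + (N + M)) x v\<bar> \<le> \<bar>B\<bar> + \<bar>B'\<bar> + L * C"
      using EB[OF _ x v, of "j + (N + M)"] by linarith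
  qed (rule le)
  then obtain s b where "strict_mono s" "\<forall>\<alpha>\<in>mons m. cconv ?K (\<lambda>j x. a (s j + (N + M)) x \<alpha>) (\<lambda>x. b x \<alpha>)" by blast
  then show ?thesis by (intro exI[of _ "\<lambda>j. s j + (N + M)"] exI[of _ b]) (auto simp: strict_mono_def)
qed

lemma perturbed_line_eq_limit:
  fixes a :: "nat \<Rightarrow> real ^ 'n::finite \<Rightarrow> ('n \<Rightarrow> nat) \<Rightarrow> real"
  assumes "compact K" "convex K"
    and le: "\<And>j. line_eq K m (a j) (\<lambda>x v. dhp m (a j x) v (G j x v) + E j x v)"
    and ac: "\<And>\<alpha>. \<alpha> \<in> mons m \<Longrightarrow> cconv K (\<lambda>j x. a j x \<alpha>) (\<lambda>x. b x \<alpha>)"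
    and G: "\<And>v. cconv K (\<lambda>j x. G j x v) (\<lambda>x. G0 x v)"
    and E: "\<And>v. cconv K (\<lambda>j x. E j x v) (\<lambda>_. 0)"
  shows "line_eq K m b (\<lambda>x v. dhp m (b x) v (G0 x v))"
proof (rule line_eq_limit[OF assms(1,2) le ac])
  fix v :: "real ^ 'n"
  show "cconv K (\<lambda>j x. dhp m (a j x) v (G j x v) + E j x v) (\<lambda>x. dhp m (b x) v (G0 x v))"
  proof (rule cconvI, goal_cases)
    case (1 x F s y)
    have "((\<lambda>z. dhp m (a (s z) (y z)) v (G (s z) (y z) v) + E (s z) (y z) v) \<longlongrightarrow> dhp m (b x) v (G0 x v) + 0) F"
      by (intro tendsto_intros cconv_compose[OF ac 1(1,4,3,2)] cconv_compose[OF G 1(1,4,3,2)] cconv_compose[OF E 1(1,4,3,2)])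
    then show ?case by simp
  qed
qed

lemma weak_integral_compactness:
  fixes c :: "real ^ 'n::finite"
  assumes \<rho>: "\<rho> > 0" and h: "C1_conv (cball c \<rho>) h g" and inv: "\<And>x. x \<in> cball c \<rho> \<Longrightarrow> invertible (g x)"
    and aB: "\<And>j x \<alpha>. x \<in> cball c \<rho> \<Longrightarrow> \<alpha> \<in> mons m \<Longrightarrow> \<bar>a j x \<alpha>\<bar> \<le> B"
    and le: "\<And>j. weak_integral (cball c \<rho>) m (h j) (a j)"
  shows "\<exists>s b. strict_mono (s :: nat \<Rightarrow> nat) \<and>
    (\<forall>\<alpha>\<in>mons m. cconv (cball c \<rho>) (\<lambda>j x. a (s j) x \<alpha>) (\<lambda>x. b x \<alpha>)) \<and>
    weak_integral (cball c \<rho>) m g b \<and> (\<forall>x\<in>cball c \<rho>. \<forall>\<alpha>\<in>mons m. \<bar>b x \<alpha>\<bar> \<le> B)"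
proof -
  let ?K = "cball c \<rho>"
  have le': "line_eq ?K m (a j) (\<lambda>x v. dhp m (a j x) v (Gam (h j) x v) + 0)" for j
    using le[of j] unfolding weak_integral_def by simp
  obtain s b where s: "strict_mono s" and sb: "\<And>\<alpha>. \<alpha> \<in> mons m \<Longrightarrow> cconv ?K (\<lambda>j x. a (s j) x \<alpha>) (\<lambda>x. b x \<alpha>)"
    using perturbed_line_eq_compactness[OF \<rho> C1_conv_Gam(1)[OF h inv] aB le', where M = 0 and B' = 0] by auto
  have "weak_integral ?K m g b"
    unfolding weak_integral_def
  proof (rule perturbed_line_eq_limit[where a = "\<lambda>j. a (s j)" and G = "\<lambda>j. Gam (h (s j))" and E = "\<lambda>_ _ _. 0"])
    show "cconv ?K (\<lambda>j x. Gam (h (s j)) x v) (\<lambda>x. Gam g x v)" for v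
      by (rule cconv_subseq[OF C1_conv_Gam(2)[OF h inv] s])
    show "cconv ?K (\<lambda>j x. 0) (\<lambda>_. 0 :: real)" by (rule cconv_const) simp
  qed (use le' sb in auto)
  moreover have "\<bar>b x \<alpha>\<bar> \<le> B" if "x \<in> ?K" "\<alpha> \<in> mons m" for x \<alpha>
    by (rule tendsto_upperbound[OF tendsto_rabs[OF cconv_pointwise[OF sb[OF that(2)] that(1)]]])
      (use aB that in auto)
  ultimately show ?thesis using s sb by blast
qed

text \<open>Every covector orthogonal to \<open>v \<noteq> 0\<close> is a multiple of some \<open>perp v w\<close>, and here \<open>v\<close> and \<open>w\<close> can be
  varied independently in a countable dense set.\<close>

definition perp :: "real ^ 'n::finite \<Rightarrow> real ^ 'n \<Rightarrow> real ^ 'n" where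
  "perp v w = (v \<bullet> v) *\<^sub>R w - (w \<bullet> v) *\<^sub>R v"

text \<open>A single constant bounds the coefficients by \<open>N\<close> and the derivative from
  below by \<open>1 / N\<close>. Both are closed conditions, and every bounded weak integral whose
  derivative in question is nonzero meets them for large \<open>N\<close>.\<close>

definition bad_metrics ::
  "nat \<Rightarrow> (real ^ 'n::finite) set \<Rightarrow> nat \<Rightarrow> real \<Rightarrow> real ^ 'n \<Rightarrow> real \<Rightarrow> real ^ 'n \<Rightarrow> real ^ 'n \<Rightarrow> (real ^ 'n \<Rightarrow> real ^ 'n ^ 'n) set" where
  "bad_metrics k D m N c \<rho> v w = {g \<in> Ck_metrics k D. \<exists>a.
     (\<forall>x\<in>cball c \<rho>. \<forall>\<alpha>\<in>mons m. \<bar>a x \<alpha>\<bar> \<le> N) \<and> weak_integral (cball c \<rho>) m g a \<and>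
     1 / N \<le> \<bar>dhp m (a c) v (matrix_inv (g c) *v perp v w)\<bar>}"

text \<open>Otherwise bad metrics would converge to \<open>g\<close>. By compactness their weak
  integrals converge along a subsequence to one of \<open>g\<close>, and the closed bounds survive
  the limit, so \<open>g\<close> itself would be bad.\<close>

lemma good_metrics_open:
  fixes D :: "(real ^ 'n::finite) set"
  assumes D: "open D" and k: "k \<ge> 1" and \<rho>: "\<rho> > 0" and K: "cball c \<rho> \<subseteq> D"
  shows "openin (Ck_topology k D) (Ck_metrics k D - bad_metrics k D m N c \<rho> v w)"
  unfolding openin_Ck_topology
proof (intro conjI ballI)
  fix g assume g: "g \<in> Ck_metrics k D - bad_metrics k D m N c \<rho> v w"
  show "\<exists>\<epsilon>>0. Ck_nbhd k D g \<epsilon> \<subseteq> Ck_metrics k D - bad_metrics k D m N c \<rho> v w"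
  proof (rule ccontr)
    assume no: "\<not> ?thesis"
    have "\<exists>h. h \<in> Ck_nbhd k D g (1 / real (Suc j)) \<and> h \<in> bad_metrics k D m N c \<rho> v w" for j
    proof -
      have "(1 :: real) / real (Suc j) > 0" by simp
      then have "\<not> Ck_nbhd k D g (1 / real (Suc j)) \<subseteq> Ck_metrics k D - bad_metrics k D m N c \<rho> v w" using no by blast
      then show ?thesis using Ck_nbhd_subset by blast
    qed
    then obtain h where h: "\<And>j. h j \<in> Ck_nbhd k D g (1 / real (Suc j))" "\<And>j. h j \<in> bad_metrics k D m N c \<rho> v w" by metis
    have "\<exists>a. (\<forall>x\<in>cball c \<rho>. \<forall>\<alpha>\<in>mons m. \<bar>a x \<alpha>\<bar> \<le> N) \<and> weak_integral (cball c \<rho>) m (h j) a \<and>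
     1 / N \<le> \<bar>dhp m (a c) v (matrix_inv (h j c) *v perp v w)\<bar>" for j
      using h(2)[of j] unfolding bad_metrics_def by blast
    then obtain a where a: "\<And>j. \<forall>x\<in>cball c \<rho>. \<forall>\<alpha>\<in>mons m. \<bar>a j x \<alpha>\<bar> \<le> N"
      "\<And>j. weak_integral (cball c \<rho>) m (h j) (a j)"
      "\<And>j. 1 / N \<le> \<bar>dhp m (a j c) v (matrix_inv (h j c) *v perp v w)\<bar>" by metis
    have g': "g \<in> Ck_metrics k D" and inv: "\<And>x. x \<in> cball c \<rho> \<Longrightarrow> invertible (g x)"
      using g K Ck_metrics_invertible by blast+
    have conv: "C1_conv (cball c \<rho>) h g"
      by (rule Ck_nbhd_C1_conv[OF g' k D K h(1) LIMSEQ_inverse_real_of_nat[unfolded inverse_eq_divide]])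
    obtain s b where s: "strict_mono s" and sb: "\<And>\<alpha>. \<alpha> \<in> mons m \<Longrightarrow> cconv (cball c \<rho>) (\<lambda>j x. a (s j) x \<alpha>) (\<lambda>x. b x \<alpha>)"
      and b: "weak_integral (cball c \<rho>) m g b" "\<forall>x\<in>cball c \<rho>. \<forall>\<alpha>\<in>mons m. \<bar>b x \<alpha>\<bar> \<le> N"
      using weak_integral_compactness[OF \<rho> conv inv, of m a N] a(1,2) by blast
    have c: "c \<in> cball c \<rho>" using \<rho> by simp
    have "(\<lambda>j. \<bar>dhp m (a (s j) c) v (matrix_inv (h (s j) c) *v perp v w)\<bar>) \<longlonglongrightarrow> \<bar>dhp m (b c) v (matrix_inv (g c) *v perp v w)\<bar>"
      by (intro tendsto_intros cconv_pointwise[OF sb c] cconv_pointwise[OF cconv_subseq[OF C1_conv_Gam(3)[OF conv inv] s] c])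
    then have "1 / N \<le> \<bar>dhp m (b c) v (matrix_inv (g c) *v perp v w)\<bar>"
      by (rule tendsto_lowerbound) (use a(3) in auto)
    then have "g \<in> bad_metrics k D m N c \<rho> v w" using b g' unfolding bad_metrics_def by blast
    then show False using g by blast
  qed
qed blast

subsection \<open>High-frequency perturbations of the metric\<close>

lemma norm_matrix_vector_le:
  fixes A :: "real ^ 'n ^ 'n::finite"
  shows "norm (A *v u) \<le> (real CARD('n))\<^sup>2 * norm A * norm u"
proof -
  have "norm (A *v u) \<le> (\<Sum>i\<in>UNIV. \<bar>(A *v u) $ i\<bar>)" by (rule norm_le_l1_cart)
  also have "\<dots> \<le> (\<Sum>i\<in>(UNIV :: 'n set). \<Sum>j\<in>(UNIV :: 'n set). norm A * norm u)"
  proof (rule sum_mono)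
    fix i
    have "\<bar>(A *v u) $ i\<bar> \<le> (\<Sum>j\<in>UNIV. \<bar>A $ i $ j * u $ j\<bar>)"
      unfolding matrix_vector_mult_def by (simp add: sum_abs)
    also have "\<dots> \<le> (\<Sum>j\<in>(UNIV :: 'n set). norm A * norm u)"
    proof (rule sum_mono)
      fix j
      have "\<bar>A $ i $ j\<bar> \<le> norm A"
        using component_le_norm_cart[of "A $ i" j] Finite_Cartesian_Product.norm_nth_le[of A i] by linarith
      then show "\<bar>A $ i $ j * u $ j\<bar> \<le> norm A * norm u"
        unfolding abs_mult by (intro mult_mono component_le_norm_cart) auto
    qed
    finally show "\<bar>(A *v u) $ i\<bar> \<le> (\<Sum>j\<in>(UNIV :: 'n set). norm A * norm u)" .
  qed
  finally show ?thesis by (simp add: power2_eq_square mult_ac)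
qed

lemma continuous_on_matrix_inv:
  fixes g :: "'a::topological_space \<Rightarrow> real ^ 'n ^ 'n::finite"
  assumes "\<And>a b. continuous_on K (\<lambda>x. g x $ a $ b)" "\<And>x. x \<in> K \<Longrightarrow> invertible (g x)"
  shows "continuous_on K (\<lambda>x. matrix_inv (g x))"
  unfolding continuous_on_def
proof (intro ballI tendsto_matrix_inv vec_tendstoI)
  fix x a b assume "x \<in> K"
  then show "((\<lambda>x. g x $ a $ b) \<longlongrightarrow> g x $ a $ b) (at x within K)" using assms(1) continuous_on_def by blast
qed (use assms(2) in auto)

lemma scaled_identity_mult: "(s *\<^sub>R (mat 1 :: real ^ 'n ^ 'n::finite)) *v u = s *\<^sub>R u"
  by (metis matrix_vector_mul_lid scaleR_matrix_vector_assoc)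

lemma scaled_identity_perturbation:
  fixes D :: "(real ^ 'n::finite) set"
  assumes D: "open D" and g: "g \<in> Ck_metrics k D" and k: "k \<ge> 1" and h: "Ck_on k UNIV h"
    and K: "compact K" "K \<subseteq> D" "\<And>x. x \<notin> K \<Longrightarrow> h x = 0" and e: "\<epsilon> > 0"
  shows "\<exists>a0>0. \<forall>a. 0 \<le> a \<longrightarrow> a \<le> a0 \<longrightarrow> restrict (\<lambda>x. g x + (a * h x) *\<^sub>R mat 1) D \<in> Ck_nbhd k D g \<epsilon>"
proof -
  obtain B where B: "B > 0" "\<And>js x. length js \<le> k \<Longrightarrow> \<bar>iter_partial js h x\<bar> \<le> B"
    using compact_support_iter_partial_bound[OF h K(1,3)] by blast
  have inv: "invertible (g x)" if "x \<in> D" for x using g that Ck_metrics_invertible by blast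
  have "continuous_on K (\<lambda>x. matrix_inv (g x))"
    using Ck_metrics_entries(1)[OF g k D] K(2) inv
    by (intro continuous_on_matrix_inv) (auto intro: continuous_on_subset)
  from compact_imp_bounded[OF compact_continuous_image[OF this K(1)]]
  obtain M where M: "M > 0" "\<And>x. x \<in> K \<Longrightarrow> norm (matrix_inv (g x)) \<le> M"
    unfolding bounded_pos by auto
  define C where "C = (real CARD('n))\<^sup>2 * M"
  have C: "C > 0" unfolding C_def using M by simp
  \<comment> \<open>The first bound keeps the components and their derivatives within
    \<open>\<epsilon> / 2\<close>. The second one makes \<open>a h\<close> times the inverse of
    \<open>g\<close> a contraction with factor at most 1/2, which keeps the metric
    invertible.\<close>
  define a0 where "a0 = min (\<epsilon> / (2 * B)) (1 / (2 * B * C))"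
  have a0: "a0 > 0" unfolding a0_def using e B C by simp
  show ?thesis
  proof (intro exI[of _ a0] conjI a0 allI impI)
    fix a assume a: "0 \<le> a" "a \<le> a0"
    let ?g = "\<lambda>x. g x + (a * h x) *\<^sub>R mat 1" and ?d = "\<lambda>i j::'n. if i = j then 1 else 0 :: real"
    have ent: "?g x $ i $ j = 1 * (g x $ i $ j) + (a * ?d i j) * h x" for x i j
      by (simp add: mat_def)
    have hD: "Ck_on k D h" using h Ck_on_subset by blast
    have gD: "Ck_on k D (\<lambda>x. g x $ i $ j)" for i j using g unfolding Ck_metrics_def by auto
    have ckD: "Ck_on k D (\<lambda>x. restrict ?g D x $ i $ j)" for i j
      by (rule Ck_on_cong[OF D _ Ck_on_lincomb[OF D gD hD, of 1 i j "a * ?d i j"]]) (simp add: mat_def)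
    have it: "iter_partial js (\<lambda>x. restrict ?g D x $ i $ j) x = iter_partial js (\<lambda>x. g x $ i $ j) x + a * ?d i j * iter_partial js h x"
      if "length js \<le> k" "x \<in> D" for js i j x
    proof -
      have "iter_partial js (\<lambda>x. restrict ?g D x $ i $ j) x = iter_partial js (\<lambda>x. 1 * (g x $ i $ j) + (a * ?d i j) * h x) x"
        by (rule iter_partial_cong[OF D _ that(2)]) (simp add: mat_def)
      then show ?thesis using iter_partial_lincomb[OF D gD hD that, of 1 i j "a * ?d i j"] by simp
    qed
    have ah: "\<bar>a * h x\<bar> * C < 1" for x
    proof -
      have "\<bar>a * h x\<bar> \<le> a0 * B" unfolding abs_mult using a B(2)[of "[]" x] by (intro mult_mono) auto
      also have "\<dots> \<le> 1 / (2 * B * C) * B" unfolding a0_def using B by (intro mult_right_mono) auto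
      finally have "\<bar>a * h x\<bar> \<le> 1 / (2 * C)" using B by simp
      then show ?thesis using C by (simp add: field_simps)
    qed
    have invg: "invertible (?g x)" if "x \<in> D" for x
    proof (cases "x \<in> K")
      case False then show ?thesis using K(3) inv that by simp
    next
      case True
      \<comment> \<open>A kernel vector would be reproduced by \<open>- a h\<close> times the
        inverse of \<open>g\<close>, which strictly shrinks nonzero vectors.\<close>
      have "u = 0" if u: "?g x *v u = 0" for u
      proof (rule ccontr)
        assume u0: "u \<noteq> 0"
        have "g x *v u = (- (a * h x)) *\<^sub>R u"
          using u by (simp add: matrix_vector_mult_add_rdistrib scaled_identity_mult eq_neg_iff_add_eq_0)
        then have "u = matrix_inv (g x) *v ((- (a * h x)) *\<^sub>R u)"
          using matrix_inv_vec(2)[OF inv[OF \<open>x \<in> D\<close>], of u] by simp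
        then have "norm u \<le> (real CARD('n))\<^sup>2 * norm (matrix_inv (g x)) * norm ((- (a * h x)) *\<^sub>R u)"
          using norm_matrix_vector_le by metis
        also have "\<dots> \<le> C * norm ((- (a * h x)) *\<^sub>R u)"
          unfolding C_def using M(2)[OF True] by (intro mult_right_mono mult_left_mono) auto
        also have "\<dots> = (\<bar>a * h x\<bar> * C) * norm u" by simp
        also have "\<dots> < 1 * norm u" using ah[of x] u0 by (intro mult_strict_right_mono) auto
        finally show False by simp
      qed
      then show ?thesis
        using matrix_left_invertible_ker[of "?g x"] invertible_left_inverse by blast
    qed
    have "transpose (?g x) = ?g x" if "x \<in> D" for x
      using Ck_metrics_symmetric[OF g that] by (simp add: vec_eq_iff transpose_def mat_def)
    then have "restrict ?g D \<in> Ck_metrics k D"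
      unfolding Ck_metrics_def using ckD invg by auto
    moreover have "\<bar>iter_partial js (\<lambda>x. restrict ?g D x $ i $ j) x - iter_partial js (\<lambda>x. g x $ i $ j) x\<bar> < \<epsilon>"
      if "length js \<le> k" "x \<in> D" for js i j x
    proof -
      have "\<bar>a * ?d i j * iter_partial js h x\<bar> \<le> a0 * B"
        unfolding abs_mult using a B(2)[OF that(1), of x] B(1) a0 by (intro mult_mono) auto
      also have "\<dots> \<le> \<epsilon> / (2 * B) * B" unfolding a0_def using B by (intro mult_right_mono) auto
      also have "\<dots> < \<epsilon>" using B e by simp
      finally show ?thesis unfolding it[OF that] by simp
    qed
    ultimately show "restrict ?g D \<in> Ck_nbhd k D g \<epsilon>" unfolding Ck_nbhd_def by blast
  qed
qed

text \<open>\<open>gam\<close> is linear in the first derivatives of the metric, so the correction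
  is \<open>a\<close> times the contribution of the conformally flat tensor \<open>h\<close> times
  the identity.\<close>

lemma gam_perturbed:
  fixes D :: "(real ^ 'n::finite) set"
  assumes D: "open D" and x: "x \<in> D" and g: "g \<in> Ck_metrics k D" and k: "k \<ge> 1"
    and h: "\<And>i. has_dir_deriv h (axis i 1) x"
  shows "gam (restrict (\<lambda>x. g x + (a * h x) *\<^sub>R mat 1) D) x v =
    gam g x v + a *\<^sub>R (((\<chi> i. dir_deriv h (axis i 1) x) \<bullet> v) *\<^sub>R v - ((v \<bullet> v) / 2) *\<^sub>R (\<chi> i. dir_deriv h (axis i 1) x))"
proof -
  let ?g = "restrict (\<lambda>x. g x + (a * h x) *\<^sub>R mat 1) D" and ?h = "\<lambda>i. dir_deriv h (axis i 1) x"
  let ?d = "\<lambda>p q::'n. if p = q then 1 else 0 :: real"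
  have dg: "dg ?g i p q x = dg g i p q x + a * ?d p q * ?h i" for i p q
  proof -
    have "dg ?g i p q x = dir_deriv (\<lambda>x. 1 * (g x $ p $ q) + (a * ?d p q) * h x) (axis i 1) x"
      unfolding dg_def by (rule dir_deriv_cong(2)[OF D x]) (simp add: mat_def)
    then show ?thesis
      using dir_deriv_lincomb(2)[OF Ck_metrics_entries(3)[OF g k D x] h, of 1 p q "a * ?d p q" i]
      unfolding dg_def by simp
  qed
  have "gam ?g x v $ l = gam g x v $ l + a * ((\<Sum>i\<in>UNIV. ?h i * v $ i) * v $ l - (\<Sum>i\<in>UNIV. v $ i * v $ i) / 2 * ?h l)" for l
  proof -
    have "gam ?g x v $ l = gam g x v $ l + (\<Sum>i\<in>UNIV. \<Sum>j\<in>UNIV. (a * ?d l j * ?h i - 1 / 2 * (a * ?d i j * ?h l)) * v $ i * v $ j)"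
      unfolding gam_def dg vec_lambda_beta sum.distrib[symmetric]
      by (intro sum.cong refl) (simp add: algebra_simps)
    also have "(\<Sum>i\<in>UNIV. \<Sum>j\<in>UNIV. (a * ?d l j * ?h i - 1 / 2 * (a * ?d i j * ?h l)) * v $ i * v $ j)
      = (\<Sum>i\<in>UNIV. a * ?h i * v $ i * v $ l - 1 / 2 * a * ?h l * v $ i * v $ i)"
    proof (intro sum.cong refl)
      fix i
      have "(\<Sum>j\<in>UNIV. (a * ?d l j * ?h i - 1 / 2 * (a * ?d i j * ?h l)) * v $ i * v $ j)
        = (\<Sum>j\<in>UNIV. (if l = j then a * ?h i * v $ i * v $ j else 0) - (if i = j then 1 / 2 * a * ?h l * v $ i * v $ j else 0))"
        by (intro sum.cong refl) (auto simp: algebra_simps)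
      then show "(\<Sum>j\<in>UNIV. (a * ?d l j * ?h i - 1 / 2 * (a * ?d i j * ?h l)) * v $ i * v $ j)
        = a * ?h i * v $ i * v $ l - 1 / 2 * a * ?h l * v $ i * v $ i"
        by (simp add: sum_subtractf)
    qed
    also have "\<dots> = a * ((\<Sum>i\<in>UNIV. ?h i * v $ i) * v $ l - (\<Sum>i\<in>UNIV. v $ i * v $ i) / 2 * ?h l)"
      by (simp add: sum_subtractf sum_distrib_left sum_distrib_right right_diff_distrib sum_divide_distrib mult_ac)
    finally show ?thesis .
  qed
  then show ?thesis by (simp add: vec_eq_iff inner_vec_def)
qed

text \<open>The factor \<open>a\<close> comes out exactly, with no expansion of the inverse in
  powers of \<open>a\<close>: in \<open>gam g x v = g x *v Gam g x v\<close> the matrix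
  \<open>g x\<close> is rewritten as the perturbed metric minus the perturbation.\<close>

lemma Gam_perturbed:
  fixes D :: "(real ^ 'n::finite) set"
  assumes D: "open D" and x: "x \<in> D" and g: "g \<in> Ck_metrics k D" and k: "k \<ge> 1"
    and h: "\<And>i. has_dir_deriv h (axis i 1) x"
    and inv: "invertible (restrict (\<lambda>x. g x + (a * h x) *\<^sub>R mat 1) D x)"
  shows "Gam (restrict (\<lambda>x. g x + (a * h x) *\<^sub>R mat 1) D) x v - Gam g x v =
    a *\<^sub>R (matrix_inv (restrict (\<lambda>x. g x + (a * h x) *\<^sub>R mat 1) D x) *v
     (((\<chi> i. dir_deriv h (axis i 1) x) \<bullet> v) *\<^sub>R v - ((v \<bullet> v) / 2) *\<^sub>R (\<chi> i. dir_deriv h (axis i 1) x) - h x *\<^sub>R Gam g x v))"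
    (is "Gam ?g x v - _ = a *\<^sub>R (?B *v (?t - _))")
proof -
  have gx: "?g x = g x + (a * h x) *\<^sub>R mat 1" using x by simp
  have "gam g x v = g x *v Gam g x v"
    unfolding Gam_def using matrix_inv_vec(1)[OF Ck_metrics_invertible[OF g x]] by simp
  also have "\<dots> = ?g x *v Gam g x v - (a * h x) *\<^sub>R Gam g x v"
    unfolding gx by (simp add: matrix_vector_mult_add_rdistrib scaled_identity_mult)
  finally have e: "gam g x v = ?g x *v Gam g x v - (a * h x) *\<^sub>R Gam g x v" .
  have "Gam ?g x v = ?B *v (gam g x v + a *\<^sub>R ?t)"
    unfolding Gam_def using gam_perturbed[OF D x g k h] by simp
  also have "gam g x v + a *\<^sub>R ?t = ?g x *v Gam g x v + a *\<^sub>R (?t - h x *\<^sub>R Gam g x v)"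
    unfolding e by (simp add: algebra_simps)
  also have "?B *v \<dots> = Gam g x v + a *\<^sub>R (?B *v (?t - h x *\<^sub>R Gam g x v))"
    by (simp only: matrix_vector_right_distrib matrix_inv_vec(2)[OF inv] matrix_vector_mult_scaleR)
  finally show ?thesis by (simp only: add_diff_cancel_left')
qed

text \<open>The added 0 is the phase \<open>b\<close> in \<open>Ck_on_cos\<close>.\<close>

definition wave :: "real ^ 'n::finite \<Rightarrow> real \<Rightarrow> nat \<Rightarrow> real ^ 'n \<Rightarrow> real \<Rightarrow> real ^ 'n \<Rightarrow> real" where
  "wave c \<rho> l \<xi> n x = bump c \<rho> l x * cos (x \<bullet> (n *\<^sub>R \<xi>) + 0)"

lemma wave_Ck: "k < l \<Longrightarrow> Ck_on k UNIV (wave c \<rho> l \<xi> n)"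
  unfolding wave_def[abs_def] by (intro Ck_on_mult Ck_on_bump Ck_on_cos) auto

lemma wave_dir_deriv:
  assumes "l > 1"
  shows "has_dir_deriv (wave c \<rho> l \<xi> n) (axis i 1) x"
    "dir_deriv (wave c \<rho> l \<xi> n) (axis i 1) x =
      dir_deriv (bump c \<rho> l) (axis i 1) x * cos (x \<bullet> (n *\<^sub>R \<xi>)) - n * (bump c \<rho> l x * sin (x \<bullet> (n *\<^sub>R \<xi>)) * \<xi> $ i)"
proof -
  have b: "has_dir_deriv (bump c \<rho> l) (axis i 1) x"
    using Ck_on_bump[of "Suc 0" l c \<rho>] assms unfolding Ck_on_Suc by auto
  have c: "has_dir_deriv (\<lambda>x. cos (x \<bullet> (n *\<^sub>R \<xi>) + 0)) (axis i 1) x"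
    "dir_deriv (\<lambda>x. cos (x \<bullet> (n *\<^sub>R \<xi>) + 0)) (axis i 1) x = - sin (x \<bullet> (n *\<^sub>R \<xi>)) * (n * \<xi> $ i)"
    by (rule dir_derivI; auto intro!: derivative_eq_intros simp: inner_left_distrib inner_axis_axis inner_axis')+
  show "has_dir_deriv (wave c \<rho> l \<xi> n) (axis i 1) x"
    unfolding wave_def[abs_def] by (rule dir_deriv_mult(1)[OF b c(1)])
  show "dir_deriv (wave c \<rho> l \<xi> n) (axis i 1) x =
      dir_deriv (bump c \<rho> l) (axis i 1) x * cos (x \<bullet> (n *\<^sub>R \<xi>)) - n * (bump c \<rho> l x * sin (x \<bullet> (n *\<^sub>R \<xi>)) * \<xi> $ i)"
    unfolding wave_def[abs_def] using dir_deriv_mult(2)[OF b c(1)] c(2) by simp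
qed

text \<open>For \<open>n \<noteq> 0\<close> this is the gradient of the wave divided by its
  frequency. It stays bounded as \<open>n\<close> grows, and only the summand along
  \<open>\<xi>\<close> survives.\<close>

definition wave_grad :: "real ^ 'n::finite \<Rightarrow> real \<Rightarrow> nat \<Rightarrow> real ^ 'n \<Rightarrow> real \<Rightarrow> real ^ 'n \<Rightarrow> real ^ 'n" where
  "wave_grad c \<rho> l \<xi> n x = (cos (x \<bullet> (n *\<^sub>R \<xi>)) / n) *\<^sub>R (\<chi> i. dir_deriv (bump c \<rho> l) (axis i 1) x)
     - (bump c \<rho> l x * sin (x \<bullet> (n *\<^sub>R \<xi>))) *\<^sub>R \<xi>"

lemma wave_grad: "l > 1 \<Longrightarrow> n \<noteq> 0 \<Longrightarrow> (\<chi> i. dir_deriv (wave c \<rho> l \<xi> n) (axis i 1) x) = n *\<^sub>R wave_grad c \<rho> l \<xi> n x"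
  by (simp add: vec_eq_iff wave_dir_deriv wave_grad_def algebra_simps)

text \<open>The deviation of the perturbed geodesic equation, before multiplication by the inverse of the
  perturbed metric and rescaled by the amplitude times the frequency \<open>n\<close> of the perturbation.\<close>

definition wave_force :: "real ^ 'n::finite \<Rightarrow> real \<Rightarrow> nat \<Rightarrow> real ^ 'n \<Rightarrow> (real ^ 'n \<Rightarrow> real ^ 'n ^ 'n) \<Rightarrow> real \<Rightarrow> real ^ 'n \<Rightarrow> real ^ 'n \<Rightarrow> real ^ 'n" where
  "wave_force c \<rho> l \<xi> g n x v = (wave_grad c \<rho> l \<xi> n x \<bullet> v) *\<^sub>R v - ((v \<bullet> v) / 2) *\<^sub>R wave_grad c \<rho> l \<xi> n x
     - (wave c \<rho> l \<xi> n x / n) *\<^sub>R Gam g x v"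

lemma Gam_wave_perturbed:
  fixes D :: "(real ^ 'n::finite) set"
  assumes "open D" "x \<in> D" "g \<in> Ck_metrics k D" "k \<ge> 1" "l > 1" "n > 0"
    and "invertible (restrict (\<lambda>x. g x + (a * wave c \<rho> l \<xi> n x) *\<^sub>R mat 1) D x)"
  shows "Gam (restrict (\<lambda>x. g x + (a * wave c \<rho> l \<xi> n x) *\<^sub>R mat 1) D) x v - Gam g x v =
    (a * n) *\<^sub>R (matrix_inv (restrict (\<lambda>x. g x + (a * wave c \<rho> l \<xi> n x) *\<^sub>R mat 1) D x) *v wave_force c \<rho> l \<xi> g n x v)"
proof -
  have "(n *\<^sub>R wave_grad c \<rho> l \<xi> n x \<bullet> v) *\<^sub>R v - (v \<bullet> v / 2) *\<^sub>R n *\<^sub>R wave_grad c \<rho> l \<xi> n x - wave c \<rho> l \<xi> n x *\<^sub>R Gam g x v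
    = n *\<^sub>R wave_force c \<rho> l \<xi> g n x v"
    using \<open>n > 0\<close> unfolding wave_force_def by (simp add: scaleR_diff_right mult_ac)
  then show ?thesis
    unfolding Gam_perturbed[OF assms(1-4) wave_dir_deriv(1)[OF assms(5)] assms(7)]
      wave_grad[OF assms(5) less_imp_neq[OF assms(6), symmetric]]
    by (simp only: matrix_vector_mult_scaleR scaleR_scaleR)
qed

text \<open>\<open>B\<close> lies within a factor 2 of the infimum of the possible bounds, so that
  attainment of the infimum is not an issue. If the infimum is below \<open>\<eta>\<close>, then
  \<open>\<eta>\<close> itself is taken; this floor keeps the ratio of \<open>\<eta>\<close> to
  \<open>B\<close> at most 1 later on.\<close>

lemma near_best_approximation:
  fixes K :: "(real ^ 'n::finite) set" and a :: "real ^ 'n \<Rightarrow> ('n \<Rightarrow> nat) \<Rightarrow> real"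
  assumes \<eta>: "\<eta> > 0" and P: "P b0" "\<And>x \<alpha>. x \<in> K \<Longrightarrow> \<alpha> \<in> mons m \<Longrightarrow> \<bar>a x \<alpha> - b0 x \<alpha>\<bar> \<le> N"
  shows "\<exists>B b. B \<ge> \<eta> \<and> P b \<and> (\<forall>x\<in>K. \<forall>\<alpha>\<in>mons m. \<bar>a x \<alpha> - b x \<alpha>\<bar> \<le> B) \<and>
    (B = \<eta> \<or> (\<forall>b'. P b' \<longrightarrow> \<not> (\<forall>x\<in>K. \<forall>\<alpha>\<in>mons m. \<bar>a x \<alpha> - b' x \<alpha>\<bar> \<le> B / 2)))"
proof -
  define S where "S = {B. B \<ge> 0 \<and> (\<exists>b. P b \<and> (\<forall>x\<in>K. \<forall>\<alpha>\<in>mons m. \<bar>a x \<alpha> - b x \<alpha>\<bar> \<le> B))}"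
  have "\<bar>N\<bar> \<in> S"
    unfolding S_def using P(1) by (auto intro!: exI[of _ b0] order_trans[OF P(2) abs_ge_self])
  then have ne: "S \<noteq> {}" by blast
  have bdd: "bdd_below S" unfolding S_def by (rule bdd_belowI[of _ 0]) auto
  show ?thesis
  proof (cases "Inf S < \<eta>")
    case True
    then obtain B where "B \<in> S" "B < \<eta>" using cInf_lessD[OF ne] by blast
    then show ?thesis unfolding S_def by (intro exI[of _ \<eta>]) fastforce
  next
    case False
    then have "Inf S < 2 * Inf S" using \<eta> by simp
    then obtain B where B: "B \<in> S" "B < 2 * Inf S" using cInf_lessD[OF ne] by blast
    then have Bge: "B \<ge> Inf S" using bdd cInf_lower by blast
    have "B / 2 \<notin> S" using B(2) bdd cInf_lower[of "B / 2" S] by auto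
    then have "\<forall>b'. P b' \<longrightarrow> \<not> (\<forall>x\<in>K. \<forall>\<alpha>\<in>mons m. \<bar>a x \<alpha> - b' x \<alpha>\<bar> \<le> B / 2)"
      unfolding S_def using Bge False \<eta> by auto
    moreover obtain b where "P b" "\<forall>x\<in>K. \<forall>\<alpha>\<in>mons m. \<bar>a x \<alpha> - b x \<alpha>\<bar> \<le> B" using B(1) unfolding S_def by auto
    ultimately show ?thesis using Bge False by (intro exI[of _ B] exI[of _ b]) auto
  qed
qed

lemma wave_force_bound:
  fixes c :: "real ^ 'n::finite"
  assumes l: "l > 1" and G: "continuous_on (cball c \<rho> \<times> cball 0 V) (\<lambda>p. Gam g (fst p) (snd p))"
  shows "\<exists>C\<ge>0. \<forall>n\<ge>1. \<forall>x\<in>cball c \<rho>. \<forall>v. norm v \<le> V \<longrightarrow> norm (wave_force c \<rho> l \<xi> g n x v) \<le> C"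
proof -
  have cb: "continuous_on (cball c \<rho>) (bump c \<rho> l)"
    unfolding bump_def[abs_def] by (intro continuous_intros)
  have "Ck_on (Suc 0) UNIV (bump c \<rho> l)" using l by (intro Ck_on_bump) auto
  then have cd: "continuous_on (cball c \<rho>) (\<lambda>x. \<chi> i. dir_deriv (bump c \<rho> l) (axis i 1) x)"
    unfolding Ck_on_Suc Ck_on_def[of 0] by (intro continuous_intros) (auto dest: spec[of _ "[]"] intro: continuous_on_subset)
  obtain C1 where C1: "C1 > 0" "\<And>x. x \<in> cball c \<rho> \<Longrightarrow> norm (bump c \<rho> l x) \<le> C1"
    using compact_imp_bounded[OF compact_continuous_image[OF cb compact_cball]] unfolding bounded_pos by auto
  obtain C2 where C2: "C2 > 0" "\<And>x. x \<in> cball c \<rho> \<Longrightarrow> norm (\<chi> i. dir_deriv (bump c \<rho> l) (axis i 1) x) \<le> C2"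
    using compact_imp_bounded[OF compact_continuous_image[OF cd compact_cball]] unfolding bounded_pos by auto
  obtain C3 where C3: "C3 > 0" "\<And>p. p \<in> cball c \<rho> \<times> cball 0 V \<Longrightarrow> norm (Gam g (fst p) (snd p)) \<le> C3"
    using compact_imp_bounded[OF compact_continuous_image[OF G compact_Times[OF compact_cball compact_cball]]]
    unfolding bounded_pos by auto
  define C where "C = 2 * ((C2 + C1 * norm \<xi>) * \<bar>V\<bar> * \<bar>V\<bar>) + C1 * C3"
  have "norm (wave_force c \<rho> l \<xi> g n x v) \<le> C" if n: "n \<ge> 1" and x: "x \<in> cball c \<rho>" and v: "norm v \<le> V" for n x v
  proof -
    have V: "norm v \<le> \<bar>V\<bar>" using v by simp
    have wg: "norm (wave_grad c \<rho> l \<xi> n x) \<le> C2 + C1 * norm \<xi>"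
    proof -
      have "norm (wave_grad c \<rho> l \<xi> n x) \<le> \<bar>cos (x \<bullet> (n *\<^sub>R \<xi>)) / n\<bar> * norm (\<chi> i. dir_deriv (bump c \<rho> l) (axis i 1) x)
        + \<bar>bump c \<rho> l x * sin (x \<bullet> (n *\<^sub>R \<xi>))\<bar> * norm \<xi>"
        unfolding wave_grad_def by (rule order_trans[OF norm_triangle_ineq4]) simp
      also have "\<dots> \<le> 1 * C2 + (C1 * 1) * norm \<xi>"
      proof (intro add_mono mult_mono)
        have "\<bar>cos (x \<bullet> (n *\<^sub>R \<xi>))\<bar> \<le> n" using n abs_cos_le_one[of "x \<bullet> (n *\<^sub>R \<xi>)"] by linarith
        then show "\<bar>cos (x \<bullet> (n *\<^sub>R \<xi>)) / n\<bar> \<le> 1" using n by (simp add: field_simps)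
        show "\<bar>bump c \<rho> l x * sin (x \<bullet> (n *\<^sub>R \<xi>))\<bar> \<le> C1 * 1"
          unfolding abs_mult using C1(2)[OF x] C1(1) by (intro mult_mono abs_sin_le_one) auto
      qed (use C1 C2 x in auto)
      finally show ?thesis by simp
    qed
    let ?W = "C2 + C1 * norm \<xi>"
    have W: "?W \<ge> 0" using C1 C2 by simp
    have 1: "norm ((wave_grad c \<rho> l \<xi> n x \<bullet> v) *\<^sub>R v) \<le> ?W * \<bar>V\<bar> * \<bar>V\<bar>"
      unfolding norm_scaleR
      by (intro mult_mono order_trans[OF Cauchy_Schwarz_ineq2] wg V) (use W in auto)
    have 2: "norm (((v \<bullet> v) / 2) *\<^sub>R wave_grad c \<rho> l \<xi> n x) \<le> ?W * \<bar>V\<bar> * \<bar>V\<bar>"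
    proof -
      have "\<bar>(v \<bullet> v) / 2\<bar> \<le> norm v * norm v" using Cauchy_Schwarz_ineq2[of v v] inner_ge_zero[of v] by linarith
      also have "\<dots> \<le> \<bar>V\<bar> * \<bar>V\<bar>" by (intro mult_mono V) auto
      finally have "\<bar>(v \<bullet> v) / 2\<bar> * norm (wave_grad c \<rho> l \<xi> n x) \<le> (\<bar>V\<bar> * \<bar>V\<bar>) * ?W"
        by (intro mult_mono wg) auto
      then show ?thesis by (simp add: mult_ac)
    qed
    have 3: "norm ((wave c \<rho> l \<xi> n x / n) *\<^sub>R Gam g x v) \<le> C1 * C3"
      unfolding norm_scaleR
    proof (intro mult_mono)
      have "\<bar>wave c \<rho> l \<xi> n x\<bar> \<le> C1 * 1"
        unfolding wave_def abs_mult using C1(2)[OF x] C1(1) by (intro mult_mono abs_cos_le_one) auto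
      also have "\<dots> \<le> C1 * n" using C1 n by (intro mult_left_mono) auto
      finally show "\<bar>wave c \<rho> l \<xi> n x / n\<bar> \<le> C1" using n by (simp add: field_simps)
      show "norm (Gam g x v) \<le> C3" using C3(2)[of "(x, v)"] x v by (auto simp: dist_norm)
    qed (use C1 in auto)
    have "norm (wave_force c \<rho> l \<xi> g n x v) \<le> norm ((wave_grad c \<rho> l \<xi> n x \<bullet> v) *\<^sub>R v) + norm (((v \<bullet> v) / 2) *\<^sub>R wave_grad c \<rho> l \<xi> n x)
       + norm ((wave c \<rho> l \<xi> n x / n) *\<^sub>R Gam g x v)"
      unfolding wave_force_def by (meson add_mono norm_triangle_ineq4 order_refl order_trans)
    then show ?thesis using 1 2 3 unfolding C_def by linarith
  qed
  moreover have "C \<ge> 0" unfolding C_def using C1 C2 C3 by (simp add: add_nonneg_nonneg)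
  ultimately show ?thesis by blast
qed

text \<open>Along a line orthogonal to the wave vector the phase is constant, so the oscillating force
  does not average out.\<close>

lemma wave_force_limit:
  fixes c :: "real ^ 'n::finite"
  assumes l: "l > 1" and n: "filterlim n at_top F" and y: "(y \<longlongrightarrow> y0) F"
    and G: "((\<lambda>j. Gam g (y j) v) \<longlongrightarrow> G0) F"
    and s: "\<And>j. sin (y j \<bullet> (n j *\<^sub>R \<xi>)) = \<sigma>" and perp: "v \<bullet> \<xi> = 0"
  shows "((\<lambda>j. wave_force c \<rho> l \<xi> g (n j) (y j) v) \<longlongrightarrow> (\<sigma> * ((v \<bullet> v) / 2) * bump c \<rho> l y0) *\<^sub>R \<xi>) F"
proof -
  have inv: "((\<lambda>j. inverse (n j)) \<longlongrightarrow> 0) F"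
    by (rule filterlim_compose[OF tendsto_inverse_0 filterlim_mono[OF n at_top_le_at_infinity order_refl]])
  have small: "((\<lambda>j. cos (t j) / n j) \<longlongrightarrow> 0) F" for t
  proof (rule Lim_null_comparison[OF _ tendsto_norm_zero[OF inv]])
    show "\<forall>\<^sub>F j in F. norm (cos (t j) / n j) \<le> norm (inverse (n j))"
      by (intro always_eventually allI) (simp add: divide_inverse abs_mult mult_left_le_one_le)
  qed
  have "Ck_on (Suc 0) UNIV (bump c \<rho> l)" using l by (intro Ck_on_bump) auto
  then have cb: "isCont (bump c \<rho> l) y0" and cd: "isCont (dir_deriv (bump c \<rho> l) (axis i 1)) y0" for i
    unfolding Ck_on_Suc Ck_on_def[of 0] by (auto dest: spec[of _ "[]"] simp: continuous_on_eq_continuous_at)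
  have b: "((\<lambda>j. bump c \<rho> l (y j)) \<longlongrightarrow> bump c \<rho> l y0) F" by (rule isCont_tendsto_compose[OF cb y])
  have d: "((\<lambda>j. \<chi> i. dir_deriv (bump c \<rho> l) (axis i 1) (y j)) \<longlongrightarrow> (\<chi> i. dir_deriv (bump c \<rho> l) (axis i 1) y0)) F"
    by (intro tendsto_vec_lambda isCont_tendsto_compose[OF cd y])
  have wg: "((\<lambda>j. wave_grad c \<rho> l \<xi> (n j) (y j)) \<longlongrightarrow> 0 *\<^sub>R (\<chi> i. dir_deriv (bump c \<rho> l) (axis i 1) y0) - (bump c \<rho> l y0 * \<sigma>) *\<^sub>R \<xi>) F"
    unfolding wave_grad_def s by (intro tendsto_intros small b d)
  have w: "((\<lambda>j. wave c \<rho> l \<xi> (n j) (y j) / n j) \<longlongrightarrow> bump c \<rho> l y0 * 0) F"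
    unfolding wave_def times_divide_eq_right[symmetric] by (intro tendsto_intros b small)
  have "((\<lambda>j. wave_force c \<rho> l \<xi> g (n j) (y j) v) \<longlongrightarrow>
      ((0 *\<^sub>R (\<chi> i. dir_deriv (bump c \<rho> l) (axis i 1) y0) - (bump c \<rho> l y0 * \<sigma>) *\<^sub>R \<xi>) \<bullet> v) *\<^sub>R v
      - ((v \<bullet> v) / 2) *\<^sub>R (0 *\<^sub>R (\<chi> i. dir_deriv (bump c \<rho> l) (axis i 1) y0) - (bump c \<rho> l y0 * \<sigma>) *\<^sub>R \<xi>)
      - (bump c \<rho> l y0 * 0) *\<^sub>R G0) F"
    unfolding wave_force_def by (intro tendsto_intros wg w G)
  \<comment> \<open>Orthogonality removes the component along \<open>v\<close>; the term with
    \<open>Gam\<close> has already lost its factor.\<close>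
  then show ?thesis using perp by (simp add: inner_commute mult_ac)
qed

text \<open>A shift of \<open>c\<close> along \<open>\<xi>\<close> suffices. The phase has to be
  corrected by at most \<open>\<bar>\<theta>\<bar> + 2 * pi\<close> and changes at the rate
  \<open>n j * (\<xi> \<bullet> \<xi>)\<close>, so the shift is of order
  \<open>1 / n j\<close>.\<close>

lemma phase_points:
  fixes c \<xi> :: "'a::real_inner" and n :: "nat \<Rightarrow> real"
  assumes \<xi>: "\<xi> \<noteq> 0" and n: "filterlim n at_top sequentially" and npos: "\<And>j. n j > 0"
  shows "\<exists>x. x \<longlonglongrightarrow> c \<and> (\<forall>j. sin (x j \<bullet> (n j *\<^sub>R \<xi>)) = sin \<theta>)"
proof -
  define \<phi> where "\<phi> j = n j * (c \<bullet> \<xi>)" for j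
  define \<tau> where "\<tau> j = (\<theta> + of_int \<lfloor>\<phi> j / (2 * pi)\<rfloor> * (2 * pi) - \<phi> j) / (n j * (\<xi> \<bullet> \<xi>))" for j
  define x where "x j = c + \<tau> j *\<^sub>R \<xi>" for j
  have "x j \<bullet> (n j *\<^sub>R \<xi>) = \<theta> + of_int \<lfloor>\<phi> j / (2 * pi)\<rfloor> * (2 * pi)" for j
  proof -
    have "x j \<bullet> (n j *\<^sub>R \<xi>) = \<phi> j + \<tau> j * (n j * (\<xi> \<bullet> \<xi>))"
      unfolding x_def \<phi>_def by (simp add: inner_left_distrib algebra_simps)
    then show ?thesis unfolding \<tau>_def using npos[of j] \<xi> by simp
  qed
  then have s: "sin (x j \<bullet> (n j *\<^sub>R \<xi>)) = sin \<theta>" for j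
    by (simp only: sin_add mult.commute[of _ "2 * pi"] sin_int_2pin cos_int_2pin
        mult_zero_right mult_1_right add_0_right)
  have "\<tau> \<longlonglongrightarrow> 0"
  proof (rule Lim_null_comparison)
    show "\<forall>\<^sub>F j in sequentially. norm (\<tau> j) \<le> ((\<bar>\<theta>\<bar> + 2 * pi) / (\<xi> \<bullet> \<xi>)) * inverse (n j)"
    proof (intro always_eventually allI)
      fix j
      have "of_int \<lfloor>\<phi> j / (2 * pi)\<rfloor> \<le> \<phi> j / (2 * pi)" "\<phi> j / (2 * pi) \<le> of_int \<lfloor>\<phi> j / (2 * pi)\<rfloor> + 1" by linarith+
      then have "of_int \<lfloor>\<phi> j / (2 * pi)\<rfloor> * (2 * pi) \<le> \<phi> j" "\<phi> j \<le> (of_int \<lfloor>\<phi> j / (2 * pi)\<rfloor> + 1) * (2 * pi)"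
        using pos_le_divide_eq[of "2 * pi"] pos_divide_le_eq[of "2 * pi"] pi_gt_zero by (metis mult_2 add_pos_pos)+
      then have "\<bar>\<theta> + of_int \<lfloor>\<phi> j / (2 * pi)\<rfloor> * (2 * pi) - \<phi> j\<bar> \<le> \<bar>\<theta>\<bar> + 2 * pi"
        unfolding distrib_right by linarith
      then have "norm (\<tau> j) \<le> (\<bar>\<theta>\<bar> + 2 * pi) / (n j * (\<xi> \<bullet> \<xi>))"
        unfolding \<tau>_def using npos[of j] \<xi> by (simp add: abs_mult divide_right_mono)
      then show "norm (\<tau> j) \<le> ((\<bar>\<theta>\<bar> + 2 * pi) / (\<xi> \<bullet> \<xi>)) * inverse (n j)"
        by (simp add: divide_inverse mult_ac)
    qed
    have "(\<lambda>j. inverse (n j)) \<longlonglongrightarrow> 0"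
      by (rule filterlim_compose[OF tendsto_inverse_0 filterlim_mono[OF n at_top_le_at_infinity order_refl]])
    from tendsto_mult_right_zero[OF this] show "(\<lambda>j. ((\<bar>\<theta>\<bar> + 2 * pi) / (\<xi> \<bullet> \<xi>)) * inverse (n j)) \<longlonglongrightarrow> 0" .
  qed
  then have "(\<lambda>j. c + \<tau> j *\<^sub>R \<xi>) \<longlonglongrightarrow> c + 0 *\<^sub>R \<xi>" by (intro tendsto_intros)
  then show ?thesis using s unfolding x_def by auto
qed

lemma perp_orthogonal: "v \<bullet> perp v w = 0"
  unfolding perp_def by (simp add: inner_diff_right inner_commute)

lemma weak_integral_zero: "weak_integral K m g (\<lambda>_ _. 0)"
proof -
  have "hp m (\<lambda>_. 0) v = 0" "dhp m (\<lambda>_. 0) v u = 0" for v u :: "real ^ 'a"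
    by (simp_all add: hp_def dhp_def)
  then show ?thesis unfolding weak_integral_def line_eq_def by simp
qed

lemma weak_integral_lincomb:
  assumes "weak_integral K m g a" "weak_integral K m g b"
  shows "weak_integral K m g (\<lambda>x \<alpha>. s * a x \<alpha> + t * b x \<alpha>)"
  using line_eq_lincomb[OF assms[unfolded weak_integral_def], of s t]
  unfolding weak_integral_def dhp_lincomb .

lemma bad_metrics_no_interior:
  fixes D :: "(real ^ 'n::finite) set"
  assumes D: "open D" and k: "k \<ge> 1" and \<rho>: "\<rho> > 0" and KD: "cball c \<rho> \<subseteq> D" and N: "N > 0"
    and g: "g \<in> Ck_metrics k D" and \<epsilon>: "\<epsilon> > 0"
  shows "\<not> Ck_nbhd k D g \<epsilon> \<subseteq> bad_metrics k D m N c \<rho> v w"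
proof
  assume sub: "Ck_nbhd k D g \<epsilon> \<subseteq> bad_metrics k D m N c \<rho> v w"
  let ?K = "cball c \<rho>" and ?l = "k + 1" and ?V = "2 * \<rho> + 1"
  define \<xi> where "\<xi> = perp v w"
  define n where "n j = real (Suc j)" for j :: nat
  have n1: "n j \<ge> 1" and n0: "n j > 0" for j unfolding n_def by auto
  have l: "?l > 1" using k by simp
  have cK: "c \<in> ?K" using \<rho> by simp
  have inv: "invertible (g x)" if "x \<in> ?K" for x using Ck_metrics_invertible[OF g] KD that by blast
  define h where "h j = wave c \<rho> ?l \<xi> (n j)" for j
  \<comment> \<open>The frequency is fixed first and the amplitude afterwards, because the
    derivatives of the wave grow with the frequency.\<close>
  have "\<exists>a0>0. \<forall>a. 0 \<le> a \<longrightarrow> a \<le> a0 \<longrightarrow> restrict (\<lambda>x. g x + (a * h j x) *\<^sub>R mat 1) D \<in> Ck_nbhd k D g (min \<epsilon> (inverse (real (Suc j))))" for j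
  proof (rule scaled_identity_perturbation[OF D g k _ _ KD])
    show "Ck_on k UNIV (h j)" unfolding h_def by (rule wave_Ck) simp
    show "h j x = 0" if "x \<notin> ?K" for x unfolding h_def wave_def using bump_eq_0[of \<rho> ?l x c] \<rho> that by simp
  qed (use \<epsilon> in auto)
  then have "\<forall>j. \<exists>a0. a0 > 0 \<and> (\<forall>a. 0 \<le> a \<longrightarrow> a \<le> a0 \<longrightarrow> restrict (\<lambda>x. g x + (a * h j x) *\<^sub>R mat 1) D \<in> Ck_nbhd k D g (min \<epsilon> (inverse (real (Suc j)))))"
    by (rule allI)
  from choice[OF this] obtain am where am':
    "\<forall>j. am j > 0 \<and> (\<forall>a. 0 \<le> a \<longrightarrow> a \<le> am j \<longrightarrow> restrict (\<lambda>x. g x + (a * h j x) *\<^sub>R mat 1) D \<in> Ck_nbhd k D g (min \<epsilon> (inverse (real (Suc j)))))"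
    by (rule exE)
  have am: "am j > 0" for j using am' by simp
  define gs where "gs j = restrict (\<lambda>x. g x + (am j * h j x) *\<^sub>R mat 1) D" for j
  have gsn: "gs j \<in> Ck_nbhd k D g (min \<epsilon> (inverse (real (Suc j))))" for j
    unfolding gs_def by (rule am'[rule_format, THEN conjunct2, rule_format]) (use am[of j] in auto)
  have gsM: "gs j \<in> Ck_metrics k D" for j using gsn Ck_nbhd_subset by blast
  have conv: "C1_conv ?K gs g"
  proof (rule Ck_nbhd_C1_conv[OF g k D KD _ LIMSEQ_inverse_real_of_nat])
    show "gs j \<in> Ck_nbhd k D g (inverse (real (Suc j)))" for j
      using gsn[of j] Ck_nbhd_mono[of "min \<epsilon> (inverse (real (Suc j)))" "inverse (real (Suc j))" k D g] by auto
  qed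
  have "gs j \<in> bad_metrics k D m N c \<rho> v w" for j
    using sub gsn[of j] Ck_nbhd_mono[of "min \<epsilon> (inverse (real (Suc j)))" \<epsilon> k D g] by auto
  then have "\<exists>a. (\<forall>x\<in>?K. \<forall>\<alpha>\<in>mons m. \<bar>a x \<alpha>\<bar> \<le> N) \<and> weak_integral ?K m (gs j) a \<and>
     1 / N \<le> \<bar>dhp m (a c) v (matrix_inv (gs j c) *v \<xi>)\<bar>" for j
    unfolding bad_metrics_def \<xi>_def by blast
  then obtain p where pB: "\<And>j. \<forall>x\<in>?K. \<forall>\<alpha>\<in>mons m. \<bar>p j x \<alpha>\<bar> \<le> N"
    and pW: "\<And>j. weak_integral ?K m (gs j) (p j)"
    and pL: "\<And>j. 1 / N \<le> \<bar>dhp m (p j c) v (matrix_inv (gs j c) *v \<xi>)\<bar>" by metis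
  \<comment> \<open>By \<open>Gam_wave_perturbed\<close> this is the factor by which the equation of
    \<open>gs j\<close> deviates from that of \<open>g\<close>.\<close>
  define \<eta> where "\<eta> j = am j * n j" for j
  have \<eta>: "\<eta> j > 0" for j unfolding \<eta>_def using am n0 by simp
  have "\<exists>B b. B \<ge> \<eta> j \<and> weak_integral ?K m g b \<and> (\<forall>x\<in>?K. \<forall>\<alpha>\<in>mons m. \<bar>p j x \<alpha> - b x \<alpha>\<bar> \<le> B) \<and>
    (B = \<eta> j \<or> (\<forall>b'. weak_integral ?K m g b' \<longrightarrow> \<not> (\<forall>x\<in>?K. \<forall>\<alpha>\<in>mons m. \<bar>p j x \<alpha> - b' x \<alpha>\<bar> \<le> B / 2)))" for j
    by (rule near_best_approximation[where P = "weak_integral ?K m g" and ?b0.0 = "\<lambda>_ _. 0" and N = N])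
      (use \<eta> weak_integral_zero pB in auto)
  then obtain B b where Bge: "\<And>j. B j \<ge> \<eta> j" and bW: "\<And>j. weak_integral ?K m g (b j)"
    and bB: "\<And>j. \<forall>x\<in>?K. \<forall>\<alpha>\<in>mons m. \<bar>p j x \<alpha> - b j x \<alpha>\<bar> \<le> B j"
    and best: "\<And>j. B j = \<eta> j \<or> (\<forall>b'. weak_integral ?K m g b' \<longrightarrow> \<not> (\<forall>x\<in>?K. \<forall>\<alpha>\<in>mons m. \<bar>p j x \<alpha> - b' x \<alpha>\<bar> \<le> B j / 2))"
    by metis
  have B0: "B j > 0" for j using \<eta>[of j] Bge[of j] by linarith
  \<comment> \<open>The weight of the oscillating force in the equation for the normalised
    difference \<open>Q j\<close>; it is at most 1 because \<open>\<eta> j\<close> is a lower bound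
    for \<open>B j\<close>.\<close>
  define \<kappa> where "\<kappa> j = \<eta> j / B j" for j
  have \<kappa>: "\<kappa> j \<in> {0..1}" for j unfolding \<kappa>_def using \<eta>[of j] Bge[of j] B0[of j] by (simp add: less_imp_le)
  define Q where "Q j x \<alpha> = (1 / B j) * p j x \<alpha> + (- 1 / B j) * b j x \<alpha>" for j x \<alpha>
  define U where "U j x u = dhp m (p j x) u (matrix_inv (gs j x) *v wave_force c \<rho> ?l \<xi> g (n j) x u)" for j x u
  have Qline: "line_eq ?K m (Q j) (\<lambda>x u. dhp m (Q j x) u (Gam g x u) + \<kappa> j * U j x u)" for j
    unfolding Q_def
  proof (rule line_eq_cong[OF line_eq_lincomb[OF pW[unfolded weak_integral_def] bW[unfolded weak_integral_def]]])
    fix x u assume x: "x \<in> ?K"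
    then have xD: "x \<in> D" using KD by blast
    have "Gam (gs j) x u - Gam g x u = \<eta> j *\<^sub>R (matrix_inv (gs j x) *v wave_force c \<rho> ?l \<xi> g (n j) x u)"
      using Gam_wave_perturbed[OF D xD g k l n0, of "am j" c \<rho> \<xi> j u] Ck_metrics_invertible[OF gsM xD, of j]
      unfolding gs_def h_def \<eta>_def by simp
    then have "Gam (gs j) x u = Gam g x u + \<eta> j *\<^sub>R (matrix_inv (gs j x) *v wave_force c \<rho> ?l \<xi> g (n j) x u)"
      by (simp add: algebra_simps)
    then show "1 / B j * dhp m (p j x) u (Gam (gs j) x u) + - 1 / B j * dhp m (b j x) u (Gam g x u) =
       dhp m (\<lambda>\<alpha>. 1 / B j * p j x \<alpha> + - 1 / B j * b j x \<alpha>) u (Gam g x u) + \<kappa> j * U j x u"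
      unfolding dhp_lincomb U_def \<kappa>_def by (simp add: dhp_add dhp_scaleR algebra_simps add_divide_distrib)
  qed
  have QB: "\<bar>Q j x \<alpha>\<bar> \<le> 1" if "x \<in> ?K" "\<alpha> \<in> mons m" for j x \<alpha>
  proof -
    have "Q j x \<alpha> = (p j x \<alpha> - b j x \<alpha>) / B j" unfolding Q_def by (simp add: diff_divide_distrib)
    moreover have "\<bar>p j x \<alpha> - b j x \<alpha>\<bar> \<le> B j" by (rule bB[rule_format, OF that])
    ultimately show ?thesis using B0[of j] by (simp only: abs_divide abs_of_pos) (simp only: divide_le_eq_1_pos)
  qed
  have UB: "\<exists>C M. \<forall>j\<ge>M. \<forall>x\<in>?K. \<forall>u. norm u \<le> V \<longrightarrow> \<bar>U j x u\<bar> \<le> C" for V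
  proof -
    obtain C1 M where C1: "C1 \<ge> 0" "\<And>j x. j \<ge> M \<Longrightarrow> x \<in> ?K \<Longrightarrow> norm (matrix_inv (gs j x)) \<le> C1"
      using cconv_bounded[OF compact_cball C1_conv_Gam(3)[OF conv inv]] by blast
    obtain C2 where C2: "C2 \<ge> 0" "\<And>j x u. x \<in> ?K \<Longrightarrow> norm u \<le> V \<Longrightarrow> norm (wave_force c \<rho> ?l \<xi> g (n j) x u) \<le> C2"
      using wave_force_bound[OF l cconv_continuous[OF C1_conv_Gam(1)[OF conv inv, of "cball 0 V"]], of \<xi>] n1 by blast
    define L where "L = real (card (mons m :: ('n \<Rightarrow> nat) set)) * real m * V ^ (m - 1) * N"
    have "\<bar>U j x u\<bar> \<le> L * ((real CARD('n))\<^sup>2 * C1 * C2)" if j: "j \<ge> M" and x: "x \<in> ?K" and u: "norm u \<le> V" for j x u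
    proof -
      let ?y = "matrix_inv (gs j x) *v wave_force c \<rho> ?l \<xi> g (n j) x u"
      have V0: "V \<ge> 0" using u norm_ge_zero[of u] by linarith
      have "norm ?y \<le> (real CARD('n))\<^sup>2 * norm (matrix_inv (gs j x)) * norm (wave_force c \<rho> ?l \<xi> g (n j) x u)"
        by (rule norm_matrix_vector_le)
      also have "\<dots> \<le> (real CARD('n))\<^sup>2 * C1 * C2"
        by (intro mult_mono C1(2)[OF j x] C2(2)[OF x u] order_refl) (use C1(1) in auto)
      finally have y: "norm ?y \<le> (real CARD('n))\<^sup>2 * C1 * C2" .
      have "\<bar>U j x u\<bar> \<le> L * norm ?y"
        unfolding U_def L_def by (rule dhp_bound) (use pB x u in auto)
      also have "\<dots> \<le> L * ((real CARD('n))\<^sup>2 * C1 * C2)"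
        using y N V0 unfolding L_def by (intro mult_left_mono) auto
      finally show ?thesis .
    qed
    then show ?thesis by blast
  qed
  have \<kappa>U: "\<bar>\<kappa> j * U j x u\<bar> \<le> C" if "\<bar>U j x u\<bar> \<le> C" for j x u C
  proof -
    have "\<bar>\<kappa> j * U j x u\<bar> \<le> 1 * \<bar>U j x u\<bar>" unfolding abs_mult using \<kappa>[of j] by (intro mult_right_mono) auto
    then show ?thesis using that by simp
  qed
  \<comment> \<open>The force acts through the derivative of \<open>p j\<close>, so its limit is
    needed as well as that of \<open>Q j\<close>. Three successive subsequences make
    \<open>p\<close>, \<open>Q\<close> and \<open>\<kappa>\<close> converge.\<close>
  obtain s1 p0 where s1: "strict_mono s1"
    and p0: "\<And>\<alpha>. \<alpha> \<in> mons m \<Longrightarrow> cconv ?K (\<lambda>j x. p (s1 j) x \<alpha>) (\<lambda>x. p0 x \<alpha>)"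
    using weak_integral_compactness[OF \<rho> conv inv, of m p N] pB pW by blast
  obtain C M where CM: "\<And>j x u. j \<ge> M \<Longrightarrow> x \<in> ?K \<Longrightarrow> norm u \<le> ?V \<Longrightarrow> \<bar>U j x u\<bar> \<le> C" using UB[of ?V] by blast
  have "\<exists>s q. strict_mono s \<and> (\<forall>\<alpha>\<in>mons m. cconv ?K (\<lambda>j x. Q (s1 (s j)) x \<alpha>) (\<lambda>x. q x \<alpha>))"
  proof (rule perturbed_line_eq_compactness[OF \<rho>, where a = "\<lambda>j. Q (s1 j)" and G = "\<lambda>_. Gam g" and ?G0.0 = "Gam g"
        and E = "\<lambda>j x u. \<kappa> (s1 j) * U (s1 j) x u" and B = 1 and B' = C and M = M])
    show "cconv (?K \<times> cball 0 ?V) (\<lambda>j p. Gam g (fst p) (snd p)) (\<lambda>p. Gam g (fst p) (snd p))"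
      by (rule cconv_const[OF cconv_continuous[OF C1_conv_Gam(1)[OF conv inv]]])
    show "\<bar>\<kappa> (s1 j) * U (s1 j) x u\<bar> \<le> C" if "M \<le> j" "x \<in> ?K" "norm u \<le> ?V" for j x u
      by (rule \<kappa>U[OF CM]) (use that seq_suble[OF s1, of j] in auto)
  qed (use QB Qline in auto)
  then obtain s2 q where s2: "strict_mono s2"
    and q0: "\<And>\<alpha>. \<alpha> \<in> mons m \<Longrightarrow> cconv ?K (\<lambda>j x. Q (s1 (s2 j)) x \<alpha>) (\<lambda>x. q x \<alpha>)" by blast
  obtain \<kappa>0 s3 where s3: "strict_mono (s3 :: nat \<Rightarrow> nat)" "\<kappa>0 \<in> {0..1}" "((\<lambda>j. \<kappa> (s1 (s2 j))) \<circ> s3) \<longlonglongrightarrow> \<kappa>0"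
    using compact_imp_seq_compact[OF compact_Icc, of 0 1, unfolded seq_compact_def, rule_format, of "\<lambda>j. \<kappa> (s1 (s2 j))"] \<kappa> by blast
  define s where "s j = s1 (s2 (s3 j))" for j
  have s: "strict_mono s" using s1 s2 s3(1) unfolding s_def strict_mono_def by simp
  have s\<kappa>: "(\<lambda>j. \<kappa> (s j)) \<longlonglongrightarrow> \<kappa>0" using s3(3) unfolding s_def o_def .
  have sp: "cconv ?K (\<lambda>j x. p (s j) x \<alpha>) (\<lambda>x. p0 x \<alpha>)" if "\<alpha> \<in> mons m" for \<alpha>
  proof -
    have "strict_mono (\<lambda>j. s2 (s3 j))" using s2 s3(1) unfolding strict_mono_def by simp
    from cconv_subseq[OF p0[OF that] this] show ?thesis unfolding s_def .
  qed
  have sq: "cconv ?K (\<lambda>j x. Q (s j) x \<alpha>) (\<lambda>x. q x \<alpha>)" if "\<alpha> \<in> mons m" for \<alpha>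
    using cconv_subseq[OF q0[OF that] s3(1)] unfolding s_def .
  have sinv: "cconv ?K (\<lambda>j x. matrix_inv (gs (s j) x)) (\<lambda>x. matrix_inv (g x))"
    by (rule cconv_subseq[OF C1_conv_Gam(3)[OF conv inv] s])
  have Gcont: "continuous_on ?K (\<lambda>x. Gam g x u)" for u
    by (rule cconv_continuous[OF C1_conv_Gam(2)[OF conv inv]])
  show False
  proof (cases "\<kappa>0 = 0")
    case True
    \<comment> \<open>The force disappears in the limit, so \<open>q\<close> is a weak integral of
      \<open>g\<close>, and adding \<open>B\<close> times \<open>q\<close> to the approximation
      \<open>b\<close> improves it beyond what near-optimality allows.\<close>
    have Wq: "weak_integral ?K m g q"
      unfolding weak_integral_def
    proof (rule perturbed_line_eq_limit[where a = "\<lambda>j. Q (s j)" and G = "\<lambda>_. Gam g" and E = "\<lambda>j x u. \<kappa> (s j) * U (s j) x u"])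
      show "cconv ?K (\<lambda>j x. \<kappa> (s j) * U (s j) x u) (\<lambda>_. 0)" for u
      proof (rule uniform_imp_cconv)
        fix e :: real assume e: "e > 0"
        obtain C' M' where C': "\<And>j x. j \<ge> M' \<Longrightarrow> x \<in> ?K \<Longrightarrow> \<bar>U j x u\<bar> \<le> C'" using UB[of "norm u"] by blast
        have "(\<lambda>j. \<kappa> (s j) * \<bar>C'\<bar>) \<longlonglongrightarrow> 0 * \<bar>C'\<bar>" using s\<kappa> True by (intro tendsto_intros) auto
        then have "eventually (\<lambda>j. \<kappa> (s j) * \<bar>C'\<bar> < e) sequentially" using e by (intro order_tendstoD(2)) auto
        then obtain J where J: "\<And>j. j \<ge> J \<Longrightarrow> \<kappa> (s j) * \<bar>C'\<bar> < e" unfolding eventually_sequentially by blast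
        have "dist (\<kappa> (s j) * U (s j) x u) 0 < e" if j: "j \<ge> max J M'" and x: "x \<in> ?K" for j x
        proof -
          have "s j \<ge> M'" using seq_suble[OF s, of j] j by linarith
          from C'[OF this x] have "\<bar>\<kappa> (s j) * U (s j) x u\<bar> \<le> \<kappa> (s j) * \<bar>C'\<bar>"
            unfolding abs_mult using \<kappa>[of "s j"] by (intro mult_mono) auto
          then show ?thesis using J[of j] j by simp
        qed
        then show "\<exists>J. \<forall>j\<ge>J. \<forall>x\<in>?K. dist (\<kappa> (s j) * U (s j) x u) 0 < e" by blast
      qed simp
      show "cconv ?K (\<lambda>j x. Gam g x u) (\<lambda>x. Gam g x u)" for u by (rule cconv_const[OF Gcont])
    qed (use Qline sq in auto)
    have "eventually (\<lambda>j. \<forall>\<alpha>\<in>mons m. \<forall>x\<in>?K. dist (Q (s j) x \<alpha>) (q x \<alpha>) < 1 / 2) sequentially"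
    proof (rule eventually_ball_finite)
      show "\<forall>\<alpha>\<in>mons m. \<forall>\<^sub>F j in sequentially. \<forall>x\<in>?K. dist (Q (s j) x \<alpha>) (q x \<alpha>) < 1 / 2"
        using cconv_uniform[OF compact_cball sq, of _ "1/2"] unfolding eventually_sequentially by auto
    qed simp
    moreover have "eventually (\<lambda>j. \<kappa> (s j) < 1) sequentially"
      using s\<kappa> True by (intro order_tendstoD(2)) auto
    ultimately have "eventually (\<lambda>j. (\<forall>\<alpha>\<in>mons m. \<forall>x\<in>?K. dist (Q (s j) x \<alpha>) (q x \<alpha>) < 1 / 2) \<and> \<kappa> (s j) < 1) sequentially"
      by (rule eventually_conj)
    from eventually_happens'[OF sequentially_bot this] obtain j where j: "\<forall>\<alpha>\<in>mons m. \<forall>x\<in>?K. dist (Q (s j) x \<alpha>) (q x \<alpha>) < 1 / 2" "\<kappa> (s j) < 1"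
      by (elim exE conjE)
    let ?i = "s j"
    \<comment> \<open>Since \<open>\<kappa>\<close> is below 1, the floor \<open>\<eta>\<close> was
      not active, and the other alternative of \<open>near_best_approximation\<close>
      applies.\<close>
    have "B ?i \<noteq> \<eta> ?i" using j(2) B0[of ?i] unfolding \<kappa>_def by auto
    then have no: "\<not> (\<forall>x\<in>?K. \<forall>\<alpha>\<in>mons m. \<bar>p ?i x \<alpha> - (1 * b ?i x \<alpha> + B ?i * q x \<alpha>)\<bar> \<le> B ?i / 2)"
      using best[of ?i] weak_integral_lincomb[OF bW[of ?i] Wq, of 1 "B ?i"] by blast
    have "\<bar>p ?i x \<alpha> - (1 * b ?i x \<alpha> + B ?i * q x \<alpha>)\<bar> \<le> B ?i / 2" if "x \<in> ?K" "\<alpha> \<in> mons m" for x \<alpha>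
    proof -
      have "p ?i x \<alpha> - (1 * b ?i x \<alpha> + B ?i * q x \<alpha>) = B ?i * (Q ?i x \<alpha> - q x \<alpha>)"
        unfolding Q_def using B0[of ?i] by (simp add: field_simps)
      also have "\<bar>\<dots>\<bar> = B ?i * \<bar>Q ?i x \<alpha> - q x \<alpha>\<bar>" using B0[of ?i] by (simp add: abs_mult)
      also have "\<dots> \<le> B ?i * (1 / 2)"
        using j(1) that B0[of ?i] by (intro mult_left_mono) (auto simp: dist_real_def intro: less_imp_le)
      finally show ?thesis by simp
    qed
    with no show False by blast
  next
    case False
    \<comment> \<open>Up to a factor depending on \<open>v\<close> only, the limiting effect of the
      force at \<open>y\<close> where the sine equals 1. It is nonzero at \<open>c\<close> by the
      lower bound in \<open>bad_metrics\<close>, hence also near \<open>c\<close>.\<close>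
    define \<Psi> where "\<Psi> y = dhp m (p0 y) v (matrix_inv (g y) *v \<xi>) * bump c \<rho> ?l y" for y
    have lim0: "(\<lambda>j. \<bar>dhp m (p (s j) c) v (matrix_inv (gs (s j) c) *v \<xi>)\<bar>) \<longlonglongrightarrow> \<bar>dhp m (p0 c) v (matrix_inv (g c) *v \<xi>)\<bar>"
      by (intro tendsto_intros cconv_pointwise[OF sp cK] cconv_pointwise[OF sinv cK])
    have low: "1 / N \<le> \<bar>dhp m (p0 c) v (matrix_inv (g c) *v \<xi>)\<bar>"
      by (rule tendsto_lowerbound[OF lim0]) (use pL in auto)
    then have nz: "dhp m (p0 c) v (matrix_inv (g c) *v \<xi>) \<noteq> 0" using N by auto
    then have \<xi>0: "\<xi> \<noteq> 0" by (metis dhp_zero mult_zero_right matrix_vector_mult_0_right)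
    then have v0: "v \<noteq> 0" unfolding \<xi>_def perp_def by auto
    have "bump c \<rho> ?l c \<noteq> 0" unfolding bump_def using \<rho> by (simp add: max_def not_le)
    then have \<Psi>c: "\<Psi> c \<noteq> 0" unfolding \<Psi>_def using nz by simp
    have "continuous_on ?K \<Psi>"
      unfolding \<Psi>_def continuous_on_def
    proof (intro ballI tendsto_mult tendsto_dhp tendsto_matrix_vector_mult tendsto_const)
      fix y assume y: "y \<in> ?K"
      show "((\<lambda>y. p0 y \<alpha>) \<longlongrightarrow> p0 y \<alpha>) (at y within ?K)" if "\<alpha> \<in> mons m" for \<alpha>
        using cconv_continuous[OF sp[OF that]] y unfolding continuous_on_def by blast
      show "((\<lambda>x. matrix_inv (g x)) \<longlongrightarrow> matrix_inv (g y)) (at y within ?K)"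
        using cconv_continuous[OF sinv] y unfolding continuous_on_def by blast
      have "continuous_on ?K (bump c \<rho> ?l)" unfolding bump_def[abs_def] by (intro continuous_intros)
      then show "(bump c \<rho> ?l \<longlongrightarrow> bump c \<rho> ?l y) (at y within ?K)" using y unfolding continuous_on_def by blast
    qed
    from continuous_on_avoid[OF this cK \<Psi>c] obtain \<delta> where \<delta>: "\<delta> > 0" "\<And>y. y \<in> ?K \<Longrightarrow> dist c y < \<delta> \<Longrightarrow> \<Psi> y \<noteq> 0" by blast
    \<comment> \<open>A segment of this duration in direction \<open>v\<close> keeps points within
      \<open>\<rho> / 2\<close> of \<open>c\<close> inside the ball, and its limit stays where
      \<open>\<Psi>\<close> does not vanish.\<close>
    define \<tau> where "\<tau> = min \<delta> \<rho> / (2 * norm v)"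
    have \<tau>: "\<tau> > 0" unfolding \<tau>_def using \<delta> \<rho> v0 by simp
    have tv: "norm (t *\<^sub>R v) \<le> min \<delta> \<rho> / 2" if "t \<in> {0..\<tau>}" for t
    proof -
      have "norm (t *\<^sub>R v) \<le> \<tau> * norm v" using that by (simp add: mult_right_mono)
      also have "\<dots> = min \<delta> \<rho> / 2" unfolding \<tau>_def using v0 by simp
      finally show ?thesis .
    qed
    have nlim: "filterlim n at_top sequentially"
      unfolding n_def by (rule filterlim_compose[OF filterlim_real_sequentially filterlim_Suc])
    have nslim: "filterlim (\<lambda>j. n (s j)) at_top sequentially"
      by (rule filterlim_compose[OF nlim filterlim_subseq[OF s]])
    \<comment> \<open>Starting points of two parallel lines, both tending to \<open>c\<close>, on
      which the sine is constantly 1 and constantly -1.\<close>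
    obtain x where x: "x \<longlonglongrightarrow> c" "\<And>j. sin (x j \<bullet> (n (s j) *\<^sub>R \<xi>)) = sin (pi / 2)"
      using phase_points[OF \<xi>0 nslim n0, of c "pi / 2"] by blast
    obtain x' where x': "x' \<longlonglongrightarrow> c" "\<And>j. sin (x' j \<bullet> (n (s j) *\<^sub>R \<xi>)) = sin (- (pi / 2))"
      using phase_points[OF \<xi>0 nslim n0, of c "- (pi / 2)"] by blast
    have "eventually (\<lambda>j. dist (x j) c < \<rho> / 2 \<and> dist (x' j) c < \<rho> / 2) sequentially"
      using \<rho> by (intro eventually_conj tendstoD[OF x(1)] tendstoD[OF x'(1)]) auto
    then obtain J where J: "\<And>j. j \<ge> J \<Longrightarrow> dist (x j) c < \<rho> / 2 \<and> dist (x' j) c < \<rho> / 2"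
      unfolding eventually_sequentially by blast
    have inK: "z + t *\<^sub>R v \<in> ?K" if "t \<in> {0..\<tau>}" "dist z c < \<rho> / 2" for t z
    proof -
      have "norm (c - (z + t *\<^sub>R v)) \<le> norm (c - z) + norm (t *\<^sub>R v)" using norm_triangle_ineq4[of "c - z" "t *\<^sub>R v"] by (simp add: diff_diff_eq)
      then show ?thesis using tv[OF that(1)] that(2) by (simp add: dist_norm norm_minus_commute)
    qed
    define f where "f j t = hp m (Q (s j) (x j + t *\<^sub>R v)) v - hp m (Q (s j) (x' j + t *\<^sub>R v)) v" for j t
    define T where "T j y = dhp m (Q (s j) y) v (Gam g y v) + \<kappa> (s j) * U (s j) y v" for j y
    \<comment> \<open>Applying the mean value theorem to the difference of the two lines gives one
      common intermediate time for both.\<close>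
    have mv: "\<exists>t\<in>{0..\<tau>}. f j \<tau> - f j 0 = (T j (x j + t *\<^sub>R v) - T j (x' j + t *\<^sub>R v)) * (\<tau> - 0)" if j: "j \<ge> J" for j
    proof (rule mvt_very_simple[where f' = "\<lambda>t r. (T j (x j + t *\<^sub>R v) - T j (x' j + t *\<^sub>R v)) * r"])
      show "0 \<le> \<tau>" using \<tau> by simp
      fix t assume t: "0 \<le> t" "t \<le> \<tau>"
      have d: "((\<lambda>t. hp m (Q (s j) (z + t *\<^sub>R v)) v) has_real_derivative T j (z + t *\<^sub>R v)) (at t within {0..\<tau>})"
        if "dist z c < \<rho> / 2" for z
      proof (rule DERIV_subset)
        show "((\<lambda>t. hp m (Q (s j) (z + t *\<^sub>R v)) v) has_real_derivative T j (z + t *\<^sub>R v)) (at t within {t. z + t *\<^sub>R v \<in> ?K})"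
          unfolding T_def by (rule line_eqD[OF Qline]) (rule inK, use t that in auto)
        show "{0..\<tau>} \<subseteq> {t. z + t *\<^sub>R v \<in> ?K}" using inK that by blast
      qed
      have "(f j has_real_derivative (T j (x j + t *\<^sub>R v) - T j (x' j + t *\<^sub>R v))) (at t within {0..\<tau>})"
        unfolding f_def[abs_def] by (intro DERIV_diff d) (use J[OF j] in auto)
      then show "(f j has_derivative (\<lambda>r. (T j (x j + t *\<^sub>R v) - T j (x' j + t *\<^sub>R v)) * r)) (at t within {0..\<tau>})"
        by (simp add: has_field_derivative_def)
    qed
    have "\<exists>t. t \<in> {0..\<tau>} \<and> f (j + J) \<tau> - f (j + J) 0 = (T (j + J) (x (j + J) + t *\<^sub>R v) - T (j + J) (x' (j + J) + t *\<^sub>R v)) * \<tau>" for j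
      using mv[OF le_add2, of j] unfolding diff_zero Bex_def .
    then obtain t where t: "\<And>j. t j \<in> {0..\<tau>}"
      "\<And>j. f (j + J) \<tau> - f (j + J) 0 = (T (j + J) (x (j + J) + t j *\<^sub>R v) - T (j + J) (x' (j + J) + t j *\<^sub>R v)) * \<tau>" by metis
    obtain t0 r where r: "strict_mono (r :: nat \<Rightarrow> nat)" "t0 \<in> {0..\<tau>}" "(t \<circ> r) \<longlonglongrightarrow> t0"
      using compact_imp_seq_compact[OF compact_Icc, of 0 \<tau>, unfolded seq_compact_def, rule_format, of t] t(1) by blast
    define i where "i j = r j + J" for j
    have i: "strict_mono i" using r(1) unfolding i_def strict_mono_def by simp
    have ilim: "filterlim i sequentially sequentially" by (rule filterlim_subseq[OF i])
    have tr: "(\<lambda>j. t (r j)) \<longlonglongrightarrow> t0" using r(3) by (simp add: o_def)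
    define y where "y j = x (i j) + t (r j) *\<^sub>R v" for j
    define y' where "y' j = x' (i j) + t (r j) *\<^sub>R v" for j
    let ?y = "c + t0 *\<^sub>R v"
    have yl: "y \<longlonglongrightarrow> ?y" "y' \<longlonglongrightarrow> ?y" unfolding y_def y'_def
      by (intro tendsto_intros tr filterlim_compose[OF x(1) ilim] filterlim_compose[OF x'(1) ilim])+
    have Ji: "dist (x (i j)) c < \<rho> / 2 \<and> dist (x' (i j)) c < \<rho> / 2" for j unfolding i_def by (rule J) simp
    have yK: "y j \<in> ?K" "y' j \<in> ?K" for j unfolding y_def y'_def using Ji[of j] t(1) by (auto simp del: mem_cball intro!: inK)
    have y0K: "?y \<in> ?K" by (rule inK) (use r(2) \<rho> in auto)
    \<comment> \<open>Both lines converge to the same segment, so this limit is 0; it is left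
      unsimplified to match the rules for limits.\<close>
    have lhs: "(\<lambda>j. f (i j) \<tau> - f (i j) 0) \<longlonglongrightarrow> (hp m (q (c + \<tau> *\<^sub>R v)) v - hp m (q (c + \<tau> *\<^sub>R v)) v) - (hp m (q (c + 0 *\<^sub>R v)) v - hp m (q (c + 0 *\<^sub>R v)) v)"
    proof -
      have part: "(\<lambda>j. hp m (Q (s (i j)) (z (i j) + t *\<^sub>R v)) v) \<longlonglongrightarrow> hp m (q (c + t *\<^sub>R v)) v"
        if t: "t \<in> {0..\<tau>}" and z: "z \<longlonglongrightarrow> c" "\<And>j. dist (z (i j)) c < \<rho> / 2" for t z
      proof (intro tendsto_hp tendsto_const cconv_seq[OF sq _ _ _ ilim])
        show "c + t *\<^sub>R v \<in> ?K" by (rule inK[OF t]) (use \<rho> in auto)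
        show "z (i j) + t *\<^sub>R v \<in> ?K" for j by (rule inK[OF t z(2)])
        show "(\<lambda>j. z (i j) + t *\<^sub>R v) \<longlonglongrightarrow> c + t *\<^sub>R v" by (intro tendsto_intros filterlim_compose[OF z(1) ilim])
      qed
      show ?thesis unfolding f_def
        by (intro tendsto_diff part) (use \<tau> x(1) x'(1) Ji in auto)
    qed
    have sc: "v \<bullet> \<xi> = 0" unfolding \<xi>_def by (rule perp_orthogonal)
    have rhs: "(\<lambda>j. T (i j) (z j)) \<longlonglongrightarrow> dhp m (q ?y) v (Gam g ?y v) + \<kappa>0 * dhp m (p0 ?y) v (matrix_inv (g ?y) *v ((\<sigma> * ((v \<bullet> v) / 2) * bump c \<rho> ?l ?y) *\<^sub>R \<xi>))"
      if z: "z \<longlonglongrightarrow> ?y" "\<And>j. z j \<in> ?K" "\<And>j. sin (z j \<bullet> (n (s (i j)) *\<^sub>R \<xi>)) = \<sigma>" for z \<sigma>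
    proof -
      have Gz: "(\<lambda>j. Gam g (z j) v) \<longlonglongrightarrow> Gam g ?y v"
        by (rule continuous_on_tendsto_compose[OF Gcont z(1) y0K]) (use z(2) in auto)
      show ?thesis
        unfolding T_def U_def
        by (intro tendsto_intros cconv_seq[OF sq y0K z(2,1) ilim] cconv_seq[OF sp y0K z(2,1) ilim] cconv_seq[OF sinv y0K z(2,1) ilim]
            Gz filterlim_compose[OF s\<kappa> ilim] wave_force_limit[OF l filterlim_compose[OF nslim ilim] z(1) Gz z(3) sc])
    qed
    have ph: "sin (y j \<bullet> (n (s (i j)) *\<^sub>R \<xi>)) = 1" "sin (y' j \<bullet> (n (s (i j)) *\<^sub>R \<xi>)) = -1" for j
      using x(2)[of "i j"] x'(2)[of "i j"] sc unfolding y_def y'_def by (simp_all add: inner_left_distrib)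
    \<comment> \<open>The contributions of \<open>q\<close> cancel, while the two forces have
      opposite signs and add up. Their sum absorbs the factor 1/2 in front of
      \<open>v \<bullet> v\<close>.\<close>
    have "(\<lambda>j. (T (i j) (y j) - T (i j) (y' j)) * \<tau>) \<longlonglongrightarrow>
       ((dhp m (q ?y) v (Gam g ?y v) + \<kappa>0 * dhp m (p0 ?y) v (matrix_inv (g ?y) *v ((1 * ((v \<bullet> v) / 2) * bump c \<rho> ?l ?y) *\<^sub>R \<xi>)))
       - (dhp m (q ?y) v (Gam g ?y v) + \<kappa>0 * dhp m (p0 ?y) v (matrix_inv (g ?y) *v ((- 1 * ((v \<bullet> v) / 2) * bump c \<rho> ?l ?y) *\<^sub>R \<xi>)))) * \<tau>" (is "_ \<longlonglongrightarrow> ?L")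
      by (intro tendsto_intros rhs yl yK ph)
    moreover have "(T (i j) (y j) - T (i j) (y' j)) * \<tau> = f (i j) \<tau> - f (i j) 0" for j
      using t(2)[of "r j"] unfolding y_def y'_def i_def by simp
    ultimately have "(\<lambda>j. f (i j) \<tau> - f (i j) 0) \<longlonglongrightarrow> ?L" by simp
    from LIMSEQ_unique[OF this lhs] have "?L = 0" by simp
    moreover have "?L = \<kappa>0 * (v \<bullet> v) * \<Psi> ?y * \<tau>"
      unfolding \<Psi>_def matrix_vector_mult_scaleR dhp_scaleR by (simp add: algebra_simps)
    moreover have "\<Psi> ?y \<noteq> 0"
    proof (rule \<delta>(2)[OF y0K])
      have "norm (t0 *\<^sub>R v) < \<delta>" using tv[OF r(2)] \<delta>(1) by linarith
      then show "dist c ?y < \<delta>" by (simp add: dist_norm)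
    qed
    ultimately show False using False \<tau> v0 by simp
  qed
qed

subsection \<open>Polynomials that are constant on level sets of a quadratic form\<close>

text \<open>Compare orders of vanishing at 0: differentiation lowers the order of a nonzero
  \<open>G\<close> by one, whereas the factor \<open>[:0, 1:]\<close> on the right raises it by
  one.\<close>

lemma polynomial_ODE_unique:
  fixes G Q :: "real poly"
  assumes ode: "Q * pderiv G = smult \<mu> ([:0, 1:] * G)" and G0: "poly G 0 = 0" and Q0: "poly Q 0 \<noteq> 0"
  shows "G = 0"
proof (rule ccontr)
  assume G: "G \<noteq> 0"
  have ord: "order 0 G \<noteq> 0" using G G0 by (simp add: order_root)
  have pd: "pderiv G \<noteq> 0"
  proof
    assume "pderiv G = 0"
    then obtain h where "G = [:h:]" using pderiv_iszero by blast
    then show False using G G0 by simp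
  qed
  have Q: "Q \<noteq> 0" "order 0 Q = 0" using Q0 by (auto simp: order_0I)
  have l: "order 0 (Q * pderiv G) = order 0 (pderiv G)" using Q pd by (simp add: order_mult)
  have "\<mu> \<noteq> 0" using ode Q pd by auto
  then have "order 0 (smult \<mu> ([:0, 1:] * G)) = order 0 ([:0, 1:] :: real poly) + order 0 G"
    using G by (simp add: order_smult order_mult del: mult_pCons_left)
  then have "order 0 (pderiv G) \<ge> order 0 G" using l ode by simp
  moreover have "order 0 G = Suc (order 0 (pderiv G))" by (rule order_pderiv[OF G G0])
  ultimately show False by simp
qed

lemma hp_along_line_poly: "\<exists>p. \<forall>t. poly p t = hp m a (w + t *\<^sub>R d)"
proof -
  have "poly (\<Sum>\<alpha>\<in>mons m. smult (a \<alpha>) (\<Prod>i\<in>UNIV. [:w $ i, d $ i:] ^ \<alpha> i)) t = hp m a (w + t *\<^sub>R d)" for t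
    unfolding hp_def mon_def by (simp add: poly_sum poly_prod)
  then show ?thesis by blast
qed

lemma hp_along_line_derivative:
  "((\<lambda>t. hp m a (w + t *\<^sub>R d)) has_real_derivative dhp m a (w + t *\<^sub>R d) d) (at t)"
proof -
  have "((\<lambda>t. hp m a (w + t *\<^sub>R d)) has_derivative (\<lambda>s. dhp m a (w + t *\<^sub>R d) (s *\<^sub>R d))) (at t)"
    by (rule has_derivative_compose[OF _ hp_has_derivative, where f = "\<lambda>t. w + t *\<^sub>R d"]) (auto intro!: derivative_eq_intros)
  then show ?thesis by (simp add: has_field_derivative_def dhp_scaleR mult.commute[of _ "dhp m a (w + t *\<^sub>R d) d"])
qed

text \<open>Writing \<open>\<xi> = A *v w\<close>, the assumption \<open>crit\<close> says that the
  derivative at \<open>v\<close> vanishes on all \<open>w\<close> with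
  \<open>v \<bullet> (A *v w) = 0\<close>. These are the directions tangent to the level set of the
  quadratic form through \<open>v\<close>.\<close>

locale level_set_polynomial =
  fixes A :: "real ^ 'n ^ 'n::finite" and m :: nat and a :: "('n \<Rightarrow> nat) \<Rightarrow> real"
  assumes sym: "transpose A = A" and inv: "invertible A"
    and crit: "\<And>v \<xi>. v \<noteq> 0 \<Longrightarrow> v \<bullet> \<xi> = 0 \<Longrightarrow> dhp m a v (matrix_inv A *v \<xi>) = 0"
begin

abbreviation (input) q :: "real ^ 'n \<Rightarrow> real" where "q v \<equiv> v \<bullet> (A *v v)"

lemma b_sym: "x \<bullet> (A *v y) = y \<bullet> (A *v x)"
  using symmetric_matrix_inner[OF sym, of x y] by (simp add: inner_commute)

text \<open>Up to the factor \<open>q v\<close>, the vector \<open>u\<close> is a tangent vector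
  plus a multiple of \<open>v\<close>, and on the latter homogeneity determines the derivative. Not
  dividing by \<open>q v\<close> keeps null vectors included.\<close>

lemma Euler_identity: "q v * dhp m a v u = real m * hp m a v * (u \<bullet> (A *v v))"
proof (cases "v = 0")
  case False
  define w where "w = q v *\<^sub>R u - (u \<bullet> (A *v v)) *\<^sub>R v"
  have "v \<bullet> (A *v w) = w \<bullet> (A *v v)" by (rule b_sym)
  also have "\<dots> = 0" unfolding w_def by (simp add: inner_diff_left)
  finally have "dhp m a v (matrix_inv A *v (A *v w)) = 0" by (rule crit[OF False])
  then have "dhp m a v w = 0" by (simp add: matrix_inv_vec[OF inv])
  then show ?thesis unfolding w_def by (simp add: dhp_diff dhp_scaleR dhp_Euler)
qed (simp add: matrix_vector_mult_0_right)

text \<open>Along \<open>w + t d\<close> the quadratic form is even in \<open>t\<close>, and the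
  restricted polynomial satisfies \<open>(q w + t\<^sup>2 q d) p' = m t (q d) p\<close>. This
  equation is invariant under reversing \<open>t\<close>, so the odd part of \<open>p\<close> solves
  it too and vanishes at 0. Working with polynomials, zeros of \<open>q\<close> on the line do no
  harm.\<close>

lemma reflection:
  assumes wd: "w \<bullet> (A *v d) = 0" and qw: "q w \<noteq> 0"
  shows "hp m a (w + d) = hp m a (w - d)"
proof -
  obtain p where p: "\<And>t. poly p t = hp m a (w + t *\<^sub>R d)" using hp_along_line_poly by metis
  have wd': "d \<bullet> (A *v w) = 0" using wd b_sym by simp
  have p': "poly (pderiv p) t = dhp m a (w + t *\<^sub>R d) d" for t
  proof -
    have "(poly p has_real_derivative dhp m a (w + t *\<^sub>R d) d) (at t)"
      using hp_along_line_derivative[of m a w d t] p by presburger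
    then show ?thesis using poly_DERIV DERIV_unique by blast
  qed
  have qt: "q (w + t *\<^sub>R d) = q w + t * t * q d" "d \<bullet> (A *v (w + t *\<^sub>R d)) = t * q d" for t
    using wd wd' by (simp_all add: matrix_vector_right_distrib matrix_vector_mult_scaleR inner_add_left inner_add_right algebra_simps)
  have ode: "(q w + t * t * q d) * poly (pderiv p) t = real m * poly p t * (t * q d)" for t
    using Euler_identity[of "w + t *\<^sub>R d" d] unfolding p p' qt .
  define r where "r = pcompose p [:0, -1:]"
  have r: "poly r t = poly p (- t)" "poly (pderiv r) t = - poly (pderiv p) (- t)" for t
    unfolding r_def by (simp_all add: poly_pcompose pderiv_pcompose pderiv_pCons)
  let ?Q = "[:q w, 0, q d:]" and ?G = "p - r"
  have "?Q * pderiv ?G = smult (real m * q d) ([:0, 1:] * ?G)"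
  proof (rule poly_eq_poly_eq_iff[THEN iffD1], rule ext)
    fix t
    have "poly ?Q t = q w + t * t * q d" by (simp add: algebra_simps)
    then have "poly (?Q * pderiv ?G) t = (q w + t * t * q d) * poly (pderiv p) t + (q w + (- t) * (- t) * q d) * poly (pderiv p) (- t)"
      by (simp only: poly_mult pderiv_diff poly_diff r(2)) (simp add: algebra_simps)
    also have "\<dots> = real m * poly p t * (t * q d) + real m * poly p (- t) * (- t * q d)"
      unfolding ode ..
    also have "\<dots> = poly (smult (real m * q d) ([:0, 1:] * ?G)) t"
      by (simp add: r(1) algebra_simps)
    finally show "poly (?Q * pderiv ?G) t = poly (smult (real m * q d) ([:0, 1:] * ?G)) t" .
  qed
  then have "?G = 0" by (rule polynomial_ODE_unique) (use qw r in auto)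
  then have "poly p 1 = poly p (- 1)" using r(1)[of 1] by simp
  then show ?thesis unfolding p by simp
qed

text \<open>Equality of \<open>q v\<close> and \<open>q v'\<close> means that half the difference is
  orthogonal to the midpoint, so \<open>v\<close> and \<open>v'\<close> are exchanged by the
  reflection.\<close>

lemma midpoint_case:
  assumes "q v = q v'" "q (v + v') \<noteq> 0"
  shows "hp m a v = hp m a v'"
proof -
  let ?w = "(1/2) *\<^sub>R (v + v')" and ?d = "(1/2) *\<^sub>R (v - v')"
  have "(v + v') \<bullet> (A *v (v - v')) = 0"
    using assms(1) b_sym[of v v'] by (simp add: matrix_vector_mult_diff_distrib inner_add_left inner_diff_right)
  then have "?w \<bullet> (A *v ?d) = 0" by (simp add: matrix_vector_mult_scaleR)
  moreover have "q ?w \<noteq> 0" using assms(2) by (simp add: matrix_vector_mult_scaleR)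
  ultimately have "hp m a (?w + ?d) = hp m a (?w - ?d)" by (rule reflection)
  moreover have "?w + ?d = v" "?w - ?d = v'"
    by (simp_all add: scaleR_right_distrib scaleR_right_diff_distrib flip: scaleR_left_distrib)
  ultimately show ?thesis by simp
qed

text \<open>The form is nondegenerate on the orthogonal complement of \<open>v\<close>.
  \<open>P\<close> projects onto it up to a factor. If \<open>P y\<close> is null, then a second
  vector \<open>?f\<close> pairing nontrivially with it, or the sum of both, is not null.\<close>

lemma orthogonal_nonnull:
  assumes n: "CARD('n) \<ge> 2" and v: "q v \<noteq> 0"
  shows "\<exists>e. e \<bullet> (A *v v) = 0 \<and> q e \<noteq> 0"
proof -
  define P where "P y = q v *\<^sub>R y - (y \<bullet> (A *v v)) *\<^sub>R v" for y
  have P0: "P y \<bullet> (A *v v) = 0" for y unfolding P_def by (simp add: inner_diff_left)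
  have "span {v} \<noteq> UNIV"
  proof
    assume "span {v} = UNIV"
    then have "DIM(real ^ 'n) \<le> card {v}" by (metis dim_le_card dim_UNIV finite.emptyI finite.insertI subset_refl)
    then show False using n by simp
  qed
  then obtain y where y: "y \<notin> span {v}" by auto
  have Py: "P y \<noteq> 0"
  proof
    assume "P y = 0"
    then have "q v *\<^sub>R y = (y \<bullet> (A *v v)) *\<^sub>R v" unfolding P_def by simp
    then have "y = ((y \<bullet> (A *v v)) / q v) *\<^sub>R v"
      using v by (metis (no_types, lifting) divide_inverse inverse_eq_divide left_inverse mult.commute scaleR_one scaleR_scaleR)
    then show False using y by (metis insertI1 span_base span_scale)
  qed
  let ?e = "P y"
  show ?thesis
  proof (cases "q ?e = 0")
    case False then show ?thesis using P0 by blast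
  next
    case True
    \<comment> \<open>With this choice the pairing of \<open>?e\<close> with \<open>z\<close> is the
      Euclidean square of \<open>z\<close>, hence positive.\<close>
    define z where "z = A *v ?e"
    have "z \<noteq> 0" unfolding z_def using Py matrix_inv_vec(2)[OF inv, of ?e] by (metis matrix_vector_mult_0_right)
    then have zz: "?e \<bullet> (A *v z) \<noteq> 0" using b_sym[of ?e z] unfolding z_def by simp
    let ?f = "P z"
    have "?e \<bullet> (A *v v) = 0" by (rule P0)
    then have ef: "?e \<bullet> (A *v ?f) = q v * (?e \<bullet> (A *v z))"
      unfolding P_def[of z] by (simp add: matrix_vector_mult_diff_distrib matrix_vector_mult_scaleR inner_diff_right)
    show ?thesis
    proof (cases "q ?f = 0")
      case False then show ?thesis using P0 by blast
    next
      case f0: True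
      have "q (?e + ?f) = 2 * (?e \<bullet> (A *v ?f))"
        using True f0 b_sym[of ?f ?e] by (simp add: matrix_vector_right_distrib inner_add_left inner_add_right)
      then have "q (?e + ?f) \<noteq> 0" using ef v zz by simp
      moreover have "(?e + ?f) \<bullet> (A *v v) = 0" using P0 by (simp add: inner_add_left)
      ultimately show ?thesis by blast
    qed
  qed
qed

text \<open>The midpoint of \<open>v\<close> and \<open>- v\<close> is 0, so
  \<open>midpoint_case\<close> does not apply directly; the detour goes through a third vector
  \<open>?u\<close> of the same level in the plane of \<open>v\<close> and \<open>e\<close>.\<close>

lemma even_on_nonnull:
  assumes n: "CARD('n) \<ge> 2" and v: "q v \<noteq> 0"
  shows "hp m a (- v) = hp m a v"
proof -
  obtain e where e: "e \<bullet> (A *v v) = 0" "q e \<noteq> 0" using orthogonal_nonnull[OF n v] by blast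
  have e': "v \<bullet> (A *v e) = 0" using e b_sym by simp
  \<comment> \<open>The square of \<open>t\<close> must be \<open>(1 - s * s) * (q v / q e)\<close>,
    so the sign of the ratio decides whether \<open>s\<close> is below or above 1. Avoiding 1 and -1
    keeps both midpoints non-null.\<close>
  obtain s t where st: "s * s * q v + t * t * q e = q v" "s \<noteq> 1" "s \<noteq> - 1"
  proof (cases "q v / q e > 0")
    case True
    then have "3 / 4 * (q v / q e) \<ge> 0" by linarith
    then have "sqrt (3 / 4 * (q v / q e)) * sqrt (3 / 4 * (q v / q e)) = 3 / 4 * (q v / q e)"
      by (simp only: real_sqrt_mult_self abs_of_nonneg)
    then show ?thesis
      by (intro that[of "1/2" "sqrt (3 / 4 * (q v / q e))"]) (use e in \<open>auto simp: field_simps\<close>)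
  next
    case False
    then have "- 3 * (q v / q e) \<ge> 0" by linarith
    then have "sqrt (- 3 * (q v / q e)) * sqrt (- 3 * (q v / q e)) = - 3 * (q v / q e)"
      by (simp only: real_sqrt_mult_self abs_of_nonneg)
    then show ?thesis
      by (intro that[of 2 "sqrt (- 3 * (q v / q e))"]) (use e in \<open>auto simp: field_simps\<close>)
  qed
  let ?u = "s *\<^sub>R v + t *\<^sub>R e"
  have qu: "q (x *\<^sub>R v + t *\<^sub>R e) = x * x * q v + t * t * q e" for x
    using e e' by (simp add: matrix_vector_right_distrib matrix_vector_mult_scaleR inner_add_left inner_add_right)
  have "q (v + ?u) = q ((1 + s) *\<^sub>R v + t *\<^sub>R e)" by (simp add: algebra_simps)
  also have "\<dots> = 2 * (1 + s) * q v" unfolding qu using st(1) by (simp add: algebra_simps)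
  finally have 1: "hp m a v = hp m a ?u"
    by (intro midpoint_case) (use st v qu[of s] in auto)
  have "q (?u + (- v)) = q ((s - 1) *\<^sub>R v + t *\<^sub>R e)" by (simp add: algebra_simps)
  also have "\<dots> = 2 * (1 - s) * q v" unfolding qu using st(1) by (simp add: algebra_simps)
  finally have qq: "q (?u + (- v)) = 2 * (1 - s) * q v" .
  have "q (- v) = q v" using matrix_vector_mult_scaleR[of A "-1" v] by simp
  then have 2: "hp m a ?u = hp m a (- v)"
    by (intro midpoint_case) (use st v qu[of s] qq in auto)
  show ?thesis using 1 2 by simp
qed

theorem constant_on_level_sets:
  assumes n: "CARD('n) \<ge> 2" and q: "q v = q v'"
  shows "hp m a v = hp m a v'"
proof (cases "q v = 0")
  case False
  have m: "q (- v') = q v'" using matrix_vector_mult_scaleR[of A "-1" v'] by simp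
  show ?thesis
  proof (cases "q (v + v') = 0")
    case False then show ?thesis using midpoint_case q by blast
  next
    case True
    \<comment> \<open>By the parallelogram law the sum and the difference cannot both be null, so
      \<open>v'\<close> may be replaced by \<open>- v'\<close> and evenness used.\<close>
    have "q (v + v') + q (v + (- v')) = 2 * q v + 2 * q v'"
      by (simp add: matrix_vector_right_distrib matrix_vector_mult_diff_distrib inner_add_left inner_add_right inner_diff_left inner_diff_right)
    then have "q (v + (- v')) \<noteq> 0" using True False q by simp
    then have "hp m a v = hp m a (- v')" by (intro midpoint_case) (use q m in auto)
    then show ?thesis using even_on_nonnull[OF n, of v'] False q by simp
  qed
next
  case True
  \<comment> \<open>On the null cone \<open>Euler_identity\<close> with the direction
    \<open>A *v x\<close>, which pairs positively with \<open>A *v x\<close>, forces the value 0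
    when the degree is positive.\<close>
  have z: "hp m a x = hp m a 0" if "q x = 0" for x
  proof (cases "m = 0 \<or> x = 0")
    case True
    then show ?thesis using hp_scale[of m a 0 x] by auto
  next
    case False
    have "A *v x \<noteq> 0" using False matrix_inv_vec(2)[OF inv, of x] by (metis matrix_vector_mult_0_right)
    then have "hp m a x = 0" using Euler_identity[of x "A *v x"] that False by simp
    moreover have "hp m a 0 = 0" using hp_scale[of m a 0 0] False by (simp add: power_0_left)
    ultimately show ?thesis by simp
  qed
  show ?thesis using z[of v] z[of v'] True q by simp
qed

end

subsection \<open>From integrals to weak integrals\<close>

lemma hamiltonian_eq: "hamiltonian g (x, p) = 1 / 2 * (p \<bullet> (matrix_inv (g x) *v p))"
  unfolding hamiltonian_def matrix_vector_mult_def inner_vec_def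
  by (simp add: sum_distrib_left mult_ac)

definition dgv :: "(real ^ 'n::finite \<Rightarrow> real ^ 'n ^ 'n) \<Rightarrow> 'n \<Rightarrow> real ^ 'n \<Rightarrow> real ^ 'n \<Rightarrow> real" where
  "dgv g i x v = (\<Sum>a\<in>UNIV. \<Sum>b\<in>UNIV. dg g i a b x * v $ a * v $ b)"

lemma hamiltonian_momentum_derivative:
  fixes g :: "real ^ 'n::finite \<Rightarrow> real ^ 'n ^ 'n"
  assumes "transpose (g x) = g x" "invertible (g x)"
  shows "dir_deriv (hamiltonian g) (0, u) (x, p) = u \<bullet> (matrix_inv (g x) *v p)"
proof (rule dir_derivI(2))
  have sy: "p \<bullet> (matrix_inv (g x) *v u) = u \<bullet> (matrix_inv (g x) *v p)"
    using symmetric_matrix_inv_inner[OF assms, of p u] by (simp add: inner_commute)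
  have "(\<lambda>t. hamiltonian g ((x, p) + t *\<^sub>R (0, u))) =
    (\<lambda>t. 1 / 2 * (p \<bullet> (matrix_inv (g x) *v p)) + t * (u \<bullet> (matrix_inv (g x) *v p)) + t * t * (1 / 2 * (u \<bullet> (matrix_inv (g x) *v u))))"
    by (simp add: fun_eq_iff hamiltonian_eq matrix_vector_right_distrib matrix_vector_mult_scaleR inner_add_left inner_add_right sy algebra_simps)
  then show "((\<lambda>t. hamiltonian g ((x, p) + t *\<^sub>R (0, u))) has_real_derivative u \<bullet> (matrix_inv (g x) *v p)) (at 0)"
    by (auto intro!: derivative_eq_intros)
qed

text \<open>The difference quotient is rewritten by applying the inverse of \<open>g y\<close> to
  \<open>g x *v v = g y *v v - (g y - g x) *v v\<close>. After that only continuity of the inverse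
  is used, not its derivative.\<close>

lemma hamiltonian_position_derivative:
  fixes g :: "real ^ 'n::finite \<Rightarrow> real ^ 'n ^ 'n"
  assumes D: "open D" and g: "g \<in> Ck_metrics k D" and k: "k \<ge> 1" and x: "x \<in> D"
  shows "dir_deriv (hamiltonian g) (axis i 1, 0) (x, g x *v v) = - 1 / 2 * dgv g i x v"
proof (rule dir_derivI(2))
  let ?y = "\<lambda>t::real. x + t *\<^sub>R axis i 1" and ?p = "g x *v v"
  have inv: "invertible (g y)" "transpose (g y) = g y" if "y \<in> D" for y
    using Ck_metrics_invertible[OF g that] Ck_metrics_symmetric[OF g that] by auto
  define A' :: "real ^ 'n ^ 'n" where "A' = (\<chi> a b. dg g i a b x)"
  have ev: "eventually (\<lambda>t. ?y t \<in> D) (at 0)"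
    using eventually_line_in_open[OF D x, of "axis i 1"] by (auto simp: eventually_at_filter elim: eventually_mono)
  have y0: "(?y \<longlongrightarrow> x) (at 0)"
  proof -
    have "(?y \<longlongrightarrow> x + 0 *\<^sub>R axis i 1) (at 0)" by (intro tendsto_intros)
    then show ?thesis by simp
  qed
  have "((\<lambda>t. g (?y t) $ a $ b) \<longlongrightarrow> g x $ a $ b) (at 0)" for a b
    by (rule isCont_tendsto_compose[OF _ y0])
      (use Ck_metrics_entries(1)[OF g k D] D x in \<open>simp add: continuous_on_eq_continuous_at\<close>)
  then have gl: "((\<lambda>t. g (?y t)) \<longlongrightarrow> g x) (at 0)" by (intro vec_tendstoI)
  have "((\<lambda>t. ((1 / t) *\<^sub>R (g (?y t) - g x)) $ a $ b) \<longlongrightarrow> A' $ a $ b) (at 0)" for a b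
    using Ck_metrics_entries(3)[OF g k D x, of a b i]
    unfolding has_dir_deriv_iff has_field_derivative_iff A'_def dg_def by (simp add: divide_inverse mult.commute)
  then have dl: "((\<lambda>t. (1 / t) *\<^sub>R (g (?y t) - g x)) \<longlongrightarrow> A') (at 0)" by (intro vec_tendstoI)
  have "((\<lambda>t. - 1 / 2 * (?p \<bullet> (matrix_inv (g (?y t)) *v (((1 / t) *\<^sub>R (g (?y t) - g x)) *v v)))) \<longlongrightarrow>
     - 1 / 2 * (?p \<bullet> (matrix_inv (g x) *v (A' *v v)))) (at 0)"
    by (intro tendsto_intros tendsto_matrix_inv gl dl inv x)
  moreover have "?p \<bullet> (matrix_inv (g x) *v (A' *v v)) = dgv g i x v"
  proof -
    have "?p \<bullet> (matrix_inv (g x) *v (A' *v v)) = (matrix_inv (g x) *v ?p) \<bullet> (A' *v v)"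
      using symmetric_matrix_inv_inner[OF inv(2,1)[OF x], of ?p "A' *v v"] by simp
    also have "\<dots> = v \<bullet> (A' *v v)" by (simp add: matrix_inv_vec[OF inv(1)[OF x]])
    also have "\<dots> = dgv g i x v"
      unfolding dgv_def A'_def matrix_vector_mult_def inner_vec_def by (simp add: sum_distrib_left mult_ac)
    finally show ?thesis .
  qed
  ultimately have lim: "((\<lambda>t. - 1 / 2 * (?p \<bullet> (matrix_inv (g (?y t)) *v (((1 / t) *\<^sub>R (g (?y t) - g x)) *v v)))) \<longlongrightarrow>
     - 1 / 2 * dgv g i x v) (at 0)" by simp
  have "((\<lambda>t. (hamiltonian g (?y t, ?p) - hamiltonian g (?y 0, ?p)) / (t - 0)) \<longlongrightarrow> - 1 / 2 * dgv g i x v) (at 0)"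
  proof (rule Lim_transform_eventually[OF lim])
    show "\<forall>\<^sub>F t in at 0. - 1 / 2 * (?p \<bullet> (matrix_inv (g (?y t)) *v (((1 / t) *\<^sub>R (g (?y t) - g x)) *v v)))
       = (hamiltonian g (?y t, ?p) - hamiltonian g (?y 0, ?p)) / (t - 0)"
      using ev
    proof eventually_elim
      case (elim t)
      have "matrix_inv (g (?y t)) *v ?p = matrix_inv (g (?y t)) *v (g (?y t) *v v - (g (?y t) - g x) *v v)"
        by (simp add: matrix_vector_mult_diff_rdistrib)
      also have "\<dots> = v - matrix_inv (g (?y t)) *v ((g (?y t) - g x) *v v)"
        by (simp only: matrix_vector_mult_diff_distrib matrix_inv_vec[OF inv(1)[OF elim]])
      finally have "?p \<bullet> (matrix_inv (g (?y t)) *v ?p) - ?p \<bullet> v = - (?p \<bullet> (matrix_inv (g (?y t)) *v ((g (?y t) - g x) *v v)))"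
        by (simp add: inner_diff_right)
      moreover have "matrix_inv (g x) *v ?p = v" by (rule matrix_inv_vec[OF inv(1)[OF x]])
      ultimately show ?case
        by (simp add: hamiltonian_eq scaleR_matrix_vector_assoc[symmetric] matrix_vector_mult_scaleR diff_divide_distrib[symmetric] flip: right_diff_distrib)
    qed
  qed
  then show "((\<lambda>t. hamiltonian g ((x, ?p) + t *\<^sub>R (axis i 1, 0))) has_real_derivative - 1 / 2 * dgv g i x v) (at 0)"
    by (simp add: has_field_derivative_iff)
qed

lemma linear_pair_sum:
  fixes f :: "(real ^ 'n::finite) \<times> (real ^ 'n) \<Rightarrow> real"
  assumes "linear f"
  shows "f (u, w) = (\<Sum>i\<in>UNIV. u $ i * f (axis i 1, 0)) + (\<Sum>i\<in>UNIV. w $ i * f (0, axis i 1))"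
proof -
  have "(u, w) = (\<Sum>i\<in>UNIV. u $ i *\<^sub>R (axis i 1, 0)) + (\<Sum>i\<in>UNIV. w $ i *\<^sub>R (0, axis i 1))"
    by (simp add: prod_eq_iff fst_sum snd_sum basis_expansion scalar_mult_eq_scaleR[symmetric])
  then have "f (u, w) = f ((\<Sum>i\<in>UNIV. u $ i *\<^sub>R (axis i 1, 0)) + (\<Sum>i\<in>UNIV. w $ i *\<^sub>R (0, axis i 1)))" by (rule arg_cong)
  then show ?thesis
    by (simp only: linear_add[OF assms] linear_sum[OF assms] linear_cmul[OF assms] o_def real_scaleR_def)
qed

lemma metric_times_vector_has_derivative:
  fixes g :: "real ^ 'n::finite \<Rightarrow> real ^ 'n ^ 'n"
  assumes D: "open D" and g: "g \<in> Ck_metrics k D" and k: "k \<ge> 1" and x: "x \<in> D"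
  shows "((\<lambda>y. g y *v v) has_derivative (\<lambda>u. \<chi> l. \<Sum>j\<in>UNIV. (\<Sum>i\<in>UNIV. u $ i * dg g i l j x) * v $ j)) (at x)"
proof -
  have e: "((\<lambda>y. g y $ l $ j) has_derivative (\<lambda>u. \<Sum>i\<in>UNIV. u $ i * dg g i l j x)) (at x)" for l j
    unfolding dg_def
    by (rule C1_has_derivative[OF D _ x]) (use g k in \<open>auto simp: Ck_metrics_def intro: Ck_on_mono\<close>)
  have "((\<lambda>y. \<Sum>j\<in>UNIV. g y $ l $ j * v $ j) has_derivative (\<lambda>u. \<Sum>j\<in>UNIV. (\<Sum>i\<in>UNIV. u $ i * dg g i l j x) * v $ j)) (at x)" for l
    by (intro has_derivative_sum has_derivative_mult_left e)
  then show ?thesis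
    unfolding matrix_vector_mult_def by (subst has_derivative_componentwise_within)
      (auto simp: Basis_vec_def inner_axis)
qed

text \<open>The equation for \<open>F\<close> is only used along the straight lines \<open>t \<mapsto> (x + t v, s g v)\<close>, with \<open>v\<close> fixed.\<close>

lemma integral_along_line:
  fixes g :: "real ^ 'n::finite \<Rightarrow> real ^ 'n ^ 'n"
  assumes D: "open D" and g: "g \<in> Ck_metrics k D" and k: "k \<ge> 1" and F: "geodesic_integral D g F"
    and x: "x + t *\<^sub>R v \<in> D" and s: "s \<noteq> 0"
  shows "((\<lambda>t. F (x + t *\<^sub>R v, s *\<^sub>R (g (x + t *\<^sub>R v) *v v))) has_real_derivative
    s * dir_deriv F (0, gam g (x + t *\<^sub>R v) v) (x + t *\<^sub>R v, s *\<^sub>R (g (x + t *\<^sub>R v) *v v))) (at t)"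
proof -
  define y where "y = x + t *\<^sub>R v"
  define p where "p = s *\<^sub>R (g y *v v)"
  have yD: "y \<in> D" using x unfolding y_def .
  have oD: "open (D \<times> (UNIV :: (real ^ 'n) set))" using D by (intro open_Times) auto
  have "F differentiable (at (y, p))"
    using F yD oD unfolding geodesic_integral_def differentiable_on_eq_differentiable_at[OF oD] by auto
  then obtain F' where F': "(F has_derivative F') (at (y, p))" unfolding differentiable_def by blast
  have lin: "linear F'" using F' has_derivative_linear by blast
  have dF: "dir_deriv F u (y, p) = F' u" for u by (rule dir_deriv_of_has_derivative(2)[OF F'])
  have iv: "matrix_inv (g y) *v p = s *\<^sub>R v"
    unfolding p_def by (simp add: matrix_vector_mult_scaleR matrix_inv_vec[OF Ck_metrics_invertible[OF g yD]])
  have p': "p = g y *v (s *\<^sub>R v)" unfolding p_def by (simp add: matrix_vector_mult_scaleR)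
  have Hp: "dir_deriv (hamiltonian g) (0, axis i 1) (y, p) = s * v $ i" for i
    using hamiltonian_momentum_derivative[where g = g, OF Ck_metrics_symmetric[OF g yD] Ck_metrics_invertible[OF g yD], of "axis i 1" p]
    by (simp add: iv inner_axis')
  have Hx: "dir_deriv (hamiltonian g) (axis i 1, 0) (y, p) = - 1 / 2 * s * s * dgv g i y v" for i
    unfolding p' hamiltonian_position_derivative[OF D g k yD] by (simp add: dgv_def sum_distrib_left mult_ac)
  have "poisson_bracket F (hamiltonian g) (y, p) = 0"
    using F yD unfolding geodesic_integral_def by auto
  then have "(\<Sum>i\<in>UNIV. - 1 / 2 * s * s * dgv g i y v * F' (0, axis i 1) - F' (axis i 1, 0) * (s * v $ i)) = 0"
    unfolding poisson_bracket_def Hx Hp dF .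
  then have "s * ((\<Sum>i\<in>UNIV. v $ i * F' (axis i 1, 0)) + s * (\<Sum>i\<in>UNIV. 1 / 2 * dgv g i y v * F' (0, axis i 1))) = 0"
    by (simp add: sum_subtractf sum_distrib_left sum_negf algebra_simps)
  \<comment> \<open>The vanishing bracket expresses the position derivative of \<open>F\<close> in
    the direction \<open>v\<close> by momentum derivatives. It is the only position derivative
    occurring along the line.\<close>
  then have key: "(\<Sum>i\<in>UNIV. v $ i * F' (axis i 1, 0)) = - s * (\<Sum>i\<in>UNIV. 1 / 2 * dgv g i y v * F' (0, axis i 1))"
    using s by auto
  define g' where "g' = (\<chi> l. \<Sum>j\<in>UNIV. (\<Sum>i\<in>UNIV. v $ i * dg g i l j y) * v $ j)"
  have gam: "gam g y v = g' - (\<chi> l. 1 / 2 * dgv g l y v)"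
  proof -
    have "(\<Sum>i\<in>UNIV. \<Sum>j\<in>UNIV. dg g i l j y * v $ i * v $ j) = (\<Sum>j\<in>UNIV. (\<Sum>i\<in>UNIV. v $ i * dg g i l j y) * v $ j)" for l
      by (subst sum.swap) (simp add: sum_distrib_right sum_distrib_left mult_ac)
    then show ?thesis
      unfolding gam_def g'_def dgv_def vec_eq_iff
      by (simp add: left_diff_distrib right_diff_distrib sum_subtractf sum_distrib_left mult_ac)
  qed
  have line: "((\<lambda>t. x + t *\<^sub>R v) has_derivative (\<lambda>r. r *\<^sub>R v)) (at t)" by (auto intro!: derivative_eq_intros)
  have "((\<lambda>t. g (x + t *\<^sub>R v) *v v) has_derivative (\<lambda>r. \<chi> l. \<Sum>j\<in>UNIV. (\<Sum>i\<in>UNIV. (r *\<^sub>R v) $ i * dg g i l j y) * v $ j)) (at t)"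
    using has_derivative_compose[OF line metric_times_vector_has_derivative[OF D g k yD, of v, unfolded y_def], folded y_def] .
  moreover have "(\<lambda>r. \<chi> l. \<Sum>j\<in>UNIV. (\<Sum>i\<in>UNIV. (r *\<^sub>R v) $ i * dg g i l j y) * v $ j) = (\<lambda>r. r *\<^sub>R g')"
    unfolding g'_def by (auto simp: vec_eq_iff sum_distrib_left sum_distrib_right mult_ac)
  ultimately have gl: "((\<lambda>t. g (x + t *\<^sub>R v) *v v) has_derivative (\<lambda>r. r *\<^sub>R g')) (at t)" by simp
  have "((\<lambda>t. (x + t *\<^sub>R v, s *\<^sub>R (g (x + t *\<^sub>R v) *v v))) has_derivative (\<lambda>r. (r *\<^sub>R v, s *\<^sub>R (r *\<^sub>R g')))) (at t)"
    by (intro has_derivative_Pair line has_derivative_scaleR_right gl)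
  from has_derivative_compose[OF this F'[unfolded p_def y_def]]
  have "((\<lambda>t. F (x + t *\<^sub>R v, s *\<^sub>R (g (x + t *\<^sub>R v) *v v))) has_derivative (\<lambda>r. F' (r *\<^sub>R v, s *\<^sub>R (r *\<^sub>R g')))) (at t)" .
  moreover have "F' (r *\<^sub>R v, s *\<^sub>R (r *\<^sub>R g')) = s * F' (0, gam g y v) * r" for r
  proof -
    have "F' (r *\<^sub>R v, s *\<^sub>R (r *\<^sub>R g')) = r * F' (v, s *\<^sub>R g')"
      using linear_cmul[OF lin, of r "(v, s *\<^sub>R g')"] by (simp add: mult.commute)
    also have "F' (v, s *\<^sub>R g') = s * F' (0, gam g y v)"
    proof -
      have e: "F' (0, gam g y v) = (\<Sum>i\<in>UNIV. gam g y v $ i * F' (0, axis i 1))"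
        using linear_pair_sum[OF lin, of 0 "gam g y v"] by simp
      show ?thesis
        unfolding linear_pair_sum[OF lin, of v "s *\<^sub>R g'"] key e
        by (simp add: gam sum_distrib_left sum_subtractf sum_negf algebra_simps)
    qed
    finally show ?thesis by simp
  qed
  ultimately show ?thesis
    unfolding has_field_derivative_def dF[unfolded y_def p_def] by (simp add: y_def)
qed

section \<open>Taylor expansions of an integral in the momenta\<close>

definition taylor :: "nat \<Rightarrow> (('n::finite \<Rightarrow> nat) \<Rightarrow> real) \<Rightarrow> real ^ 'n \<Rightarrow> real" where
  "taylor m a p = (\<Sum>j\<le>m. hp j a p)"

text \<open>The Lipschitz form of the remainder estimate controls the momentum derivatives of the
  remainder as well, and it is preserved under limits in \<open>x\<close>.\<close>

definition taylor_bound ::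
  "((real ^ 'n::finite) \<times> (real ^ 'n) \<Rightarrow> real) \<Rightarrow> real \<Rightarrow> nat \<Rightarrow> real ^ 'n \<Rightarrow> (('n \<Rightarrow> nat) \<Rightarrow> real) \<Rightarrow> bool" where
  "taylor_bound F N m x a \<longleftrightarrow> (\<forall>j\<le>m. \<forall>\<alpha>\<in>mons j. \<bar>a \<alpha>\<bar> \<le> N) \<and> F (x, 0) = taylor m a 0 \<and>
     (\<forall>p q \<sigma>. norm p \<le> \<sigma> \<longrightarrow> norm q \<le> \<sigma> \<longrightarrow> \<sigma> * N \<le> 1 \<longrightarrow>
       \<bar>(F (x, p) - taylor m a p) - (F (x, q) - taylor m a q)\<bar> \<le> N * \<sigma> ^ m * norm (p - q))"

lemma low_degree_mons: "{\<alpha> :: 'n::finite \<Rightarrow> nat. mdeg \<alpha> \<le> m} = (\<Union>j\<le>m. mons j)"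
  by (auto simp: mons_def)

lemma finite_low_degree [simp]: "finite {\<alpha> :: 'n::finite \<Rightarrow> nat. mdeg \<alpha> \<le> m}"
  unfolding low_degree_mons by simp

lemma taylor_eq_sum: "taylor m a p = (\<Sum>\<alpha> | mdeg \<alpha> \<le> m. a \<alpha> * mon \<alpha> p)"
proof -
  have "(\<Sum>\<alpha>\<in>(\<Union>j\<le>m. mons j). a \<alpha> * mon \<alpha> p) = (\<Sum>j\<le>m. \<Sum>\<alpha>\<in>mons j. a \<alpha> * mon \<alpha> p)"
    by (rule sum.UNION_disjoint) (simp, simp, auto simp: mons_def)
  then show ?thesis unfolding low_degree_mons taylor_def hp_def by simp
qed

lemma has_sum_subtract:
  fixes x y :: real
  assumes "(f has_sum x) A" "(g has_sum y) A"
  shows "((\<lambda>i. f i - g i) has_sum (x - y)) A"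
proof -
  have "((\<lambda>i. - g i) has_sum - y) A" using assms(2) by (simp add: has_sum_uminus)
  from has_sum_add[OF assms(1) this] show ?thesis by simp
qed

text \<open>Absolute convergence at one point with all coordinates equal to \<open>\<rho>\<close>
  dominates the coefficients. Together with \<open>mon_Lipschitz\<close>, the terms of degree above
  \<open>m\<close> then have summable Lipschitz constants of order
  \<open>\<sigma> ^ m\<close>.\<close>

lemma analytic_imp_taylor_bound:
  fixes x :: "real ^ 'n::finite"
  assumes r: "r > 0" and ps: "\<And>p. p \<in> ball 0 r \<Longrightarrow> ((\<lambda>\<alpha>. a \<alpha> * mon \<alpha> p) has_sum F (x, p)) UNIV"
  shows "\<exists>N. \<forall>N'\<ge>N. taylor_bound F N' m x a"
proof -
  define \<rho> where "\<rho> = r / (2 * real CARD('n))"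
  have \<rho>: "\<rho> > 0" unfolding \<rho>_def using r by simp
  define p0 :: "real ^ 'n" where "p0 = (\<chi> i. \<rho>)"
  have "norm p0 \<le> (\<Sum>i\<in>UNIV. \<bar>p0 $ i\<bar>)" by (rule norm_le_l1_cart)
  also have "\<dots> = r / 2" unfolding p0_def \<rho>_def using r by simp
  finally have p0: "p0 \<in> ball 0 r" using r by simp
  have mp0: "mon \<alpha> p0 = \<rho> ^ mdeg \<alpha>" for \<alpha> unfolding mon_def p0_def mdeg_def by (simp add: power_sum)
  have "(\<lambda>\<alpha>. a \<alpha> * mon \<alpha> p0) summable_on UNIV" by (rule has_sum_imp_summable[OF ps[OF p0]])
  then have "(\<lambda>\<alpha>. norm (a \<alpha> * mon \<alpha> p0)) summable_on UNIV" by (rule summable_on_iff_abs_summable_on_real[THEN iffD1])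
  moreover have "norm (a \<alpha> * mon \<alpha> p0) = \<bar>a \<alpha>\<bar> * \<rho> ^ mdeg \<alpha>" for \<alpha> unfolding mp0 using \<rho> by (simp add: abs_mult)
  ultimately obtain S where S: "((\<lambda>\<alpha>. \<bar>a \<alpha>\<bar> * \<rho> ^ mdeg \<alpha>) has_sum S) UNIV" unfolding summable_on_def by auto
  have S0: "S \<ge> 0" by (rule has_sum_nonneg[OF S]) (use \<rho> in simp)
  have R: "((\<lambda>\<alpha>. if mdeg \<alpha> \<le> m then 0 else a \<alpha> * mon \<alpha> p) has_sum (F (x, p) - taylor m a p)) UNIV" if "p \<in> ball 0 r" for p
  proof -
    have "((\<lambda>\<alpha>. if mdeg \<alpha> \<le> m then a \<alpha> * mon \<alpha> p else 0) has_sum taylor m a p) UNIV"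
      by (rule has_sum_finite_neutralI[of "{\<alpha>. mdeg \<alpha> \<le> m}"]) (auto simp: taylor_eq_sum)
    from has_sum_subtract[OF ps[OF that] this] show ?thesis
      by (rule has_sum_cong[THEN iffD1, rotated]) auto
  qed
  \<comment> \<open>The degree is estimated by \<open>2 ^ mdeg \<alpha>\<close>, and all but
    \<open>m\<close> of the factors \<open>\<sigma>\<close> by \<open>\<rho> / 2\<close>. The powers
    of 2 beyond \<open>Suc m\<close> cancel.\<close>
  define C where "C = 2 ^ Suc m / \<rho> ^ Suc m"
  have C: "C > 0" unfolding C_def using \<rho> by simp
  have one: "(F (x, p) - taylor m a p) - (F (x, q) - taylor m a q) \<le> S * (C * \<sigma> ^ m * norm (p - q))"
    if p: "norm p \<le> \<sigma>" and q: "norm q \<le> \<sigma>" and \<sigma>: "\<sigma> \<le> \<rho> / 2" for p q \<sigma>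
  proof (rule has_sum_mono[OF has_sum_subtract[OF R R] has_sum_cmult_left[OF S, of "C * \<sigma> ^ m * norm (p - q)"]])
    have "\<rho> / 2 < r"
    proof -
      have "real CARD('n) \<ge> 1" by (simp add: Suc_leI)
      then have "r / (2 * real CARD('n)) \<le> r / 1" using r by (intro divide_left_mono) linarith+
      then have "\<rho> \<le> r" unfolding \<rho>_def by simp
      then show ?thesis using \<rho> by simp
    qed
    then show "p \<in> ball 0 r" "q \<in> ball 0 r" using p q \<sigma> by auto
    have \<sigma>0: "\<sigma> \<ge> 0" using p norm_ge_zero[of p] by linarith
    fix \<alpha> :: "'n \<Rightarrow> nat"
    show "(if mdeg \<alpha> \<le> m then 0 else a \<alpha> * mon \<alpha> p) - (if mdeg \<alpha> \<le> m then 0 else a \<alpha> * mon \<alpha> q)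
      \<le> \<bar>a \<alpha>\<bar> * \<rho> ^ mdeg \<alpha> * (C * \<sigma> ^ m * norm (p - q))"
    proof (cases "mdeg \<alpha> \<le> m")
      case True
      then show ?thesis using \<rho> C \<sigma>0 by simp
    next
      case False
      then obtain d where d: "mdeg \<alpha> = Suc (m + d)" by (metis add_Suc_right less_imp_Suc_add not_le)
      have "real (mdeg \<alpha>) * \<sigma> ^ (mdeg \<alpha> - 1) \<le> \<rho> ^ mdeg \<alpha> * (C * \<sigma> ^ m)"
      proof -
        have "real (mdeg \<alpha>) * \<sigma> ^ (mdeg \<alpha> - 1) = real (mdeg \<alpha>) * (\<sigma> ^ d * \<sigma> ^ m)"
          unfolding d by (simp add: power_add mult.commute)
        also have "\<dots> \<le> 2 ^ mdeg \<alpha> * ((\<rho> / 2) ^ d * \<sigma> ^ m)"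
        proof (intro mult_mono power_mono)
          show "real (mdeg \<alpha>) \<le> 2 ^ mdeg \<alpha>" using less_exp[of "mdeg \<alpha>"] by (metis less_imp_le of_nat_less_two_power)
        qed (use \<sigma> \<sigma>0 \<rho> in auto)
        also have "\<dots> = \<rho> ^ mdeg \<alpha> * (C * \<sigma> ^ m)"
          unfolding d C_def using \<rho> by (simp add: power_add power_divide field_simps)
        finally show ?thesis .
      qed
      then have "real (mdeg \<alpha>) * \<sigma> ^ (mdeg \<alpha> - 1) * norm (p - q) \<le> \<rho> ^ mdeg \<alpha> * (C * \<sigma> ^ m) * norm (p - q)"
        by (intro mult_right_mono) auto
      with mon_Lipschitz[OF p q, of \<alpha>] have b: "\<bar>mon \<alpha> p - mon \<alpha> q\<bar> \<le> \<rho> ^ mdeg \<alpha> * (C * \<sigma> ^ m) * norm (p - q)" by linarith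
      have "a \<alpha> * mon \<alpha> p - a \<alpha> * mon \<alpha> q \<le> \<bar>a \<alpha>\<bar> * \<bar>mon \<alpha> p - mon \<alpha> q\<bar>"
        unfolding abs_mult[symmetric] right_diff_distrib by (rule abs_ge_self)
      also have "\<dots> \<le> \<bar>a \<alpha>\<bar> * (\<rho> ^ mdeg \<alpha> * (C * \<sigma> ^ m) * norm (p - q))"
        by (rule mult_left_mono[OF b]) simp
      finally show ?thesis using False by (simp add: mult_ac)
    qed
  qed
  \<comment> \<open>The three summands provide the bound on the coefficients, the implication from
    \<open>\<sigma> * N' \<le> 1\<close> to \<open>\<sigma> \<le> \<rho> / 2\<close>, and the
    constant of the remainder.\<close>
  define N where "N = (\<Sum>\<alpha> | mdeg \<alpha> \<le> m. \<bar>a \<alpha>\<bar>) + 2 / \<rho> + S * C"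
  have "taylor_bound F N' m x a" if N': "N' \<ge> N" for N'
    unfolding taylor_bound_def
  proof (intro conjI allI impI ballI)
    have pos: "0 \<le> (\<Sum>\<alpha> | mdeg \<alpha> \<le> m. \<bar>a \<alpha>\<bar>)" "0 < 2 / \<rho>" "0 \<le> S * C" using \<rho> S0 C by (auto intro: sum_nonneg)
    fix j and \<alpha> :: "'n \<Rightarrow> nat" assume "j \<le> m" "\<alpha> \<in> mons j"
    then have "\<bar>a \<alpha>\<bar> \<le> (\<Sum>\<alpha> | mdeg \<alpha> \<le> m. \<bar>a \<alpha>\<bar>)" by (intro member_le_sum) (auto simp: mons_def)
    then show "\<bar>a \<alpha>\<bar> \<le> N'" using N' pos unfolding N_def by linarith
  next
    have z: "mon \<alpha> 0 = 0" if "\<not> mdeg \<alpha> \<le> m" for \<alpha> :: "'n \<Rightarrow> nat"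
      using mon_scale[of \<alpha> 0 0] that by (simp add: power_0_left)
    have "((\<lambda>\<alpha>. if mdeg \<alpha> \<le> m then 0 else a \<alpha> * mon \<alpha> 0) has_sum 0) (UNIV :: ('n \<Rightarrow> nat) set)"
      by (rule has_sum_0) (use z in auto)
    then show "F (x, 0) = taylor m a 0" using has_sum_unique[OF R[of 0]] r by fastforce
  next
    fix p q :: "real ^ 'n" and \<sigma> assume *: "norm p \<le> \<sigma>" "norm q \<le> \<sigma>" "\<sigma> * N' \<le> 1"
    have pos: "0 \<le> (\<Sum>\<alpha> | mdeg \<alpha> \<le> m. \<bar>a \<alpha>\<bar>)" "0 < 2 / \<rho>" "0 \<le> S * C" using \<rho> S0 C by (auto intro: sum_nonneg)
    have \<sigma>0: "\<sigma> \<ge> 0" using * norm_ge_zero[of p] by linarith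
    have "N' \<ge> 2 / \<rho>" "N' \<ge> S * C" using N' pos unfolding N_def by linarith+
    then have "\<sigma> * (2 / \<rho>) \<le> 1" using *(3) \<sigma>0 mult_left_mono[of "2 / \<rho>" N' \<sigma>] by linarith
    then have s: "\<sigma> \<le> \<rho> / 2" using \<rho> by (simp add: field_simps)
    have "\<bar>(F (x, p) - taylor m a p) - (F (x, q) - taylor m a q)\<bar> \<le> S * (C * \<sigma> ^ m * norm (p - q))"
      using one[OF *(1,2) s] one[OF *(2,1) s] by (simp add: norm_minus_commute abs_le_iff)
    also have "\<dots> = (S * C) * (\<sigma> ^ m * norm (p - q))" by (simp add: mult_ac)
    also have "\<dots> \<le> N' * (\<sigma> ^ m * norm (p - q))"
      using \<open>N' \<ge> S * C\<close> \<sigma>0 by (intro mult_right_mono) auto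
    finally show "\<bar>(F (x, p) - taylor m a p) - (F (x, q) - taylor m a q)\<bar> \<le> N' * \<sigma> ^ m * norm (p - q)" by (simp add: mult_ac)
  qed
  then show ?thesis by blast
qed

lemma taylor_bound_ex:
  assumes "analytic_in_momenta D F" "x \<in> D"
  shows "\<exists>N :: nat. \<exists>a. taylor_bound F (real N) m x a"
proof -
  obtain r a where ra: "r > 0" "\<And>p. p \<in> ball 0 r \<Longrightarrow> ((\<lambda>\<alpha>. a \<alpha> * (\<Prod>i\<in>UNIV. (p $ i - 0 $ i) ^ \<alpha> i)) has_sum F (x, p)) UNIV"
    using assms unfolding analytic_in_momenta_def real_analytic_on_def by blast
  have "((\<lambda>\<alpha>. a \<alpha> * mon \<alpha> p) has_sum F (x, p)) UNIV" if "p \<in> ball 0 r" for p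
    using ra(2)[OF that] unfolding mon_def by simp
  from analytic_imp_taylor_bound[OF ra(1) this] obtain N where "\<forall>N'\<ge>N. taylor_bound F N' m x a" by blast
  then show ?thesis using real_arch_simple[of N] by blast
qed

lemma tendsto_taylor:
  assumes "\<And>j \<alpha>. j \<le> m \<Longrightarrow> \<alpha> \<in> mons j \<Longrightarrow> ((\<lambda>i. a i \<alpha>) \<longlongrightarrow> b \<alpha>) F"
  shows "((\<lambda>i. taylor m (a i) p) \<longlongrightarrow> taylor m b p) F"
  unfolding taylor_def by (intro tendsto_sum tendsto_hp tendsto_const assms) auto

text \<open>With \<open>N\<close> fixed the finitely many relevant coefficients are bounded, so they
  converge along a subsequence, and every condition in \<open>taylor_bound\<close> is
  closed.\<close>

lemma taylor_bound_closed:
  fixes x :: "nat \<Rightarrow> real ^ 'n::finite"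
  assumes bnd: "\<And>i. \<exists>a. taylor_bound F N m (x i) a" and x: "x \<longlonglongrightarrow> x0"
    and F: "\<And>p. ((\<lambda>y. F (y, p)) \<longlongrightarrow> F (x0, p)) (nhds x0)"
  shows "\<exists>a. taylor_bound F N m x0 a"
proof -
  have "\<forall>i. \<exists>a. taylor_bound F N m (x i) a" using bnd by (rule allI)
  from choice[OF this] obtain a where a: "\<And>i. taylor_bound F N m (x i) (a i)" by blast
  have "\<exists>s. strict_mono s \<and> (\<forall>\<alpha>\<in>{\<alpha> :: 'n \<Rightarrow> nat. mdeg \<alpha> \<le> m}. \<exists>l. (\<lambda>i. a (s i) \<alpha>) \<longlonglongrightarrow> l)"
  proof (rule common_subsequence)
    fix \<alpha> :: "'n \<Rightarrow> nat" and s :: "nat \<Rightarrow> nat" assume "\<alpha> \<in> {\<alpha>. mdeg \<alpha> \<le> m}"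
    then have "\<bar>a (s i) \<alpha>\<bar> \<le> N" for i using a[of "s i"] unfolding taylor_bound_def by (auto simp: mons_def)
    then have "\<forall>i. a (s i) \<alpha> \<in> {-N..N}" by (auto simp: abs_le_iff) (metis minus_le_iff)
    then obtain l r where "strict_mono (r :: nat \<Rightarrow> nat)" "((\<lambda>i. a (s i) \<alpha>) \<circ> r) \<longlonglongrightarrow> l"
      using compact_imp_seq_compact[OF compact_Icc, of "-N" N, unfolded seq_compact_def, rule_format, of "\<lambda>i. a (s i) \<alpha>"] by blast
    then show "\<exists>r. strict_mono r \<and> (\<exists>l. (\<lambda>i. a ((s \<circ> r) i) \<alpha>) \<longlonglongrightarrow> l)" by (auto simp: o_def)
  next
    fix \<alpha> :: "'n \<Rightarrow> nat" and s r :: "nat \<Rightarrow> nat"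
    assume "\<exists>l. (\<lambda>i. a (s i) \<alpha>) \<longlonglongrightarrow> l" "strict_mono r"
    then show "\<exists>l. (\<lambda>i. a ((s \<circ> r) i) \<alpha>) \<longlonglongrightarrow> l"
      using LIMSEQ_subseq_LIMSEQ[of "\<lambda>i. a (s i) \<alpha>" _ r] by (auto simp: o_def)
  qed simp
  then obtain s where s: "strict_mono s" "\<forall>\<alpha>\<in>{\<alpha> :: 'n \<Rightarrow> nat. mdeg \<alpha> \<le> m}. \<exists>l. (\<lambda>i. a (s i) \<alpha>) \<longlonglongrightarrow> l" by blast
  from bchoice[OF s(2)] obtain b where b: "\<forall>\<alpha>\<in>{\<alpha> :: 'n \<Rightarrow> nat. mdeg \<alpha> \<le> m}. (\<lambda>i. a (s i) \<alpha>) \<longlonglongrightarrow> b \<alpha>" by blast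
  have bl: "(\<lambda>i. a (s i) \<alpha>) \<longlonglongrightarrow> b \<alpha>" if "j \<le> m" "\<alpha> \<in> mons j" for j \<alpha>
    using b that by (auto simp: mons_def)
  have xs: "(\<lambda>i. x (s i)) \<longlonglongrightarrow> x0" using LIMSEQ_subseq_LIMSEQ[OF x s(1)] by (simp add: o_def)
  have Fl: "(\<lambda>i. F (x (s i), p)) \<longlonglongrightarrow> F (x0, p)" for p by (rule filterlim_compose[OF F xs])
  have "taylor_bound F N m x0 b"
    unfolding taylor_bound_def
  proof (intro conjI allI impI ballI)
    fix j and \<alpha> :: "'n \<Rightarrow> nat" assume j: "j \<le> m" "\<alpha> \<in> mons j"
    show "\<bar>b \<alpha>\<bar> \<le> N"
      by (rule tendsto_upperbound[OF tendsto_rabs[OF bl[OF j]]]) (use a j in \<open>auto simp: taylor_bound_def\<close>)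
  next
    have "(\<lambda>i. taylor m (a (s i)) 0) \<longlonglongrightarrow> taylor m b 0" by (rule tendsto_taylor[OF bl])
    moreover have "taylor m (a (s i)) 0 = F (x (s i), 0)" for i using a[of "s i"] unfolding taylor_bound_def by simp
    ultimately show "F (x0, 0) = taylor m b 0" using LIMSEQ_unique[OF Fl[of 0]] by simp
  next
    fix p q :: "real ^ 'n" and \<sigma> assume *: "norm p \<le> \<sigma>" "norm q \<le> \<sigma>" "\<sigma> * N \<le> 1"
    have "(\<lambda>i. \<bar>(F (x (s i), p) - taylor m (a (s i)) p) - (F (x (s i), q) - taylor m (a (s i)) q)\<bar>)
      \<longlonglongrightarrow> \<bar>(F (x0, p) - taylor m b p) - (F (x0, q) - taylor m b q)\<bar>"
      by (intro tendsto_intros Fl tendsto_taylor[OF bl])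
    then show "\<bar>(F (x0, p) - taylor m b p) - (F (x0, q) - taylor m b q)\<bar> \<le> N * \<sigma> ^ m * norm (p - q)"
      by (rule tendsto_upperbound) (use a * in \<open>auto simp: taylor_bound_def\<close>)
  qed
  then show ?thesis by blast
qed

lemma taylor_bound_on_ball:
  fixes D :: "(real ^ 'n::finite) set"
  assumes D: "open D" and an: "analytic_in_momenta D F" and cont: "continuous_on (D \<times> UNIV) F"
    and y: "cball y \<delta> \<subseteq> D" "\<delta> > 0"
  shows "\<exists>z \<epsilon> N. \<epsilon> > 0 \<and> cball z \<epsilon> \<subseteq> cball y \<delta> \<and> (\<forall>x\<in>cball z \<epsilon>. \<exists>a. taylor_bound F N m x a)"
proof -
  define T where "T N = {x\<in>cball y \<delta>. \<exists>a. taylor_bound F (real N) m x a}" for N :: nat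
  have oD: "open (D \<times> (UNIV :: (real ^ 'n) set))" using D by (intro open_Times) auto
  have Fc: "((\<lambda>z. F (z, p)) \<longlongrightarrow> F (x, p)) (nhds x)" if "x \<in> D" for x p
  proof -
    have "isCont F (x, p)" using cont that continuous_on_eq_continuous_at[OF oD] by auto
    moreover have "isCont (\<lambda>z. (z, p)) x" by (intro continuous_intros)
    ultimately have "isCont (\<lambda>z. F (z, p)) x" using isCont_o2[of x "\<lambda>z. (z, p)" F] by blast
    then show ?thesis unfolding isCont_def tendsto_at_iff_tendsto_nhds[of "\<lambda>z. F (z, p)" x] .
  qed
  have cl: "closed (T N)" for N
    unfolding closed_sequential_limits
  proof (intro allI impI, elim conjE)
    fix x l assume x: "\<forall>n. x n \<in> T N" "x \<longlonglongrightarrow> l"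
    have l: "l \<in> cball y \<delta>" by (rule closed_sequentially[OF closed_cball _ x(2)]) (use x(1) in \<open>auto simp: T_def\<close>)
    have "\<exists>a. taylor_bound F (real N) m l a"
      by (rule taylor_bound_closed[OF _ x(2)]) (use x(1) l y(1) Fc in \<open>auto simp: T_def\<close>)
    then show "l \<in> T N" using l unfolding T_def by simp
  qed
  have "\<exists>N. interior (T N) \<noteq> {}"
  proof (rule ccontr)
    assume "\<not> ?thesis"
    then have emp: "interior (T N) = {}" for N by blast
    have "(UNIV :: (real ^ 'n) set) \<subseteq> closure (\<Inter> (range (\<lambda>N. - T N)))"
    proof (rule Baire)
      fix S assume "S \<in> range (\<lambda>N. - T N)"
      then obtain N where "S = - T N" by blast
      then show "openin (top_of_set UNIV) S \<and> UNIV \<subseteq> closure S"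
        using cl[of N] emp[of N] by (simp add: closure_complement open_Compl)
    qed auto
    moreover have "\<Inter> (range (\<lambda>N. - T N)) \<subseteq> - cball y \<delta>"
    proof
      fix x assume x: "x \<in> \<Inter> (range (\<lambda>N. - T N))"
      show "x \<in> - cball y \<delta>"
      proof
        assume xc: "x \<in> cball y \<delta>"
        obtain N a where "taylor_bound F (real (N :: nat)) m x a" using taylor_bound_ex[OF an] xc y(1) by blast
        then have "x \<in> T N" using xc unfolding T_def by blast
        then show False using x by blast
      qed
    qed
    ultimately have "UNIV \<subseteq> closure (- cball y \<delta>)" using closure_mono by blast
    then have "y \<in> closure (- cball y \<delta>)" by blast
    then show False using y(2) by (simp add: closure_complement)
  qed
  then obtain N z where "z \<in> interior (T N)" by blast
  then obtain \<epsilon> where "\<epsilon> > 0" "cball z \<epsilon> \<subseteq> T N" unfolding mem_interior_cball by blast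
  then show ?thesis unfolding T_def by blast
qed

text \<open>Subtracting the lower terms and dividing by \<open>s ^ j\<close> isolates
  \<open>p j\<close>. At most \<open>m\<close> higher terms and the remainder are left, each
  carrying an additional factor \<open>s\<close>.\<close>

lemma expansion_coefficient_bound:
  fixes p :: "nat \<Rightarrow> real"
  assumes X: "\<bar>X - (\<Sum>i\<le>m. s ^ i * p i)\<bar> \<le> C * s ^ Suc m" and L: "\<And>i. i \<le> m \<Longrightarrow> \<bar>p i\<bar> \<le> L"
    and s: "0 < s" "s \<le> 1" and j: "j \<le> m" and C: "C \<ge> 0" and L0: "L \<ge> 0"
  shows "\<bar>(X - (\<Sum>i<j. s ^ i * p i)) / s ^ j - p j\<bar> \<le> s * (real m * L + C)"
proof -
  have split: "(\<Sum>i\<le>m. s ^ i * p i) = (\<Sum>i<j. s ^ i * p i) + (s ^ j * p j + (\<Sum>i\<in>{j<..m}. s ^ i * p i))"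
  proof -
    have "{..m} = {..<j} \<union> ({j} \<union> {j<..m})" using j by auto
    moreover have "(\<Sum>i\<in>{..<j} \<union> ({j} \<union> {j<..m}). s ^ i * p i) = (\<Sum>i<j. s ^ i * p i) + (\<Sum>i\<in>{j} \<union> {j<..m}. s ^ i * p i)"
      by (rule sum.union_disjoint) auto
    moreover have "(\<Sum>i\<in>{j} \<union> {j<..m}. s ^ i * p i) = s ^ j * p j + (\<Sum>i\<in>{j<..m}. s ^ i * p i)"
      by (subst sum.union_disjoint) auto
    ultimately show ?thesis by simp
  qed
  have tail: "\<bar>\<Sum>i\<in>{j<..m}. s ^ i * p i\<bar> \<le> real m * L * s ^ Suc j"
  proof -
    have "\<bar>\<Sum>i\<in>{j<..m}. s ^ i * p i\<bar> \<le> (\<Sum>i\<in>{j<..m}. \<bar>s ^ i * p i\<bar>)" by (rule sum_abs)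
    also have "\<dots> \<le> (\<Sum>i\<in>{j<..m}. s ^ Suc j * L)"
    proof (rule sum_mono)
      fix i assume i: "i \<in> {j<..m}"
      then have "s ^ i \<le> s ^ Suc j" using s by (intro power_decreasing) auto
      then show "\<bar>s ^ i * p i\<bar> \<le> s ^ Suc j * L" unfolding abs_mult using L[of i] i s by (intro mult_mono) auto
    qed
    also have "\<dots> = real (m - j) * (s ^ Suc j * L)" by simp
    also have "\<dots> \<le> real m * (s ^ Suc j * L)" using s L0 by (intro mult_right_mono) auto
    finally show ?thesis by (simp add: mult_ac)
  qed
  have sm: "C * s ^ Suc m \<le> C * s ^ Suc j" using s j C by (intro mult_left_mono power_decreasing) auto
  have "(X - (\<Sum>i<j. s ^ i * p i)) / s ^ j - p j = (X - (\<Sum>i<j. s ^ i * p i) - s ^ j * p j) / s ^ j"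
    using s by (simp add: field_simps)
  also have "\<bar>\<dots>\<bar> = \<bar>X - (\<Sum>i<j. s ^ i * p i) - s ^ j * p j\<bar> / s ^ j" using s by (simp add: abs_divide)
  also have "\<dots> \<le> (s ^ Suc j * (real m * L + C)) / s ^ j"
  proof (rule divide_right_mono)
    have "X - (\<Sum>i<j. s ^ i * p i) - s ^ j * p j = (X - (\<Sum>i\<le>m. s ^ i * p i)) + (\<Sum>i\<in>{j<..m}. s ^ i * p i)"
      unfolding split by simp
    then have "\<bar>X - (\<Sum>i<j. s ^ i * p i) - s ^ j * p j\<bar> \<le> C * s ^ Suc j + real m * L * s ^ Suc j"
      using X tail sm by linarith
    then show "\<bar>X - (\<Sum>i<j. s ^ i * p i) - s ^ j * p j\<bar> \<le> s ^ Suc j * (real m * L + C)" by (simp add: algebra_simps)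
  qed (use s in simp)
  finally show ?thesis using s by simp
qed

lemma taylor_boundD:
  assumes "taylor_bound F N m x a" "norm p \<le> \<sigma>" "norm q \<le> \<sigma>" "\<sigma> * N \<le> 1"
  shows "\<bar>(F (x, p) - taylor m a p) - (F (x, q) - taylor m a q)\<bar> \<le> N * \<sigma> ^ m * norm (p - q)"
  using assms unfolding taylor_bound_def by blast

lemma taylor_scale: "taylor m a (s *\<^sub>R p) = (\<Sum>i\<le>m. s ^ i * hp i a p)"
  unfolding taylor_def hp_scale ..

lemma taylor_remainder_derivative:
  assumes tb: "taylor_bound F N m y a" and hd: "has_dir_deriv F (0, u) (y, p)"
    and p: "norm p < \<sigma>" and \<sigma>: "\<sigma> * N \<le> 1"
  shows "\<bar>dir_deriv F (0, u) (y, p) - (\<Sum>i\<le>m. dhp i a p u)\<bar> \<le> N * \<sigma> ^ m * norm u"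
proof -
  have "((\<lambda>t. F (y, p + t *\<^sub>R u)) has_real_derivative dir_deriv F (0, u) (y, p)) (at 0)"
    using hd unfolding has_dir_deriv_iff by simp
  moreover have "((\<lambda>t. taylor m a (p + t *\<^sub>R u)) has_real_derivative (\<Sum>i\<le>m. dhp i a (p + 0 *\<^sub>R u) u)) (at 0)"
    unfolding taylor_def by (intro DERIV_sum hp_along_line_derivative)
  ultimately have "((\<lambda>t. F (y, p + t *\<^sub>R u) - taylor m a (p + t *\<^sub>R u)) has_real_derivative
      (dir_deriv F (0, u) (y, p) - (\<Sum>i\<le>m. dhp i a p u))) (at 0)"
    by (auto intro: DERIV_diff)
  then have lim: "((\<lambda>t. \<bar>((F (y, p + t *\<^sub>R u) - taylor m a (p + t *\<^sub>R u)) - (F (y, p) - taylor m a p)) / t\<bar>) \<longlongrightarrow>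
      \<bar>dir_deriv F (0, u) (y, p) - (\<Sum>i\<le>m. dhp i a p u)\<bar>) (at 0)"
    unfolding has_field_derivative_iff by (intro tendsto_rabs) simp
  have "((\<lambda>t::real. norm (p + t *\<^sub>R u)) \<longlongrightarrow> norm (p + 0 *\<^sub>R u)) (at 0)" by (intro tendsto_intros)
  then have "eventually (\<lambda>t. norm (p + t *\<^sub>R u) < \<sigma>) (at 0)" using p by (intro order_tendstoD(2)) auto
  moreover have "eventually (\<lambda>t::real. t \<noteq> 0) (at 0)" by (simp add: eventually_at_filter)
  ultimately have "eventually (\<lambda>t. \<bar>((F (y, p + t *\<^sub>R u) - taylor m a (p + t *\<^sub>R u)) - (F (y, p) - taylor m a p)) / t\<bar> \<le> N * \<sigma> ^ m * norm u) (at 0)"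
  proof eventually_elim
    case (elim t)
    have "\<bar>(F (y, p + t *\<^sub>R u) - taylor m a (p + t *\<^sub>R u)) - (F (y, p) - taylor m a p)\<bar> \<le> N * \<sigma> ^ m * norm (p + t *\<^sub>R u - p)"
      using tb[unfolded taylor_bound_def] elim p \<sigma> by (meson less_imp_le)
    also have "\<dots> = (N * \<sigma> ^ m * norm u) * \<bar>t\<bar>" by simp
    finally show ?case using elim by (simp add: abs_divide pos_divide_le_eq)
  qed
  then show ?thesis by (rule tendsto_upperbound[OF lim]) simp
qed

text \<open>No regularity of \<open>a\<close> in the position is assumed. The term of degree
  \<open>j\<close> is a uniform limit, as the scale \<open>s\<close> tends to 0, of quotients built
  from \<open>F\<close> and the lower terms. These are differentiable along the line and their
  derivatives converge uniformly too, so the limit may be differentiated.\<close>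

lemma taylor_coefficients_line:
  fixes D :: "(real ^ 'n::finite) set" and a :: "real ^ 'n \<Rightarrow> ('n \<Rightarrow> nat) \<Rightarrow> real"
  assumes D: "open D" and g: "g \<in> Ck_metrics k D" and k: "k \<ge> 1" and F: "geodesic_integral D g F"
    and K: "K \<subseteq> D" "compact K" "convex K" and tb: "\<And>x. x \<in> K \<Longrightarrow> taylor_bound F N m x (a x)" and N: "N \<ge> 0"
    and j: "j \<le> m" and xt: "x + t *\<^sub>R v \<in> K"
  shows "((\<lambda>t. hp j (a (x + t *\<^sub>R v)) (g (x + t *\<^sub>R v) *v v)) has_real_derivative
     dhp j (a (x + t *\<^sub>R v)) (g (x + t *\<^sub>R v) *v v) (gam g (x + t *\<^sub>R v) v)) (at t within {t. x + t *\<^sub>R v \<in> K})"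
proof -
  define S where "S = {t. x + t *\<^sub>R v \<in> K}"
  define w where "w t = g (x + t *\<^sub>R v) *v v" for t
  define \<gamma> where "\<gamma> t = gam g (x + t *\<^sub>R v) v" for t
  define P where "P i t = hp i (a (x + t *\<^sub>R v)) (w t)" for i t
  define P' where "P' i t = dhp i (a (x + t *\<^sub>R v)) (w t) (\<gamma> t)" for i t
  have gc: "continuous_on K (\<lambda>y. g y *v v)"
    unfolding continuous_on_def
  proof (intro ballI tendsto_matrix_vector_mult tendsto_const vec_tendstoI)
    fix y b c assume "y \<in> K"
    then show "((\<lambda>y. g y $ b $ c) \<longlongrightarrow> g y $ b $ c) (at y within K)"
      using Ck_metrics_entries(1)[OF g k D, of b c] K(1) continuous_on_subset continuous_on_def by blast
  qed
  have gac: "continuous_on K (\<lambda>y. gam g y v)"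
    unfolding continuous_on_def
  proof (intro ballI tendsto_gam tendsto_const)
    fix y i b c assume "y \<in> K"
    then show "(dg g i b c \<longlongrightarrow> dg g i b c y) (at y within K)"
      using Ck_metrics_entries(2)[OF g k D, of i b c] K(1) continuous_on_subset continuous_on_def by blast
  qed
  obtain C1 where C1: "\<And>y. y \<in> K \<Longrightarrow> norm (g y *v v) \<le> C1"
    using compact_imp_bounded[OF compact_continuous_image[OF gc K(2)]] unfolding bounded_iff by auto
  obtain C2 where C2: "\<And>y. y \<in> K \<Longrightarrow> norm (gam g y v) \<le> C2"
    using compact_imp_bounded[OF compact_continuous_image[OF gac K(2)]] unfolding bounded_iff by auto
  define C where "C = \<bar>C1\<bar> + \<bar>C2\<bar> + 1"
  have C: "C \<ge> 1" unfolding C_def by simp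
  have wC: "norm (w t) \<le> C" "norm (\<gamma> t) \<le> C" if "t \<in> S" for t
    using C1[of "x + t *\<^sub>R v"] C2[of "x + t *\<^sub>R v"] that unfolding w_def \<gamma>_def S_def C_def by auto
  define L1 where "L1 i = real (card (mons i :: ('n \<Rightarrow> nat) set)) * C ^ i * N" for i
  define L2 where "L2 i = real (card (mons i :: ('n \<Rightarrow> nat) set)) * real i * C ^ (i - 1) * N * C" for i
  define L where "L = (\<Sum>i\<le>m. L1 i + L2 i)"
  have L12: "L1 i \<ge> 0" "L2 i \<ge> 0" for i unfolding L1_def L2_def using C N by auto
  have L0: "L \<ge> 0" unfolding L_def using L12 by (intro sum_nonneg add_nonneg_nonneg)
  have aN: "\<bar>a y \<alpha>\<bar> \<le> N" if "y \<in> K" "i \<le> m" "\<alpha> \<in> mons i" for y i \<alpha>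
    using tb[OF that(1)] that(2,3) unfolding taylor_bound_def by blast
  have LL: "L1 i + L2 i \<le> L" if "i \<le> m" for i
    unfolding L_def using that L12 by (intro member_le_sum) auto
  have PL: "\<bar>P i t\<bar> \<le> L" if i: "i \<le> m" and t: "t \<in> S" for i t
  proof -
    have "\<bar>P i t\<bar> \<le> L1 i" unfolding P_def L1_def
      by (rule hp_bound) (use aN i t wC S_def in auto)
    then show ?thesis using LL[OF i] L12(2)[of i] by linarith
  qed
  have P'L: "\<bar>P' i t\<bar> \<le> L" if i: "i \<le> m" and t: "t \<in> S" for i t
  proof -
    have "\<bar>P' i t\<bar> \<le> real (card (mons i :: ('n \<Rightarrow> nat) set)) * real i * C ^ (i - 1) * N * norm (\<gamma> t)" unfolding P'_def
      by (rule dhp_bound) (use aN i t wC S_def in auto)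
    also have "\<dots> \<le> L2 i" unfolding L2_def using wC(2)[OF t] C N by (intro mult_left_mono) auto
    finally show ?thesis using LL[OF i] L12(1)[of i] by linarith
  qed
  \<comment> \<open>Makes the radius \<open>2 * C * s\<close> admissible in
    \<open>taylor_bound\<close> for all \<open>s \<le> s0\<close>. The factor 2 provides the strict
    inequality required by \<open>taylor_remainder_derivative\<close>.\<close>
  define s0 where "s0 = 1 / (2 * C * (N + 1))"
  have s0: "s0 > 0" "s0 \<le> 1"
  proof -
    have "2 * C * (N + 1) \<ge> 1 * 1" using C N by (intro mult_mono) auto
    then show "s0 > 0" "s0 \<le> 1" unfolding s0_def by auto
  qed
  define E where "E = N * (2 * C) ^ m * C"
  have E: "E \<ge> 0" unfolding E_def using N C by auto
  have \<sigma>N: "2 * C * s * N \<le> 1" if "0 < s" "s \<le> s0" for s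
  proof -
    have "2 * C * s * N \<le> 2 * C * s0 * (N + 1)" using that N C by (intro mult_mono) auto
    also have "\<dots> = 1" unfolding s0_def using N C by auto
    finally show ?thesis .
  qed
  have exp1: "\<bar>F (x + t *\<^sub>R v, s *\<^sub>R w t) - (\<Sum>i\<le>m. s ^ i * P i t)\<bar> \<le> E * s ^ Suc m"
    if t: "t \<in> S" and s: "0 < s" "s \<le> s0" for s t
  proof -
    let ?y = "x + t *\<^sub>R v"
    have yK: "?y \<in> K" using t unfolding S_def by simp
    have "norm (s *\<^sub>R w t) \<le> s * C" using wC(1)[OF t] s by (simp add: mult_left_mono)
    also have "\<dots> \<le> 2 * C * s" using s C by simp
    finally have n: "norm (s *\<^sub>R w t) \<le> 2 * C * s" .
    have "\<bar>(F (?y, s *\<^sub>R w t) - taylor m (a ?y) (s *\<^sub>R w t)) - (F (?y, 0) - taylor m (a ?y) 0)\<bar> \<le> N * (2 * C * s) ^ m * norm (s *\<^sub>R w t - 0)"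
      by (rule taylor_boundD[OF tb[OF yK] n _ \<sigma>N[OF s]]) (use s C in auto)
    moreover have "F (?y, 0) = taylor m (a ?y) 0" using tb[OF yK] unfolding taylor_bound_def by blast
    ultimately have "\<bar>F (?y, s *\<^sub>R w t) - (\<Sum>i\<le>m. s ^ i * P i t)\<bar> \<le> N * (2 * C * s) ^ m * norm (s *\<^sub>R w t)"
      unfolding taylor_scale P_def by simp
    also have "\<dots> \<le> N * (2 * C * s) ^ m * (s * C)"
      using wC(1)[OF t] s N C by (intro mult_left_mono) (auto simp: mult_left_mono)
    also have "\<dots> = E * s ^ Suc m" unfolding E_def by (simp add: power_mult_distrib mult_ac)
    finally show ?thesis .
  qed
  define dF where "dF s t = dir_deriv F (0, \<gamma> t) (x + t *\<^sub>R v, s *\<^sub>R w t)" for s t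
  \<comment> \<open>By \<open>dhp_scale\<close>, the extra factor \<open>s\<close> makes the
    derivative expand in the same powers of \<open>s\<close> as \<open>F\<close> itself, so the same
    coefficient estimate serves both.\<close>
  have exp2: "\<bar>s * dF s t - (\<Sum>i\<le>m. s ^ i * P' i t)\<bar> \<le> E * s ^ Suc m"
    if t: "t \<in> S" and s: "0 < s" "s \<le> s0" for s t
  proof -
    let ?y = "x + t *\<^sub>R v"
    have yK: "?y \<in> K" using t unfolding S_def by simp
    have oD: "open (D \<times> (UNIV :: (real ^ 'n) set))" using D by (intro open_Times) auto
    have "F differentiable (at (?y, s *\<^sub>R w t))"
      using F yK K(1) unfolding geodesic_integral_def differentiable_on_eq_differentiable_at[OF oD] by auto
    then have hd: "has_dir_deriv F (0, \<gamma> t) (?y, s *\<^sub>R w t)"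
      unfolding differentiable_def using dir_deriv_of_has_derivative(1) by blast
    have "norm (s *\<^sub>R w t) \<le> s * C" using wC(1)[OF t] s by (simp add: mult_left_mono)
    also have "\<dots> < 2 * C * s" using s C by simp
    finally have n: "norm (s *\<^sub>R w t) < 2 * C * s" .
    have "s * dF s t - (\<Sum>i\<le>m. s ^ i * P' i t) = s * (dF s t - (\<Sum>i\<le>m. dhp i (a ?y) (s *\<^sub>R w t) (\<gamma> t)))"
      unfolding P'_def right_diff_distrib sum_distrib_left dhp_scale ..
    also have "\<bar>\<dots>\<bar> = s * \<bar>dF s t - (\<Sum>i\<le>m. dhp i (a ?y) (s *\<^sub>R w t) (\<gamma> t))\<bar>" using s by (simp add: abs_mult)
    also have "\<dots> \<le> s * (N * (2 * C * s) ^ m * norm (\<gamma> t))"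
      unfolding dF_def using s by (intro mult_left_mono taylor_remainder_derivative[OF tb[OF yK] hd n \<sigma>N]) auto
    also have "\<dots> \<le> s * (N * (2 * C * s) ^ m * C)"
      using wC(2)[OF t] s N C by (intro mult_left_mono) auto
    also have "\<dots> = E * s ^ Suc m" unfolding E_def by (simp add: power_mult_distrib mult_ac)
    finally show ?thesis .
  qed
  define s where "s n = s0 * inverse (real (Suc n))" for n
  have s: "0 < s n" "s n \<le> s0" "s n \<le> 1" for n
  proof -
    have "inverse (real (Suc n)) \<le> 1" by (simp add: field_simps)
    then have "s n \<le> s0 * 1" unfolding s_def by (rule mult_left_mono) (use s0 in simp)
    then show "s n \<le> s0" "s n \<le> 1" using s0 by linarith+
    show "0 < s n" unfolding s_def using s0 by simp
  qed
  have slim: "(\<lambda>n. s n * c) \<longlonglongrightarrow> 0" for c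
    unfolding s_def using tendsto_mult_left_zero[OF tendsto_mult_right_zero[OF LIMSEQ_inverse_real_of_nat, of s0], of c] .
  have "(P j has_real_derivative P' j t) (at t within S)" if "t \<in> S" for t
    using j that
  proof (induction j arbitrary: t rule: less_induct)
    case (less j)
    let ?c = "real m * L + E"
    show ?case
    proof (rule DERIV_sequence_limit[where f = "\<lambda>n t. (F (x + t *\<^sub>R v, s n *\<^sub>R w t) - (\<Sum>i<j. s n ^ i * P i t)) / s n ^ j"
          and f' = "\<lambda>n t. (s n * dF (s n) t - (\<Sum>i<j. s n ^ i * P' i t)) / s n ^ j"])
      show "convex S" unfolding S_def by (rule convex_line_section[OF K(3)])
      show "t \<in> S" by (rule less.prems)
    next
      fix n t assume t: "t \<in> S"
      have "((\<lambda>t. F (x + t *\<^sub>R v, s n *\<^sub>R w t)) has_real_derivative s n * dF (s n) t) (at t within S)"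
        unfolding w_def dF_def \<gamma>_def
        by (rule has_field_derivative_at_within, rule integral_along_line[OF D g k F])
          (use t K(1) s(1)[of n] in \<open>auto simp: S_def\<close>)
      moreover have "((\<lambda>t. \<Sum>i<j. s n ^ i * P i t) has_real_derivative (\<Sum>i<j. s n ^ i * P' i t)) (at t within S)"
        by (intro DERIV_sum DERIV_cmult less.IH) (use less.prems t in auto)
      ultimately show "((\<lambda>t. (F (x + t *\<^sub>R v, s n *\<^sub>R w t) - (\<Sum>i<j. s n ^ i * P i t)) / s n ^ j) has_real_derivative
          (s n * dF (s n) t - (\<Sum>i<j. s n ^ i * P' i t)) / s n ^ j) (at t within S)"
        by (intro DERIV_cdivide DERIV_diff)
    next
      fix e :: real assume e: "e > 0"
      have "eventually (\<lambda>n. s n * ?c < e) sequentially" using slim[of ?c] e by (intro order_tendstoD(2)) auto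
      then obtain M where M: "\<And>n. n \<ge> M \<Longrightarrow> s n * ?c < e" unfolding eventually_sequentially by blast
      have "\<bar>(s n * dF (s n) t - (\<Sum>i<j. s n ^ i * P' i t)) / s n ^ j - P' j t\<bar> < e" if n: "n \<ge> M" and t: "t \<in> S" for n t
        using expansion_coefficient_bound[OF exp2[OF t s(1,2)] P'L[OF _ t] s(1,3) less.prems(1) E L0, of n] M[OF n] by linarith
      then show "\<exists>M. \<forall>n\<ge>M. \<forall>t\<in>S. \<bar>(s n * dF (s n) t - (\<Sum>i<j. s n ^ i * P' i t)) / s n ^ j - P' j t\<bar> < e" by blast
    next
      fix t assume t: "t \<in> S"
      have "(\<lambda>n. (F (x + t *\<^sub>R v, s n *\<^sub>R w t) - (\<Sum>i<j. s n ^ i * P i t)) / s n ^ j - P j t) \<longlonglongrightarrow> 0"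
      proof (rule Lim_null_comparison[OF _ slim[of ?c]])
        show "\<forall>\<^sub>F n in sequentially. norm ((F (x + t *\<^sub>R v, s n *\<^sub>R w t) - (\<Sum>i<j. s n ^ i * P i t)) / s n ^ j - P j t) \<le> s n * ?c"
          using expansion_coefficient_bound[OF exp1[OF t s(1,2)] PL[OF _ t] s(1,3) less.prems(1) E L0] by simp
      qed
      then show "(\<lambda>n. (F (x + t *\<^sub>R v, s n *\<^sub>R w t) - (\<Sum>i<j. s n ^ i * P i t)) / s n ^ j) \<longlonglongrightarrow> P j t"
        by (simp add: LIM_zero_iff)
    qed
  qed
  from this[of t] xt show ?thesis unfolding S_def P_def[abs_def] P'_def w_def \<gamma>_def by simp
qed

lemma weak_integral_of_taylor_coefficients:
  fixes D :: "(real ^ 'n::finite) set" and a :: "real ^ 'n \<Rightarrow> ('n \<Rightarrow> nat) \<Rightarrow> real"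
  assumes D: "open D" and g: "g \<in> Ck_metrics k D" and k: "k \<ge> 1" and F: "geodesic_integral D g F"
    and K: "cball z \<epsilon> \<subseteq> D" and tb: "\<And>x. x \<in> cball z \<epsilon> \<Longrightarrow> taylor_bound F N m x (a x)" and N: "N \<ge> 0"
    and j: "j \<le> m"
  shows "\<exists>b B. weak_integral (cball z \<epsilon>) j g b \<and> (\<forall>x\<in>cball z \<epsilon>. \<forall>\<alpha>\<in>mons j. \<bar>b x \<alpha>\<bar> \<le> B) \<and>
     (\<forall>x v. hp j (b x) v = hp j (a x) (g x *v v))"
proof -
  let ?K = "cball z \<epsilon>"
  have "\<forall>x. \<exists>b. \<forall>v. hp j (a x) (g x *v v) = hp j b v" using hp_linear_substitution by blast
  from choice[OF this] obtain b where b: "\<And>x v. hp j (a x) (g x *v v) = hp j (b x) v" by blast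
  have db: "dhp j (b x) v u = dhp j (a x) (g x *v v) (g x *v u)" for x v u
  proof -
    have l: "((\<lambda>v. g x *v v) has_derivative (\<lambda>u. g x *v u)) (at v)"
      by (intro bounded_linear_imp_has_derivative matrix_vector_mul_bounded_linear)
    have "((\<lambda>v. hp j (a x) (g x *v v)) has_derivative (\<lambda>u. dhp j (a x) (g x *v v) (g x *v u))) (at v)"
      by (rule has_derivative_compose[OF l hp_has_derivative])
    then have "(hp j (b x) has_derivative (\<lambda>u. dhp j (a x) (g x *v v) (g x *v u))) (at v)" unfolding b .
    from has_derivative_unique[OF this hp_has_derivative] show ?thesis by metis
  qed
  have "weak_integral ?K j g b"
    unfolding weak_integral_def line_eq_def
  proof (intro allI impI)
    fix x v t assume xt: "x + t *\<^sub>R v \<in> ?K"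
    have "g (x + t *\<^sub>R v) *v Gam g (x + t *\<^sub>R v) v = gam g (x + t *\<^sub>R v) v"
      unfolding Gam_def using matrix_inv_vec(1) Ck_metrics_invertible[OF g] K xt by blast
    then show "((\<lambda>s. hp j (b (x + s *\<^sub>R v)) v) has_real_derivative dhp j (b (x + t *\<^sub>R v)) v (Gam g (x + t *\<^sub>R v) v))
         (at t within {s. x + s *\<^sub>R v \<in> ?K})"
      using taylor_coefficients_line[OF D g k F K compact_cball convex_cball tb N j xt] unfolding db b by simp
  qed
  \<comment> \<open>\<open>b\<close> was merely chosen pointwise, so its bound is recovered from its
    values, which are bounded through those of \<open>a\<close>.\<close>
  moreover have "\<exists>B. \<forall>x\<in>?K. \<forall>\<alpha>\<in>mons j. \<bar>b x \<alpha>\<bar> \<le> B"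
  proof -
    obtain I :: "('n \<Rightarrow> nat) set" and \<zeta> :: "('n \<Rightarrow> nat) \<Rightarrow> real ^ 'n" and \<Lambda> where I: "finite I" "\<zeta> ` I \<subseteq> cball 0 1"
      and co: "\<forall>a x. \<forall>\<alpha>\<in>mons j. a \<alpha> = (\<Sum>\<kappa>\<in>I. \<Lambda> \<alpha> \<kappa> * hp j a (\<zeta> \<kappa> - x))"
      using hp_coefficients_from_values[OF zero_less_one, of 0 j] by (elim exE conjE) (rule that)
    have gc: "continuous_on ?K g"
      unfolding continuous_on_def
    proof (intro ballI vec_tendstoI)
      fix y b c assume "y \<in> ?K"
      then show "((\<lambda>y. g y $ b $ c) \<longlongrightarrow> g y $ b $ c) (at y within ?K)"
        using Ck_metrics_entries(1)[OF g k D, of b c] K continuous_on_subset continuous_on_def by blast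
    qed
    obtain C where C: "C > 0" "\<And>y. y \<in> ?K \<Longrightarrow> norm (g y) \<le> C"
      using compact_imp_bounded[OF compact_continuous_image[OF gc compact_cball]] unfolding bounded_pos by auto
    define V where "V = (real CARD('n))\<^sup>2 * C"
    define B where "B = real (card (mons j :: ('n \<Rightarrow> nat) set)) * V ^ j * N"
    have B: "\<bar>hp j (b x) (\<zeta> \<kappa> - 0)\<bar> \<le> B" if x: "x \<in> ?K" and \<kappa>: "\<kappa> \<in> I" for x \<kappa>
    proof -
      have "norm (\<zeta> \<kappa>) \<le> 1" using I \<kappa> by auto
      have "norm (g x *v \<zeta> \<kappa>) \<le> (real CARD('n))\<^sup>2 * norm (g x) * norm (\<zeta> \<kappa>)" by (rule norm_matrix_vector_le)
      also have "\<dots> \<le> (real CARD('n))\<^sup>2 * C * 1"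
        using C(2)[OF x] C(1) \<open>norm (\<zeta> \<kappa>) \<le> 1\<close> by (intro mult_mono) auto
      finally have n: "norm (g x *v \<zeta> \<kappa>) \<le> V" unfolding V_def by simp
      have "\<bar>hp j (a x) (g x *v \<zeta> \<kappa>)\<bar> \<le> B"
        unfolding B_def by (rule hp_bound[OF _ n]) (use tb[OF x] j in \<open>auto simp: taylor_bound_def\<close>)
      then show ?thesis unfolding b by simp
    qed
    have "\<bar>b x \<alpha>\<bar> \<le> (\<Sum>\<alpha>\<in>mons j. \<Sum>\<kappa>\<in>I. \<bar>\<Lambda> \<alpha> \<kappa>\<bar> * B)" if x: "x \<in> ?K" and \<alpha>: "\<alpha> \<in> mons j" for x \<alpha>
    proof -
      have B0: "B \<ge> 0" unfolding B_def V_def using C N by simp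
      have "\<bar>b x \<alpha>\<bar> = \<bar>\<Sum>\<kappa>\<in>I. \<Lambda> \<alpha> \<kappa> * hp j (b x) (\<zeta> \<kappa> - 0)\<bar>"
        using co[rule_format, OF \<alpha>, of "b x" 0] by simp
      also have "\<dots> \<le> (\<Sum>\<kappa>\<in>I. \<bar>\<Lambda> \<alpha> \<kappa> * hp j (b x) (\<zeta> \<kappa> - 0)\<bar>)" by (rule sum_abs)
      also have "\<dots> \<le> (\<Sum>\<kappa>\<in>I. \<bar>\<Lambda> \<alpha> \<kappa>\<bar> * B)"
        unfolding abs_mult by (intro sum_mono mult_left_mono B[OF x]) auto
      also have "\<dots> \<le> (\<Sum>\<alpha>\<in>mons j. \<Sum>\<kappa>\<in>I. \<bar>\<Lambda> \<alpha> \<kappa>\<bar> * B)"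
        using \<alpha> B0 by (intro member_le_sum) (auto intro: sum_nonneg)
      finally show ?thesis .
    qed
    then show ?thesis by blast
  qed
  ultimately show ?thesis using b by metis
qed

section \<open>Real analytic functions that vanish to infinite order at a point\<close>

lemma power_series_flat_zero:
  fixes h :: "real \<Rightarrow> real"
  assumes r: "r > 0" and ps: "\<And>s. \<bar>s - s0\<bar> < r \<Longrightarrow> (\<lambda>k. c k * (s - s0) ^ k) sums h s"
    and G: "G \<le> at s0" "G \<noteq> bot" and flat: "\<And>k. ((\<lambda>s. h s / (s - s0) ^ k) \<longlongrightarrow> 0) G"
    and s: "\<bar>s - s0\<bar> < r"
  shows "h s = 0"
proof -
  \<comment> \<open>Once the lower coefficients are known to vanish, \<open>c k\<close> is the limit
    of the quotient with denominator \<open>(s - s0) ^ k\<close>. This limit may be taken along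
    \<open>G\<close>, which covers both one-sided limits and approach through a set accumulating at
    \<open>s0\<close>.\<close>
  have "c k = 0" for k
  proof (induction k rule: less_induct)
    case (less k)
    define f where "f x = (if x = 0 then c k else h (s0 + x) / x ^ k)" for x
    have "(\<lambda>n. c (n + k) * x ^ n) sums f x" if x: "norm x < r" for x
    proof (cases "x = 0")
      case True
      then show ?thesis using powser_sums_zero[of "\<lambda>n. c (n + k)"] by (simp add: f_def)
    next
      case False
      have "(\<lambda>i. c i * x ^ i) sums h (s0 + x)" using ps[of "s0 + x"] x by simp
      then have "(\<lambda>n. c (n + k) * x ^ (n + k)) sums (h (s0 + x) - (\<Sum>i<k. c i * x ^ i))"
        by (rule sums_split_initial_segment)
      then have "(\<lambda>n. c (n + k) * x ^ (n + k)) sums h (s0 + x)" using less by simp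
      from sums_divide[OF this, of "x ^ k"] show ?thesis using False by (simp add: f_def power_add)
    qed
    from powser_limit_0[OF r this] have "(f \<longlongrightarrow> c k) (at 0)" by simp
    from LIM_offset[OF this, of "- s0"] have "((\<lambda>s. f (s - s0)) \<longlongrightarrow> c k) (at s0)" by simp
    then have "((\<lambda>s. h s / (s - s0) ^ k) \<longlongrightarrow> c k) (at s0)"
      by (rule Lim_transform_eventually) (auto simp: eventually_at_filter f_def)
    then have "((\<lambda>s. h s / (s - s0) ^ k) \<longlongrightarrow> c k) G" using G(1) tendsto_mono by blast
    then show "c k = 0" using tendsto_unique[OF G(2)] flat by blast
  qed
  then show ?thesis using ps[OF s] sums_unique2[OF _ sums_zero] by simp
qed

text \<open>The identity theorem: the set of points near which \<open>h\<close> vanishes is open and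
  closed. Flatness is assumed on the right only, because it will come from estimates at positive
  scales.\<close>

lemma real_analytic_flat_zero:
  fixes h :: "real \<Rightarrow> real"
  assumes an: "\<And>s0. \<exists>r>0. \<exists>c. \<forall>s. \<bar>s - s0\<bar> < r \<longrightarrow> (\<lambda>k. c k * (s - s0) ^ k) sums h s"
    and flat: "\<And>k. ((\<lambda>s. h s / s ^ k) \<longlongrightarrow> 0) (at_right 0)"
  shows "h s = 0"
proof -
  define Z where "Z = {s. \<exists>r>0. \<forall>t. \<bar>t - s\<bar> < r \<longrightarrow> h t = 0}"
  have hZ: "h t = 0" if "t \<in> Z" for t using that unfolding Z_def by auto
  have inZ: "s0 \<in> Z" if G: "G \<le> at s0" "G \<noteq> bot" "\<And>k. ((\<lambda>s. h s / (s - s0) ^ k) \<longlongrightarrow> 0) G" for s0 G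
  proof -
    obtain r c where rc: "r > 0" "\<And>s. \<bar>s - s0\<bar> < r \<Longrightarrow> (\<lambda>k. c k * (s - s0) ^ k) sums h s"
      using an[of s0] by blast
    have "h t = 0" if "\<bar>t - s0\<bar> < r" for t
      by (rule power_series_flat_zero[OF rc G that])
    then show ?thesis using rc(1) unfolding Z_def by blast
  qed
  have "0 \<in> Z" by (rule inZ[of "at_right 0"]) (use flat in \<open>auto simp: at_le\<close>)
  moreover have "open Z"
    unfolding open_dist
  proof
    fix s assume "s \<in> Z"
    then obtain r where r: "r > 0" "\<forall>t. \<bar>t - s\<bar> < r \<longrightarrow> h t = 0" unfolding Z_def by blast
    have "y \<in> Z" if y: "dist y s < r / 2" for y
    proof -
      have "\<forall>t. \<bar>t - y\<bar> < r / 2 \<longrightarrow> h t = 0"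
      proof (intro allI impI)
        fix t assume "\<bar>t - y\<bar> < r / 2"
        then have "\<bar>t - s\<bar> < r" using y unfolding dist_real_def by linarith
        then show "h t = 0" using r by blast
      qed
      then show ?thesis using r(1) unfolding Z_def by (auto intro!: exI[of _ "r/2"])
    qed
    then show "\<exists>e>0. \<forall>y. dist y s < e \<longrightarrow> y \<in> Z" using r(1) by (intro exI[of _ "r/2"]) auto
  qed
  moreover have "closed Z"
    unfolding closed_limpt
  proof (intro allI impI)
    fix s0 assume "s0 islimpt Z"
    then have nb: "at s0 within Z \<noteq> bot" by (simp add: trivial_limit_within)
    show "s0 \<in> Z"
    proof (rule inZ[OF _ nb])
      show "at s0 within Z \<le> at s0" by (rule at_le) simp
      fix k
      have "eventually (\<lambda>s. 0 = h s / (s - s0) ^ k) (at s0 within Z)"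
        unfolding eventually_at_filter by (rule always_eventually) (simp add: hZ)
      then show "((\<lambda>s. h s / (s - s0) ^ k) \<longlongrightarrow> 0) (at s0 within Z)"
        by (rule Lim_transform_eventually[OF tendsto_const])
    qed
  qed
  ultimately have "Z = UNIV" using clopen[of Z] by blast
  then show ?thesis using hZ by blast
qed

text \<open>Grouping the unconditional sum over multi-indices by degree gives a power series in
  \<open>s - s0\<close>. The radius uses \<open>norm p + 1\<close> so that \<open>p = 0\<close>
  needs no separate treatment.\<close>

lemma analytic_along_ray:
  fixes p :: "real ^ 'n::finite"
  assumes "real_analytic_on f UNIV"
  shows "\<exists>r>0. \<exists>c. \<forall>s. \<bar>s - s0\<bar> < r \<longrightarrow> (\<lambda>k. c k * (s - s0) ^ k) sums f (s *\<^sub>R p)"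
proof -
  obtain r a where r: "r > 0" and a: "\<And>q. q \<in> ball (s0 *\<^sub>R p) r \<Longrightarrow>
      ((\<lambda>\<alpha>. a \<alpha> * (\<Prod>i\<in>UNIV. (q $ i - (s0 *\<^sub>R p) $ i) ^ \<alpha> i)) has_sum f q) UNIV"
    using assms[unfolded real_analytic_on_def, rule_format, OF UNIV_I, of "s0 *\<^sub>R p"] by (elim exE conjE) blast
  have main: "(\<lambda>k. hp k a p * (s - s0) ^ k) sums f (s *\<^sub>R p)" if s: "\<bar>s - s0\<bar> < r / (norm p + 1)" for s
  proof -
    have "norm (s0 *\<^sub>R p - s *\<^sub>R p) = \<bar>s - s0\<bar> * norm p"
      by (simp add: scaleR_left_diff_distrib[symmetric] abs_minus_commute)
    also have "\<dots> \<le> \<bar>s - s0\<bar> * (norm p + 1)" by (intro mult_left_mono) auto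
    also have "\<dots> < r" using s by (simp add: pos_less_divide_eq add_nonneg_pos)
    finally have "s *\<^sub>R p \<in> ball (s0 *\<^sub>R p) r" by (simp add: dist_norm)
    from a[OF this] have hs: "((\<lambda>\<alpha>. a \<alpha> * (\<Prod>i\<in>UNIV. ((s *\<^sub>R p) $ i - (s0 *\<^sub>R p) $ i) ^ \<alpha> i)) has_sum f (s *\<^sub>R p)) UNIV" .
    have "(\<Prod>i\<in>UNIV. ((s *\<^sub>R p) $ i - (s0 *\<^sub>R p) $ i) ^ \<alpha> i) = (s - s0) ^ mdeg \<alpha> * mon \<alpha> p" for \<alpha>
    proof -
      have "(\<Prod>i\<in>UNIV. ((s *\<^sub>R p) $ i - (s0 *\<^sub>R p) $ i) ^ \<alpha> i) = mon \<alpha> ((s - s0) *\<^sub>R p)"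
        unfolding mon_def by (simp add: left_diff_distrib)
      then show ?thesis by (simp add: mon_scale)
    qed
    with hs have hs: "((\<lambda>\<alpha>. a \<alpha> * ((s - s0) ^ mdeg \<alpha> * mon \<alpha> p)) has_sum f (s *\<^sub>R p)) UNIV" by simp
    let ?g = "\<lambda>\<alpha>. a \<alpha> * ((s - s0) ^ mdeg \<alpha> * mon \<alpha> p)" and ?S = "Sigma (UNIV :: nat set) (\<lambda>k. mons k :: ('n \<Rightarrow> nat) set)"
    have inj: "inj_on snd ?S" by (auto simp: inj_on_def mons_def)
    have im: "snd ` ?S = UNIV" by (force simp: mons_def)
    have "((?g \<circ> snd) has_sum f (s *\<^sub>R p)) ?S"
      using has_sum_reindex[OF inj, of ?g] hs unfolding im by blast
    then have "((\<lambda>k. \<Sum>\<alpha>\<in>mons k. ?g \<alpha>) has_sum f (s *\<^sub>R p)) UNIV"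
    proof (rule has_sum_SigmaD)
      fix k :: nat
      show "((\<lambda>\<alpha>. (?g \<circ> snd) (k, \<alpha>)) has_sum (\<Sum>\<alpha>\<in>mons k. ?g \<alpha>)) (mons k)"
        by (simp add: has_sum_finite)
    qed
    moreover have "(\<Sum>\<alpha>\<in>mons k. ?g \<alpha>) = hp k a p * (s - s0) ^ k" for k
      unfolding hp_def sum_distrib_right by (intro sum.cong) (auto simp: mons_def)
    ultimately show ?thesis using has_sum_imp_sums by simp
  qed
  have "r / (norm p + 1) > 0" using r by (simp add: add_nonneg_pos)
  with main show ?thesis
    by (intro exI[of _ "r / (norm p + 1)"] conjI exI[of _ "\<lambda>k. hp k a p"] allI impI)
qed

text \<open>By homogeneity the Taylor terms agree along the two rays through \<open>p\<close> and
  \<open>p'\<close>. Hence the difference is flat at 0, and by analyticity it vanishes up to the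
  parameter 1. Coefficients and constants may differ from one order \<open>m\<close> to the next,
  which is why flatness is used rather than a single series.\<close>

lemma equal_on_level_sets:
  fixes F :: "(real ^ 'n::finite) \<times> (real ^ 'n) \<Rightarrow> real"
  assumes an: "real_analytic_on (\<lambda>p. F (x, p)) UNIV" and H: "hamiltonian g (x, p) = hamiltonian g (x, p')"
    and triv: "\<And>m. \<exists>N a. taylor_bound F N m x a \<and>
      (\<forall>j\<le>m. \<forall>p p'. hamiltonian g (x, p) = hamiltonian g (x, p') \<longrightarrow> hp j a p = hp j a p')"
  shows "F (x, p) = F (x, p')"
proof -
  define h where "h s = F (x, s *\<^sub>R p) - F (x, s *\<^sub>R p')" for s
  have "h 1 = 0"
  proof (rule real_analytic_flat_zero[where h = h])
    fix s0
    obtain r c where rc: "r > 0" "\<forall>s. \<bar>s - s0\<bar> < r \<longrightarrow> (\<lambda>k. c k * (s - s0) ^ k) sums F (x, s *\<^sub>R p)"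
      using analytic_along_ray[OF an] by blast
    obtain r' c' where rc': "r' > 0" "\<forall>s. \<bar>s - s0\<bar> < r' \<longrightarrow> (\<lambda>k. c' k * (s - s0) ^ k) sums F (x, s *\<^sub>R p')"
      using analytic_along_ray[OF an] by blast
    have "(\<lambda>k. (c k - c' k) * (s - s0) ^ k) sums h s" if "\<bar>s - s0\<bar> < min r r'" for s
      unfolding h_def left_diff_distrib using rc(2) rc'(2) that by (intro sums_diff) auto
    then show "\<exists>r>0. \<exists>c. \<forall>s. \<bar>s - s0\<bar> < r \<longrightarrow> (\<lambda>k. c k * (s - s0) ^ k) sums h s"
      using rc(1) rc'(1) by (intro exI[of _ "min r r'"] conjI exI[of _ "\<lambda>k. c k - c' k"]) auto
  next
    fix k
    obtain N a where tb: "taylor_bound F N k x a"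
      and eq: "\<forall>j\<le>k. \<forall>p p'. hamiltonian g (x, p) = hamiltonian g (x, p') \<longrightarrow> hp j a p = hp j a p'"
      using triv[of k] by blast
    define C where "C = norm p + norm p'"
    have "hp i a p = hp i a p'" if "i \<le> k" for i by (rule eq[rule_format, OF that H])
    then have ts: "taylor k a (s *\<^sub>R p) = taylor k a (s *\<^sub>R p')" for s
      unfolding taylor_scale by simp
    have hb: "\<bar>h s\<bar> \<le> N * (s * C) ^ k * norm (s *\<^sub>R p - s *\<^sub>R p')" if "s > 0" "s * C * N \<le> 1" for s
    proof -
      have "norm (s *\<^sub>R p) \<le> s * C" "norm (s *\<^sub>R p') \<le> s * C" unfolding C_def using that by auto
      from taylor_boundD[OF tb this that(2)] show ?thesis
        unfolding h_def using ts[of s] by simp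
    qed
    have ev: "eventually (\<lambda>s. s > 0 \<and> s * C * N \<le> 1) (at_right (0::real))"
    proof (rule eventually_conj)
      show "eventually (\<lambda>s. s > 0) (at_right (0::real))" by (simp add: eventually_at_filter)
      have "((\<lambda>s. s * C * N) \<longlongrightarrow> 0 * C * N) (at_right 0)" by (intro tendsto_intros)
      then have "eventually (\<lambda>s. s * C * N < 1) (at_right 0)" by (intro order_tendstoD(2)) auto
      then show "eventually (\<lambda>s. s * C * N \<le> 1) (at_right 0)" by eventually_elim simp
    qed
    have "((\<lambda>s. N * C ^ k * norm (s *\<^sub>R p - s *\<^sub>R p')) \<longlongrightarrow> N * C ^ k * norm (0 *\<^sub>R p - 0 *\<^sub>R p')) (at_right (0::real))"
      by (intro tendsto_intros)
    then have lim: "((\<lambda>s. N * C ^ k * norm (s *\<^sub>R p - s *\<^sub>R p')) \<longlongrightarrow> 0) (at_right (0::real))" by simp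
    show "((\<lambda>s. h s / s ^ k) \<longlongrightarrow> 0) (at_right 0)"
    proof (rule Lim_null_comparison[OF _ lim])
      show "\<forall>\<^sub>F s in at_right 0. norm (h s / s ^ k) \<le> N * C ^ k * norm (s *\<^sub>R p - s *\<^sub>R p')"
        using ev
      proof eventually_elim
        case (elim s)
        have "\<bar>h s\<bar> \<le> (N * C ^ k * norm (s *\<^sub>R p - s *\<^sub>R p')) * s ^ k"
          using hb[of s] elim by (simp add: power_mult_distrib mult_ac)
        then show ?case using elim by (simp add: abs_divide pos_divide_le_eq)
      qed
    qed
  qed
  then show ?thesis unfolding h_def by simp
qed

definition good_metric :: "(real ^ 'n::finite) set \<Rightarrow> nat \<Rightarrow> (real ^ 'n) set \<Rightarrow> (real ^ 'n \<Rightarrow> real ^ 'n ^ 'n) \<Rightarrow> bool" where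
  "good_metric S k D g \<longleftrightarrow> g \<in> Ck_metrics k D \<and> (\<forall>m N i. \<forall>c\<in>S. \<forall>v\<in>S. \<forall>w\<in>S.
     cball c (1 / real (Suc i)) \<subseteq> D \<longrightarrow> g \<notin> bad_metrics k D m (real (Suc N)) c (1 / real (Suc i)) v w)"

text \<open>Compactness applied to a constant sequence: the limit is continuous and coincides with
  the given coefficients.\<close>

lemma weak_integral_continuous:
  fixes D :: "(real ^ 'n::finite) set"
  assumes D: "open D" and g: "g \<in> Ck_metrics k D" and k: "k \<ge> 1" and \<epsilon>: "\<epsilon> > 0" and K: "cball z \<epsilon> \<subseteq> D"
    and wi: "weak_integral (cball z \<epsilon>) j g b" and B: "\<forall>x\<in>cball z \<epsilon>. \<forall>\<alpha>\<in>mons j. \<bar>b x \<alpha>\<bar> \<le> B"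
    and \<alpha>: "\<alpha> \<in> mons j"
  shows "continuous_on (cball z \<epsilon>) (\<lambda>x. b x \<alpha>)"
proof -
  have "C1_conv (cball z \<epsilon>) (\<lambda>_. g) g"
    unfolding C1_conv_def using Ck_metrics_entries(1,2)[OF g k D] K continuous_on_subset
    by (intro conjI allI cconv_const) blast+
  from weak_integral_compactness[OF \<epsilon> this, of j "\<lambda>_. b" B] wi B K Ck_metrics_invertible[OF g]
  obtain b' where b': "\<forall>\<alpha>\<in>mons j. cconv (cball z \<epsilon>) (\<lambda>_ x. b x \<alpha>) (\<lambda>x. b' x \<alpha>)" by blast
  have c: "cconv (cball z \<epsilon>) (\<lambda>_ x. b x \<alpha>) (\<lambda>x. b' x \<alpha>)" using b' \<alpha> by blast
  show ?thesis
  proof (rule continuous_on_eq[OF cconv_continuous[OF c]])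
    show "b' x \<alpha> = b x \<alpha>" if "x \<in> cball z \<epsilon>" for x
      using LIMSEQ_unique[OF cconv_pointwise[OF c that] tendsto_const] .
  qed
qed

lemma dense_sequence:
  fixes S :: "'a::metric_space set"
  assumes S: "\<And>X. open X \<Longrightarrow> X \<noteq> {} \<Longrightarrow> \<exists>d\<in>S. d \<in> X" and U: "open U" "x \<in> U"
  shows "\<exists>y. y \<longlonglongrightarrow> x \<and> (\<forall>n. y n \<in> S \<inter> U)"
proof -
  have "x \<in> closure (S \<inter> U)"
    unfolding closure_approachable
  proof (intro allI impI)
    fix e :: real assume "e > 0"
    then have "U \<inter> ball x e \<noteq> {}" "open (U \<inter> ball x e)" using U by auto
    then obtain d where "d \<in> S" "d \<in> U \<inter> ball x e" using S by blast
    then show "\<exists>y\<in>S \<inter> U. dist y x < e" by (auto simp: dist_commute)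
  qed
  then show ?thesis unfolding closure_sequential by blast
qed

text \<open>Around a point of \<open>S\<close> a nonzero derivative, for directions in
  \<open>S\<close>, would put \<open>g\<close> into one of the excluded sets on a smaller ball.
  Density of \<open>S\<close> and continuity of the coefficients extend the vanishing to all points
  and directions.\<close>

lemma good_metric_level_sets:
  fixes D :: "(real ^ 'n::finite) set"
  assumes D: "open D" and k: "k \<ge> 1" and good: "good_metric S k D g"
    and S: "\<And>X. open X \<Longrightarrow> X \<noteq> {} \<Longrightarrow> \<exists>d\<in>S. d \<in> X"
    and \<epsilon>: "\<epsilon> > 0" and K: "cball z \<epsilon> \<subseteq> D"
    and wi: "weak_integral (cball z \<epsilon>) j g b" and B: "\<forall>x\<in>cball z \<epsilon>. \<forall>\<alpha>\<in>mons j. \<bar>b x \<alpha>\<bar> \<le> B"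
    and x: "x \<in> ball z \<epsilon>"
  shows "level_set_polynomial (g x) j (b x)"
proof -
  have g: "g \<in> Ck_metrics k D" using good unfolding good_metric_def by blast
  have zero: "dhp j (b c) v (matrix_inv (g c) *v perp v w) = 0"
    if c: "c \<in> S" "c \<in> ball z \<epsilon>" and v: "v \<in> S" and w: "w \<in> S" for c v w
  proof (rule ccontr)
    assume nz: "dhp j (b c) v (matrix_inv (g c) *v perp v w) \<noteq> 0"
    let ?d = "\<bar>dhp j (b c) v (matrix_inv (g c) *v perp v w)\<bar>"
    obtain e where e: "e > 0" "ball c e \<subseteq> ball z \<epsilon>" using c(2) open_ball open_contains_ball by blast
    obtain i where i: "1 / real (Suc i) < e" using nat_approx_posE[OF e(1)] by blast
    have sub: "cball c (1 / real (Suc i)) \<subseteq> cball z \<epsilon>" 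
    proof
      fix y assume "y \<in> cball c (1 / real (Suc i))"
      then have "y \<in> ball c e" using i by (simp del: of_nat_Suc)
      then show "y \<in> cball z \<epsilon>" using e(2) ball_subset_cball by blast
    qed
    obtain N :: nat where N: "real N \<ge> max B (1 / ?d)" using real_arch_simple by blast
    have "1 / real (Suc N) \<le> ?d"
    proof -
      have "1 / ?d \<le> real (Suc N)" using N by simp
      then show ?thesis using nz by (simp add: field_simps)
    qed
    moreover have "weak_integral (cball c (1 / real (Suc i))) j g b"
      using line_eq_subset[OF wi[unfolded weak_integral_def] sub] unfolding weak_integral_def .
    moreover have "\<forall>x\<in>cball c (1 / real (Suc i)). \<forall>\<alpha>\<in>mons j. \<bar>b x \<alpha>\<bar> \<le> real (Suc N)"
    proof (intro ballI)
      fix x and \<alpha> :: "'n \<Rightarrow> nat" assume "x \<in> cball c (1 / real (Suc i))" "\<alpha> \<in> mons j"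
      then have "\<bar>b x \<alpha>\<bar> \<le> B" using B sub by blast
      then show "\<bar>b x \<alpha>\<bar> \<le> real (Suc N)" using N by simp
    qed
    ultimately have "g \<in> bad_metrics k D j (real (Suc N)) c (1 / real (Suc i)) v w"
      unfolding bad_metrics_def using g by blast
    then show False using good c v w sub K unfolding good_metric_def by blast
  qed
  have xD: "x \<in> D" using x K by auto
  have all: "dhp j (b x) v (matrix_inv (g x) *v perp v w) = 0" for v w
  proof -
    obtain c where c: "c \<longlonglongrightarrow> x" "\<And>n. c n \<in> S \<inter> ball z \<epsilon>" using dense_sequence[OF S open_ball x] by blast
    obtain vv where vv: "vv \<longlonglongrightarrow> v" "\<And>n. vv n \<in> S \<inter> UNIV" using dense_sequence[OF S open_UNIV UNIV_I, of v] by blast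
    obtain ww where ww: "ww \<longlonglongrightarrow> w" "\<And>n. ww n \<in> S \<inter> UNIV" using dense_sequence[OF S open_UNIV UNIV_I, of w] by blast
    have bl: "(\<lambda>n. b (c n) \<alpha>) \<longlonglongrightarrow> b x \<alpha>" if "\<alpha> \<in> mons j" for \<alpha>
    proof (rule continuous_on_tendsto_compose[OF weak_integral_continuous[OF D g k \<epsilon> K wi B that] c(1)])
      show "x \<in> cball z \<epsilon>" using x by simp
      show "\<forall>\<^sub>F n in sequentially. c n \<in> cball z \<epsilon>" using c(2) by (intro always_eventually) (auto simp: less_imp_le)
    qed
    have gl: "(\<lambda>n. g (c n)) \<longlonglongrightarrow> g x"
    proof (intro vec_tendstoI)
      fix i l
      have "isCont (\<lambda>y. g y $ i $ l) x"
        using Ck_metrics_entries(1)[OF g k D] D xD by (simp add: continuous_on_eq_continuous_at)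
      then show "(\<lambda>n. g (c n) $ i $ l) \<longlonglongrightarrow> g x $ i $ l" by (rule isCont_tendsto_compose[OF _ c(1)])
    qed
    have "(\<lambda>n. dhp j (b (c n)) (vv n) (matrix_inv (g (c n)) *v perp (vv n) (ww n))) \<longlonglongrightarrow> dhp j (b x) v (matrix_inv (g x) *v perp v w)"
      unfolding perp_def
      by (intro tendsto_intros bl tendsto_matrix_inv gl Ck_metrics_invertible[OF g xD] vv(1) ww(1))
    moreover have "dhp j (b (c n)) (vv n) (matrix_inv (g (c n)) *v perp (vv n) (ww n)) = 0" for n
      using zero c(2) vv(2) ww(2) by blast
    ultimately show ?thesis using LIMSEQ_unique[OF _ tendsto_const] by fastforce
  qed
  show ?thesis
  proof
    show "transpose (g x) = g x" "invertible (g x)"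
      using Ck_metrics_symmetric[OF g xD] Ck_metrics_invertible[OF g xD] by auto
    fix v \<xi> :: "real ^ 'n" assume v: "v \<noteq> 0" "v \<bullet> \<xi> = 0"
    \<comment> \<open>Here \<open>\<xi>\<close> is orthogonal to \<open>v\<close>, so
      \<open>perp\<close> only rescales it by a nonzero factor.\<close>
    have "perp v \<xi> = (v \<bullet> v) *\<^sub>R \<xi>" unfolding perp_def using v(2) by (simp add: inner_commute)
    then show "dhp j (b x) v (matrix_inv (g x) *v \<xi>) = 0"
      using all[of v \<xi>] v(1) by (simp add: matrix_vector_mult_scaleR dhp_scaleR)
  qed
qed

subsection \<open>Integrals that are constant on level sets of the Hamiltonian in a dense set of fibres\<close>

definition trivial_at ::
  "((real ^ 'n::finite) \<times> (real ^ 'n) \<Rightarrow> real) \<Rightarrow> (real ^ 'n \<Rightarrow> real ^ 'n ^ 'n) \<Rightarrow> nat \<Rightarrow> real ^ 'n \<Rightarrow> bool" where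
  "trivial_at F g m x \<longleftrightarrow> (\<exists>N a. taylor_bound F N m x a \<and>
      (\<forall>j\<le>m. \<forall>p p'. hamiltonian g (x, p) = hamiltonian g (x, p') \<longrightarrow> hp j a p = hp j a p'))"

lemma trivial_on_ball:
  fixes D :: "(real ^ 'n::finite) set"
  assumes n: "CARD('n) \<ge> 2" and D: "open D" and k: "k \<ge> 1" and good: "good_metric S k D g"
    and S: "\<And>X. open X \<Longrightarrow> X \<noteq> {} \<Longrightarrow> \<exists>d\<in>S. d \<in> X"
    and F: "geodesic_integral D g F" and an: "analytic_in_momenta D F"
    and y: "cball y \<delta> \<subseteq> D" "\<delta> > 0"
  shows "\<exists>z \<epsilon>. \<epsilon> > 0 \<and> ball z \<epsilon> \<subseteq> cball y \<delta> \<and> (\<forall>x\<in>ball z \<epsilon>. trivial_at F g m x)"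
proof -
  have g: "g \<in> Ck_metrics k D" using good unfolding good_metric_def by blast
  have Fc: "continuous_on (D \<times> UNIV) F"
    using F unfolding geodesic_integral_def by (intro differentiable_imp_continuous_on) blast
  obtain z \<epsilon> N where z: "\<epsilon> > 0" "cball z \<epsilon> \<subseteq> cball y \<delta>" and ex: "\<forall>x\<in>cball z \<epsilon>. \<exists>a. taylor_bound F N m x a"
    using taylor_bound_on_ball[OF D an Fc y, of m] by (elim exE conjE) (rule that)
  from bchoice[OF ex] obtain a where a: "\<forall>x\<in>cball z \<epsilon>. taylor_bound F N m x (a x)" by blast
  then have tb: "taylor_bound F N m x (a x)" if "x \<in> cball z \<epsilon>" for x using that by blast
  have N: "N \<ge> 0"
  proof -
    have "(\<lambda>_. 0) \<in> (mons 0 :: ('n \<Rightarrow> nat) set)" unfolding mons_def mdeg_def by simp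
    then have "\<bar>a z (\<lambda>_. 0)\<bar> \<le> N" using tb[of z] z(1) unfolding taylor_bound_def by auto
    then show ?thesis by linarith
  qed
  have KD: "cball z \<epsilon> \<subseteq> D" using z y by blast
  have "trivial_at F g m x" if x: "x \<in> ball z \<epsilon>" for x
    unfolding trivial_at_def
  proof (intro exI conjI allI impI)
    show "taylor_bound F N m x (a x)" using tb x by simp
    fix j and p p' :: "real ^ 'n" assume j: "j \<le> m" and H: "hamiltonian g (x, p) = hamiltonian g (x, p')"
    have "x \<in> D" using x ball_subset_cball KD by blast
    then have inv: "invertible (g x)" by (rule Ck_metrics_invertible[OF g])
    have "\<exists>b B. weak_integral (cball z \<epsilon>) j g b \<and> (\<forall>x\<in>cball z \<epsilon>. \<forall>\<alpha>\<in>mons j. \<bar>b x \<alpha>\<bar> \<le> B) \<and>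
        (\<forall>x v. hp j (b x) v = hp j (a x) (g x *v v))"
      by (rule weak_integral_of_taylor_coefficients[OF D g k F KD _ N j]) (rule tb)
    then obtain b B where b: "weak_integral (cball z \<epsilon>) j g b" "\<forall>x\<in>cball z \<epsilon>. \<forall>\<alpha>\<in>mons j. \<bar>b x \<alpha>\<bar> \<le> B"
      and ba: "\<forall>x v. hp j (b x) v = hp j (a x) (g x *v v)"
      by (elim exE conjE) (rule that)
    interpret level_set_polynomial "g x" j "b x"
      by (rule good_metric_level_sets[OF D k good S z(1) KD b x])
    let ?v = "matrix_inv (g x) *v p" and ?v' = "matrix_inv (g x) *v p'"
    have "?v \<bullet> (g x *v ?v) = ?v' \<bullet> (g x *v ?v')"
      using H by (simp add: hamiltonian_eq matrix_inv_vec[OF inv] inner_commute)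
    then have "hp j (b x) ?v = hp j (b x) ?v'" by (rule constant_on_level_sets[OF n])
    then show "hp j (a x) p = hp j (a x) p'" unfolding ba[rule_format] by (simp add: matrix_inv_vec[OF inv])
  qed
  then show ?thesis using z ball_subset_cball[of z \<epsilon>] by blast
qed

text \<open>The balls given by \<open>trivial_on_ball\<close> depend on the order \<open>m\<close>.
  A second use of Baire's theorem, over \<open>m\<close>, finds points that serve all
  orders.\<close>

lemma trivial_dense:
  fixes D :: "(real ^ 'n::finite) set"
  assumes D: "open D"
    and ball: "\<And>m y \<delta>. cball y \<delta> \<subseteq> D \<Longrightarrow> \<delta> > 0 \<Longrightarrow> \<exists>z \<epsilon>. \<epsilon> > 0 \<and> ball z \<epsilon> \<subseteq> cball y \<delta> \<and> (\<forall>x\<in>ball z \<epsilon>. trivial_at F g m x)"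
    and x: "x \<in> D" "\<epsilon> > 0"
  shows "\<exists>y\<in>D. dist y x < \<epsilon> \<and> (\<forall>m. trivial_at F g m y)"
proof -
  have "open (D \<inter> ball x \<epsilon>)" "x \<in> D \<inter> ball x \<epsilon>" using D x by auto
  then obtain \<delta> where \<delta>: "\<delta> > 0" "cball x \<delta> \<subseteq> D \<inter> ball x \<epsilon>" using open_contains_cball by blast
  \<comment> \<open>Adding the complement of the ball makes the sets dense in the whole space, so
    that Baire's theorem can be applied there.\<close>
  define W where "W m = interior {y\<in>D. trivial_at F g m y} \<union> - cball x \<delta>" for m
  have "(UNIV :: (real ^ 'n) set) \<subseteq> closure (\<Inter> (range W))"
  proof (rule Baire)
    fix T assume "T \<in> range W"
    then obtain m where T: "T = W m" by blast
    have "open T" unfolding T W_def by (intro open_Un open_interior open_Compl closed_cball)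
    moreover have "p \<in> closure T" for p
      unfolding closure_approachable
    proof (intro allI impI)
      fix e :: real assume e: "e > 0"
      show "\<exists>y\<in>T. dist y p < e"
      proof (cases "cball p (e / 2) \<subseteq> cball x \<delta>")
        case False
        then obtain y where "y \<in> cball p (e / 2)" "y \<notin> cball x \<delta>" by blast
        then show ?thesis using e unfolding T W_def by (intro bexI[of _ y]) (auto simp: dist_commute)
      next
        case True
        then have "cball p (e / 2) \<subseteq> D" using \<delta> by blast
        then obtain z r where z: "r > 0" "ball z r \<subseteq> cball p (e / 2)" "\<forall>y\<in>ball z r. trivial_at F g m y"
          using ball[of p "e/2" m] e by auto
        have "ball z r \<subseteq> {y\<in>D. trivial_at F g m y}" using z \<open>cball p (e / 2) \<subseteq> D\<close> by blast
        then have "z \<in> T" unfolding T W_def using z(1) interior_maximal[OF _ open_ball, of z r] by (meson UnI1 centre_in_ball subsetD)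
        moreover have "dist z p < e" using z(1,2) e by (auto simp: dist_commute dest!: subsetD[of _ _ z])
        ultimately show ?thesis by blast
      qed
    qed
    ultimately show "openin (top_of_set UNIV) T \<and> UNIV \<subseteq> closure T" by auto
  qed auto
  then have "x \<in> closure (\<Inter> (range W))" by blast
  then obtain y where y: "y \<in> \<Inter> (range W)" "dist y x < \<delta>" using \<delta>(1) unfolding closure_approachable by blast
  have yb: "y \<in> cball x \<delta>" using y(2) by (simp add: dist_commute)
  have "trivial_at F g m y" for m
  proof -
    have "y \<in> W m" using y(1) by blast
    then have "y \<in> interior {y\<in>D. trivial_at F g m y}" unfolding W_def using yb by blast
    then show ?thesis using interior_subset by blast
  qed
  then show ?thesis using yb \<delta>(2) by (intro bexI[of _ y]) (auto simp: dist_commute)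
qed

section \<open>Passing from a dense set of fibres to all fibres\<close>

lemma hamiltonian_scale: "hamiltonian g (x, s *\<^sub>R p) = s\<^sup>2 * hamiltonian g (x, p)"
  by (simp add: hamiltonian_eq matrix_vector_mult_scaleR power2_eq_square)

lemma hamiltonian_rescale:
  assumes "h / hamiltonian g (x, p) > 0"
  shows "hamiltonian g (x, sqrt (h / hamiltonian g (x, p)) *\<^sub>R p) = h"
  unfolding hamiltonian_scale real_sqrt_pow2[OF less_imp_le[OF assms]] using assms by auto

lemma hamiltonian_add:
  assumes "transpose (g x) = g x" "invertible (g x)"
  shows "hamiltonian g (x, p + t *\<^sub>R e) = hamiltonian g (x, p) + t * (e \<bullet> (matrix_inv (g x) *v p)) + t\<^sup>2 * hamiltonian g (x, e)"
proof -
  have sy: "p \<bullet> (matrix_inv (g x) *v e) = e \<bullet> (matrix_inv (g x) *v p)"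
    using symmetric_matrix_inv_inner[OF assms, of p e] by (simp add: inner_commute)
  show ?thesis
    by (simp add: hamiltonian_eq matrix_vector_right_distrib matrix_vector_mult_scaleR inner_add_left inner_add_right sy power2_eq_square algebra_simps)
qed

text \<open>The assumption \<open>dense\<close> is all that is kept of genericity and analyticity;
  the rest uses the equation of the integral.\<close>

locale level_integral =
  fixes D :: "(real ^ 'n::finite) set" and k :: nat and g F
  assumes D: "open D" "convex D" and g: "g \<in> Ck_metrics k D" and k: "k \<ge> 1"
    and F: "geodesic_integral D g F"
    and dense: "\<And>x \<epsilon>. x \<in> D \<Longrightarrow> \<epsilon> > 0 \<Longrightarrow> \<exists>y\<in>D. dist y x < \<epsilon> \<and>
      (\<forall>p p'. hamiltonian g (y, p) = hamiltonian g (y, p') \<longrightarrow> F (y, p) = F (y, p'))"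
begin

abbreviation (input) H where "H x p \<equiv> hamiltonian g (x, p)"

lemma open_TD: "open (D \<times> (UNIV :: (real ^ 'n) set))"
  using D by (intro open_Times) auto

lemma gsym: "x \<in> D \<Longrightarrow> transpose (g x) = g x" and ginv: "x \<in> D \<Longrightarrow> invertible (g x)"
  using Ck_metrics_symmetric[OF g] Ck_metrics_invertible[OF g] by auto

lemma F_has_derivative: "x \<in> D \<Longrightarrow> \<exists>F'. (F has_derivative F') (at (x, p))"
  using F unfolding geodesic_integral_def differentiable_on_eq_differentiable_at[OF open_TD] differentiable_def by auto

lemma tendsto_F:
  assumes "x \<in> D" "(y \<longlongrightarrow> x) G" "(q \<longlongrightarrow> p) G" shows "((\<lambda>n. F (y n, q n)) \<longlongrightarrow> F (x, p)) G"
proof -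
  have "isCont F (x, p)" using F_has_derivative[OF assms(1)] has_derivative_continuous by blast
  then show ?thesis by (rule isCont_tendsto_compose) (intro tendsto_intros assms)
qed

lemma tendsto_g:
  assumes "x \<in> D" "(y \<longlongrightarrow> x) G" shows "((\<lambda>n. g (y n)) \<longlongrightarrow> g x) G"
proof (intro vec_tendstoI)
  fix i l
  have "isCont (\<lambda>y. g y $ i $ l) x"
    using Ck_metrics_entries(1)[OF g k D(1)] D assms by (simp add: continuous_on_eq_continuous_at)
  then show "((\<lambda>n. g (y n) $ i $ l) \<longlongrightarrow> g x $ i $ l) G" by (rule isCont_tendsto_compose[OF _ assms(2)])
qed

lemma tendsto_H:
  assumes "x \<in> D" "(y \<longlongrightarrow> x) G" "(q \<longlongrightarrow> p) G" shows "((\<lambda>n. H (y n) (q n)) \<longlongrightarrow> H x p) G"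
  unfolding hamiltonian_eq by (intro tendsto_intros tendsto_matrix_inv tendsto_g assms ginv)

text \<open>In a nearby fibre of the dense set, rescaling \<open>p\<close> and \<open>p'\<close>
  puts both on the level \<open>h\<close>. The scaling factors tend to 1, because \<open>h\<close>
  is nonzero, and continuity of \<open>F\<close> does the rest.\<close>

lemma level_nonzero:
  assumes x: "x \<in> D" and h: "H x p = h" "H x p' = h" "h \<noteq> 0"
  shows "F (x, p) = F (x, p')"
proof -
  have "\<forall>n. \<exists>y. y \<in> D \<and> dist y x < inverse (real (Suc n)) \<and> (\<forall>p p'. H y p = H y p' \<longrightarrow> F (y, p) = F (y, p'))"
  proof
    fix n
    have "inverse (real (Suc n)) > 0" by simp
    from dense[OF x this] show "\<exists>y. y \<in> D \<and> dist y x < inverse (real (Suc n)) \<and> (\<forall>p p'. H y p = H y p' \<longrightarrow> F (y, p) = F (y, p'))"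
      unfolding Bex_def .
  qed
  from choice[OF this] obtain y where y: "\<And>n. y n \<in> D" "\<And>n. dist (y n) x < inverse (real (Suc n))"
    "\<And>n p p'. H (y n) p = H (y n) p' \<Longrightarrow> F (y n, p) = F (y n, p')" by blast
  have yl: "y \<longlonglongrightarrow> x"
    unfolding tendsto_dist_iff[of y x]
    by (rule Lim_null_comparison[OF _ LIMSEQ_inverse_real_of_nat]) (use y(2) in \<open>auto intro!: always_eventually less_imp_le simp del: of_nat_Suc\<close>)
  have sl: "((\<lambda>n. sqrt (h / H (y n) q) *\<^sub>R q) \<longlonglongrightarrow> q) \<and> eventually (\<lambda>n. h / H (y n) q > 0) sequentially" if q: "H x q = h" for q
  proof -
    have "(\<lambda>n. h / H (y n) q) \<longlonglongrightarrow> h / H x q" using q h(3) by (intro tendsto_intros tendsto_H[OF x yl]) auto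
    then have l: "(\<lambda>n. h / H (y n) q) \<longlonglongrightarrow> 1" using q h(3) by simp
    have "(\<lambda>n. sqrt (h / H (y n) q) *\<^sub>R q) \<longlonglongrightarrow> sqrt 1 *\<^sub>R q" by (intro tendsto_intros l)
    moreover have "eventually (\<lambda>n. h / H (y n) q > 0) sequentially" by (rule order_tendstoD(1)[OF l]) simp
    ultimately show ?thesis by simp
  qed
  have l1: "(\<lambda>n. F (y n, sqrt (h / H (y n) p) *\<^sub>R p)) \<longlonglongrightarrow> F (x, p)" using sl[OF h(1)] by (intro tendsto_F x yl) auto
  have l2: "(\<lambda>n. F (y n, sqrt (h / H (y n) p') *\<^sub>R p')) \<longlonglongrightarrow> F (x, p')" using sl[OF h(2)] by (intro tendsto_F x yl) auto
  have "eventually (\<lambda>n. h / H (y n) p > 0 \<and> h / H (y n) p' > 0) sequentially"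
    using sl[OF h(1)] sl[OF h(2)] by (intro eventually_conj) auto
  then have ev: "eventually (\<lambda>n. F (y n, sqrt (h / H (y n) p) *\<^sub>R p) = F (y n, sqrt (h / H (y n) p') *\<^sub>R p')) sequentially"
  proof eventually_elim
    case (elim n)
    show ?case by (rule y(3)) (use elim hamiltonian_rescale in metis)
  qed
  show ?thesis by (rule LIMSEQ_unique[OF Lim_transform_eventually[OF l1 ev] l2])
qed

text \<open>The direction \<open>g x *v p\<close> pairs with the velocity of \<open>p\<close> to the
  Euclidean square of \<open>p\<close>, so it leaves the null cone to first order.\<close>

lemma nonnull_direction:
  assumes x: "x \<in> D" and p: "p \<noteq> 0" "H x p = 0"
  shows "\<exists>e. \<forall>t. H x (p + t *\<^sub>R e) = t * (p \<bullet> p) + t\<^sup>2 * H x e"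
proof -
  have "(g x *v p) \<bullet> (matrix_inv (g x) *v p) = p \<bullet> p"
    using symmetric_matrix_inner[OF gsym[OF x], of p "matrix_inv (g x) *v p"] by (simp add: matrix_inv_vec[OF ginv[OF x]])
  then show ?thesis using hamiltonian_add[where g = g, OF gsym[OF x] ginv[OF x], of p _ "g x *v p"] p(2) by (intro exI[of _ "g x *v p"]) simp
qed

text \<open>Rescaling cannot reach level 0. Instead \<open>p\<close> is approached through momenta
  of small positive energy. Each of them lies on the same level as a point of the fixed ray through
  \<open>?q\<close>, and these points tend to 0.\<close>

lemma level_zero:
  assumes x: "x \<in> D" and p: "H x p = 0"
  shows "F (x, p) = F (x, 0)"
proof (cases "p = 0")
  case False
  obtain e where e: "\<And>t. H x (p + t *\<^sub>R e) = t * (p \<bullet> p) + t\<^sup>2 * H x e" using nonnull_direction[OF x False p] by blast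
  define d where "d = \<bar>H x e\<bar> + 1"
  \<comment> \<open>Up to this parameter the linear term of the energy dominates the quadratic
    one.\<close>
  define t1 where "t1 = (p \<bullet> p) / d"
  have pp: "p \<bullet> p > 0" and d: "d > 0" using False unfolding d_def by auto
  have pos: "H x (p + t *\<^sub>R e) > 0" if "0 < t" "t \<le> t1" for t
  proof -
    have "H x (p + t *\<^sub>R e) = t * (p \<bullet> p + t * H x e)" unfolding e by (simp add: power2_eq_square algebra_simps)
    moreover have "t * \<bar>H x e\<bar> < p \<bullet> p"
    proof -
      have "t * \<bar>H x e\<bar> < t * d" using that unfolding d_def by simp
      also have "\<dots> \<le> t1 * d" using that d by (intro mult_right_mono) auto
      also have "\<dots> = p \<bullet> p" unfolding t1_def using d by simp
      finally show ?thesis .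
    qed
    then have "p \<bullet> p + t * H x e > 0" using abs_mult[of t "H x e"] that by (smt (verit) abs_ge_minus_self mult_minus_right)
    ultimately show ?thesis using that by simp
  qed
  have t1: "t1 > 0" unfolding t1_def using pp d by simp
  let ?q = "p + t1 *\<^sub>R e"
  have q: "H x ?q > 0" by (rule pos[OF t1]) simp
  have eq: "F (x, p + t *\<^sub>R e) = F (x, sqrt (H x (p + t *\<^sub>R e) / H x ?q) *\<^sub>R ?q)" if t: "0 < t" "t \<le> t1" for t
    by (rule level_nonzero[OF x refl]) (use pos[OF t] q hamiltonian_rescale[of "H x (p + t *\<^sub>R e)" g x ?q] in auto)
  have tl: "((\<lambda>t. p + t *\<^sub>R e) \<longlongrightarrow> p + 0 *\<^sub>R e) (at_right 0)" by (intro tendsto_intros)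
  then have tl: "((\<lambda>t. p + t *\<^sub>R e) \<longlongrightarrow> p) (at_right 0)" by simp
  have "((\<lambda>t. sqrt (H x (p + t *\<^sub>R e) / H x ?q) *\<^sub>R ?q) \<longlongrightarrow> sqrt (H x p / H x ?q) *\<^sub>R ?q) (at_right 0)"
    using q by (intro tendsto_intros tendsto_H[OF x] tl) auto
  then have "((\<lambda>t. sqrt (H x (p + t *\<^sub>R e) / H x ?q) *\<^sub>R ?q) \<longlongrightarrow> 0) (at_right 0)" using p by simp
  then have l1: "((\<lambda>t. F (x, sqrt (H x (p + t *\<^sub>R e) / H x ?q) *\<^sub>R ?q)) \<longlongrightarrow> F (x, 0)) (at_right 0)"
    by (intro tendsto_F x tendsto_const)
  have l2: "((\<lambda>t. F (x, p + t *\<^sub>R e)) \<longlongrightarrow> F (x, p)) (at_right 0)" by (intro tendsto_F x tendsto_const tl)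
  have "eventually (\<lambda>t. t \<in> {0<..<t1}) (at_right (0::real))" by (rule eventually_at_right_real[OF t1])
  then have "eventually (\<lambda>t. F (x, p + t *\<^sub>R e) = F (x, sqrt (H x (p + t *\<^sub>R e) / H x ?q) *\<^sub>R ?q)) (at_right 0)"
    by eventually_elim (rule eq, auto)
  from Lim_transform_eventually[OF l2 this] l1 show ?thesis
    by (rule tendsto_unique[OF trivial_limit_at_right_real])
qed simp

lemma level_set_constant:
  assumes "x \<in> D" "H x p = H x p'" shows "F (x, p) = F (x, p')"
proof (cases "H x p = 0")
  case True
  then show ?thesis using level_zero[OF assms(1), of p] level_zero[OF assms(1), of p'] assms(2) by simp
next
  case False
  show ?thesis by (rule level_nonzero[OF assms(1) refl assms(2)[symmetric] False])
qed

text \<open>Which signs the energy takes cannot change over the connected set \<open>D\<close>.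
  Attaining \<open>h\<close> is an open condition by rescaling, and so is its failure, since a limit
  of attaining fibres carries a nonzero null momentum, which can be pushed to either sign.\<close>

lemma level_extends:
  assumes h: "h \<noteq> 0" and x: "x \<in> D" "H x p = h" and y: "y \<in> D"
  shows "\<exists>q. H y q = h"
proof -
  define A where "A = {y\<in>D. \<exists>q. H y q = h}"
  have "open A"
  proof (rule openI)
    fix z assume "z \<in> A"
    then obtain q where z: "z \<in> D" and q: "H z q = h" unfolding A_def by blast
    have "((\<lambda>y. h / H y q) \<longlongrightarrow> h / H z q) (nhds z)"
      using q h by (intro tendsto_intros tendsto_H[OF z] filterlim_ident) auto
    then have "eventually (\<lambda>y. h / H y q > 0) (nhds z)" using q h by (intro order_tendstoD(1)) auto
    moreover have "eventually (\<lambda>y. y \<in> D) (nhds z)" by (rule eventually_nhds_in_open[OF D(1) z])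
    ultimately have "eventually (\<lambda>y. y \<in> A) (nhds z)"
      by eventually_elim (use hamiltonian_rescale A_def in blast)
    then obtain e where "e > 0" "\<forall>y. dist y z < e \<longrightarrow> y \<in> A" unfolding eventually_nhds_metric by blast
    then show "\<exists>e>0. ball z e \<subseteq> A" by (intro exI[of _ e]) (auto simp: dist_commute)
  qed
  moreover have "open (D - A)"
  proof (rule openI)
    fix z assume "z \<in> D - A"
    then have z: "z \<in> D" and zA: "z \<notin> A" by auto
    have neg: "h * H z p \<le> 0" for p
    proof (rule ccontr)
      assume "\<not> h * H z p \<le> 0"
      then have "h * H z p > 0" by simp
      then have "h / H z p > 0" by (simp add: zero_less_mult_iff zero_less_divide_iff)
      from hamiltonian_rescale[OF this] show False using zA z unfolding A_def by blast
    qed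
    obtain r0 where r0: "r0 > 0" "ball z r0 \<subseteq> D" using D(1) z open_contains_ball by blast
    show "\<exists>e>0. ball z e \<subseteq> D - A"
    proof (rule ccontr)
      assume no: "\<not> ?thesis"
      have "\<exists>y. dist y z < inverse (real (Suc n)) \<and> y \<in> A" for n
      proof -
        have "min r0 (inverse (real (Suc n))) > 0" using r0(1) by simp
        then have "\<not> ball z (min r0 (inverse (real (Suc n)))) \<subseteq> D - A" using no by blast
        then obtain y where y: "y \<in> ball z (min r0 (inverse (real (Suc n))))" "y \<notin> D - A" by blast
        then have "y \<in> ball z r0" by simp
        then have "y \<in> A" using y(2) r0(2) by blast
        moreover have "dist y z < inverse (real (Suc n))" using y(1) by (simp add: dist_commute)
        ultimately show ?thesis by blast
      qed
      then have "\<forall>n. \<exists>y. dist y z < inverse (real (Suc n)) \<and> y \<in> A" by (rule allI)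
      from choice[OF this] obtain y where y: "\<And>n. dist (y n) z < inverse (real (Suc n))" "\<And>n. y n \<in> A" by blast
      have yl: "y \<longlonglongrightarrow> z"
        unfolding tendsto_dist_iff[of y z]
        by (rule Lim_null_comparison[OF _ LIMSEQ_inverse_real_of_nat]) (use y(1) in \<open>auto intro!: always_eventually less_imp_le simp del: of_nat_Suc\<close>)
      have "\<forall>n. \<exists>q. H (y n) q = h" using y(2) unfolding A_def by blast
      from choice[OF this] obtain p where p: "\<And>n. H (y n) (p n) = h" by blast
      \<comment> \<open>Normalisation gives compactness and preserves the sign of the
        energy.\<close>
      define q where "q n = (1 / norm (p n)) *\<^sub>R p n" for n
      have hq: "h * H (y n) (q n) \<ge> 0" for n
        unfolding q_def hamiltonian_scale p by (simp add: power2_eq_square)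
      have "p n \<noteq> 0" for n using p[of n] h by (auto simp: hamiltonian_eq)
      then have "q n \<in> sphere 0 1" for n unfolding q_def by simp
      then obtain q0 r where q0: "q0 \<in> sphere 0 1" "strict_mono (r :: nat \<Rightarrow> nat)" "(q \<circ> r) \<longlonglongrightarrow> q0"
        using compact_imp_seq_compact[OF compact_sphere, of 0 1, unfolded seq_compact_def, rule_format, of q] by blast
      have yr: "(\<lambda>n. y (r n)) \<longlonglongrightarrow> z" using LIMSEQ_subseq_LIMSEQ[OF yl q0(2)] by (simp add: o_def)
      have "(\<lambda>n. h * H (y (r n)) (q (r n))) \<longlonglongrightarrow> h * H z q0"
        by (intro tendsto_intros tendsto_H z yr) (use q0(3) in \<open>simp add: o_def\<close>)
      then have "h * H z q0 \<ge> 0" by (rule tendsto_lowerbound) (use hq in auto)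
      then have "H z q0 = 0" using neg[of q0] h by auto
      moreover have "q0 \<noteq> 0" "q0 \<bullet> q0 = 1" using q0(1) by (auto simp: dot_square_norm)
      ultimately obtain e where e: "\<And>t. H z (q0 + t *\<^sub>R e) = t + t\<^sup>2 * H z e"
        using nonnull_direction[OF z, of q0] by auto
      \<comment> \<open>The step \<open>h * s\<close> from \<open>q0\<close> gives energy of the
        sign of \<open>h\<close> as soon as \<open>1 + s * c\<close> is positive, which the choice
        of \<open>s\<close> ensures.\<close>
      define c where "c = h * H z e"
      define s where "s = 1 / (\<bar>c\<bar> + 1)"
      have s: "s > 0" unfolding s_def by simp
      have "s * \<bar>c\<bar> < 1" unfolding s_def by simp
      then have "\<bar>s * c\<bar> < 1" using s by (simp add: abs_mult)
      then have "1 + s * c > 0" by linarith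
      then have "h\<^sup>2 * (s * (1 + s * c)) > 0" using h s by simp
      moreover have "h * H z (q0 + (h * s) *\<^sub>R e) = h\<^sup>2 * (s * (1 + s * c))"
        unfolding e c_def by (simp add: power2_eq_square algebra_simps)
      ultimately show False using neg[of "q0 + (h * s) *\<^sub>R e"] by linarith
    qed
  qed
  moreover have "connected D" by (rule convex_connected[OF D(2)])
  ultimately have "A \<inter> D = {} \<or> (D - A) \<inter> D = {}"
    by (intro connectedD) auto
  then show ?thesis using x y unfolding A_def by blast
qed

text \<open>\<open>w\<close> is tangent to the level at \<open>p\<close>. Renormalising
  \<open>p + t w\<close> to energy \<open>h\<close> changes it only to second order, so the
  resulting curve in the level has velocity \<open>w\<close>, and \<open>F\<close> is constant on
  it.\<close>

lemma tangential_derivative: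
  assumes z: "z \<in> D" and Hp: "H z p = h" "h \<noteq> 0" and F': "(F has_derivative F') (at (z, p))"
    and w: "w \<bullet> (matrix_inv (g z) *v p) = 0"
  shows "F' (0, w) = 0"
proof -
  let ?r = "\<lambda>t. sqrt (h / (h + t\<^sup>2 * H z w))"
  have e: "H z (p + t *\<^sub>R w) = h + t\<^sup>2 * H z w" for t
    using hamiltonian_add[where g = g, OF gsym[OF z] ginv[OF z], of p t w] Hp w by simp
  have r: "(?r has_real_derivative 0) (at 0)"
    using Hp(2) by (auto intro!: derivative_eq_intros)
  have curve: "((\<lambda>t. (z, ?r t *\<^sub>R (p + t *\<^sub>R w))) has_derivative (\<lambda>t. (0, t *\<^sub>R w))) (at 0)"
  proof -
    have rd: "(?r has_derivative (\<lambda>t. 0 * t)) (at 0)" using r by (simp only: has_field_derivative_def)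
    have "((\<lambda>t. p + t *\<^sub>R w) has_derivative (\<lambda>t. t *\<^sub>R w)) (at 0)" by (auto intro!: derivative_eq_intros)
    from has_derivative_scaleR[OF rd this]
    have "((\<lambda>t. ?r t *\<^sub>R (p + t *\<^sub>R w)) has_derivative (\<lambda>t. t *\<^sub>R w)) (at 0)" using Hp(2) by simp
    then show ?thesis by (intro has_derivative_Pair has_derivative_const)
  qed
  have "(F has_derivative F') (at (z, ?r 0 *\<^sub>R (p + 0 *\<^sub>R w)))" using F' Hp(2) by simp
  from has_derivative_compose[OF curve this]
  have d1: "((\<lambda>t. F (z, ?r t *\<^sub>R (p + t *\<^sub>R w))) has_derivative (\<lambda>t. F' (0, t *\<^sub>R w))) (at 0)" .
  have ev: "eventually (\<lambda>t. F (z, ?r t *\<^sub>R (p + t *\<^sub>R w)) = F (z, p)) (nhds 0)"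
  proof -
    have "((\<lambda>t. h / (h + t\<^sup>2 * H z w)) \<longlongrightarrow> h / (h + 0\<^sup>2 * H z w)) (nhds 0)"
      using Hp(2) by (intro tendsto_intros filterlim_ident) auto
    then have "eventually (\<lambda>t. h / (h + t\<^sup>2 * H z w) > 0) (nhds 0)" using Hp(2) by (intro order_tendstoD(1)) auto
    then show ?thesis
    proof eventually_elim
      case (elim t)
      have "H z (?r t *\<^sub>R (p + t *\<^sub>R w)) = h" using hamiltonian_rescale[of h g z "p + t *\<^sub>R w"] elim unfolding e by simp
      then show ?case using level_set_constant[OF z] Hp by simp
    qed
  qed
  have "((\<lambda>t. F (z, ?r t *\<^sub>R (p + t *\<^sub>R w))) has_derivative (\<lambda>t. 0)) (at (0::real))"
  proof (rule has_derivative_transform_eventually[of "\<lambda>_. F (z, p)"])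
    show "eventually (\<lambda>t. F (z, p) = F (z, ?r t *\<^sub>R (p + t *\<^sub>R w))) (at 0)"
      using ev by (auto simp: eventually_at_filter elim: eventually_mono)
  qed (use Hp(2) in auto)
  from has_derivative_unique[OF d1 this] have "F' (0, 1 *\<^sub>R w) = 0" by metis
  then show ?thesis by simp
qed

text \<open>\<open>\<psi>\<close> is the common value of \<open>F\<close> on the level
  \<open>h\<close> of each fibre. Near \<open>z\<close> it equals \<open>F\<close> at the momentum
  of \<open>v\<close> renormalised to energy \<open>h\<close>, so it is differentiable. In the
  direction \<open>v\<close> the equation of the integral turns its derivative into a momentum
  derivative tangent to the level.\<close>

lemma level_value_derivative:
  assumes h: "h \<noteq> 0" and \<psi>: "\<And>y q. y \<in> D \<Longrightarrow> H y q = h \<Longrightarrow> \<psi> y = F (y, q)"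
    and z: "z \<in> D" and v: "v \<bullet> (g z *v v) = 2 * h"
  shows "\<exists>\<psi>'. (\<psi> has_derivative \<psi>') (at z) \<and> \<psi>' v = 0"
proof -
  define p where "p = g z *v v"
  have iv: "matrix_inv (g z) *v p = v" unfolding p_def by (rule matrix_inv_vec[OF ginv[OF z]])
  have Hg: "H y (g y *v v) = (v \<bullet> (g y *v v)) / 2" if "y \<in> D" for y
    by (simp add: hamiltonian_eq matrix_inv_vec[OF ginv[OF that]] inner_commute)
  have Hp: "H z p = h" unfolding p_def Hg[OF z] v by simp
  define G' where "G' u = (\<chi> l. \<Sum>j\<in>UNIV. (\<Sum>i\<in>UNIV. u $ i * dg g i l j z) * v $ j)" for u
  have G: "((\<lambda>y. g y *v v) has_derivative G') (at z)"
    unfolding G'_def[abs_def] by (rule metric_times_vector_has_derivative[OF D(1) g k z])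
  define s where "s y = sqrt (2 * h / (v \<bullet> (g y *v v)))" for y
  have sz: "s z = 1" unfolding s_def v using h by simp
  obtain F' where F': "(F has_derivative F') (at (z, p))" using F_has_derivative[OF z] by blast
  have lin: "linear F'" using F' has_derivative_linear by blast
  have "((\<lambda>r. sqrt (2 * h / r)) has_real_derivative (- 1 / (4 * h))) (at (v \<bullet> (g z *v v)))"
    unfolding v using h by (auto intro!: derivative_eq_intros simp: field_simps power2_eq_square)
  then have "((\<lambda>r. sqrt (2 * h / r)) has_derivative (\<lambda>r. (- 1 / (4 * h)) * r)) (at (v \<bullet> (g z *v v)))"
    by (simp only: has_field_derivative_def)
  from has_derivative_compose[OF has_derivative_inner_right[OF G, of v] this]
  have s': "(s has_derivative (\<lambda>u. (- 1 / (4 * h)) * (v \<bullet> G' u))) (at z)" unfolding s_def[abs_def] .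
  from has_derivative_scaleR[OF s' G]
  have "((\<lambda>y. s y *\<^sub>R (g y *v v)) has_derivative (\<lambda>u. G' u + ((- 1 / (4 * h)) * (v \<bullet> G' u)) *\<^sub>R p)) (at z)"
    unfolding sz p_def by simp
  from has_derivative_Pair[OF has_derivative_ident this]
  have curve: "((\<lambda>y. (y, s y *\<^sub>R (g y *v v))) has_derivative (\<lambda>u. (u, G' u + ((- 1 / (4 * h)) * (v \<bullet> G' u)) *\<^sub>R p))) (at z)" .
  have "(F has_derivative F') (at (z, s z *\<^sub>R (g z *v v)))" using F' unfolding sz p_def by simp
  from has_derivative_compose[OF curve this]
  have d: "((\<lambda>y. F (y, s y *\<^sub>R (g y *v v))) has_derivative (\<lambda>u. F' (u, G' u + ((- 1 / (4 * h)) * (v \<bullet> G' u)) *\<^sub>R p))) (at z)" .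
  have ev: "eventually (\<lambda>y. F (y, s y *\<^sub>R (g y *v v)) = \<psi> y) (nhds z)"
  proof -
    have "((\<lambda>y. 2 * h / (v \<bullet> (g y *v v))) \<longlongrightarrow> 2 * h / (v \<bullet> (g z *v v))) (nhds z)"
      using v h by (intro tendsto_intros tendsto_g[OF z] filterlim_ident) auto
    then have "eventually (\<lambda>y. 2 * h / (v \<bullet> (g y *v v)) > 0) (nhds z)" using v h by (intro order_tendstoD(1)) auto
    moreover have "eventually (\<lambda>y. y \<in> D) (nhds z)" by (rule eventually_nhds_in_open[OF D(1) z])
    ultimately show ?thesis
    proof eventually_elim
      case (elim y)
      have "h / H y (g y *v v) = 2 * h / (v \<bullet> (g y *v v))" unfolding Hg[OF elim(2)] by simp
      then have "H y (s y *\<^sub>R (g y *v v)) = h"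
        using hamiltonian_rescale[of h g y "g y *v v"] elim(1) unfolding s_def by simp
      then show ?case using \<psi>[OF elim(2)] by simp
    qed
  qed
  have "(\<psi> has_derivative (\<lambda>u. F' (u, G' u + ((- 1 / (4 * h)) * (v \<bullet> G' u)) *\<^sub>R p))) (at z)"
  proof (rule has_derivative_transform_eventually[OF d])
    show "eventually (\<lambda>y. F (y, s y *\<^sub>R (g y *v v)) = \<psi> y) (at z)"
      using ev by (auto simp: eventually_at_filter elim: eventually_mono)
    show "F (z, s z *\<^sub>R (g z *v v)) = \<psi> z" using ev by (rule eventually_nhds_x_imp_x)
  qed simp
  moreover have "F' (v, G' v + ((- 1 / (4 * h)) * (v \<bullet> G' v)) *\<^sub>R p) = 0"
  proof -
    have gam: "gam g z v = G' v - (\<chi> l. 1 / 2 * dgv g l z v)"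
    proof -
      have "(\<Sum>i\<in>UNIV. \<Sum>j\<in>UNIV. dg g i l j z * v $ i * v $ j) = (\<Sum>j\<in>UNIV. (\<Sum>i\<in>UNIV. v $ i * dg g i l j z) * v $ j)" for l
        by (subst sum.swap) (simp add: sum_distrib_right sum_distrib_left mult_ac)
      then show ?thesis
        unfolding gam_def G'_def dgv_def vec_eq_iff
        by (simp add: left_diff_distrib right_diff_distrib sum_subtractf sum_distrib_left mult_ac)
    qed
    \<comment> \<open>Both sides are the derivative of the metric contracted with \<open>v\<close>
      three times.\<close>
    have "v \<bullet> (\<chi> l. dgv g l z v) = v \<bullet> G' v"
    proof -
      have "v \<bullet> G' v = (\<Sum>l\<in>UNIV. \<Sum>j\<in>UNIV. \<Sum>i\<in>UNIV. v $ l * (v $ i * dg g i l j z * v $ j))"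
        unfolding G'_def inner_vec_def by (simp add: sum_distrib_left sum_distrib_right)
      also have "\<dots> = (\<Sum>l\<in>UNIV. \<Sum>i\<in>UNIV. \<Sum>j\<in>UNIV. v $ l * (v $ i * dg g i l j z * v $ j))"
        by (intro sum.cong refl sum.swap)
      also have "\<dots> = (\<Sum>i\<in>UNIV. \<Sum>l\<in>UNIV. \<Sum>j\<in>UNIV. v $ l * (v $ i * dg g i l j z * v $ j))"
        by (rule sum.swap)
      also have "\<dots> = v \<bullet> (\<chi> l. dgv g l z v)"
        unfolding dgv_def inner_vec_def by (simp add: sum_distrib_left mult_ac)
      finally show ?thesis by simp
    qed
    moreover have "(\<chi> l. 1 / 2 * dgv g l z v) = (1 / 2) *\<^sub>R (\<chi> l. dgv g l z v)" by (simp add: vec_eq_iff)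
    ultimately have vg: "v \<bullet> gam g z v = (v \<bullet> G' v) / 2" unfolding gam by (simp add: inner_diff_right)
    have line: "((\<lambda>t. z + t *\<^sub>R v) has_derivative (\<lambda>r. r *\<^sub>R v)) (at 0)" by (auto intro!: derivative_eq_intros)
    have "((\<lambda>t. g (z + t *\<^sub>R v) *v v) has_derivative (\<lambda>r. G' (r *\<^sub>R v))) (at 0)"
      by (rule has_derivative_compose[OF line]) (use G in simp)
    from has_derivative_Pair[OF line this]
    have c2: "((\<lambda>t. (z + t *\<^sub>R v, g (z + t *\<^sub>R v) *v v)) has_derivative (\<lambda>r. (r *\<^sub>R v, G' (r *\<^sub>R v)))) (at 0)" .
    have "(F has_derivative F') (at (z + 0 *\<^sub>R v, g (z + 0 *\<^sub>R v) *v v))" using F' unfolding p_def by simp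
    from has_derivative_compose[OF c2 this]
    have f1: "((\<lambda>t. F (z + t *\<^sub>R v, g (z + t *\<^sub>R v) *v v)) has_derivative (\<lambda>r. F' (r *\<^sub>R v, G' (r *\<^sub>R v)))) (at 0)" .
    have "((\<lambda>t. F (z + t *\<^sub>R v, g (z + t *\<^sub>R v) *v v)) has_real_derivative dir_deriv F (0, gam g z v) (z, p)) (at 0)"
      using integral_along_line[OF D(1) g k F, of z 0 v 1] z unfolding p_def by simp
    then have f2: "((\<lambda>t. F (z + t *\<^sub>R v, g (z + t *\<^sub>R v) *v v)) has_derivative (\<lambda>r. F' (0, gam g z v) * r)) (at 0)"
      unfolding has_field_derivative_def dir_deriv_of_has_derivative(2)[OF F'] .
    have "F' (1 *\<^sub>R v, G' (1 *\<^sub>R v)) = F' (0, gam g z v) * 1"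
      using fun_cong[OF has_derivative_unique[OF f1 f2], of 1] .
    then have e1: "F' (v, G' v) = F' (0, gam g z v)" by simp
    let ?c = "(- 1 / (4 * h)) * (v \<bullet> G' v)"
    have "F' (v, G' v + ?c *\<^sub>R p) = F' ((v, G' v) + (0, ?c *\<^sub>R p))" by simp
    also have "\<dots> = F' (0, gam g z v) + F' (0, ?c *\<^sub>R p)" unfolding linear_add[OF lin] e1 ..
    also have "\<dots> = F' (0, gam g z v + ?c *\<^sub>R p)" unfolding linear_add[OF lin, symmetric] by simp
    also have "\<dots> = 0"
    proof (rule tangential_derivative[OF z Hp h F'])
      \<comment> \<open>The coefficient \<open>- 1 / (4 * h)\<close> from the renormalisation
        exactly cancels the normal component of \<open>gam g z v\<close>, which is half of
        \<open>v \<bullet> G' v\<close>.\<close>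
      have "v \<bullet> p = 2 * h" using v unfolding p_def .
      then have "v \<bullet> (gam g z v + ?c *\<^sub>R p) = 0" using vg h by (simp add: inner_add_right inner_diff_right)
      then show "(gam g z v + ?c *\<^sub>R p) \<bullet> (matrix_inv (g z) *v p) = 0" unfolding iv by (simp only: inner_commute)
    qed
    finally show ?thesis .
  qed
  ultimately show ?thesis by blast
qed

text \<open>The velocities of energy \<open>h\<close> span the space: for any \<open>e\<close> and
  small \<open>t\<close>, a multiple of \<open>v + t e\<close> has energy \<open>h\<close>. So the
  derivative of \<open>\<psi>\<close> vanishes in all directions, and \<open>\<psi>\<close> is
  constant on the convex set \<open>D\<close>.\<close>

lemma level_value_constant:
  assumes h: "h \<noteq> 0" and x: "x \<in> D" "H x p = h" and y: "y \<in> D" "H y q = h"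
  shows "F (x, p) = F (y, q)"
proof -
  define \<psi> where "\<psi> y = F (y, SOME q. H y q = h)" for y
  have \<psi>: "\<psi> y = F (y, q)" if "y \<in> D" "H y q = h" for y q
    unfolding \<psi>_def using someI[of "\<lambda>q. H y q = h" q] that level_set_constant by metis
  have "(\<psi> has_derivative (\<lambda>_. 0)) (at z within D)" if z: "z \<in> D" for z
  proof -
    obtain q where q: "H z q = h" using level_extends[OF h x z] by blast
    let ?v = "matrix_inv (g z) *v q"
    let ?Q = "\<lambda>v. v \<bullet> (g z *v v)"
    have v: "?Q ?v = 2 * h" using q by (simp add: hamiltonian_eq matrix_inv_vec[OF ginv[OF z]] inner_commute)
    obtain \<psi>' where d: "(\<psi> has_derivative \<psi>') (at z)" using level_value_derivative[OF h \<psi> z v] by blast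
    have lin: "linear \<psi>'" using d has_derivative_linear by blast
    have zero: "\<psi>' w = 0" if "?Q w = 2 * h" for w
      using level_value_derivative[OF h \<psi> z that] has_derivative_unique[OF d] by blast
    have "\<psi>' e = 0" for e
    proof -
      have "((\<lambda>t. 2 * h / ?Q (?v + t *\<^sub>R e)) \<longlongrightarrow> 2 * h / ?Q (?v + 0 *\<^sub>R e)) (at_right 0)"
        using v h by (intro tendsto_intros) auto
      then have "eventually (\<lambda>t. 2 * h / ?Q (?v + t *\<^sub>R e) > 0) (at_right 0)" using v h by (intro order_tendstoD(1)) auto
      moreover have "eventually (\<lambda>t::real. t > 0) (at_right 0)" by (simp add: eventually_at_filter)
      ultimately have "eventually (\<lambda>t. 2 * h / ?Q (?v + t *\<^sub>R e) > 0 \<and> t > 0) (at_right 0)" by (rule eventually_conj)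
      from eventually_happens'[OF trivial_limit_at_right_real this]
      obtain t where t: "2 * h / ?Q (?v + t *\<^sub>R e) > 0" "t > 0" by blast
      let ?c = "sqrt (2 * h / ?Q (?v + t *\<^sub>R e))"
      have "?Q (?c *\<^sub>R (?v + t *\<^sub>R e)) = ?c * ?c * ?Q (?v + t *\<^sub>R e)"
        by (simp only: matrix_vector_mult_scaleR inner_scaleR_left inner_scaleR_right mult.assoc)
      also have "?c * ?c = 2 * h / ?Q (?v + t *\<^sub>R e)" using t(1) by (simp only: real_sqrt_mult_self abs_of_pos)
      also have "\<dots> * ?Q (?v + t *\<^sub>R e) = 2 * h" using t(1) by (cases "?Q (?v + t *\<^sub>R e) = 0") auto
      finally have "\<psi>' (?c *\<^sub>R (?v + t *\<^sub>R e)) = 0" by (rule zero)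
      moreover have "\<psi>' (?c *\<^sub>R (?v + t *\<^sub>R e)) = ?c * (\<psi>' ?v + t * \<psi>' e)"
        by (simp only: linear_add[OF lin] linear_cmul[OF lin] real_scaleR_def)
      ultimately have "?c * (\<psi>' ?v + t * \<psi>' e) = 0" by (simp only:)
      moreover have "?c > 0" using t(1) by (simp only: real_sqrt_gt_0_iff)
      ultimately have "\<psi>' ?v + t * \<psi>' e = 0" by (simp only: mult_eq_0_iff) linarith
      then show ?thesis unfolding zero[OF v] using t(2) by simp
    qed
    then have "\<psi>' = (\<lambda>_. 0)" by auto
    then show ?thesis using d has_derivative_at_withinI by blast
  qed
  then obtain c where "\<And>z. z \<in> D \<Longrightarrow> \<psi> z = c" using has_derivative_zero_constant[OF D(2)] by blast
  then show ?thesis using \<psi>[OF x] \<psi>[OF y] x(1) y(1) by metis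
qed

text \<open>Let the scale tend to 0 along two rays of equal nonzero energy in the two
  fibres.\<close>

lemma zero_section_constant:
  assumes x: "x \<in> D" and y: "y \<in> D"
  shows "F (x, 0) = F (y, 0)"
proof -
  have "\<exists>p. H x p \<noteq> 0"
  proof (rule ccontr)
    assume "\<not> ?thesis"
    then have z: "H x p = 0" for p by blast
    have "axis undefined 1 \<noteq> (0 :: real ^ 'n)" by (simp add: axis_eq_0_iff)
    from nonnull_direction[OF x this z] obtain e where "\<forall>t. t * (axis undefined 1 \<bullet> (axis undefined 1 :: real ^ 'n)) + t\<^sup>2 * H x e = 0"
      unfolding z by auto
    then show False using z[of e] by (auto dest: spec[of _ 1] simp: inner_axis_axis)
  qed
  then obtain p where p: "H x p \<noteq> 0" by blast
  obtain q where q: "H y q = H x p" using level_extends[OF p x refl y] by blast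
  have l1: "((\<lambda>s. F (x, s *\<^sub>R p)) \<longlongrightarrow> F (x, 0 *\<^sub>R p)) (at_right (0::real))" by (intro tendsto_F x tendsto_intros)
  have l2: "((\<lambda>s. F (y, s *\<^sub>R q)) \<longlongrightarrow> F (y, 0 *\<^sub>R q)) (at_right (0::real))" by (intro tendsto_F y tendsto_intros)
  have ev: "eventually (\<lambda>s. F (x, s *\<^sub>R p) = F (y, s *\<^sub>R q)) (at_right (0::real))"
    unfolding eventually_at_filter
    by (intro always_eventually allI impI level_value_constant[OF _ x refl y]) (use p q in \<open>auto simp: hamiltonian_scale\<close>)
  have "F (x, 0 *\<^sub>R p) = F (y, 0 *\<^sub>R q)"
    by (rule tendsto_unique[OF trivial_limit_at_right_real Lim_transform_eventually[OF l1 ev] l2])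
  then show ?thesis by simp
qed

theorem trivial: "trivial_integral D g F"
  unfolding trivial_integral_def
proof (intro exI ballI)
  fix z :: "(real ^ 'n) \<times> (real ^ 'n)" assume "z \<in> D \<times> UNIV"
  then obtain x p where z: "z = (x, p)" "x \<in> D" by auto
  \<comment> \<open>The function of the energy evaluates \<open>F\<close> at an arbitrarily chosen
    point of that energy, possibly in another fibre.\<close>
  let ?w = "SOME w. w \<in> D \<times> UNIV \<and> hamiltonian g w = H x p"
  obtain y q where yq: "?w = (y, q)" by (cases ?w)
  have "?w \<in> D \<times> UNIV \<and> hamiltonian g ?w = H x p" by (rule someI[of _ "(x, p)"]) (use z in auto)
  then have w: "?w = (y, q)" "y \<in> D" "H y q = H x p" unfolding yq by auto
  have "F (x, p) = F (y, q)"
  proof (cases "H x p = 0")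
    case True
    then show ?thesis
      using level_zero[OF z(2) True] level_zero[OF w(2), of q] w(3) zero_section_constant[OF z(2) w(2)] by simp
  next
    case False
    then show ?thesis using level_value_constant[OF False z(2) refl w(2,3)] by simp
  qed
  then show "F z = (\<lambda>h. F (SOME w. w \<in> D \<times> UNIV \<and> hamiltonian g w = h)) (hamiltonian g z)" unfolding z w(1) by simp
qed

end

section \<open>The generic set as a countable intersection of complements of bad sets\<close>

theorem corollary4:
  fixes D :: "(real ^ 'n) set" and c :: "real ^ 'n" and r :: real and k :: nat
  assumes "CARD('n) \<ge> 2"
    and "r > 0" and "D = ball c r"
    and "k \<ge> 2"
  shows "\<exists>\<G>. generic_in (Ck_topology k D) \<G> \<and>
    (\<forall>g\<in>\<G>. \<forall>F :: (real ^ 'n) \<times> (real ^ 'n) \<Rightarrow> real.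
       geodesic_integral D g F \<longrightarrow> analytic_in_momenta D F \<longrightarrow> trivial_integral D g F)"
proof -
  have D: "open D" "convex D" using assms(3) by auto
  have k: "k \<ge> 1" using assms(4) by simp
  obtain S :: "(real ^ 'n) set" where S: "countable S" "\<And>X. open X \<Longrightarrow> X \<noteq> {} \<Longrightarrow> \<exists>d\<in>S. d \<in> X"
    using countable_dense_exists[where 'a = "real ^ 'n"] by auto
  \<comment> \<open>Degree, bound, radius, centre and the two vectors defining the directions:
    natural numbers and points of the countable set \<open>S\<close>, so that countably many open
    sets are intersected.\<close>
  define J where "J = {(m :: nat, N :: nat, i :: nat, c, v, w). c \<in> S \<and> v \<in> S \<and> w \<in> S \<and> cball c (1 / real (Suc i)) \<subseteq> D}"
  define U where "U = (\<lambda>(m :: nat, N :: nat, i :: nat, c, v, w). Ck_metrics k D - bad_metrics k D m (real (Suc N)) c (1 / real (Suc i)) v w)"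
  have "countable J"
    by (rule countable_subset[of _ "UNIV \<times> UNIV \<times> UNIV \<times> S \<times> S \<times> S"]) (use S(1) in \<open>auto simp: J_def\<close>)
  have op: "openin (Ck_topology k D) (U t)" if "t \<in> J" for t
    using that good_metrics_open[OF D(1) k] unfolding J_def U_def by auto
  have cl: "Ck_topology k D closure_of U t = topspace (Ck_topology k D)" if t: "t \<in> J" for t
  proof (rule subset_antisym[OF closure_of_subset_topspace], rule subsetI)
    fix g assume g: "g \<in> topspace (Ck_topology k D)"
    show "g \<in> Ck_topology k D closure_of U t"
      unfolding in_closure_of
    proof (intro conjI allI impI g, elim conjE)
      fix T assume T: "g \<in> T" "openin (Ck_topology k D) T"
      then obtain \<epsilon> where e: "\<epsilon> > 0" "Ck_nbhd k D g \<epsilon> \<subseteq> T" unfolding openin_Ck_topology by blast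
      obtain m N i c v w where tt: "t = (m, N, i, c, v, w)" by (cases t)
      have "cball c (1 / real (Suc i)) \<subseteq> D" using t unfolding tt J_def by auto
      then have "\<not> Ck_nbhd k D g \<epsilon> \<subseteq> bad_metrics k D m (real (Suc N)) c (1 / real (Suc i)) v w"
        using g e(1) unfolding topspace_Ck_topology by (intro bad_metrics_no_interior[OF D(1) k]) auto
      then show "\<exists>y. y \<in> U t \<and> y \<in> T" using e(2) Ck_nbhd_subset unfolding U_def tt by fastforce
    qed
  qed
  define \<G> where "\<G> = topspace (Ck_topology k D) \<inter> \<Inter> (U ` J)"
  have "generic_in (Ck_topology k D) \<G>"
    unfolding generic_in_def \<G>_def
    using \<open>countable J\<close> op cl by (intro exI[of _ "U ` J"]) auto
  moreover have "trivial_integral D g F"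
    if g: "g \<in> \<G>" and F: "geodesic_integral D g F" and an: "analytic_in_momenta D F" for g F
  proof -
    have good: "good_metric S k D g"
      unfolding good_metric_def
    proof (intro conjI allI ballI impI)
      show "g \<in> Ck_metrics k D" using g unfolding \<G>_def topspace_Ck_topology by blast
      fix m N i c v w assume "c \<in> S" "v \<in> S" "w \<in> S" "cball c (1 / real (Suc i)) \<subseteq> D"
      then have "(m, N, i, c, v, w) \<in> J" unfolding J_def by auto
      then have "g \<in> U (m, N, i, c, v, w)" using g unfolding \<G>_def by blast
      then show "g \<notin> bad_metrics k D m (real (Suc N)) c (1 / real (Suc i)) v w" unfolding U_def by simp
    qed
    interpret level_integral D k g F
    proof
      show "g \<in> Ck_metrics k D" using good unfolding good_metric_def by blast
      fix x \<epsilon> assume x: "x \<in> D" "(\<epsilon> :: real) > 0"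
      obtain y where y: "y \<in> D" "dist y x < \<epsilon>" "\<forall>m. trivial_at F g m y"
        using trivial_dense[OF D(1) trivial_on_ball[OF assms(1) D(1) k good S(2) F an] x] by blast
      have "F (y, p) = F (y, p')" if H: "hamiltonian g (y, p) = hamiltonian g (y, p')" for p p'
        by (rule equal_on_level_sets[OF _ H])
          (use y(1,3) an in \<open>auto simp: analytic_in_momenta_def trivial_at_def\<close>)
      then show "\<exists>y\<in>D. dist y x < \<epsilon> \<and> (\<forall>p p'. hamiltonian g (y, p) = hamiltonian g (y, p') \<longrightarrow> F (y, p) = F (y, p'))"
        using y by blast
    qed (use D k F in auto)
    show ?thesis by (rule trivial)
  qed
  ultimately show ?thesis by blast
qed

end
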